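(* Let $p$ be an odd prime. For $2\le\ell\le p-1$ and a $\mathbb{Z}/p$-extension $K/F$ (a Galois extension of fields with $\mathrm{Gal}(K/F)\simeq\mathbb{Z}/p$), we have $$\nu(A_\ell\rtimes\mathbb{Z}/p\twoheadrightarrow\mathbb{Z}/p,K/F)=\nu(H_{p^3}\twoheadrightarrow\mathbb{Z}/p,K/F)\left(\frac1p+\frac{(p-1)\,\nu(H_{p^3}\twoheadrightarrow\mathbb{Z}/p,K/F)}{1+(p-1)\,\nu(\mathbb{Z}/p\times\mathbb{Z}/p\twoheadrightarrow\mathbb{Z}/p,K/F)}\right)^{\ell-2}.$$
   Context: Write $G_1=\mathbb{Z}/p$ multiplicatively with generator $\sigma$. For $1\le\ell\le p$, $A_\ell=\mathbb{F}_p[G_1]/\langle(\sigma-1)^\ell\rangle$ as an $\mathbb{F}_p[G_1]$-module, and $A_\ell\rtimes\mathbb{Z}/p=A_\ell\rtimes G_1$ is the semidirect product: the set $A_\ell\times G_1$ with $(f_1,\sigma^{j_1})(f_2,\sigma^{j_2})=(f_1+\sigma^{j_1}f_2,\sigma^{j_1+j_2})$. The surjection $A_\ell\rtimes\mathbb{Z}/p\twoheadrightarrow\mathbb{Z}/p$ is the projection to the second coordinate. $H_{p^3}$ is the unique nonabelian group of order $p^3$ and exponent $p$; it is isomorphic to $A_2\rtimes G_1$, and $H_{p^3}\twoheadrightarrow\mathbb{Z}/p$ denotes the corresponding projection $A_2\rtimes G_1\twoheadrightarrow G_1$. Likewise $\mathbb{Z}/p\times\mathbb{Z}/p\twoheadrightarrow\mathbb{Z}/p$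 is the projection $A_1\rtimes G_1\twoheadrightarrow G_1$. Given a surjection of finite groups $G\twoheadrightarrow Q$ and a Galois extension $K/F$ with an identification $\mathrm{Gal}(K/F)\simeq Q$, a solution of the embedding problem $G\twoheadrightarrow Q$ over $K/F$ is a Galois extension $L/F$ (in a fixed algebraic closure) with $K\subseteq L$ and an isomorphism $\mathrm{Gal}(L/F)\simeq G$ under which restriction $\mathrm{Gal}(L/F)\to\mathrm{Gal}(K/F)$ corresponds to $G\twoheadrightarrow Q$. $\nu(G\twoheadrightarrow Q,K/F)$ is the number of fields $L$ that are solutions. *)

theory Defs
  imports
    "HOL-Algebra.Algebraic_Closure"
    "HOL-Algebra.Elementary_Groups"
    "HOL-Algebra.Bij"
    "HOL-Number_Theory.Residues"
    "HOL-Library.Extended_Nonnegative_Real"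
begin

section \<open>Galois extensions and embedding problems\<close>

text \<open>All fields are subfields of one ambient field \<open>\<Omega>\<close>. An automorphism of \<open>L\<close> is an
  extensional function on \<open>L\<close>, so distinct elements of \<open>gal_group \<Omega> L F\<close> differ on \<open>L\<close>.\<close>

definition gal_group :: "('a, 'm) ring_scheme \<Rightarrow> 'a set \<Rightarrow> 'a set \<Rightarrow> ('a \<Rightarrow> 'a) monoid" where
  "gal_group \<Omega> L F = (BijGroup L)
     \<lparr>carrier := {s \<in> Bij L. s \<in> ring_hom (\<Omega>\<lparr>carrier := L\<rparr>) (\<Omega>\<lparr>carrier := L\<rparr>) \<and> (\<forall>x\<in>F. s x = x)}\<rparr>"

definition galois_extension :: "('a, 'm) ring_scheme \<Rightarrow> 'a set \<Rightarrow> 'a set \<Rightarrow> bool" where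
  "galois_extension \<Omega> L F \<longleftrightarrow>
     subfield F \<Omega> \<and> subfield L \<Omega> \<and> F \<subseteq> L \<and>
     (\<forall>x\<in>L. (ring.algebraic \<Omega> over F) x) \<and>
     {x \<in> L. \<forall>s\<in>carrier (gal_group \<Omega> L F). s x = x} = F"

text \<open>The embedding problem is given by \<open>\<pi> : G \<rightarrow> Q\<close> and the identification
  \<open>\<theta> : Gal(K/F) \<rightarrow> Q\<close>.\<close>

definition embedding_solutions ::
  "('a, 'm) ring_scheme \<Rightarrow> 'a set \<Rightarrow> 'a set \<Rightarrow> (('a \<Rightarrow> 'a) \<Rightarrow> 'q) \<Rightarrow>
   ('g, 'n) monoid_scheme \<Rightarrow> ('g \<Rightarrow> 'q) \<Rightarrow> 'a set set" where
  "embedding_solutions \<Omega> F K \<theta> G \<pi> =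
     {L. galois_extension \<Omega> L F \<and> K \<subseteq> L \<and>
         (\<exists>\<phi> \<in> iso (gal_group \<Omega> L F) G.
            \<forall>s \<in> carrier (gal_group \<Omega> L F). \<pi> (\<phi> s) = \<theta> (restrict s K))}"

text \<open>The number of solutions may be infinite, and is then \<open>\<infinity>\<close>.\<close>

definition nu ::
  "('a, 'm) ring_scheme \<Rightarrow> 'a set \<Rightarrow> 'a set \<Rightarrow> (('a \<Rightarrow> 'a) \<Rightarrow> 'q) \<Rightarrow>
   ('g, 'n) monoid_scheme \<Rightarrow> ('g \<Rightarrow> 'q) \<Rightarrow> ennreal" where
  "nu \<Omega> F K \<theta> G \<pi> =
     (let S = embedding_solutions \<Omega> F K \<theta> G \<pi>
      in if finite S then of_nat (card S) else \<infinity>)"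


section \<open>The groups \<open>A\<^sub>\<ell> \<rtimes> G\<^sub>1\<close>\<close>

text \<open>The group ring \<open>R[G]\<close> of a finite group \<open>G\<close>: all functions \<open>G \<rightarrow> R\<close>, under convolution.\<close>

definition group_ring_elt ::
  "('r, 'm) ring_scheme \<Rightarrow> ('g, 'n) monoid_scheme \<Rightarrow> 'g \<Rightarrow> 'g \<Rightarrow> 'r" where
  "group_ring_elt R G g = (\<lambda>x \<in> carrier G. if x = g then \<one>\<^bsub>R\<^esub> else \<zero>\<^bsub>R\<^esub>)"

definition group_ring ::
  "('r, 'm) ring_scheme \<Rightarrow> ('g, 'n) monoid_scheme \<Rightarrow> ('g \<Rightarrow> 'r) ring" where
  "group_ring R G =
     \<lparr>carrier = carrier G \<rightarrow>\<^sub>E carrier R,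
      monoid.mult = (\<lambda>f h. \<lambda>x \<in> carrier G.
                finsum R (\<lambda>y. f y \<otimes>\<^bsub>R\<^esub> h (inv\<^bsub>G\<^esub> y \<otimes>\<^bsub>G\<^esub> x)) (carrier G)),
      one = group_ring_elt R G \<one>\<^bsub>G\<^esub>,
      zero = (\<lambda>x \<in> carrier G. \<zero>\<^bsub>R\<^esub>),
      add = (\<lambda>f h. \<lambda>x \<in> carrier G. f x \<oplus>\<^bsub>R\<^esub> h x)\<rparr>"

text \<open>\<open>G\<^sub>1\<close> is \<^term>\<open>integer_mod_group p\<close>, whose element \<open>j\<close> stands for \<open>\<sigma>\<^sup>j\<close>; the generator \<open>\<sigma>\<close>
  is thus the element \<open>1 :: int\<close> (not to be confused with the neutral element \<open>0\<close>).\<close>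

abbreviation FpG :: "nat \<Rightarrow> (int \<Rightarrow> int) ring" where
  "FpG p \<equiv> group_ring (residue_ring (int p)) (integer_mod_group p)"

abbreviation FpG_elt :: "nat \<Rightarrow> int \<Rightarrow> int \<Rightarrow> int" where
  "FpG_elt p \<equiv> group_ring_elt (residue_ring (int p)) (integer_mod_group p)"

definition A_ideal :: "nat \<Rightarrow> nat \<Rightarrow> (int \<Rightarrow> int) set" where
  "A_ideal p l = Idl\<^bsub>FpG p\<^esub> {(FpG_elt p 1 \<ominus>\<^bsub>FpG p\<^esub> \<one>\<^bsub>FpG p\<^esub>) [^]\<^bsub>FpG p\<^esub> l}"

definition A_mod :: "nat \<Rightarrow> nat \<Rightarrow> (int \<Rightarrow> int) set ring" where
  "A_mod p l = FpG p Quot A_ideal p l"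

definition A_act :: "nat \<Rightarrow> nat \<Rightarrow> int \<Rightarrow> (int \<Rightarrow> int) set \<Rightarrow> (int \<Rightarrow> int) set" where
  "A_act p l g a = (A_ideal p l +>\<^bsub>FpG p\<^esub> FpG_elt p g) \<otimes>\<^bsub>A_mod p l\<^esub> a"

definition semidirect_product ::
  "('n, 'u) monoid_scheme \<Rightarrow> ('g, 'v) monoid_scheme \<Rightarrow> ('g \<Rightarrow> 'n \<Rightarrow> 'n) \<Rightarrow> ('n \<times> 'g) monoid" where
  "semidirect_product N G act =
     \<lparr>carrier = carrier N \<times> carrier G,
      monoid.mult = (\<lambda>(a, g) (b, h). (a \<otimes>\<^bsub>N\<^esub> act g b, g \<otimes>\<^bsub>G\<^esub> h)),
      one = (\<one>\<^bsub>N\<^esub>, \<one>\<^bsub>G\<^esub>)\<rparr>"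

definition A_semidirect :: "nat \<Rightarrow> nat \<Rightarrow> ((int \<Rightarrow> int) set \<times> int) monoid" where
  "A_semidirect p l =
     semidirect_product (add_monoid (A_mod p l)) (integer_mod_group p) (A_act p l)"

text \<open>The projections are \<open>snd : A_semidirect p l \<rightarrow> integer_mod_group p\<close>. For \<open>l = 1\<close> the action
  is trivial and this is the projection of \<open>\<int>/p \<times> \<int>/p\<close> to its second factor. For
  \<open>H\<close> of order \<open>p\<^sup>3\<close> as below it is \<open>snd \<circ> \<iota>\<close> with \<open>\<iota> : H \<cong> A_semidirect p 2\<close>.\<close>

text \<open>\<open>H\<close> is nonabelian of order \<open>p\<^sup>3\<close> and exponent \<open>p\<close>. For a nontrivial group and a prime \<open>p\<close>,
  exponent \<open>p\<close> means \<open>x\<^sup>p = 1\<close> for all \<open>x\<close>.\<close>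

definition is_H_p3 :: "nat \<Rightarrow> ('h, 'n) monoid_scheme \<Rightarrow> bool" where
  "is_H_p3 p H \<longleftrightarrow>
     group H \<and> \<not> comm_group H \<and> order H = p ^ 3 \<and>
     (\<forall>x \<in> carrier H. x [^]\<^bsub>H\<^esub> p = \<one>\<^bsub>H\<^esub>)"

end

theory Submission
  imports Defs "HOL-Computational_Algebra.Polynomial"
begin

text \<open>
  Let \<open>\<Gamma>\<close> be the group of automorphisms of \<open>\<Omega>\<close> over \<open>F\<close>, let \<open>N\<close> be the kernel of
  \<open>\<Gamma> \<rightarrow> Gal(K/F) \<cong> \<int>/p\<close>, and let \<open>\<tau> \<in> \<Gamma>\<close> be a lift of the generator \<open>\<sigma>\<close>. Call a subgroup open
  if it contains the fixer of a finite set of separable elements.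

  A solution \<open>L\<close> is determined by the subgroup of \<open>\<Gamma>\<close> fixing it, so \<open>\<nu>\<close> counts the open normal
  subgroups that are kernels of surjections \<open>\<Gamma> \<rightarrow> A\<^sub>\<ell> \<rtimes> G\<^sub>1\<close> over \<open>G\<^sub>1\<close> (\<open>nu_quotients\<close>). The problem
  becomes one about the smooth characters \<open>f : N \<rightarrow> \<int>/p\<close>, on which \<open>\<sigma> - 1\<close> acts as
  \<open>(D f)(n) = f(\<tau> n \<tau>\<^sup>-\<^sup>1) - f(n)\<close>. Write \<open>A\<^sub>\<ell> = (\<int>/p)[T]/(T\<^sup>\<ell>)\<close> with \<open>T = \<sigma> - 1\<close>. An equivariant
  homomorphism \<open>N \<rightarrow> A\<^sub>\<ell>\<close> is determined by its coefficient \<open>f\<close> at \<open>T\<^sup>\<ell>\<^sup>-\<^sup>1\<close>, since its other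
  coefficients are \<open>D f, D\<^sup>2 f, \<dots>\<close>. It extends to a homomorphism
  \<open>\<Gamma> \<rightarrow> A\<^sub>\<ell> \<rtimes> G\<^sub>1\<close> over \<open>G\<^sub>1\<close> exactly if \<open>f(\<tau>\<^sup>p) = 0\<close>: the norm
  \<open>1 + \<sigma> + \<dots> + \<sigma>\<^sup>p\<^sup>-\<^sup>1 = T\<^sup>p\<^sup>-\<^sup>1\<close> annihilates \<open>A\<^sub>\<ell>\<close> because \<open>\<ell> \<le> p - 1\<close>. It is onto exactly if
  \<open>D\<^sup>\<ell>\<^sup>-\<^sup>1 f \<noteq> 0\<close>, and two characters give the same kernel exactly if they differ by a unit of
  \<open>A\<^sub>\<ell>\<close>. With \<open>J\<^sub>\<ell> = {f. D\<^sup>\<ell> f = 0, f(\<tau>\<^sup>p) = 0}\<close> this reads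
  \<open>|J\<^sub>\<ell> - J\<^sub>\<ell>\<^sub>-\<^sub>1| = \<nu>\<^sub>\<ell> \<cdot> p\<^sup>\<ell>\<^sup>-\<^sup>1 (p - 1)\<close> (\<open>ecard_Xs\<close>).

  Let \<open>W = D J\<^sub>2\<close>. The map \<open>D\<^sup>\<ell>\<^sup>-\<^sup>1 : J\<^sub>\<ell> \<rightarrow> W\<close> has kernel \<open>J\<^sub>\<ell>\<^sub>-\<^sub>1\<close>. If it is onto for all
  \<open>2 \<le> \<ell> \<le> p - 1\<close> (\<open>top_power_image\<close>), then \<open>|J\<^sub>\<ell> - J\<^sub>\<ell>\<^sub>-\<^sub>1| = (|W| - 1) |W|\<^sup>\<ell>\<^sup>-\<^sup>2 |J\<^sub>1|\<close>, and
  \<open>|J\<^sub>1| = 1 + (p - 1) \<nu>\<^sub>1\<close>. Eliminating \<open>|W|\<close> between the cases \<open>2\<close> and \<open>\<ell>\<close> gives the theorem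
  (\<open>counting_formula\<close>); all these identities are between products, so they also hold when some
  of the sets are infinite.

  Surjectivity follows from the norm equation: for every \<open>f \<in> J\<^sub>2\<close> there is a smooth character
  \<open>g\<close> of \<open>N\<close> with \<open>T\<^sup>p\<^sup>-\<^sup>1 g = D f\<close>; then \<open>D\<^sup>p\<^sup>-\<^sup>\<ell> g\<close> lies in \<open>J\<^sub>\<ell>\<close> and is mapped to \<open>D f\<close>. Only here is
  field arithmetic used. The character \<open>h = D f\<close> is invariant with \<open>h(\<tau>\<^sup>p) = 0\<close>, so it extends to a
  character \<open>\<chi>\<close> of \<open>\<Gamma>\<close> with \<open>\<chi>(\<tau>) = 0\<close>.

  In characteristic \<open>p\<close>, Artin--Schreier theory gives \<open>\<chi>\<close> by some \<open>b\<close> in \<open>F\<close>. The trace of \<open>K/F\<close> is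
  onto, so \<open>b\<close> is the trace of some \<open>a \<in> K\<close>, and the Artin--Schreier character of \<open>a\<close> on \<open>N\<close> is a
  solution \<open>g\<close> (\<open>norm_equation_char_p\<close>).

  In other characteristics, let \<open>\<xi>\<close> be a primitive \<open>p\<close>-th root of unity and choose \<open>\<tau>\<close> fixing it.
  Let \<open>z\<close> and \<open>y\<close> be Kummer generators of \<open>f\<close> and \<open>\<chi>\<close> on the subgroups fixing \<open>\<xi>\<close>. The relation
  \<open>h = D f\<close> says that \<open>d = z y / \<tau>\<^sup>-\<^sup>1 z\<close> is fixed by the subgroup \<open>N'\<close> of \<open>N\<close> fixing \<open>\<xi>\<close>. The norm of
  \<open>d\<close> telescopes to \<open>y\<^sup>p\<close>, so the Kummer character of \<open>d\<close> on \<open>N'\<close> has norm \<open>h\<close>. The index of \<open>N'\<close> in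
  \<open>N\<close> is prime to \<open>p\<close>, and a transfer argument replaces \<open>N'\<close> by \<open>N\<close> (\<open>transfer_norm\<close>,
  \<open>norm_equation_char_not_p\<close>).
\<close>

section \<open>Extending embeddings to automorphisms\<close>

locale galois_closure = algebraic_closure \<Omega> F
  for \<Omega> :: "('a, 'm) ring_scheme" (structure) and F

context galois_closure
begin

lemma closure_over: 
  assumes "subfield M \<Omega>" "F \<subseteq> M" shows "galois_closure \<Omega> M"
proof -
  have "algebraic_closure \<Omega> M"
  proof (intro algebraic_closure.intro algebraic_closure_axioms.intro)
    show "field \<Omega>" by (rule field_axioms)
    show "subfield M \<Omega>" by fact
    show "(algebraic over M) x" if "x \<in> carrier \<Omega>" for x
      using algebraic_mono[OF assms(2)] algebraic_extension[OF that] by blast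
    show "splitted P" if "P \<in> carrier (M[X])" for P
      using roots_over_carrier carrier_polynomial_shell[OF subfieldE(1)[OF assms(1)] that] by auto
  qed
  then show ?thesis by (simp add: galois_closure_def)
qed

lemma root_exists:
  assumes "P \<in> carrier (poly_ring \<Omega>)" "Polynomials.degree P \<ge> 1"
  obtains y where "y \<in> carrier \<Omega>" "eval P y = \<zero>"
proof -
  have "size (roots P) \<noteq> 0" using roots_over_carrier[OF assms(1)] assms(2) by (simp add: splitted_def)
  then obtain y where "y \<in># roots P" by (metis multiset_nonemptyE size_empty)
  then show ?thesis using that assms(1) by (auto simp: roots_mem_iff_is_root is_root_def)
qed

text \<open>A partial embedding is the graph of an isomorphism between two subfields of \<open>\<Omega>\<close>. Graphs, unlike
  pairs of a field and a map, form chains under inclusion to which Zorn's lemma applies directly.\<close>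

definition partial_emb :: "('a \<times> 'a) set \<Rightarrow> bool" where
  "partial_emb r \<longleftrightarrow> r \<subseteq> carrier \<Omega> \<times> carrier \<Omega> \<and> (\<one>, \<one>) \<in> r \<and>
     (\<forall>x y x' y'. (x, y) \<in> r \<longrightarrow> (x', y') \<in> r \<longrightarrow> (x \<oplus> x', y \<oplus> y') \<in> r \<and> (x \<otimes> x', y \<otimes> y') \<in> r) \<and>
     (\<forall>x y. (x, y) \<in> r \<longrightarrow> (\<ominus> x, \<ominus> y) \<in> r \<and> (x = \<zero> \<longleftrightarrow> y = \<zero>) \<and> (x \<noteq> \<zero> \<longrightarrow> (inv x, inv y) \<in> r))"

lemma partial_embD:
  assumes "partial_emb r"
  shows "(x, y) \<in> r \<Longrightarrow> x \<in> carrier \<Omega>" "(x, y) \<in> r \<Longrightarrow> y \<in> carrier \<Omega>" "(\<one>, \<one>) \<in> r"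
    "(x, y) \<in> r \<Longrightarrow> (x', y') \<in> r \<Longrightarrow> (x \<oplus> x', y \<oplus> y') \<in> r"
    "(x, y) \<in> r \<Longrightarrow> (x', y') \<in> r \<Longrightarrow> (x \<otimes> x', y \<otimes> y') \<in> r"
    "(x, y) \<in> r \<Longrightarrow> (\<ominus> x, \<ominus> y) \<in> r" "(x, y) \<in> r \<Longrightarrow> x = \<zero> \<longleftrightarrow> y = \<zero>"
    "(x, y) \<in> r \<Longrightarrow> x \<noteq> \<zero> \<Longrightarrow> (inv x, inv y) \<in> r"
  using assms unfolding partial_emb_def by blast+

lemma partial_emb_unique:
  assumes r: "partial_emb r" and "(x, y) \<in> r" "(x, y') \<in> r" shows "y = y'"
proof -
  note D = partial_embD[OF r]
  have "(x \<oplus> \<ominus> x, y \<oplus> \<ominus> y') \<in> r" using D(4)[OF assms(2) D(6)[OF assms(3)]] .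
  then have "y \<oplus> \<ominus> y' = \<zero>" using D(7) D(1)[OF assms(2)] by (metis r_neg)
  then show ?thesis using D(2)[OF assms(2)] D(2)[OF assms(3)] by (simp add: minus_eq[symmetric])
qed

lemma partial_emb_inj:
  assumes r: "partial_emb r" and "(x, y) \<in> r" "(x', y) \<in> r" shows "x = x'"
proof -
  note D = partial_embD[OF r]
  have "(x \<oplus> \<ominus> x', y \<oplus> \<ominus> y) \<in> r" using D(4)[OF assms(2) D(6)[OF assms(3)]] .
  then have "x \<oplus> \<ominus> x' = \<zero>" using D(7) D(2)[OF assms(2)] by (metis r_neg)
  then show ?thesis using D(1)[OF assms(2)] D(1)[OF assms(3)] by (simp add: minus_eq[symmetric])
qed

lemma partial_emb_Domain:
  assumes r: "partial_emb r" shows "subfield (Domain r) \<Omega>"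
proof (rule subfieldI')
  note D = partial_embD[OF r]
  show "subring (Domain r) \<Omega>"
  proof (rule subringI)
    show "Domain r \<subseteq> carrier \<Omega>" using D(1) by auto
    show "\<one> \<in> Domain r" using D(3) by auto
    show "\<ominus> h \<in> Domain r" if "h \<in> Domain r" for h using that D(6) by blast
    show "h1 \<otimes> h2 \<in> Domain r" if "h1 \<in> Domain r" "h2 \<in> Domain r" for h1 h2 
      using that D(5) by blast
    show "h1 \<oplus> h2 \<in> Domain r" if "h1 \<in> Domain r" "h2 \<in> Domain r" for h1 h2 
      using that D(4) by blast
  qed
  show "inv k \<in> Domain r" if "k \<in> Domain r - {\<zero>}" for k using that D(8) by blast
qed

text \<open>The map \<open>q(x) \<mapsto> q\<^sup>h(y)\<close> is well defined on \<open>M[x]\<close> because \<open>q(x) = 0\<close> forces the minimal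
  polynomial of \<open>x\<close> to divide \<open>q\<close>, and its image under \<open>h\<close> has the root \<open>y\<close>.\<close>

lemma adjoin_emb:
  assumes M: "subfield M \<Omega>" and h: "h \<in> ring_hom (\<Omega>\<lparr>carrier := M\<rparr>) \<Omega>"
    and x: "x \<in> carrier \<Omega>" "(algebraic over M) x" and y: "y \<in> carrier \<Omega>"
    and root: "eval (map h (Irr M x)) y = \<zero>"
  obtains r where "partial_emb r" "(x, y) \<in> r" "\<And>a. a \<in> M \<Longrightarrow> (a, h a) \<in> r"
proof -
  have Msub: "subring M \<Omega>" by (rule subfieldE(1)[OF M])
  have Mc: "M \<subseteq> carrier \<Omega>" by (rule subfieldE(3)[OF M])
  interpret M: ring "\<Omega>\<lparr>carrier := M\<rparr>" by (rule subring_is_ring[OF Msub])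
  interpret h: ring_hom_ring "\<Omega>\<lparr>carrier := M\<rparr>" \<Omega> h
    by (rule ring_hom_ringI2[OF M.ring_axioms ring_axioms h])
  interpret UP: domain "M[X]" by (rule univ_poly_is_domain[OF Msub])
  have hc: "h a \<in> carrier \<Omega>" if "a \<in> M" for a using h.hom_closed that by simp
  define \<Phi> where "\<Phi> q = eval (map h q) y" for q
  have setM: "set q \<subseteq> M" if "q \<in> carrier (M[X])" for q
    using that by (simp add: univ_poly_carrier[symmetric] polynomial_incl)
  have setc: "set q \<subseteq> carrier \<Omega>" if "q \<in> carrier (M[X])" for q using setM[OF that] Mc by auto
  have mapc: "set (map h q) \<subseteq> carrier \<Omega>" if "set q \<subseteq> M" for q using that hc by auto
  have \<Phi>c: "\<Phi> q \<in> carrier \<Omega>" if "q \<in> carrier (M[X])" for q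
    unfolding \<Phi>_def using eval_in_carrier mapc[OF setM[OF that]] y by blast
  have \<Phi>add: "\<Phi> (q \<oplus>\<^bsub>M[X]\<^esub> q') = \<Phi> q \<oplus> \<Phi> q'" if q: "q \<in> carrier (M[X])" "q' \<in> carrier (M[X])" for q q'
  proof -
    have "normalize (map h (poly_add q q')) = poly_add (map h q) (map h q')"
      using h.poly_add_hom'[of q q'] setM q by (simp add: poly_add_consistent[OF Msub] univ_poly_add)
    moreover have "eval (normalize (map h (poly_add q q'))) y = eval (map h (poly_add q q')) y"
      by (rule eval_normalize) (use mapc setM UP.a_closed q y univ_poly_add in metis)+
    ultimately show ?thesis unfolding \<Phi>_def univ_poly_add
      using eval_poly_add[OF mapc mapc y] setM q by metis
  qed
  have \<Phi>mult: "\<Phi> (q \<otimes>\<^bsub>M[X]\<^esub> q') = \<Phi> q \<otimes> \<Phi> q'" if q: "q \<in> carrier (M[X])" "q' \<in> carrier (M[X])" for q q'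
  proof -
    have "normalize (map h (poly_mult q q')) = poly_mult (map h q) (map h q')"
      using h.poly_mult_hom'[of q q'] setM q by (simp add: poly_mult_consistent[OF Msub] univ_poly_mult)
    moreover have "eval (normalize (map h (poly_mult q q'))) y = eval (map h (poly_mult q q')) y"
      by (rule eval_normalize) (use mapc setM UP.m_closed q y univ_poly_mult in metis)+
    ultimately show ?thesis unfolding \<Phi>_def univ_poly_mult
      using eval_poly_mult[OF mapc mapc y] setM q by metis
  qed
  have \<Phi>one: "\<Phi> \<one>\<^bsub>M[X]\<^esub> = \<one>" using h.hom_one y by (simp add: \<Phi>_def univ_poly_one)
  have "\<Phi> \<in> ring_hom (M[X]) \<Omega>"
    by (rule ring_hom_memI) (auto simp: \<Phi>c \<Phi>mult \<Phi>add \<Phi>one)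
  then interpret \<Phi>: ring_hom_ring "M[X]" \<Omega> \<Phi>
    by (intro ring_hom_ringI2 ring_axioms UP.ring_axioms)
  interpret ev: ring_hom_ring "M[X]" \<Omega> "\<lambda>q. eval q x" by (rule eval_ring_hom[OF Msub x(1)])
  note x' = x(2)
  note I = IrrE[OF M x(1) x']
  have ker: "\<Phi> q = \<zero>" if q: "q \<in> carrier (M[X])" "eval q x = \<zero>" for q
  proof -
    have "Irr M x divides\<^bsub>M[X]\<^esub> q"
      using Irr_minimal[OF M x(1) x' q] pdivides_iff_shell[OF M I(1) q(1)] by simp
    then obtain t where t: "t \<in> carrier (M[X])" "q = Irr M x \<otimes>\<^bsub>M[X]\<^esub> t" unfolding factor_def by blast
    have "\<Phi> (Irr M x) = \<zero>" using root by (simp add: \<Phi>_def)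
    then show ?thesis using \<Phi>mult[OF I(1) t(1)] t \<Phi>c by (simp add: l_null)
  qed
  have inv_ex: "\<exists>q'. q' \<in> carrier (M[X]) \<and> inv (eval q x) = eval q' x" 
    if q: "q \<in> carrier (M[X])" "eval q x \<noteq> \<zero>" for q
  proof -
    have sf: "subfield (simple_extension M x) \<Omega>"
      using simple_extension_is_subfield[OF M x(1)] x' by simp
    have im: "simple_extension M x = (\<lambda>p. eval p x) ` carrier (M[X])"
      by (rule simple_extension_as_eval_img[OF Mc x(1)])
    have "inv (eval q x) \<in> simple_extension M x"
      using subfield_m_inv(1)[OF sf, of "eval q x"] q im by auto
    then show ?thesis unfolding im by auto
  qed
  have kery: "\<Phi> q \<noteq> \<zero> \<and> inv (\<Phi> q) = \<Phi> q'" 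
    if q: "q \<in> carrier (M[X])" "eval q x \<noteq> \<zero>" and q': "q' \<in> carrier (M[X])" "inv (eval q x) = eval q' x" for q q'
  proof -
    have *: "eval q x \<in> carrier \<Omega>" using ev.hom_closed q(1) by simp
    define a where "a = q \<otimes>\<^bsub>M[X]\<^esub> q'"
    have a: "a \<in> carrier (M[X])" unfolding a_def using q(1) q'(1) by simp
    have "eval q x \<otimes> inv (eval q x) = \<one>" using q(2) * by (simp add: field_Units)
    then have "eval a x = \<one>" unfolding a_def using ev.hom_mult[OF q(1) q'(1)] q'(2) by simp
    then have "eval (a \<oplus>\<^bsub>M[X]\<^esub> \<ominus>\<^bsub>M[X]\<^esub> \<one>\<^bsub>M[X]\<^esub>) x = \<zero>"
      using a ev.hom_one by (simp add: r_neg)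
    then have "\<Phi> (a \<oplus>\<^bsub>M[X]\<^esub> \<ominus>\<^bsub>M[X]\<^esub> \<one>\<^bsub>M[X]\<^esub>) = \<zero>"
      using ker[of "a \<oplus>\<^bsub>M[X]\<^esub> \<ominus>\<^bsub>M[X]\<^esub> \<one>\<^bsub>M[X]\<^esub>"] a by simp
    then have "\<Phi> a \<oplus> \<ominus> \<one> = \<zero>"
      using a \<Phi>one by (simp add: \<Phi>add)
    then have "\<Phi> (q \<otimes>\<^bsub>M[X]\<^esub> q') = \<one>"
      using \<Phi>c[OF a] by (simp add: a_def minus_eq[symmetric])
    then have 1: "\<Phi> q \<otimes> \<Phi> q' = \<one>" using \<Phi>mult q(1) q'(1) by simp
    then have "\<Phi> q \<noteq> \<zero>" using \<Phi>c[OF q'(1)] by auto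
    moreover have "inv (\<Phi> q) = \<Phi> q'" using 1 \<Phi>c q(1) q'(1) by (simp add: comm_inv_char)
    ultimately show ?thesis by simp
  qed
  define r where "r = {(eval q x, \<Phi> q) | q. q \<in> carrier (M[X])}"
  have rI: "(eval q x, \<Phi> q) \<in> r" if "q \<in> carrier (M[X])" for q using that unfolding r_def by blast
  have "partial_emb r"
    unfolding partial_emb_def
  proof (intro conjI allI impI)
    show "r \<subseteq> carrier \<Omega> \<times> carrier \<Omega>" unfolding r_def using \<Phi>c ev.hom_closed by auto
    show "(\<one>, \<one>) \<in> r" using rI[of "\<one>\<^bsub>M[X]\<^esub>"] \<Phi>one ev.hom_one by simp
  next
    fix a b a' b' assume "(a, b) \<in> r" "(a', b') \<in> r"
    then obtain q q' where q: "q \<in> carrier (M[X])" "a = eval q x" "b = \<Phi> q" 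
      and q': "q' \<in> carrier (M[X])" "a' = eval q' x" "b' = \<Phi> q'" unfolding r_def by blast
    show "(a \<oplus> a', b \<oplus> b') \<in> r" 
      using rI[of "q \<oplus>\<^bsub>M[X]\<^esub> q'"] q q' by (simp add: \<Phi>add)
    show "(a \<otimes> a', b \<otimes> b') \<in> r" 
      using rI[of "q \<otimes>\<^bsub>M[X]\<^esub> q'"] q q' by (simp add: \<Phi>mult)
  next
    fix a b assume "(a, b) \<in> r"
    then obtain q where q: "q \<in> carrier (M[X])" "a = eval q x" "b = \<Phi> q" unfolding r_def by blast
    show "(\<ominus> a, \<ominus> b) \<in> r" 
      using rI[of "\<ominus>\<^bsub>M[X]\<^esub> q"] q by simp
    show "(a = \<zero>) = (b = \<zero>)" using ker q kery inv_ex by metis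
    show "(inv a, inv b) \<in> r" if "a \<noteq> \<zero>" 
      using inv_ex[OF q(1)] kery[OF q(1)] q that rI by metis
  qed
  moreover have "(x, y) \<in> r"
  proof -
    have "eval X x = x" "\<Phi> X = y" 
      using x y hc subringE(2,3)[OF Msub] h.hom_one h.hom_zero by (auto simp: \<Phi>_def var_def)
    then show ?thesis using rI[OF var_closed(1)[OF Msub]] by simp
  qed
  moreover have "(a, h a) \<in> r" if a: "a \<in> M" for a
  proof (cases "a = \<zero>")
    case True
    then show ?thesis using rI[OF UP.zero_closed] h.hom_zero by (simp add: univ_poly_zero \<Phi>_def)
  next
    case False
    then have "[a] \<in> carrier (M[X])" using a by (simp add: univ_poly_carrier[symmetric] polynomial_def)
    from rI[OF this] show ?thesis using a Mc hc by (auto simp: \<Phi>_def subset_iff)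
  qed
  ultimately show ?thesis using that by blast
qed

lemma partial_emb_step:
  assumes r: "partial_emb r" and F: "\<And>a. a \<in> F \<Longrightarrow> (a, a) \<in> r" and x: "x \<in> carrier \<Omega>"
  obtains r' where "partial_emb r'" "r \<subseteq> r'" "x \<in> Domain r'"
proof -
  note D = partial_embD[OF r]
  define M where "M = Domain r"
  define h where "h a = (THE b. (a, b) \<in> r)" for a
  have h: "h a = b" if "(a, b) \<in> r" for a b
    unfolding h_def using that partial_emb_unique[OF r] by blast
  have hr: "(a, h a) \<in> r" if "a \<in> M" for a using that h unfolding M_def by auto
  have M: "subfield M \<Omega>" unfolding M_def by (rule partial_emb_Domain[OF r])
  have hom: "h \<in> ring_hom (\<Omega>\<lparr>carrier := M\<rparr>) \<Omega>"
    by (rule ring_hom_memI) (use D(2)[OF hr] h D(3) D(4)[OF hr hr] D(5)[OF hr hr] in auto)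
  have "F \<subseteq> M" using F unfolding M_def by blast
  then have x': "(algebraic over M) x" using algebraic_mono[OF \<open>F \<subseteq> M\<close>] algebraic_extension[OF x] by blast
  note I = IrrE[OF M x x']
  have Msub: "subring M \<Omega>" by (rule subfieldE(1)[OF M])
  have P: "map h (Irr M x) \<in> carrier (poly_ring \<Omega>)"
  proof -
    have s: "set (Irr M x) \<subseteq> M" using I(1) by (simp add: univ_poly_carrier[symmetric] polynomial_incl)
    have ne: "Irr M x \<noteq> []" using pirreducibleE(1)[OF Msub I(1,2)] .
    have "h (hd (Irr M x)) = \<one>" using h[OF D(3)] I(3) by simp
    then have "hd (map h (Irr M x)) \<noteq> \<zero>" using ne by (simp add: hd_map)
    moreover have "set (map h (Irr M x)) \<subseteq> carrier \<Omega>" using s hr D(2) by auto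
    ultimately show ?thesis by (simp add: univ_poly_carrier[symmetric] polynomial_def)
  qed
  have "Polynomials.degree (Irr M x) \<ge> 1" by (rule pirreducible_degree[OF M I(1,2)])
  then obtain y where y: "y \<in> carrier \<Omega>" "eval (map h (Irr M x)) y = \<zero>" using root_exists[OF P] by auto
  obtain r' where r': "partial_emb r'" "(x, y) \<in> r'" "\<And>a. a \<in> M \<Longrightarrow> (a, h a) \<in> r'"
    using adjoin_emb[OF M hom x x' y] by blast
  have "r \<subseteq> r'" using r'(3) h unfolding M_def by (auto simp: Domain_iff) 
  then show ?thesis using that r' by blast
qed

text \<open>A maximal extension has domain \<open>\<Omega>\<close> by \<open>partial_emb_step\<close>. It is onto because it permutes the
  roots of each polynomial over \<open>F\<close>.\<close>

lemma partial_emb_extends: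
  assumes r0: "partial_emb r0" and F: "\<And>a. a \<in> F \<Longrightarrow> (a, a) \<in> r0"
  obtains s where "s \<in> carrier (gal_group \<Omega> (carrier \<Omega>) F)" "\<forall>(x, y) \<in> r0. s x = y"
proof -
  define A where "A = {r. partial_emb r \<and> r0 \<subseteq> r}"
  have "\<exists>r\<in>A. \<forall>Z\<in>A. r \<subseteq> Z \<longrightarrow> Z = r"
  proof (rule subset_Zorn_nonempty)
    show "A \<noteq> {}" using r0 unfolding A_def by blast
    fix C assume C: "C \<noteq> {}" "subset.chain A C"
    have CA: "c \<in> A" if "c \<in> C" for c using C that by (auto simp: subset_chain_def)
    have two: "\<exists>c\<in>C. u \<in> c \<and> v \<in> c" if uv: "u \<in> \<Union>C" "v \<in> \<Union>C" for u v
    proof -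
      obtain c c' where "c \<in> C" "u \<in> c" "c' \<in> C" "v \<in> c'" using uv by blast
      moreover have "c \<subseteq> c' \<or> c' \<subseteq> c" using C(2) calculation unfolding subset_chain_def by blast
      ultimately show ?thesis by blast
    qed
    have "partial_emb (\<Union>C)"
      unfolding partial_emb_def
    proof (intro conjI allI impI)
      show "\<Union>C \<subseteq> carrier \<Omega> \<times> carrier \<Omega>" using CA unfolding A_def partial_emb_def by blast
      show "(\<one>, \<one>) \<in> \<Union>C" using CA C(1) unfolding A_def partial_emb_def by blast
    next
      fix a b a' b' assume "(a, b) \<in> \<Union>C" "(a', b') \<in> \<Union>C"
      then obtain c where c: "c \<in> C" "(a, b) \<in> c" "(a', b') \<in> c" using two by blast
      note Dc = partial_embD[of c]
      show "(a \<oplus> a', b \<oplus> b') \<in> \<Union>C" "(a \<otimes> a', b \<otimes> b') \<in> \<Union>C" 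
        using Dc(4,5) c CA unfolding A_def by blast+
    next
      fix a b assume "(a, b) \<in> \<Union>C"
      then obtain c where c: "c \<in> C" "(a, b) \<in> c" by blast
      note Dc = partial_embD[of c]
      show "(\<ominus> a, \<ominus> b) \<in> \<Union>C" "(a = \<zero>) = (b = \<zero>)" 
        using Dc(6,7) c CA unfolding A_def by blast+
      show "(inv a, inv b) \<in> \<Union>C" if "a \<noteq> \<zero>"  using Dc(8) c CA that unfolding A_def by blast
    qed
    then show "\<Union>C \<in> A" using C(1) CA unfolding A_def by blast
  qed
  then obtain r where rA: "r \<in> A" and max: "\<forall>Z\<in>A. r \<subseteq> Z \<longrightarrow> Z = r" by (elim bexE)
  have r: "partial_emb r" "r0 \<subseteq> r" using rA unfolding A_def by simp_all
  note D = partial_embD[OF r(1)]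
  have Fr: "(a, a) \<in> r" if "a \<in> F" for a using F r(2) that by blast
  have dom: "x \<in> Domain r" if x: "x \<in> carrier \<Omega>" for x
  proof -
    obtain r' where r': "partial_emb r'" "r \<subseteq> r'" "x \<in> Domain r'"
      using partial_emb_step[OF r(1) Fr x] by blast
    then have "r' = r" using max r(2) unfolding A_def by (simp add: subset_trans)
    then show ?thesis using r'(3) by simp
  qed
  define s where "s = (\<lambda>x\<in>carrier \<Omega>. THE y. (x, y) \<in> r)"
  have s: "s x = y" if "(x, y) \<in> r" for x y
    unfolding s_def using that partial_emb_unique[OF r(1)] D(1)[OF that] by auto
  have sr: "(x, s x) \<in> r" if "x \<in> carrier \<Omega>" for x using dom[OF that] s by auto
  have hom: "s \<in> ring_hom \<Omega> \<Omega>"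
    by (rule ring_hom_memI) (use D(2)[OF sr] s D(3) D(4)[OF sr sr] D(5)[OF sr sr] in auto)
  interpret s: ring_hom_ring \<Omega> \<Omega> s by (rule ring_hom_ringI2[OF ring_axioms ring_axioms hom])
  have inj: "inj_on s (carrier \<Omega>)"
    using sr partial_emb_inj[OF r(1)] by (metis inj_onI)
  have "s ` carrier \<Omega> = carrier \<Omega>"
  proof
    show "s ` carrier \<Omega> \<subseteq> carrier \<Omega>" using s.hom_closed by blast
    show "carrier \<Omega> \<subseteq> s ` carrier \<Omega>"
    proof
      fix y assume y: "y \<in> carrier \<Omega>"
      \<comment> \<open>The injective map permutes the finitely many roots of any polynomial over the base field.\<close>
      have "(algebraic over F) y" using algebraic_extension[OF y] .
      then obtain P where P: "P \<in> carrier (F[X])" "P \<noteq> []" "eval P y = \<zero>"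
        using algebraicE[OF subfieldE(1)[OF subfield_axioms] y] by blast
      define Z where "Z = {x. is_root P x}"
      have P': "P \<in> carrier (poly_ring \<Omega>)" 
        using carrier_polynomial_shell[OF subfieldE(1)[OF subfield_axioms] P(1)] .
      have fin: "finite Z" unfolding Z_def by (rule finite_number_of_roots[OF P'])
      have setP: "set P \<subseteq> F" using P(1) by (simp add: univ_poly_carrier[symmetric] polynomial_incl)
      have mapP: "map s P = P" using s[OF Fr] setP by (simp add: map_idI subset_iff)
      have "s ` Z \<subseteq> Z"
      proof
        fix w assume "w \<in> s ` Z"
        then obtain z where z: "z \<in> carrier \<Omega>" "eval P z = \<zero>" "w = s z" unfolding Z_def is_root_def by auto
        have "s (eval P z) = eval (map s P) (s z)" 
          using s.eval_hom'[OF z(1)] P' by (simp add: univ_poly_carrier[symmetric] polynomial_incl)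
        then have "eval P w = \<zero>" using z mapP by (simp add: s.hom_zero)
        then show "w \<in> Z" using z P(2) s.hom_closed unfolding Z_def is_root_def by simp
      qed
      moreover have "inj_on s Z" using inj unfolding Z_def is_root_def inj_on_def by blast
      ultimately have "s ` Z = Z" using fin endo_inj_surj by blast
      moreover have "y \<in> Z" using P y unfolding Z_def is_root_def by simp
      ultimately show "y \<in> s ` carrier \<Omega>" unfolding Z_def is_root_def by blast
    qed
  qed
  then have "bij_betw s (carrier \<Omega>) (carrier \<Omega>)" using inj by (simp add: bij_betw_def)
  then have "s \<in> carrier (gal_group \<Omega> (carrier \<Omega>) F)"
    unfolding gal_group_def Bij_def using hom s[OF Fr] by (auto simp: s_def)
  then show ?thesis using that[of s] s r(2) by auto
qed

end

section \<open>Groups of field automorphisms\<close>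

lemma gal_group_iff:
  "s \<in> carrier (gal_group R L M) \<longleftrightarrow>
     s \<in> extensional L \<and> bij_betw s L L \<and> s \<in> ring_hom (R\<lparr>carrier := L\<rparr>) (R\<lparr>carrier := L\<rparr>) \<and> (\<forall>x\<in>M. s x = x)"
  unfolding gal_group_def Bij_def by auto

lemma gal_group_mult:
  assumes "s \<in> carrier (gal_group R L M)" "t \<in> carrier (gal_group R L M)" "x \<in> L"
  shows "(s \<otimes>\<^bsub>gal_group R L M\<^esub> t) x = s (t x)"
  using assms unfolding gal_group_def BijGroup_def by (simp add: compose_def)

lemma gal_group_one: "\<one>\<^bsub>gal_group R L M\<^esub> = (\<lambda>x\<in>L. x)"
  unfolding gal_group_def BijGroup_def by simp

lemma gal_group_ext:
  assumes "s \<in> carrier (gal_group R L M)" "t \<in> carrier (gal_group R L M)" "\<And>x. x \<in> L \<Longrightarrow> s x = t x"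
  shows "s = t"
  using assms unfolding gal_group_iff by (meson extensionalityI)

lemma gal_group_subgroup:
  assumes "ring (R\<lparr>carrier := L\<rparr>)" "M \<subseteq> L"
  shows "subgroup (carrier (gal_group R L M)) (BijGroup L)"
proof -
  interpret B: group "BijGroup L" by (rule group_BijGroup)
  interpret L: ring "R\<lparr>carrier := L\<rparr>" by fact
  have inL: "s \<in> L \<rightarrow> L" if "s \<in> Bij L" for s using Bij_imp_funcset[OF that] .
  show ?thesis
  proof (rule B.subgroupI)
    show "carrier (gal_group R L M) \<subseteq> carrier (BijGroup L)" unfolding gal_group_def BijGroup_def by auto
    have "(\<lambda>x\<in>L. x) \<in> carrier (gal_group R L M)"
      unfolding gal_group_def using id_Bij assms(2) L.m_closed L.add.m_closed L.one_closed by (auto simp: ring_hom_def)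
    then show "carrier (gal_group R L M) \<noteq> {}" by blast
  next
    fix s assume s: "s \<in> carrier (gal_group R L M)"
    then have sB: "s \<in> Bij L" and sh: "s \<in> ring_hom (R\<lparr>carrier := L\<rparr>) (R\<lparr>carrier := L\<rparr>)" and sM: "\<forall>x\<in>M. s x = x"
      unfolding gal_group_def by auto
    define u where "u = (\<lambda>x\<in>L. inv_into L s x)"
    have u: "inv\<^bsub>BijGroup L\<^esub> s = u" unfolding u_def by (rule inv_BijGroup[OF sB])
    have uB: "u \<in> Bij L" unfolding u_def by (rule restrict_inv_into_Bij[OF sB])
    have us: "u (s x) = x" if "x \<in> L" for x
      using sB that inL[OF sB] unfolding u_def Bij_def bij_betw_def by (auto simp: Pi_iff)
    have su: "s (u x) = x" if "x \<in> L" for x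
      using sB that unfolding u_def Bij_def bij_betw_def by (auto simp: f_inv_into_f)
    have uL: "u x \<in> L" if "x \<in> L" for x using inL[OF uB] that by auto
    have "u \<in> ring_hom (R\<lparr>carrier := L\<rparr>) (R\<lparr>carrier := L\<rparr>)"
    proof (rule ring_hom_memI)
      fix x y assume xy: "x \<in> carrier (R\<lparr>carrier := L\<rparr>)" "y \<in> carrier (R\<lparr>carrier := L\<rparr>)"
      then have xy': "x \<in> L" "y \<in> L" by auto
      show "u x \<in> carrier (R\<lparr>carrier := L\<rparr>)" using uL xy by simp
      have "s (u x \<otimes>\<^bsub>R\<^esub> u y) = x \<otimes>\<^bsub>R\<^esub> y" 
        using ring_hom_mult[OF sh] uL[OF xy'(1)] uL[OF xy'(2)] su xy' by simp
      then show "u (x \<otimes>\<^bsub>R\<lparr>carrier := L\<rparr>\<^esub> y) = u x \<otimes>\<^bsub>R\<lparr>carrier := L\<rparr>\<^esub> u y"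
        using us[of "u x \<otimes>\<^bsub>R\<^esub> u y"] L.m_closed[of "u x" "u y"] uL xy' by simp
      have "s (u x \<oplus>\<^bsub>R\<^esub> u y) = x \<oplus>\<^bsub>R\<^esub> y" 
        using ring_hom_add[OF sh] uL[OF xy'(1)] uL[OF xy'(2)] su xy' by simp
      then show "u (x \<oplus>\<^bsub>R\<lparr>carrier := L\<rparr>\<^esub> y) = u x \<oplus>\<^bsub>R\<lparr>carrier := L\<rparr>\<^esub> u y"
        using us[of "u x \<oplus>\<^bsub>R\<^esub> u y"] L.add.m_closed[of "u x" "u y"] uL xy' by simp
    next
      have "s \<one>\<^bsub>R\<^esub> = \<one>\<^bsub>R\<^esub>" using ring_hom_one[OF sh] by simp
      then show "u \<one>\<^bsub>R\<lparr>carrier := L\<rparr>\<^esub> = \<one>\<^bsub>R\<lparr>carrier := L\<rparr>\<^esub>" using us[of "\<one>\<^bsub>R\<^esub>"] L.one_closed by simp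
    qed
    moreover have "u x = x" if "x \<in> M" for x using us[of x] sM that assms(2) by auto
    ultimately show "inv\<^bsub>BijGroup L\<^esub> s \<in> carrier (gal_group R L M)"
      unfolding u gal_group_def using uB by auto
  next
    fix s t assume s: "s \<in> carrier (gal_group R L M)" and t: "t \<in> carrier (gal_group R L M)"
    then have B: "s \<in> Bij L" "t \<in> Bij L" and
      h: "s \<in> ring_hom (R\<lparr>carrier := L\<rparr>) (R\<lparr>carrier := L\<rparr>)" "t \<in> ring_hom (R\<lparr>carrier := L\<rparr>) (R\<lparr>carrier := L\<rparr>)"
      unfolding gal_group_def by auto
    have tL: "t x \<in> L" if "x \<in> L" for x using inL[OF B(2)] that by auto
    have sL: "s x \<in> L" if "x \<in> L" for x using inL[OF B(1)] that by auto
    have "compose L s t \<in> ring_hom (R\<lparr>carrier := L\<rparr>) (R\<lparr>carrier := L\<rparr>)"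
      using ring_hom_mult[OF h(1)] ring_hom_mult[OF h(2)] ring_hom_add[OF h(1)] ring_hom_add[OF h(2)] 
        ring_hom_one[OF h(1)] ring_hom_one[OF h(2)] tL sL L.m_closed L.add.m_closed L.one_closed
      by (intro ring_hom_memI) (simp_all add: compose_def)
    then show "s \<otimes>\<^bsub>BijGroup L\<^esub> t \<in> carrier (gal_group R L M)"
      using s t compose_Bij[OF B] assms(2) unfolding gal_group_def BijGroup_def 
      by (auto simp: compose_def subset_iff)
  qed
qed

lemma gal_group_is_group:
  assumes "ring (R\<lparr>carrier := L\<rparr>)" "M \<subseteq> L"
  shows "group (gal_group R L M)"
  using subgroup.subgroup_is_group[OF gal_group_subgroup[OF assms] group_BijGroup]
  unfolding gal_group_def by simp

context galois_closure
begin

abbreviation nmul :: "nat \<Rightarrow> 'a \<Rightarrow> 'a" where "nmul n x \<equiv> add_pow \<Omega> n x"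

abbreviation "auts M \<equiv> carrier (gal_group \<Omega> (carrier \<Omega>) M)"

lemma F_sub: "F \<subseteq> carrier \<Omega>" by (rule subfieldE(3)[OF subfield_axioms])

lemma auts_group: "M \<subseteq> carrier \<Omega> \<Longrightarrow> group (gal_group \<Omega> (carrier \<Omega>) M)"
  by (rule gal_group_is_group) (simp_all add: ring_axioms)

lemma aut_ring_hom: "s \<in> auts M \<Longrightarrow> ring_hom_ring \<Omega> \<Omega> s"
  unfolding gal_group_iff by (intro ring_hom_ringI2 ring_axioms) simp

lemma auts_mono: "M \<subseteq> M' \<Longrightarrow> auts M' \<subseteq> auts M"
  unfolding subset_iff gal_group_iff by blast

lemma aut_closed [simp]: "s \<in> auts M \<Longrightarrow> x \<in> carrier \<Omega> \<Longrightarrow> s x \<in> carrier \<Omega>"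
  unfolding gal_group_iff using bij_betwE by blast

lemma aut_inj: "s \<in> auts M \<Longrightarrow> x \<in> carrier \<Omega> \<Longrightarrow> y \<in> carrier \<Omega> \<Longrightarrow> s x = s y \<Longrightarrow> x = y"
  unfolding gal_group_iff bij_betw_def inj_on_def by blast

lemma aut_fix: "s \<in> auts M \<Longrightarrow> x \<in> M \<Longrightarrow> s x = x"
  unfolding gal_group_iff by blast

lemma
  assumes s: "s \<in> auts M"
  shows aut_add: "x \<in> carrier \<Omega> \<Longrightarrow> y \<in> carrier \<Omega> \<Longrightarrow> s (x \<oplus> y) = s x \<oplus> s y"
    and aut_mult: "x \<in> carrier \<Omega> \<Longrightarrow> y \<in> carrier \<Omega> \<Longrightarrow> s (x \<otimes> y) = s x \<otimes> s y"
    and aut_one: "s \<one> = \<one>" and aut_zero: "s \<zero> = \<zero>"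
    and aut_neg: "x \<in> carrier \<Omega> \<Longrightarrow> s (\<ominus> x) = \<ominus> s x"
    and aut_pow: "x \<in> carrier \<Omega> \<Longrightarrow> s (x [^] (n::nat)) = s x [^] n"
    and aut_zero_iff: "x \<in> carrier \<Omega> \<Longrightarrow> s x = \<zero> \<longleftrightarrow> x = \<zero>"
    and aut_inv: "x \<in> carrier \<Omega> \<Longrightarrow> x \<noteq> \<zero> \<Longrightarrow> s (inv x) = inv (s x)"
proof -
  interpret s: ring_hom_ring \<Omega> \<Omega> s by (rule aut_ring_hom[OF s])
  show "x \<in> carrier \<Omega> \<Longrightarrow> y \<in> carrier \<Omega> \<Longrightarrow> s (x \<oplus> y) = s x \<oplus> s y"
    "x \<in> carrier \<Omega> \<Longrightarrow> y \<in> carrier \<Omega> \<Longrightarrow> s (x \<otimes> y) = s x \<otimes> s y"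
    "s \<one> = \<one>" "s \<zero> = \<zero>" "x \<in> carrier \<Omega> \<Longrightarrow> s (\<ominus> x) = \<ominus> s x" by simp_all
  show "x \<in> carrier \<Omega> \<Longrightarrow> s (x [^] n) = s x [^] n" by (induct n) simp_all
  show z: "x \<in> carrier \<Omega> \<Longrightarrow> s x = \<zero> \<longleftrightarrow> x = \<zero>" 
    using aut_inj[OF s, of x \<zero>] s.hom_zero by auto
  show "x \<in> carrier \<Omega> \<Longrightarrow> x \<noteq> \<zero> \<Longrightarrow> s (inv x) = inv (s x)"
  proof -
    assume x: "x \<in> carrier \<Omega>" "x \<noteq> \<zero>"
    then have i: "inv x \<in> carrier \<Omega>" "x \<otimes> inv x = \<one>" by (simp_all add: field_Units)
    then have "s x \<otimes> s (inv x) = \<one>" using s.hom_mult[OF x(1) i(1)] by simp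
    then show ?thesis using comm_inv_char[of "s x" "s (inv x)"] i x s.hom_closed by auto
  qed
qed

lemma auts_mult: "s \<in> auts M \<Longrightarrow> t \<in> auts M \<Longrightarrow> x \<in> carrier \<Omega> \<Longrightarrow> (s \<otimes>\<^bsub>gal_group \<Omega> (carrier \<Omega>) M\<^esub> t) x = s (t x)"
  by (rule gal_group_mult)

lemma auts_inv1: 
  assumes "M \<subseteq> carrier \<Omega>" "s \<in> auts M" "x \<in> carrier \<Omega>" 
  shows "(inv\<^bsub>gal_group \<Omega> (carrier \<Omega>) M\<^esub> s) (s x) = x" "s ((inv\<^bsub>gal_group \<Omega> (carrier \<Omega>) M\<^esub> s) x) = x"
proof -
  interpret group "gal_group \<Omega> (carrier \<Omega>) M" by (rule auts_group[OF assms(1)])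
  show "(inv\<^bsub>gal_group \<Omega> (carrier \<Omega>) M\<^esub> s) (s x) = x" 
    using gal_group_mult[OF inv_closed[OF assms(2)] assms(2,3)] l_inv[OF assms(2)] assms(3)
    by (simp add: gal_group_one)
  show "s ((inv\<^bsub>gal_group \<Omega> (carrier \<Omega>) M\<^esub> s) x) = x" 
    using gal_group_mult[OF assms(2) inv_closed[OF assms(2)] assms(3)] r_inv[OF assms(2)] assms(3)
    by (simp add: gal_group_one)
qed

lemma conjugate_aut:
  assumes x: "x \<in> carrier \<Omega>" and y: "y \<in> carrier \<Omega>" "eval (Irr F x) y = \<zero>"
  obtains s where "s \<in> auts F" "s x = y"
proof -
  have id: "(\<lambda>a. a) \<in> ring_hom (\<Omega>\<lparr>carrier := F\<rparr>) \<Omega>" using F_sub by (auto simp: ring_hom_def)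
  obtain r where r: "partial_emb r" "(x, y) \<in> r" "\<And>a. a \<in> F \<Longrightarrow> (a, a) \<in> r"
    using adjoin_emb[OF subfield_axioms id x algebraic_extension[OF x] y(1)] y(2) by auto
  then obtain s where "s \<in> auts F" "\<forall>(x, y) \<in> r. s x = y"
    using partial_emb_extends[OF r(1,3)] by blast
  then show ?thesis using that[of s] r(2) by auto
qed

text \<open>Every relative automorphism of an intermediate field is the restriction of an automorphism of \<open>\<Omega>\<close>.
  So all Galois groups below are quotients of one group.\<close>

lemma extend_aut:
  assumes L: "subfield L \<Omega>" "F \<subseteq> L" and t: "t \<in> carrier (gal_group \<Omega> L F)"
  obtains s where "s \<in> auts F" "\<And>x. x \<in> L \<Longrightarrow> s x = t x"
proof -
  have Lc: "L \<subseteq> carrier \<Omega>" by (rule subfieldE(3)[OF L(1)])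
  have tL: "t x \<in> L" if "x \<in> L" for x using t that unfolding gal_group_iff using bij_betwE by blast
  have th: "t \<in> ring_hom (\<Omega>\<lparr>carrier := L\<rparr>) \<Omega>"
    using t Lc unfolding gal_group_iff ring_hom_def by auto
  interpret L: ring "\<Omega>\<lparr>carrier := L\<rparr>" by (rule subring_is_ring[OF subfieldE(1)[OF L(1)]])
  interpret t: ring_hom_ring "\<Omega>\<lparr>carrier := L\<rparr>" \<Omega> t by (rule ring_hom_ringI2[OF L.ring_axioms ring_axioms th])
  note Ls = subringE[OF subfieldE(1)[OF L(1)]]
  define r where "r = {(x, t x) | x. x \<in> L}"
  have inj: "inj_on t L" using t unfolding gal_group_iff bij_betw_def by blast
  have neg: "t (\<ominus> x) = \<ominus> t x" if "x \<in> L" for x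
  proof -
    have "t (x \<oplus> \<ominus> x) = t x \<oplus> t (\<ominus> x)" using t.hom_add[of x "\<ominus> x"] that Ls(5) by simp
    moreover have "t (x \<oplus> \<ominus> x) = \<zero>" using t.hom_zero that Lc by (simp add: r_neg subset_iff)
    ultimately show ?thesis using that Lc tL Ls(5)
      by (metis (no_types, lifting) a_comm minus_equality subsetD)
  qed
  have inv: "inv x \<in> L" "t (inv x) = inv (t x)" if x: "x \<in> L" "x \<noteq> \<zero>" for x
  proof -
    show i: "inv x \<in> L" using subfield_m_inv(1)[OF L(1), of x] x by simp
    have "x \<otimes> inv x = \<one>" using subfield_m_inv(2)[OF L(1), of x] x by simp
    then have "t x \<otimes> t (inv x) = \<one>" using t.hom_mult[of x "inv x"] x i t.hom_one by simp
    then show "t (inv x) = inv (t x)" 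
      using tL[OF x(1)] tL[OF i] Lc by (intro comm_inv_char[symmetric]) auto
  qed
  have zero: "t x = \<zero> \<longleftrightarrow> x = \<zero>" if "x \<in> L" for x 
    using inj that t.hom_zero Ls(2) unfolding inj_on_def by auto
  have "partial_emb r"
    unfolding partial_emb_def r_def using tL Lc t.hom_one Ls t.hom_add t.hom_mult neg inv zero
    by auto
  moreover have "(a, a) \<in> r" if "a \<in> F" for a using that t L unfolding r_def gal_group_iff by force
  ultimately obtain s where s: "s \<in> auts F" "\<forall>(x, y) \<in> r. s x = y"
    by (rule partial_emb_extends) blast
  show ?thesis by (rule that[OF s(1)]) (use s(2) in \<open>auto simp: r_def\<close>)
qed

section \<open>Frobenius\<close>

lemma binomial_ring:
  assumes x: "x \<in> carrier \<Omega>" and y: "y \<in> carrier \<Omega>"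
  shows "(x \<oplus> y) [^] n = (\<Oplus>k\<in>{..n}. nmul (n choose k) (x [^] k \<otimes> y [^] (n - k)))"
proof (induct n)
  case 0
  show ?case using x y by simp
next
  case (Suc n)
  define f where "f n k = nmul (n choose k) (x [^] k \<otimes> y [^] (n - k))" for n k :: nat
  have fc: "f m k \<in> carrier \<Omega>" for m k unfolding f_def using x y by simp
  have step: "f (Suc n) k = (if k = 0 then \<zero> else f n (k - 1) \<otimes> x) \<oplus> (if k = Suc n then \<zero> else f n k \<otimes> y)"
    if k: "k \<le> Suc n" for k
  proof (cases k)
    case 0
    then show ?thesis using x y by (simp add: f_def)
  next
    case (Suc j)
    have e1: "f n j \<otimes> x = nmul (n choose j) (x [^] Suc j \<otimes> y [^] (n - j))"
      unfolding f_def using x y by (simp add: add_pow_ldistr add_pow_rdistr m_ac)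
    show ?thesis
    proof (cases "j = n")
      case True
      then show ?thesis using Suc e1 x y by (simp add: f_def)
    next
      case False
      then have nj: "n - j = Suc (n - Suc j)" using k Suc by auto
      have e2: "f n k \<otimes> y = nmul (n choose Suc j) (x [^] Suc j \<otimes> y [^] (n - j))"
        unfolding f_def Suc nj using x y by (simp add: add_pow_ldistr m_assoc)
      have "f (Suc n) k = nmul ((n choose j) + (n choose Suc j)) (x [^] Suc j \<otimes> y [^] (n - j))"
        unfolding f_def Suc by simp
      also have "\<dots> = f n j \<otimes> x \<oplus> f n k \<otimes> y"
        unfolding e1 e2 using x y by (simp add: add.nat_pow_mult[symmetric])
      finally show ?thesis using Suc False by simp
    qed
  qed
  have "(x \<oplus> y) [^] Suc n = (\<Oplus>k\<in>{..n}. f n k) \<otimes> (x \<oplus> y)"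
    using Suc unfolding f_def by simp
  also have "\<dots> = (\<Oplus>k\<in>{..n}. f n k \<otimes> x) \<oplus> (\<Oplus>k\<in>{..n}. f n k \<otimes> y)"
    using fc x y by (simp add: r_distr finsum_ldistr finsum_closed Pi_I)
  also have "(\<Oplus>k\<in>{..n}. f n k \<otimes> x) = (\<Oplus>k\<in>{..Suc n}. if k = 0 then \<zero> else f n (k - 1) \<otimes> x)"
    using fc x by (subst finsum_Suc2) (auto simp: Pi_def)
  also have "(\<Oplus>k\<in>{..n}. f n k \<otimes> y) = (\<Oplus>k\<in>{..Suc n}. if k = Suc n then \<zero> else f n k \<otimes> y)"
  proof -
    have "(\<Oplus>k\<in>{..n}. f n k \<otimes> y) = (\<Oplus>k\<in>{..n}. if k = Suc n then \<zero> else f n k \<otimes> y)"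
      by (rule finsum_cong') (use fc y in auto)
    then show ?thesis using fc y by (subst finsum_Suc) (auto simp: Pi_def)
  qed
  also have "(\<Oplus>k\<in>{..Suc n}. if k = 0 then \<zero> else f n (k - 1) \<otimes> x) \<oplus> (\<Oplus>k\<in>{..Suc n}. if k = Suc n then \<zero> else f n k \<otimes> y)
      = (\<Oplus>k\<in>{..Suc n}. (if k = 0 then \<zero> else f n (k - 1) \<otimes> x) \<oplus> (if k = Suc n then \<zero> else f n k \<otimes> y))"
    using fc x y by (subst finsum_addf) (auto simp: Pi_def)
  also have "\<dots> = (\<Oplus>k\<in>{..Suc n}. f (Suc n) k)"
    by (rule finsum_cong') (use fc step in auto)
  finally show ?case unfolding f_def .
qed

text \<open>The characteristic exponent: \<open>1\<close> in characteristic zero, so that \<open>a \<mapsto> a\<^sup>c\<close> is an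
  injective endomorphism in every characteristic.\<close>

definition char_exp :: "nat \<Rightarrow> bool" where
  "char_exp c \<longleftrightarrow> (c = 1 \<and> (\<forall>n>0. nmul (n::nat) \<one> \<noteq> \<zero>)) \<or> (prime c \<and> nmul (c) \<one> = \<zero>)"

lemma nat_mult_one: "nmul ((m * n :: nat)) \<one> = (nmul (m) \<one>) \<otimes> (nmul (n) \<one>)"
  by (simp add: add_pow_ldistr add.nat_pow_pow mult.commute)

lemma char_exp_exists: obtains c where "char_exp c"
proof (cases "\<forall>n>0. nmul (n::nat) \<one> \<noteq> \<zero>")
  case True
  then show ?thesis using that[of 1] by (simp add: char_exp_def)
next
  case False
  define c where "c = (LEAST n. n > 0 \<and> nmul (n::nat) \<one> = \<zero>)"
  have c: "c > 0 \<and> nmul (c) \<one> = \<zero>" unfolding c_def by (rule LeastI_ex) (use False in auto)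
  have least: "nmul (n) \<one> \<noteq> \<zero>" if "0 < n" "n < c" for n
    using not_less_Least[of n "\<lambda>n. n > 0 \<and> nmul (n::nat) \<one> = \<zero>"] that unfolding c_def by blast
  have "c \<noteq> 1" using c by auto
  moreover have "m = 1 \<or> m = c" if "m dvd c" for m
  proof (rule ccontr)
    assume A: "\<not> ?thesis"
    obtain k where k: "c = m * k" using \<open>m dvd c\<close> by (elim dvdE)
    have "m > 0" "k > 0" using c k by (auto intro: Nat.gr0I)
    then have "m < c" "k < c" using A k by auto
    moreover have "(nmul (m) \<one>) \<otimes> (nmul (k) \<one>) = \<zero>" using c k nat_mult_one by metis
    then have "nmul (m) \<one> = \<zero> \<or> nmul (k) \<one> = \<zero>" by (simp add: integral_iff)
    ultimately show False using least \<open>m > 0\<close> \<open>k > 0\<close> by blast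
  qed
  ultimately have "prime c" using c by (simp add: prime_nat_iff)
  then show ?thesis using that[of c] c by (simp add: char_exp_def)
qed

lemma char_exp_pos: "char_exp c \<Longrightarrow> c > 0"
  unfolding char_exp_def using prime_gt_0_nat by auto

lemma char_exp_dvd:
  assumes "char_exp c" "nmul (n::nat) \<one> = \<zero>" "n > 0" shows "prime c" "c dvd n"
proof -
  show p: "prime c" using assms unfolding char_exp_def by auto
  then have c0: "nmul (c) \<one> = \<zero>" using assms(1) unfolding char_exp_def by auto
  show "c dvd n"
  proof (rule ccontr)
    assume "\<not> c dvd n"
    then have "coprime c n" using p by (simp add: prime_imp_coprime)
    moreover have n1: "n \<noteq> 1" using assms(2) by auto
    ultimately obtain a b where ab: "c * a = n * b + 1" 
      using coprime_bezout_strong[of c n] n1 by auto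
    have "nmul (c * a) \<one> = nmul (n * b) \<one> \<oplus> \<one>" unfolding ab by (simp add: add.nat_pow_mult[symmetric])
    then have "\<zero> = \<zero> \<oplus> \<one>" using c0 assms(2) by (simp only: nat_mult_one) simp
    then show False by simp
  qed
qed

lemma frobenius_add:
  assumes c: "char_exp c" and x: "x \<in> carrier \<Omega>" and y: "y \<in> carrier \<Omega>"
  shows "(x \<oplus> y) [^] c = x [^] c \<oplus> y [^] c"
proof (cases "c = 1")
  case True
  then show ?thesis using x y by simp
next
  case False
  then have p: "prime c" and c0: "nmul (c) \<one> = \<zero>" using c unfolding char_exp_def by auto
  have zero: "nmul (c choose k) a = \<zero>" if "k \<noteq> 0" "k < c" "a \<in> carrier \<Omega>" for k a
  proof -
    have "c dvd (c choose k)" using p that by (intro dvd_choose_prime) auto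
    then obtain m where m: "c choose k = c * m" by (elim dvdE)
    have "nmul (c * m) a = (nmul (c * m) \<one>) \<otimes> a" using that by (simp add: add_pow_ldistr)
    then show ?thesis using m c0 that by (simp add: nat_mult_one)
  qed
  obtain c' where c': "c = Suc c'" using p by (metis not0_implies_Suc not_prime_0)
  define f where "f k = nmul (c choose k) (x [^] k \<otimes> y [^] (c - k))" for k
  have fc: "f k \<in> carrier \<Omega>" for k unfolding f_def using x y by simp
  have c'pos: "c' > 0" using False c' by simp
  have "(x \<oplus> y) [^] c = (\<Oplus>k\<in>{..Suc c'}. f k)"
    using binomial_ring[OF x y, of c] unfolding f_def c' .
  also have "\<dots> = f (Suc c') \<oplus> (\<Oplus>k\<in>{..c'}. f k)" using fc by (simp add: Pi_def)
  also have "(\<Oplus>k\<in>{..c'}. f k) = (\<Oplus>k\<in>{..c'}. if k = 0 then f 0 else \<zero>)"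
    by (rule finsum_cong') (use fc zero c' x y in \<open>auto simp: f_def\<close>)
  also have "\<dots> = f 0" using finsum_singleton[of 0 "{..c'}" "\<lambda>_. f 0"] fc by (simp add: Pi_def eq_commute)
  also have "f (Suc c') = x [^] c" unfolding f_def using x y c' by simp
  also have "f 0 = y [^] c" unfolding f_def using x y c' by simp
  finally show ?thesis .
qed

lemma frobenius_hom: "char_exp c \<Longrightarrow> (\<lambda>a. a [^] c) \<in> ring_hom \<Omega> \<Omega>"
  by (rule ring_hom_memI) (auto simp: frobenius_add nat_pow_distrib)

lemma pow_eq_zero: "x \<in> carrier \<Omega> \<Longrightarrow> x [^] (n::nat) = \<zero> \<Longrightarrow> x = \<zero>"
  by (induct n) (auto simp: integral_iff)

lemma frobenius_inj:
  assumes c: "char_exp c" and x: "x \<in> carrier \<Omega>" and y: "y \<in> carrier \<Omega>" and e: "x [^] c = y [^] c"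
  shows "x = y"
proof -
  interpret f: ring_hom_ring \<Omega> \<Omega> "\<lambda>a. a [^] c"
    by (intro ring_hom_ringI2 ring_axioms frobenius_hom[OF c])
  have "(x \<oplus> \<ominus> y) [^] c = \<zero>" using e x y f.hom_add[of x "\<ominus> y"] f.hom_a_inv[of y] by (simp add: r_neg)
  then have "x \<oplus> \<ominus> y = \<zero>" by (rule pow_eq_zero[rotated]) (use x y in simp)
  then show ?thesis using x y by (simp add: minus_eq[symmetric])
qed

end

section \<open>Separability through the Frobenius map\<close>

context galois_closure
begin

lemma poly_in_sub:
  assumes "p \<in> carrier (M[X])" shows "set p \<subseteq> M"
  using assms by (simp add: univ_poly_carrier[symmetric] polynomial_incl)

lemma eval_in_subring:
  assumes "subring M \<Omega>" "set p \<subseteq> M" "x \<in> M" shows "eval p x \<in> M"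
proof -
  interpret M: ring "\<Omega>\<lparr>carrier := M\<rparr>" by (rule subring_is_ring[OF assms(1)])
  show ?thesis using M.eval_in_carrier[of p x] assms eval_consistent[OF assms(1)] by simp
qed

lemma pow_in_subring: "subring M \<Omega> \<Longrightarrow> x \<in> M \<Longrightarrow> x [^] (n::nat) \<in> M"
  by (induct n) (auto simp: subringE)

lemma inv_in_subfield: "subfield M \<Omega> \<Longrightarrow> x \<in> M \<Longrightarrow> x \<noteq> \<zero> \<Longrightarrow> inv x \<in> M"
  using subfield_m_inv(1)[of M x] by simp

lemma algebraic_intermediate: "F \<subseteq> M \<Longrightarrow> x \<in> carrier \<Omega> \<Longrightarrow> (algebraic over M) x"
  using algebraic_mono algebraic_extension by blast

lemma simple_extension_subfield:
  assumes "subfield M \<Omega>" "F \<subseteq> M" "x \<in> carrier \<Omega>"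
  shows "subfield (simple_extension M x) \<Omega>" "M \<subseteq> simple_extension M x" "x \<in> simple_extension M x"
  using simple_extension_is_subfield[OF assms(1,3)] algebraic_intermediate[OF assms(2,3)]
    simple_extension_incl[OF subfieldE(3)[OF assms(1)] assms(3)]
    simple_extension_mem[OF subfieldE(1)[OF assms(1)] assms(3)] by auto

text \<open>This is \<open>X\<^sup>n - y\<close>.\<close>

definition pure_poly :: "nat \<Rightarrow> 'a \<Rightarrow> 'a list" where
  "pure_poly n y = monom \<one> (n - 1) @ [\<ominus> y]"

lemma pure_poly:
  assumes "subring M \<Omega>" "y \<in> M" "n > 0"
  shows "pure_poly n y \<in> carrier (M[X])" "Polynomials.degree (pure_poly n y) = n" "pure_poly n y \<noteq> []"
    "x \<in> carrier \<Omega> \<Longrightarrow> eval (pure_poly n y) x = \<zero> \<longleftrightarrow> x [^] n = y"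
proof -
  note M = subringE[OF assms(1)]
  have yc: "y \<in> carrier \<Omega>" using M(1) assms(2) by auto
  show "pure_poly n y \<in> carrier (M[X])"
    using M assms(2) by (auto simp: pure_poly_def monom_def univ_poly_carrier[symmetric] polynomial_def)
  show "Polynomials.degree (pure_poly n y) = n" "pure_poly n y \<noteq> []" using assms(3) by (auto simp: pure_poly_def monom_def)
  assume x: "x \<in> carrier \<Omega>"
  have "eval (pure_poly n y) x = x [^] (n - 1) \<otimes> x \<oplus> \<ominus> y"
    unfolding pure_poly_def using x yc eval_append_aux[of "monom \<one> (n - 1)" "\<ominus> y" x] monom_in_carrier[of \<one> "n - 1"]
    by (simp add: eval_monom)
  also have "x [^] (n - 1) \<otimes> x = x [^] n" using assms(3) x by (metis Suc_pred' nat_pow_Suc)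
  finally show "eval (pure_poly n y) x = \<zero> \<longleftrightarrow> x [^] n = y" 
    using x yc by (simp add: minus_eq[symmetric])
qed

text \<open>As \<open>M(x\<^sup>c) = M(x)\<close>, the powers of \<open>x\<^sup>c\<close> below the degree \<open>d\<close> of \<open>x\<close> are independent over \<open>M\<close>. If
  \<open>z = \<Sum> a\<^sub>i x\<^sup>i\<close> with \<open>i < d\<close>, then \<open>z\<^sup>c = \<Sum> a\<^sub>i\<^sup>c (x\<^sup>c)\<^sup>i\<close> lies in \<open>M\<close> only if \<open>a\<^sub>i = 0\<close> for \<open>i > 0\<close>.\<close>

lemma separable_descent:
  assumes c: "char_exp c" and M: "subfield M \<Omega>" "F \<subseteq> M" and x: "x \<in> carrier \<Omega>"
    and xc: "x \<in> simple_extension M (x [^] c)" and z: "z \<in> simple_extension M x" "z [^] c \<in> M"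
  shows "z \<in> M"
proof -
  have Msub: "subring M \<Omega>" by (rule subfieldE(1)[OF M(1)])
  have Mc: "M \<subseteq> carrier \<Omega>" by (rule subfieldE(3)[OF M(1)])
  define y where "y = x [^] c"
  have y: "y \<in> carrier \<Omega>" unfolding y_def using x by simp
  note algx = algebraic_intermediate[OF M(2) x] and algy = algebraic_intermediate[OF M(2) y]
  note Ex = simple_extension_subfield[OF M x] and Ey = simple_extension_subfield[OF M y]
  have "y \<in> simple_extension M x" unfolding y_def
    by (rule pow_in_subring[OF subfieldE(1)[OF Ex(1)] Ex(3)])
  then have E: "simple_extension M y = simple_extension M x"
    using simple_extension_subring_incl[OF subfieldE(1)[OF Ex(1)] Ex(2)]
      simple_extension_subring_incl[OF subfieldE(1)[OF Ey(1)] Ey(2)] xc unfolding y_def by blast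
  define d where "d = Polynomials.degree (Irr M x)"
  have "dimension (Polynomials.degree (Irr M y)) M (simple_extension M x)"
    using dimension_simple_extension[OF M(1) y algy] E by simp
  then have dy: "Polynomials.degree (Irr M y) = d" unfolding d_def
    by (rule dimension_is_inj[OF M(1) _ dimension_simple_extension[OF M(1) x algx]])
  have ind: "independent M (exp_base y d)" using exp_base_independent[OF M(1) y algy] dy by simp
  have "z \<in> Span M (exp_base x d)" using z(1) Span_exp_base[OF M(1) x algx] unfolding d_def by simp
  then obtain p where p: "p \<in> carrier (M[X])" "length p \<le> d" "z = eval p x"
    using Span_eq_eval_img[OF M(1) x] by auto
  show ?thesis
  proof (cases "p = []")
    case True
    then show ?thesis using p(3) subringE(2)[OF Msub] by simp
  next
    case False
    interpret f: ring_hom_ring \<Omega> \<Omega> "\<lambda>a. a [^] c"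
      by (intro ring_hom_ringI2 ring_axioms frobenius_hom[OF c])
    define q where "q = map (\<lambda>a. a [^] c) p"
    define w where "w = z [^] c"
    have sp: "set p \<subseteq> M" by (rule poly_in_sub[OF p(1)])
    have sq: "set q \<subseteq> M" unfolding q_def using sp pow_in_subring[OF Msub] by auto
    have q0: "q \<noteq> []" using False q_def by simp
    have wM: "w \<in> M" using z(2) w_def by simp
    have wq: "w = eval q y" unfolding w_def q_def y_def p(3) 
      by (rule f.eval_hom'[OF x]) (use sp Mc in auto)
    define q' where "q' = butlast q @ [last q \<ominus> w]"
    have bl: "set (butlast q) \<subseteq> carrier \<Omega>" using sq Mc in_set_butlastD by fastforce
    have lq: "last q \<in> M" using sq q0 by auto
    have qd: "eval q y = eval (butlast q) y \<otimes> y \<oplus> last q"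
      using eval_append_aux[OF bl _ y, of "last q"] lq Mc q0 by auto
    have e: "eval (butlast q) y \<in> carrier \<Omega>" by (rule eval_in_carrier[OF bl y])
    have lqc: "last q \<in> carrier \<Omega>" and wc: "w \<in> carrier \<Omega>" using lq wM Mc by auto
    have "eval q' y = eval (butlast q) y \<otimes> y \<oplus> (last q \<ominus> w)"
      unfolding q'_def by (rule eval_append_aux[OF bl _ y]) (use lqc wc in simp)
    also have "\<dots> = eval q y \<ominus> w" unfolding qd using e y lqc wc by (simp add: minus_eq a_assoc)
    also have "\<dots> = \<zero>" using wq wc by (simp add: minus_eq r_neg)
    finally have q'0: "eval q' y = \<zero>" .
    define Ks where "Ks = replicate (d - length q') \<zero> @ q'"
    have lq': "length q' \<le> d" unfolding q'_def using p(2) q0 unfolding q_def by simp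
    have sq': "set q' \<subseteq> M" unfolding q'_def using sq lq wM subringE(5,7)[OF Msub] 
      by (auto simp: minus_eq dest: in_set_butlastD)
    have lK: "length Ks = d" unfolding Ks_def using lq' by simp
    have sK: "set Ks \<subseteq> M" unfolding Ks_def using sq' subringE(2)[OF Msub] by auto
    have "combine Ks (exp_base y d) = eval Ks y" using combine_eq_eval[of Ks y] lK by simp
    also have "\<dots> = eval q' y" unfolding Ks_def by (rule eval_replicate) (use sq' Mc y in auto)
    finally have comb: "combine Ks (exp_base y d) = \<zero>" using q'0 by simp
    have "set (take (length (exp_base y d)) Ks) \<subseteq> {\<zero>}"
      by (rule independent_imp_trivial_combine[OF M(1) ind sK comb])
    then have "set Ks \<subseteq> {\<zero>}" using lK by (simp add: exp_base_def)
    then have "set (butlast q) \<subseteq> {\<zero>}" unfolding Ks_def q'_def by auto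
    then have bz: "a = \<zero>" if "a \<in> set (butlast p)" for a
    proof -
      have "a [^] c \<in> set (butlast q)" using that unfolding q_def by (simp add: map_butlast[symmetric])
      then have "a [^] c = \<zero>" using \<open>set (butlast q) \<subseteq> {\<zero>}\<close> by auto
      then show ?thesis using pow_eq_zero that sp Mc by (meson in_set_butlastD subsetD)
    qed
    have "butlast p = []"
    proof (rule ccontr)
      assume ne: "butlast p \<noteq> []"
      then have "hd p \<in> set (butlast p)" by (cases p) (auto split: if_splits)
      then have "hd p = \<zero>" using bz by blast
      moreover have "hd p \<noteq> \<zero>" using p(1) False by (simp add: univ_poly_carrier[symmetric] polynomial_def)
      ultimately show False by simp
    qed
    then have "p = [last p]" using False by (metis append_Nil append_butlast_last_id)
    then obtain k where k: "p = [k]" by blast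
    then show ?thesis using p(3) sp Mc x by auto
  qed
qed

text \<open>The condition says that \<open>F(x\<^sup>c) = F(x)\<close>, which means that \<open>x\<close> is separable over \<open>F\<close>. In this form
  separability passes to intermediate fields and is checked with the Frobenius map alone.\<close>

definition sep :: "nat \<Rightarrow> 'a set" where
  "sep c = {x \<in> carrier \<Omega>. \<forall>M. subfield M \<Omega> \<longrightarrow> F \<subseteq> M \<longrightarrow> x [^] c \<in> M \<longrightarrow> x \<in> M}"

lemma sepD: "x \<in> sep c \<Longrightarrow> subfield M \<Omega> \<Longrightarrow> F \<subseteq> M \<Longrightarrow> x [^] c \<in> M \<Longrightarrow> x \<in> M"
  unfolding sep_def by blast

lemma sep_carrier: "sep c \<subseteq> carrier \<Omega>" unfolding sep_def by blast

lemma F_sub_sep: "F \<subseteq> sep c" unfolding sep_def using F_sub by blast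

lemma sep_combine:
  assumes c: "char_exp c" and x: "x \<in> sep c" and z: "z \<in> carrier \<Omega>"
    and M: "subfield M \<Omega>" "F \<subseteq> M" and zc: "z [^] c \<in> M" and zx: "z \<in> simple_extension M x"
  shows "z \<in> M"
proof -
  have xc: "x \<in> carrier \<Omega>" using x sep_carrier by blast
  then have y: "x [^] c \<in> carrier \<Omega>" by simp
  note E = simple_extension_subfield[OF M y]
  have "x \<in> simple_extension M (x [^] c)"
    by (rule sepD[OF x E(1) _ E(3)]) (use E(2) M(2) in blast)
  then show ?thesis by (rule separable_descent[OF c M xc _ zx zc])
qed

text \<open>A sum \<open>x + y\<close> whose \<open>c\<close>-th power lies in \<open>M\<close> belongs to \<open>M(x)\<close>, because \<open>y\<^sup>c\<close> and hence
  \<open>y\<close> does; then the descent along the separable element \<open>x\<close> puts it in \<open>M\<close>. Products are similar.\<close>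

lemma sep_subfield:
  assumes c: "char_exp c" shows "subfield (sep c) \<Omega>"
proof (rule subfieldI')
  have add: "x \<oplus> y \<in> sep c" if x: "x \<in> sep c" and y: "y \<in> sep c" for x y
    unfolding sep_def
  proof (intro CollectI conjI allI impI)
    have xc: "x \<in> carrier \<Omega>" and yc: "y \<in> carrier \<Omega>" using x y sep_carrier by blast+
    then show z: "x \<oplus> y \<in> carrier \<Omega>" by simp
    fix M assume M: "subfield M \<Omega>" "F \<subseteq> M" and zM: "(x \<oplus> y) [^] c \<in> M"
    note E = simple_extension_subfield[OF M xc]
    note Es = subringE[OF subfieldE(1)[OF E(1)]]
    have "y [^] c = (x \<oplus> y) [^] c \<oplus> \<ominus> (x [^] c)"
      using frobenius_add[OF c xc yc] xc yc by (simp add: a_comm[of "x [^] c" "y [^] c"] a_assoc r_neg)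
    moreover have "x [^] c \<in> simple_extension M x" by (rule pow_in_subring[OF subfieldE(1)[OF E(1)] E(3)])
    ultimately have "y [^] c \<in> simple_extension M x" using zM E(2) Es(5,7) by auto
    then have "y \<in> simple_extension M x" using sepD[OF y E(1)] E(2) M(2) by blast
    then have "x \<oplus> y \<in> simple_extension M x" using E(3) Es(7) by blast
    then show "x \<oplus> y \<in> M" by (rule sep_combine[OF c x z M zM])
  qed
  have mult: "x \<otimes> y \<in> sep c" if x: "x \<in> sep c" and y: "y \<in> sep c" for x y
    unfolding sep_def
  proof (intro CollectI conjI allI impI)
    have xc: "x \<in> carrier \<Omega>" and yc: "y \<in> carrier \<Omega>" using x y sep_carrier by blast+
    then show z: "x \<otimes> y \<in> carrier \<Omega>" by simp
    fix M assume M: "subfield M \<Omega>" "F \<subseteq> M" and zM: "(x \<otimes> y) [^] c \<in> M"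
    show "x \<otimes> y \<in> M"
    proof (cases "x = \<zero>")
      case True
      then show ?thesis using yc subringE(2)[OF subfieldE(1)[OF M(1)]] by simp
    next
      case False
      note E = simple_extension_subfield[OF M xc]
      note Es = subringE[OF subfieldE(1)[OF E(1)]]
      have x0: "x [^] c \<noteq> \<zero>" using False pow_eq_zero xc by blast
      have xE: "x [^] c \<in> simple_extension M x" by (rule pow_in_subring[OF subfieldE(1)[OF E(1)] E(3)])
      have ic: "inv (x [^] c) \<in> carrier \<Omega>" "inv (x [^] c) \<otimes> x [^] c = \<one>" 
        using x0 xc by (simp_all add: field_Units)
      have "inv (x [^] c) \<otimes> (x \<otimes> y) [^] c = inv (x [^] c) \<otimes> x [^] c \<otimes> y [^] c"
        using xc yc ic(1) by (simp add: nat_pow_distrib m_assoc)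
      then have "y [^] c = inv (x [^] c) \<otimes> (x \<otimes> y) [^] c" using ic yc by simp
      moreover have "inv (x [^] c) \<in> simple_extension M x" by (rule inv_in_subfield[OF E(1) xE x0])
      ultimately have "y [^] c \<in> simple_extension M x" using zM E(2) Es(6) by auto
      then have "y \<in> simple_extension M x" using sepD[OF y E(1)] E(2) M(2) by blast
      then have "x \<otimes> y \<in> simple_extension M x" using E(3) Es(6) by blast
      then show ?thesis by (rule sep_combine[OF c x z M zM])
    qed
  qed
  have one: "\<one> \<in> F" and mone: "\<ominus> \<one> \<in> F" using subringE(3,5)[OF subfieldE(1)[OF subfield_axioms]] by auto
  show "subring (sep c) \<Omega>"
  proof (rule subringI)
    show "sep c \<subseteq> carrier \<Omega>" by (rule sep_carrier)
    show "\<one> \<in> sep c" using one F_sub_sep by blast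
    fix h assume h: "h \<in> sep c"
    have "\<ominus> \<one> \<otimes> h \<in> sep c" using mult mone F_sub_sep h by blast
    then show "\<ominus> h \<in> sep c" using h sep_carrier by (simp add: l_minus subset_iff)
  qed (use add mult in auto)
  show "inv k \<in> sep c" if k: "k \<in> sep c - {\<zero>}" for k
    unfolding sep_def
  proof (intro CollectI conjI allI impI)
    have kc: "k \<in> carrier \<Omega>" "k \<noteq> \<zero>" using k sep_carrier by auto
    then show ik: "inv k \<in> carrier \<Omega>" by (simp add: field_Units)
    fix M assume M: "subfield M \<Omega>" "F \<subseteq> M" and zM: "(inv k) [^] c \<in> M"
    have kk: "inv k \<otimes> k = \<one>" using kc by (simp add: field_Units)
    have ik0: "inv k \<noteq> \<zero>" using kk kc by auto
    then have "(inv k) [^] c \<noteq> \<zero>" using pow_eq_zero ik by blast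
    then have "inv ((inv k) [^] c) \<in> M" using inv_in_subfield[OF M(1) zM] by blast
    moreover have "inv ((inv k) [^] c) = k [^] c"
    proof (rule comm_inv_char)
      show "inv k [^] c \<otimes> k [^] c = \<one>" using kk kc ik by (metis nat_pow_distrib nat_pow_one)
    qed (use kc ik in auto)
    ultimately have "k \<in> M" using sepD[of k c M] k M by simp
    then show "inv k \<in> M" using inv_in_subfield[OF M(1)] kc by blast
  qed
qed

lemma sep_aut:
  assumes s: "s \<in> auts F" and x: "x \<in> sep c" shows "s x \<in> sep c"
  unfolding sep_def
proof (intro CollectI conjI allI impI)
  have xc: "x \<in> carrier \<Omega>" using x sep_carrier by blast
  then show "s x \<in> carrier \<Omega>" using s by simp
  fix M assume M: "subfield M \<Omega>" "F \<subseteq> M" and zM: "s x [^] c \<in> M"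
  interpret G: group "gal_group \<Omega> (carrier \<Omega>) F" by (rule auts_group[OF F_sub])
  define t where "t = inv\<^bsub>gal_group \<Omega> (carrier \<Omega>) F\<^esub> s"
  have t: "t \<in> auts F" unfolding t_def using s by simp
  have ts: "t (s a) = a" "s (t a) = a" if "a \<in> carrier \<Omega>" for a
    unfolding t_def using auts_inv1[OF F_sub s that] by auto
  interpret t: ring_hom_ring \<Omega> \<Omega> t by (rule aut_ring_hom[OF t])
  have "subfield (t ` M) \<Omega>" by (rule t.img_is_subfield(2)[OF M(1)]) simp
  moreover have "F \<subseteq> t ` M" 
  proof
    fix a assume "a \<in> F"
    then show "a \<in> t ` M" using aut_fix[OF t] M(2) by (metis imageI subsetD)
  qed
  moreover have "x [^] c \<in> t ` M"
  proof -
    have "t (s x [^] c) = x [^] c" using aut_pow[OF s xc] ts xc by (metis nat_pow_closed)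
    then show ?thesis using zM by (metis imageI)
  qed
  ultimately have "x \<in> t ` M" using sepD[OF x] by blast
  then obtain m where "m \<in> M" "x = t m" by blast
  then show "s x \<in> M" using ts subfieldE(3)[OF M(1)] by auto
qed

text \<open>A root of \<open>1 + X + \<dots> + X\<^sup>d\<^sup>-\<^sup>1\<close>, which does not vanish at \<open>1\<close>.\<close>

lemma root_of_unity_exists:
  assumes "d \<ge> 2" "nmul d \<one> \<noteq> \<zero>"
  obtains u where "u \<in> carrier \<Omega>" "u \<noteq> \<one>" "u [^] d = \<one>"
proof -
  have ev: "eval (replicate n \<one>) u \<otimes> (u \<oplus> \<ominus> \<one>) = u [^] n \<oplus> \<ominus> \<one>" if u: "u \<in> carrier \<Omega>" for n u
  proof (induct n)
    case 0
    show ?case using u by (simp add: r_neg)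
  next
    case (Suc n)
    have e: "eval (replicate n \<one>) u \<in> carrier \<Omega>" by (rule eval_in_carrier) (use u in auto)
    have "eval (replicate (Suc n) \<one>) u \<otimes> (u \<oplus> \<ominus> \<one>) = u [^] n \<otimes> (u \<oplus> \<ominus> \<one>) \<oplus> eval (replicate n \<one>) u \<otimes> (u \<oplus> \<ominus> \<one>)"
      using u e by (simp add: l_distr)
    also have "\<dots> = u [^] n \<otimes> u \<oplus> (\<ominus> (u [^] n) \<oplus> (u [^] n \<oplus> \<ominus> \<one>))"
      unfolding Suc using u by (simp add: r_distr r_minus a_assoc)
    also have "\<ominus> (u [^] n) \<oplus> (u [^] n \<oplus> \<ominus> \<one>) = \<ominus> \<one>" using u by (simp add: r_neg1)
    finally show ?case by simp
  qed
  have P: "replicate d \<one> \<in> carrier (poly_ring \<Omega>)" 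
    using assms by (auto simp: univ_poly_carrier[symmetric] polynomial_def)
  have "Polynomials.degree (replicate d \<one>) \<ge> 1" using assms(1) by simp
  then obtain u where u: "u \<in> carrier \<Omega>" "eval (replicate d \<one>) u = \<zero>"
    by (rule root_exists[OF P])
  have "u [^] d \<oplus> \<ominus> \<one> = \<zero>" using ev[OF u(1), of d] u by simp
  then have "u [^] d = \<one>" using u by (simp add: minus_eq[symmetric])
  moreover have "u \<noteq> \<one>"
  proof
    assume "u = \<one>"
    moreover have "eval (replicate n \<one>) \<one> = nmul n \<one>" for n 
      by (induct n) (simp_all add: a_comm)
    ultimately show False using u(2) assms(2) by simp
  qed
  ultimately show ?thesis using that u by blast
qed

lemma degree_one_mem:
  assumes M: "subfield M \<Omega>" "F \<subseteq> M" and x: "x \<in> carrier \<Omega>" and d: "Polynomials.degree (Irr M x) = 1"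
  shows "x \<in> M"
proof -
  note I = IrrE[OF M(1) x algebraic_intermediate[OF M(2) x]]
  obtain a b where ab: "a \<in> M" "b \<in> M" "Irr M x = [a, b]" using degree_oneE[OF I(1) d] by metis
  have Mc: "M \<subseteq> carrier \<Omega>" by (rule subfieldE(3)[OF M(1)])
  have b: "b \<in> carrier \<Omega>" using ab Mc by blast
  have "a = \<one>" using I(3) ab by simp
  then have "x \<oplus> b = \<zero>" using I(4) ab x b by simp
  then have "x = \<ominus> b" using x b by (metis a_comm minus_equality)
  then show ?thesis using ab subringE(5)[OF subfieldE(1)[OF M(1)]] by simp
qed

lemma unique_root_multiset:
  assumes M: "subfield M \<Omega>" "F \<subseteq> M" and x: "x \<in> carrier \<Omega>" 
    and uniq: "\<And>y. y \<in> carrier \<Omega> \<Longrightarrow> eval (Irr M x) y = \<zero> \<Longrightarrow> y = x"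
  shows "roots (Irr M x) = replicate_mset (Polynomials.degree (Irr M x)) x"
proof -
  note I = IrrE[OF M(1) x algebraic_intermediate[OF M(2) x]]
  have P: "Irr M x \<in> carrier (poly_ring \<Omega>)" by (rule carrier_polynomial_shell[OF subfieldE(1)[OF M(1)] I(1)])
  have size: "size (roots (Irr M x)) = Polynomials.degree (Irr M x)" using roots_over_carrier[OF P] by (simp add: splitted_def)
  have "set_mset (roots (Irr M x)) \<subseteq> {x}" 
    using uniq by (auto simp: roots_mem_iff_is_root[OF P] is_root_def)
  then show ?thesis using set_mset_subset_singletonD[of "roots (Irr M x)" x] size by simp
qed

text \<open>If \<open>x\<close> is fixed, it is the only root of its minimal polynomial \<open>m = (X - x)\<^sup>d\<close>, so
  \<open>x\<^sup>d \<in> M\<close>. Suppose \<open>d \<ge> 2\<close>. If \<open>d\<close> vanishes in \<open>\<Omega>\<close>, then \<open>c\<close> divides \<open>d\<close> and separability of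
  \<open>x\<^sup>d\<^sup>/\<^sup>c\<close> gives a polynomial of smaller degree. Otherwise some \<open>u \<noteq> 1\<close> has \<open>u\<^sup>d = 1\<close>; then
  \<open>u x\<close> is a further root of \<open>X\<^sup>d - x\<^sup>d\<close>, which is a multiple of \<open>m\<close> of the same degree.\<close>

lemma sep_fixed:
  assumes c: "char_exp c" and M: "subfield M \<Omega>" "F \<subseteq> M" and x: "x \<in> sep c"
    and fixed: "\<And>s. s \<in> auts M \<Longrightarrow> s x = x"
  shows "x \<in> M"
proof (rule ccontr)
  assume nM: "x \<notin> M"
  have Msub: "subring M \<Omega>" and Mc: "M \<subseteq> carrier \<Omega>" using subfieldE(1,3)[OF M(1)] by auto
  have xc: "x \<in> carrier \<Omega>" using x sep_carrier by blast
  have x0: "x \<noteq> \<zero>" using nM subringE(2)[OF Msub] by auto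
  interpret C: galois_closure \<Omega> M by (rule closure_over[OF M])
  interpret UP: domain "poly_ring \<Omega>" by (rule univ_poly_is_domain[OF carrier_is_subring])
  note I = IrrE[OF M(1) xc algebraic_intermediate[OF M(2) xc]]
  define m where "m = Irr M x"
  define d where "d = Polynomials.degree m"
  have mP: "m \<in> carrier (poly_ring \<Omega>)" unfolding m_def by (rule carrier_polynomial_shell[OF Msub I(1)])
  have m0: "m \<noteq> []" unfolding m_def by (rule pirreducibleE(1)[OF Msub I(1,2)])
  have "y = x" if "y \<in> carrier \<Omega>" "eval (Irr M x) y = \<zero>" for y
    using C.conjugate_aut[OF xc that] fixed by blast
  then have roots: "roots m = replicate_mset d x"
    unfolding m_def d_def using unique_root_multiset[OF M xc] by blast
  have d1: "d \<noteq> 1" using degree_one_mem[OF M xc] nM unfolding d_def m_def by blast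
  have "d \<ge> 1" unfolding d_def m_def by (rule pirreducible_degree[OF M(1) I(1,2)])
  then have d2: "d \<ge> 2" using d1 by simp
  define b where "b = [\<one>, \<ominus> x]"
  have b: "b \<in> carrier (poly_ring \<Omega>)" "b \<noteq> []" 
    unfolding b_def using xc by (auto simp: univ_poly_carrier[symmetric] polynomial_def)
  have "alg_mult m x = d" using roots alg_mult_eq_count_roots[OF mP] by simp
  then have "b [^]\<^bsub>poly_ring \<Omega>\<^esub> d pdivides m" using alg_multE(1)[OF xc mP m0] unfolding b_def by simp
  then obtain t where t: "t \<in> carrier (poly_ring \<Omega>)" "m = (b [^]\<^bsub>poly_ring \<Omega>\<^esub> d) \<otimes>\<^bsub>poly_ring \<Omega>\<^esub> t"
    unfolding pdivides_def factor_def by blast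
  have t0: "t \<noteq> []" using t m0 b by (metis UP.nat_pow_closed UP.r_null univ_poly_zero)
  have bd: "b [^]\<^bsub>poly_ring \<Omega>\<^esub> n \<in> carrier (poly_ring \<Omega>)" "b [^]\<^bsub>poly_ring \<Omega>\<^esub> n \<noteq> []" 
    "Polynomials.lead_coeff (b [^]\<^bsub>poly_ring \<Omega>\<^esub> n) = \<one>" "Polynomials.degree (b [^]\<^bsub>poly_ring \<Omega>\<^esub> n) = n" for n :: nat
  proof -
    show 1: "b [^]\<^bsub>poly_ring \<Omega>\<^esub> n \<in> carrier (poly_ring \<Omega>)" for n :: nat using b by simp
    show 2: "b [^]\<^bsub>poly_ring \<Omega>\<^esub> n \<noteq> []" for n :: nat using polynomial_pow_not_zero[OF b] .
    show "Polynomials.degree (b [^]\<^bsub>poly_ring \<Omega>\<^esub> n) = n" using polynomial_pow_degree[OF b(1), of n] by (simp add: b_def)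
    show "Polynomials.lead_coeff (b [^]\<^bsub>poly_ring \<Omega>\<^esub> n) = \<one>"
    proof (induct n)
      case 0
      show ?case by (simp add: univ_poly_one)
    next
      case (Suc n)
      have "Polynomials.lead_coeff (poly_mult (b [^]\<^bsub>poly_ring \<Omega>\<^esub> n) b) = Polynomials.lead_coeff (b [^]\<^bsub>poly_ring \<Omega>\<^esub> n) \<otimes> Polynomials.lead_coeff b"
        by (rule poly_mult_lead_coeff[OF carrier_is_subring]) (use 1 2 b in \<open>auto simp: univ_poly_carrier\<close>)
      then show ?case using Suc by (simp add: univ_poly_mult b_def)
    qed
  qed
  have "Polynomials.degree m = Polynomials.degree (b [^]\<^bsub>poly_ring \<Omega>\<^esub> d) + Polynomials.degree t"
    using poly_mult_degree_eq[OF carrier_is_subring, of "b [^]\<^bsub>poly_ring \<Omega>\<^esub> d" t] t bd t0 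
    by (simp add: univ_poly_mult univ_poly_carrier)
  then have "Polynomials.degree t = 0" using bd(4) unfolding d_def by simp
  then obtain k where k: "t = [k]" using t0 by (cases t) auto
  have "Polynomials.lead_coeff m = Polynomials.lead_coeff (b [^]\<^bsub>poly_ring \<Omega>\<^esub> d) \<otimes> Polynomials.lead_coeff t"
    using poly_mult_lead_coeff[OF carrier_is_subring, of "b [^]\<^bsub>poly_ring \<Omega>\<^esub> d" t] t bd t0
    by (simp add: univ_poly_mult univ_poly_carrier)
  moreover have "k \<in> carrier \<Omega>" using t(1) k by (simp add: univ_poly_carrier[symmetric] polynomial_def)
  ultimately have "k = \<one>" using I(3) bd(3) k unfolding m_def by simp
  then have "t = \<one>\<^bsub>poly_ring \<Omega>\<^esub>" using k by (simp add: univ_poly_one)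
  then have mb: "m = b [^]\<^bsub>poly_ring \<Omega>\<^esub> d" using t bd(1) by simp
  interpret ev: ring_hom_ring "poly_ring \<Omega>" \<Omega> "\<lambda>q. eval q \<zero>" by (rule eval_ring_hom[OF carrier_is_subring]) simp
  have "eval (b [^]\<^bsub>poly_ring \<Omega>\<^esub> n) \<zero> = (\<ominus> x) [^] n" for n :: nat
  proof (induct n)
    case 0
    show ?case using ev.hom_one by simp
  next
    case (Suc n)
    have "eval b \<zero> = \<ominus> x" unfolding b_def using xc by simp
    then show ?case using ev.hom_mult[OF bd(1)[of n] b(1)] Suc by simp
  qed
  then have "(\<ominus> x) [^] d = eval m \<zero>" using mb by simp
  also have "\<dots> \<in> M" 
    by (rule eval_in_subring[OF Msub]) (use poly_in_sub[OF I(1)] m_def subringE(2)[OF Msub] in auto)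
  finally have "(\<ominus> \<one>) [^] d \<otimes> (\<ominus> x) [^] d \<in> M"
    using subringE(3,5,6)[OF Msub] pow_in_subring[OF Msub, of "\<ominus> \<one>" d] by blast
  moreover have "(\<ominus> \<one>) [^] d \<otimes> (\<ominus> x) [^] d = (\<ominus> \<one> \<otimes> \<ominus> x) [^] d" using xc by (simp add: nat_pow_distrib)
  moreover have "\<ominus> \<one> \<otimes> \<ominus> x = x" using xc by (simp add: l_minus)
  ultimately have xd: "x [^] d \<in> M" by simp
  show False
  proof (cases "nmul d \<one> = \<zero>")
    case True
    then have p: "prime c" and "c dvd d" using char_exp_dvd[OF c True] d2 by auto
    then obtain e where e: "d = e * c" by (metis dvdE mult.commute)
    have "e > 0" "e < d" using e d2 prime_gt_1_nat[OF p] by (auto intro: Nat.gr0I)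
    have "x [^] e \<in> sep c" by (rule pow_in_subring[OF subfieldE(1)[OF sep_subfield[OF c]] x])
    moreover have "(x [^] e) [^] c \<in> M" using xd e xc by (simp add: nat_pow_pow)
    ultimately have y: "x [^] e \<in> M" using sepD M by blast
    note pp = pure_poly[OF Msub y \<open>e > 0\<close>]
    have "m pdivides pure_poly e (x [^] e)"
      unfolding m_def by (rule Irr_minimal[OF M(1) xc algebraic_intermediate[OF M(2) xc] pp(1)]) (use pp(4) xc in blast)
    then have "Polynomials.degree m \<le> e" 
      using pdivides_imp_degree_le[OF carrier_is_subring mP carrier_polynomial_shell[OF Msub pp(1)] pp(3)] pp(2) by simp
    then show False using \<open>e < d\<close> unfolding d_def by simp
  next
    case False
    obtain u where u: "u \<in> carrier \<Omega>" "u \<noteq> \<one>" "u [^] d = \<one>" using root_of_unity_exists[OF d2 False] .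
    have d0: "d > 0" using d2 by simp
    note pp = pure_poly[OF Msub xd d0]
    define B where "B = pure_poly d (x [^] d)"
    have B: "B \<in> carrier (poly_ring \<Omega>)" unfolding B_def by (rule carrier_polynomial_shell[OF Msub pp(1)])
    have ux: "u \<otimes> x \<in> carrier \<Omega>" using u xc by simp
    have ne: "u \<otimes> x \<noteq> x"
    proof
      assume "u \<otimes> x = x"
      then have "u \<otimes> x = \<one> \<otimes> x" using xc by simp
      then show False using u xc x0 m_rcancel by blast
    qed
    have "(u \<otimes> x) [^] d = x [^] d" using u xc by (simp add: nat_pow_distrib)
    then have "is_root B (u \<otimes> x)" using pp(3) pp(4)[OF ux] ux unfolding is_root_def B_def by blast
    then have "u \<otimes> x \<in># roots B" by (simp only: roots_mem_iff_is_root[OF B])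
    have "m pdivides B"
      unfolding m_def B_def by (rule Irr_minimal[OF M(1) xc algebraic_intermediate[OF M(2) xc] pp(1)]) (use pp(4) xc in blast)
    then have "roots m \<subseteq># roots B" using pdivides_imp_roots_incl[OF mP B] pp(3) unfolding B_def by blast
    then have "count (roots B) x \<ge> d" using roots by (metis count_replicate_mset mset_subset_eq_count)
    moreover have "count (roots B) (u \<otimes> x) \<ge> 1" using \<open>u \<otimes> x \<in># roots B\<close> by (simp add: Suc_leI)
    ultimately have "replicate_mset d x + {#u \<otimes> x#} \<subseteq># roots B"
      using ne by (auto simp: subseteq_mset_def)
    then have "Suc d \<le> size (roots B)" using size_mset_mono by fastforce
    moreover have "size (roots B) \<le> d" using size_roots_le_degree[OF B] pp(2) unfolding B_def by simp
    ultimately show False by simp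
  qed
qed

section \<open>Galois extensions inside the closure\<close>

text \<open>This is the product of the \<open>X - a\<close> for \<open>a \<in> A\<close>.\<close>

definition linear_prod :: "'a set \<Rightarrow> 'a list" where
  "linear_prod A = finprod (poly_ring \<Omega>) (\<lambda>a. [\<one>, \<ominus> a]) A"

lemma linear_prod_insert:
  assumes "finite A" "a \<notin> A" "insert a A \<subseteq> carrier \<Omega>"
  shows "linear_prod (insert a A) = [\<one>, \<ominus> a] \<otimes>\<^bsub>poly_ring \<Omega>\<^esub> linear_prod A"
proof -
  interpret UP: domain "poly_ring \<Omega>" by (rule univ_poly_is_domain[OF carrier_is_subring])
  show ?thesis unfolding linear_prod_def
    by (rule UP.finprod_insert) (use assms in \<open>auto simp: univ_poly_carrier[symmetric] polynomial_def\<close>)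
qed

lemma linear_prod_empty: "linear_prod {} = [\<one>]"
proof -
  interpret UP: domain "poly_ring \<Omega>" by (rule univ_poly_is_domain[OF carrier_is_subring])
  show ?thesis unfolding linear_prod_def by (simp add: univ_poly_one)
qed

lemma linear_prod:
  assumes L: "subring L \<Omega>" and A: "finite A" "A \<subseteq> L"
  shows "linear_prod A \<in> carrier (L[X])" "linear_prod A \<noteq> []" "roots (linear_prod A) = mset_set A"
proof -
  interpret UP: domain "L[X]" by (rule univ_poly_is_domain[OF L])
  interpret UPc: domain "poly_ring \<Omega>" by (rule univ_poly_is_domain[OF carrier_is_subring])
  have Lc: "L \<subseteq> carrier \<Omega>" by (rule subringE(1)[OF L])
  have "linear_prod A \<in> carrier (L[X]) \<and> linear_prod A \<noteq> [] \<and> roots (linear_prod A) = mset_set A"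
    using A
  proof (induct A)
    case empty
    have "[\<one>] \<in> carrier (L[X])" using UP.one_closed by (simp add: univ_poly_one)
    moreover have "roots [\<one>] = {#}"
      by (rule degree_zero_imp_empty_roots) (use UPc.one_closed in \<open>auto simp: univ_poly_one\<close>)
    ultimately show ?case unfolding linear_prod_empty by simp
  next
    case (insert a A)
    then have IH: "linear_prod A \<in> carrier (L[X])" "linear_prod A \<noteq> []" "roots (linear_prod A) = mset_set A" by auto
    have a: "a \<in> L" "a \<in> carrier \<Omega>" using insert Lc by auto
    have b: "[\<one>, \<ominus> a] \<in> carrier (L[X])" using a(1) subringE(3,5)[OF L] 
      by (simp add: univ_poly_carrier[symmetric] polynomial_def)
    have eq: "linear_prod (insert a A) = [\<one>, \<ominus> a] \<otimes>\<^bsub>poly_ring \<Omega>\<^esub> linear_prod A"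
      by (rule linear_prod_insert) (use insert Lc in auto)
    have same: "[\<one>, \<ominus> a] \<otimes>\<^bsub>poly_ring \<Omega>\<^esub> linear_prod A = [\<one>, \<ominus> a] \<otimes>\<^bsub>L[X]\<^esub> linear_prod A" by (simp add: univ_poly_mult)
    have "roots (linear_prod (insert a A)) = add_mset a (roots (linear_prod A))"
      unfolding eq by (rule poly_mult_degree_one_monic_imp_same_roots[OF a(2) carrier_polynomial_shell[OF L IH(1)] IH(2)])
    moreover have "linear_prod (insert a A) \<in> carrier (L[X])" unfolding eq same using b IH(1) by simp
    moreover have "linear_prod (insert a A) \<noteq> []" 
      unfolding eq same using UP.integral_iff[OF b IH(1)] IH(2) by (simp add: univ_poly_zero)
    ultimately show ?case using IH(3) insert by simp
  qed
  then show "linear_prod A \<in> carrier (L[X])" "linear_prod A \<noteq> []" "roots (linear_prod A) = mset_set A" by auto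
qed

lemma map_aut_linear_prod:
  assumes s: "s \<in> auts F" and A: "finite A" "A \<subseteq> carrier \<Omega>"
  shows "map s (linear_prod A) = linear_prod (s ` A)"
  using A
proof (induct A)
  case empty
  show ?case by (simp add: linear_prod_empty aut_one[OF s])
next
  case (insert a A)
  interpret s: ring_hom_ring \<Omega> \<Omega> s by (rule aut_ring_hom[OF s])
  interpret UPc: domain "poly_ring \<Omega>" by (rule univ_poly_is_domain[OF carrier_is_subring])
  have a: "a \<in> carrier \<Omega>" and A: "A \<subseteq> carrier \<Omega>" using insert by auto
  note lp = linear_prod[OF carrier_is_subring insert(1) A]
  have b: "[\<one>, \<ominus> a] \<in> carrier (poly_ring \<Omega>)" using a 
      by (simp add: univ_poly_carrier[symmetric] polynomial_def)
  define q where "q = linear_prod (insert a A)"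
  have q: "q \<in> carrier (poly_ring \<Omega>)" "q \<noteq> []" 
    unfolding q_def by (rule linear_prod(1,2)[OF carrier_is_subring]; use insert in simp)+
  have "hd (map s q) \<noteq> \<zero>"
  proof -
    have "hd q \<in> carrier \<Omega>" "hd q \<noteq> \<zero>" using q by (auto simp: univ_poly_carrier[symmetric] polynomial_def)
    then show ?thesis using aut_zero_iff[OF s] q(2) by (simp add: hd_map)
  qed
  then have norm: "normalize (map s q) = map s q" using q(2) by (cases "map s q") auto
  have eq: "q = poly_mult [\<one>, \<ominus> a] (linear_prod A)"
    unfolding q_def using linear_prod_insert[of A a] insert by (simp add: univ_poly_mult)
  have "map s q = poly_mult (map s [\<one>, \<ominus> a]) (map s (linear_prod A))"
    using s.poly_mult_hom'[of "[\<one>, \<ominus> a]" "linear_prod A"] poly_in_sub[OF lp(1)] poly_in_sub[OF b] norm unfolding eq by simp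
  also have "map s [\<one>, \<ominus> a] = [\<one>, \<ominus> s a]" using a by (simp add: s.hom_a_inv)
  also have "map s (linear_prod A) = linear_prod (s ` A)" using insert by simp
  also have "poly_mult [\<one>, \<ominus> s a] (linear_prod (s ` A)) = linear_prod (insert (s a) (s ` A))"
  proof -
    have "s a \<notin> s ` A" using aut_inj[OF s a] A insert(2) by (auto simp: subset_iff)
    moreover have "insert (s a) (s ` A) \<subseteq> carrier \<Omega>" using a A s by auto
    ultimately show ?thesis using linear_prod_insert[of "s ` A" "s a"] insert(1)
      by (simp add: univ_poly_mult del: poly_add.simps poly_mult.simps)
  qed
  finally show ?case unfolding q_def by simp
qed

lemma finite_orbit:
  assumes x: "x \<in> carrier \<Omega>" shows "finite {s x | s. s \<in> auts F}"
proof -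
  note I = IrrE[OF subfield_axioms x algebraic_extension[OF x]]
  have Fs: "subring F \<Omega>" by (rule subfieldE(1)[OF subfield_axioms])
  have P: "Irr F x \<in> carrier (poly_ring \<Omega>)" by (rule carrier_polynomial_shell[OF Fs I(1)])
  have "{s x | s. s \<in> auts F} \<subseteq> {y. is_root (Irr F x) y}"
  proof clarify
    fix s assume s: "s \<in> auts F"
    interpret s: ring_hom_ring \<Omega> \<Omega> s by (rule aut_ring_hom[OF s])
    have "map s (Irr F x) = Irr F x" using aut_fix[OF s] poly_in_sub[OF I(1)] by (simp add: map_idI subset_iff)
    then have "eval (Irr F x) (s x) = \<zero>" 
      using s.eval_hom'[OF x, of "Irr F x"] poly_in_sub[OF P] I(4) by simp
    then show "is_root (Irr F x) (s x)" 
      unfolding is_root_def using s x pirreducibleE(1)[OF Fs I(1,2)] by simp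
  qed
  then show ?thesis using finite_number_of_roots[OF P] finite_subset by blast
qed

text \<open>\<open>A\<close> is the orbit of \<open>x\<close> under the Galois group, which is finite as it consists of roots of the
  minimal polynomial of \<open>x\<close>.\<close>

lemma galois_orbit_poly:
  assumes L: "galois_extension \<Omega> L F" and x: "x \<in> L"
  obtains A where "finite A" "x \<in> A" "A \<subseteq> L" "linear_prod A \<in> carrier (F[X])"
proof -
  have Lf: "subfield L \<Omega>" and FL: "F \<subseteq> L" 
    and fix_F: "{y \<in> L. \<forall>s\<in>carrier (gal_group \<Omega> L F). s y = y} = F"
    using L unfolding galois_extension_def by auto
  have Lsub: "subring L \<Omega>" and Lc: "L \<subseteq> carrier \<Omega>" using subfieldE(1,3)[OF Lf] by auto
  interpret G: group "gal_group \<Omega> L F" by (rule gal_group_is_group[OF subring_is_ring[OF Lsub] FL])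
  define A where "A = {t x | t. t \<in> carrier (gal_group \<Omega> L F)}"
  have AL: "A \<subseteq> L" unfolding A_def gal_group_iff using x bij_betwE by blast
  have "x = \<one>\<^bsub>gal_group \<Omega> L F\<^esub> x" using x by (simp add: gal_group_one)
  then have xA: "x \<in> A" unfolding A_def using G.one_closed by blast
  have "A \<subseteq> {s x | s. s \<in> auts F}"
  proof
    fix a assume "a \<in> A"
    then obtain t where t: "t \<in> carrier (gal_group \<Omega> L F)" "a = t x" unfolding A_def by blast
    obtain s where "s \<in> auts F" "\<And>x. x \<in> L \<Longrightarrow> s x = t x" using extend_aut[OF Lf FL t(1)] by blast
    moreover from this t(2) x have "a = s x" by simp
    ultimately show "a \<in> {s x | s. s \<in> auts F}" by blast
  qed
  then have fin: "finite A" using finite_orbit[of x] x Lc finite_subset by blast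
  note lp = linear_prod[OF Lsub fin AL]
  have "set (linear_prod A) \<subseteq> F"
  proof
    fix a assume a: "a \<in> set (linear_prod A)"
    have aL: "a \<in> L" using poly_in_sub[OF lp(1)] a by blast
    have "t a = a" if t: "t \<in> carrier (gal_group \<Omega> L F)" for t
    proof -
      obtain s where s: "s \<in> auts F" "\<And>x. x \<in> L \<Longrightarrow> s x = t x" using extend_aut[OF Lf FL t] by blast
      have "s ` A \<subseteq> A"
      proof
        fix b assume "b \<in> s ` A"
        then obtain t' where t': "t' \<in> carrier (gal_group \<Omega> L F)" "b = s (t' x)" unfolding A_def by blast
        have "t' x \<in> L" using t' x unfolding gal_group_iff using bij_betwE by blast
        then have "b = (t \<otimes>\<^bsub>gal_group \<Omega> L F\<^esub> t') x" using s(2) t' gal_group_mult[OF t t'(1) x] by simp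
        then show "b \<in> A" unfolding A_def using t t' by blast
      qed
      moreover have "inj_on s A" using aut_inj[OF s(1)] AL Lc unfolding inj_on_def by blast
      ultimately have "s ` A = A" using endo_inj_surj[OF fin] by blast
      then have "map s (linear_prod A) = linear_prod A"
        using map_aut_linear_prod[OF s(1) fin] AL Lc by auto
      then have "map s (linear_prod A) = map (\<lambda>y. y) (linear_prod A)" by simp
      then have "s a = a" using a unfolding map_eq_conv by blast
      then show ?thesis using s(2)[OF aL] by simp
    qed
    then show "a \<in> F" using fix_F aL by blast
  qed
  then have "linear_prod A \<in> carrier (F[X])"
    using lp(1,2) by (simp add: univ_poly_carrier[symmetric] polynomial_def)
  then show ?thesis using that fin xA AL by blast
qed

text \<open>An automorphism fixing \<open>F\<close> fixes the coefficients of an orbit polynomial, so it permutes its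
  roots.\<close>

lemma galois_normal:
  assumes L: "galois_extension \<Omega> L F" and x: "x \<in> L" and s: "s \<in> auts F"
  shows "s x \<in> L"
proof -
  obtain A where A: "finite A" "x \<in> A" "A \<subseteq> L" "linear_prod A \<in> carrier (F[X])"
    using galois_orbit_poly[OF L x] .
  have Lc: "L \<subseteq> carrier \<Omega>" using L subfieldE(3) unfolding galois_extension_def by blast
  have Ac: "A \<subseteq> carrier \<Omega>" using A Lc by blast
  have "linear_prod (s ` A) = map s (linear_prod A)" using map_aut_linear_prod[OF s A(1) Ac] by simp
  also have "\<dots> = linear_prod A" using aut_fix[OF s] poly_in_sub[OF A(4)] by (simp add: map_idI subset_iff)
  finally have eq: "linear_prod (s ` A) = linear_prod A" .
  have sA: "s ` A \<subseteq> carrier \<Omega>" using Ac s by auto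
  have "mset_set (s ` A) = mset_set A"
    using linear_prod(3)[OF carrier_is_subring A(1) Ac] linear_prod(3)[OF carrier_is_subring finite_imageI[OF A(1)] sA] eq 
    by simp
  then have "s ` A = A" using A(1) by (metis finite_imageI finite_set_mset_mset_set)
  then show ?thesis using A by blast
qed

text \<open>If \<open>x\<^sup>c \<in> M\<close>, the minimal polynomial of \<open>x\<close> over \<open>M\<close> divides both \<open>X\<^sup>c - x\<^sup>c\<close>, whose only root is \<open>x\<close>,
  and the orbit polynomial, whose roots are simple.\<close>

lemma galois_sub_sep:
  assumes c: "char_exp c" and L: "galois_extension \<Omega> L F" shows "L \<subseteq> sep c"
proof
  fix x assume x: "x \<in> L"
  have Lc: "L \<subseteq> carrier \<Omega>" using L subfieldE(3) unfolding galois_extension_def by blast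
  show "x \<in> sep c" unfolding sep_def
  proof (intro CollectI conjI allI impI)
    show xc: "x \<in> carrier \<Omega>" using x Lc by blast
    fix M assume M: "subfield M \<Omega>" "F \<subseteq> M" and xM: "x [^] c \<in> M"
    obtain A where A: "finite A" "x \<in> A" "A \<subseteq> L" "linear_prod A \<in> carrier (F[X])"
      using galois_orbit_poly[OF L x] .
    have Ac: "A \<subseteq> carrier \<Omega>" using A Lc by blast
    note lp = linear_prod[OF carrier_is_subring A(1) Ac]
    have Msub: "subring M \<Omega>" by (rule subfieldE(1)[OF M(1)])
    note alg = algebraic_intermediate[OF M(2) xc]
    note I = IrrE[OF M(1) xc alg]
    have mP: "Irr M x \<in> carrier (poly_ring \<Omega>)" by (rule carrier_polynomial_shell[OF Msub I(1)])
    note pp = pure_poly[OF Msub xM char_exp_pos[OF c]]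
    have "Irr M x pdivides pure_poly c (x [^] c)"
      by (rule Irr_minimal[OF M(1) xc alg pp(1)]) (use pp(4) xc in blast)
    then have "y = x" if "y \<in> carrier \<Omega>" "eval (Irr M x) y = \<zero>" for y
      using pdivides_imp_root_sharing[OF mP _ that(1) that(2)] pp(4)[OF that(1)] frobenius_inj[OF c that(1) xc] by blast
    then have r: "roots (Irr M x) = replicate_mset (Polynomials.degree (Irr M x)) x"
      using unique_root_multiset[OF M xc] by blast
    have "linear_prod A \<in> carrier (M[X])" using A(4) M(2) lp(2) by (auto simp: univ_poly_carrier[symmetric] polynomial_def)
    moreover have "eval (linear_prod A) x = \<zero>"
      using lp A(1,2) roots_mem_iff_is_root[OF lp(1), of x] by (simp add: is_root_def)
    ultimately have "Irr M x pdivides linear_prod A" using Irr_minimal[OF M(1) xc alg] by blast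
    then have "roots (Irr M x) \<subseteq># mset_set A" using pdivides_imp_roots_incl[OF mP lp(1,2)] lp(3) by simp
    then have "Polynomials.degree (Irr M x) \<le> count (mset_set A) x" using r by (metis count_replicate_mset mset_subset_eq_count)
    then have "Polynomials.degree (Irr M x) \<le> 1" using A(1,2) by simp
    moreover have "Polynomials.degree (Irr M x) \<ge> 1" by (rule pirreducible_degree[OF M(1) I(1,2)])
    ultimately show "x \<in> M" using degree_one_mem[OF M xc] by simp
  qed
qed

end

context galois_closure
begin

section \<open>Separable elements of the ambient closure\<close>

definition "chr = (SOME c. char_exp c)"

lemma chr: "char_exp chr" unfolding chr_def using char_exp_exists by (metis someI)

definition "\<S> = sep chr"

lemma S_subfield: "subfield \<S> \<Omega>" unfolding \<S>_def by (rule sep_subfield[OF chr])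
lemma S_carrier: "x \<in> \<S> \<Longrightarrow> x \<in> carrier \<Omega>" unfolding \<S>_def using sep_carrier by blast
lemma F_sub_S: "F \<subseteq> \<S>" unfolding \<S>_def by (rule F_sub_sep)
lemma S_aut: "s \<in> auts F \<Longrightarrow> x \<in> \<S> \<Longrightarrow> s x \<in> \<S>" unfolding \<S>_def by (rule sep_aut)
lemma S_fixed: "subfield M \<Omega> \<Longrightarrow> F \<subseteq> M \<Longrightarrow> x \<in> \<S> \<Longrightarrow> (\<And>s. s \<in> auts M \<Longrightarrow> s x = x) \<Longrightarrow> x \<in> M"
  unfolding \<S>_def by (rule sep_fixed[OF chr])
lemma galois_sub_S: "galois_extension \<Omega> L F \<Longrightarrow> L \<subseteq> \<S>" unfolding \<S>_def by (rule galois_sub_sep[OF chr])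

lemmas S_ring = subringE[OF subfieldE(1)[OF S_subfield]]

lemma S_finsum: "finite A \<Longrightarrow> (\<And>a. a \<in> A \<Longrightarrow> f a \<in> \<S>) \<Longrightarrow> (\<Oplus>a\<in>A. f a) \<in> \<S>"
proof (induct A rule: finite_induct)
  case empty then show ?case using S_ring by simp
next
  case (insert a A)
  have "(\<Oplus>a\<in>insert a A. f a) = f a \<oplus> (\<Oplus>a\<in>A. f a)"
    by (rule finsum_insert) (use insert S_carrier in auto)
  then show ?case using insert S_ring(7) by auto
qed

lemma aut_finsum: 
  assumes s: "s \<in> auts M" and "finite A" "\<And>a. a \<in> A \<Longrightarrow> f a \<in> carrier \<Omega>"
  shows "s (\<Oplus>a\<in>A. f a) = (\<Oplus>a\<in>A. s (f a))"
  using assms(2,3)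
proof (induct A rule: finite_induct)
  case empty then show ?case by (simp add: aut_zero[OF s])
next
  case (insert a A)
  have c: "f \<in> A \<rightarrow> carrier \<Omega>" "f a \<in> carrier \<Omega>" "(\<lambda>a. s (f a)) \<in> A \<rightarrow> carrier \<Omega>" using insert s by auto
  have "s (\<Oplus>a\<in>insert a A. f a) = s (f a) \<oplus> s (\<Oplus>a\<in>A. f a)"
    using insert c by (simp add: aut_add[OF s])
  then show ?case using insert c s by simp
qed

section \<open>Independence of characters\<close>

text \<open>Comparing the relation at \<open>x y\<close> with \<open>t(y)\<close> times the relation at \<open>x\<close> eliminates the character \<open>t\<close>.
  The domain is a set \<open>E\<close> so that the characters can be restrictions of automorphisms to a finite level.\<close>

lemma dedekind_independence:
  assumes "finite T" and E: "\<one> \<in> E" "\<And>x y. x \<in> E \<Longrightarrow> y \<in> E \<Longrightarrow> x \<otimes> y \<in> E"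
    and hom: "\<And>t x. t \<in> T \<Longrightarrow> x \<in> E \<Longrightarrow> t x \<in> carrier \<Omega>" 
      "\<And>t x y. t \<in> T \<Longrightarrow> x \<in> E \<Longrightarrow> y \<in> E \<Longrightarrow> t (x \<otimes> y) = t x \<otimes> t y" 
      "\<And>t. t \<in> T \<Longrightarrow> t \<one> = \<one>"
    and dist: "\<And>t t'. t \<in> T \<Longrightarrow> t' \<in> T \<Longrightarrow> t \<noteq> t' \<Longrightarrow> \<exists>x\<in>E. t x \<noteq> t' x"
    and a: "\<And>t. t \<in> T \<Longrightarrow> a t \<in> carrier \<Omega>" and rel: "\<And>x. x \<in> E \<Longrightarrow> (\<Oplus>t\<in>T. a t \<otimes> t x) = \<zero>"
    and t: "t \<in> T"
  shows "a t = \<zero>"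
  using assms(1) hom dist a rel t
proof (induct T arbitrary: a t rule: finite_induct)
  case empty
  then show ?case by simp
next
  case (insert t0 T)
  note hom = insert(4,5,6) and dist = insert(7) and ac = insert(8) and rel = insert(9)
  have split: "(\<Oplus>t\<in>insert t0 T. b t \<otimes> t x) = b t0 \<otimes> t0 x \<oplus> (\<Oplus>t\<in>T. b t \<otimes> t x)" 
    if "x \<in> E" "\<And>t. t \<in> insert t0 T \<Longrightarrow> b t \<in> carrier \<Omega>" for x b
    by (rule finsum_insert) (use that hom insert(1,2) in auto)
  have z: "a t = \<zero>" if t: "t \<in> T" for t
  proof -
    obtain y where y: "y \<in> E" "t y \<noteq> t0 y" using dist[of t t0] t insert(2) by auto
    define b where "b t = a t \<otimes> (t y \<ominus> t0 y)" for t
    have bc: "b t \<in> carrier \<Omega>" if "t \<in> insert t0 T" for t unfolding b_def using that ac hom(1) y by simp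
    have relb: "(\<Oplus>t\<in>T. b t \<otimes> t x) = \<zero>" if x: "x \<in> E" for x
    proof -
      have t0y: "t0 y \<in> carrier \<Omega>" using hom(1) y by simp
      have "\<zero> = (\<Oplus>t\<in>insert t0 T. a t \<otimes> t (x \<otimes> y)) \<oplus> (\<Oplus>t\<in>insert t0 T. a t \<otimes> t x) \<otimes> (\<ominus> t0 y)"
        using rel x y E(2) t0y by simp
      also have "(\<Oplus>t\<in>insert t0 T. a t \<otimes> t x) \<otimes> (\<ominus> t0 y) = (\<Oplus>t\<in>insert t0 T. a t \<otimes> t x \<otimes> (\<ominus> t0 y))"
        by (rule finsum_ldistr) (use insert(1) ac hom(1) x y in auto)
      also have "(\<Oplus>t\<in>insert t0 T. a t \<otimes> t (x \<otimes> y)) \<oplus> (\<Oplus>t\<in>insert t0 T. a t \<otimes> t x \<otimes> (\<ominus> t0 y))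
          = (\<Oplus>t\<in>insert t0 T. a t \<otimes> t (x \<otimes> y) \<oplus> a t \<otimes> t x \<otimes> (\<ominus> t0 y))"
        by (rule finsum_addf[symmetric]) (use ac hom(1) x y E(2) in auto)
      also have "\<dots> = (\<Oplus>t\<in>insert t0 T. b t \<otimes> t x)"
      proof (rule finsum_cong')
        fix t assume t: "t \<in> insert t0 T"
        have c: "a t \<in> carrier \<Omega>" "t x \<in> carrier \<Omega>" "t y \<in> carrier \<Omega>" using ac hom(1) t x y by auto
        show "a t \<otimes> t (x \<otimes> y) \<oplus> a t \<otimes> t x \<otimes> (\<ominus> t0 y) = b t \<otimes> t x"
          unfolding b_def hom(2)[OF t x y(1)] using c t0y 
          by (simp add: minus_eq r_distr l_distr m_ac r_minus l_minus)
      qed (use bc hom(1) x in auto)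
      also have "\<dots> = b t0 \<otimes> t0 x \<oplus> (\<Oplus>t\<in>T. b t \<otimes> t x)" by (rule split[OF x bc])
      also have "b t0 = \<zero>" unfolding b_def using t0y ac by (simp add: minus_eq r_neg)
      also have "\<zero> \<otimes> t0 x \<oplus> (\<Oplus>t\<in>T. b t \<otimes> t x) = (\<Oplus>t\<in>T. b t \<otimes> t x)"
        using hom(1) x bc by (subst l_null) (auto intro!: l_zero finsum_closed)
      finally show ?thesis by simp
    qed
    have "b t = \<zero>" 
    proof (rule insert(3)[of b t])
      show "t \<in> T" by (rule t)
      show "\<exists>x\<in>E. t x \<noteq> t' x" if "t \<in> T" "t' \<in> T" "t \<noteq> t'" for t t' using dist that by simp
    qed (use hom bc relb in auto)
    moreover have "t y \<ominus> t0 y \<noteq> \<zero>" using y hom(1) t by simp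
    moreover have "t y \<ominus> t0 y \<in> carrier \<Omega>" "a t \<in> carrier \<Omega>" using y hom(1) t ac by simp_all
    ultimately show ?thesis unfolding b_def using integral by blast
  qed
  have "(\<Oplus>t\<in>T. a t \<otimes> t \<one>) = (\<Oplus>t\<in>T. \<zero>)"
    by (rule finsum_cong') (use z hom(1) E in auto)
  then have "a t0 \<otimes> t0 \<one> = \<zero>" using rel[OF E(1)] split[OF E(1) ac] ac hom(1) E(1) by simp
  then have "a t0 = \<zero>" using hom(3)[of t0] ac[of t0] by simp
  then show ?case using z insert(10) by blast
qed

section \<open>Finite levels of the absolute Galois group\<close>

abbreviation "\<Gamma> \<equiv> gal_group \<Omega> (carrier \<Omega>) F"

lemma group_\<Gamma>: "group \<Gamma>" by (rule auts_group[OF F_sub])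

definition stab :: "'a set \<Rightarrow> ('a \<Rightarrow> 'a) set" where
  "stab B = {s \<in> auts F. \<forall>b\<in>B. s b = b}"

definition fixf :: "('a \<Rightarrow> 'a) set \<Rightarrow> 'a set" where
  "fixf U = {x \<in> \<S>. \<forall>s\<in>U. s x = x}"

lemma stab_subgroup: assumes "B \<subseteq> carrier \<Omega>" shows "subgroup (stab B) \<Gamma>"
proof -
  interpret \<Gamma>: group \<Gamma> by (rule group_\<Gamma>)
  show ?thesis
  proof (rule \<Gamma>.subgroupI)
    show "stab B \<subseteq> auts F" unfolding stab_def by blast
    have "\<one>\<^bsub>\<Gamma>\<^esub> \<in> stab B" unfolding stab_def using \<Gamma>.one_closed assms by (auto simp: gal_group_one)
    then show "stab B \<noteq> {}" by blast
    fix s assume s: "s \<in> stab B"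
    have "(inv\<^bsub>\<Gamma>\<^esub> s) b = b" if b: "b \<in> B" for b
      using auts_inv1(1)[OF F_sub, of s b] s b assms unfolding stab_def by auto
    then show "inv\<^bsub>\<Gamma>\<^esub> s \<in> stab B" using s unfolding stab_def by auto
    fix t assume t: "t \<in> stab B"
    show "s \<otimes>\<^bsub>\<Gamma>\<^esub> t \<in> stab B" using s t \<Gamma>.m_closed assms unfolding stab_def
      by (auto simp: auts_mult subset_iff)
  qed
qed

lemma fixf_subfield:
  assumes U: "U \<subseteq> auts F" shows "subfield (fixf U) \<Omega>"
proof (rule subfieldI')
  have Uc: "s \<in> U \<Longrightarrow> s \<in> auts F" for s using U by blast
  show "subring (fixf U) \<Omega>"
  proof (rule subringI)
    show "h1 \<otimes> h2 \<in> fixf U" "h1 \<oplus> h2 \<in> fixf U" if h: "h1 \<in> fixf U" "h2 \<in> fixf U" for h1 h2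
    proof -
      have hS: "h1 \<in> \<S>" "h2 \<in> \<S>" and e: "\<forall>s\<in>U. s h1 = h1 \<and> s h2 = h2" using h unfolding fixf_def by blast+
      have "s (h1 \<otimes> h2) = h1 \<otimes> h2" "s (h1 \<oplus> h2) = h1 \<oplus> h2" if "s \<in> U" for s
        using aut_mult[OF Uc[OF that], of h1 h2] aut_add[OF Uc[OF that], of h1 h2] hS S_carrier bspec[OF e that] by auto
      then show "h1 \<otimes> h2 \<in> fixf U" "h1 \<oplus> h2 \<in> fixf U" unfolding fixf_def using hS S_ring by auto
    qed
  qed (auto simp: fixf_def S_carrier S_ring aut_one[OF Uc] aut_neg[OF Uc])
  fix k assume k: "k \<in> fixf U - {\<zero>}"
  then have kS: "k \<in> \<S>" "k \<noteq> \<zero>" and e: "\<forall>s\<in>U. s k = k" unfolding fixf_def by auto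
  have "s (inv k) = inv k" if "s \<in> U" for s
    using aut_inv[OF Uc[OF that] S_carrier[OF kS(1)] kS(2)] bspec[OF e that] by simp
  then show "inv k \<in> fixf U"
    using inv_in_subfield[OF S_subfield kS] unfolding fixf_def by auto
qed

text \<open>For a set \<open>B\<close> of separable elements this is \<open>F(B)\<close>. Restricting a subgroup \<open>V\<close> to it for finite \<open>B\<close>
  gives the finite set \<open>level_maps V B\<close>, so that sums over the profinite group become finite sums.\<close>

definition level :: "'a set \<Rightarrow> 'a set" where "level B = fixf (stab B)"

definition level_maps :: "('a \<Rightarrow> 'a) set \<Rightarrow> 'a set \<Rightarrow> ('a \<Rightarrow> 'a) set" where
  "level_maps V B = (\<lambda>h. restrict h (level B)) ` V"

lemma level_base: "B \<subseteq> \<S> \<Longrightarrow> B \<subseteq> level B" unfolding level_def fixf_def stab_def by auto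

lemma level_S: "x \<in> level B \<Longrightarrow> x \<in> \<S>" unfolding level_def fixf_def by blast

lemma level_eqI:
  assumes B: "B \<subseteq> \<S>" and h: "h \<in> auts F" "h' \<in> auts F" and e: "\<And>b. b \<in> B \<Longrightarrow> h b = h' b"
  shows "inv\<^bsub>\<Gamma>\<^esub> h \<otimes>\<^bsub>\<Gamma>\<^esub> h' \<in> stab B" "restrict h (level B) = restrict h' (level B)"
proof -
  interpret \<Gamma>: group \<Gamma> by (rule group_\<Gamma>)
  have c: "inv\<^bsub>\<Gamma>\<^esub> h \<otimes>\<^bsub>\<Gamma>\<^esub> h' \<in> auts F" using h by simp
  have v: "(inv\<^bsub>\<Gamma>\<^esub> h \<otimes>\<^bsub>\<Gamma>\<^esub> h') x = (inv\<^bsub>\<Gamma>\<^esub> h) (h' x)" if "x \<in> carrier \<Omega>" for x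
    using auts_mult[OF _ h(2) that] h(1) by simp
  show 1: "inv\<^bsub>\<Gamma>\<^esub> h \<otimes>\<^bsub>\<Gamma>\<^esub> h' \<in> stab B"
    unfolding stab_def using c v e auts_inv1(1)[OF F_sub h(1)] B S_carrier by (auto simp: subset_iff) metis
  have "h x = h' x" if x: "x \<in> level B" for x
  proof -
    have xc: "x \<in> carrier \<Omega>" using x level_S S_carrier by blast
    have "(inv\<^bsub>\<Gamma>\<^esub> h) (h' x) = x" using x 1 v[OF xc] unfolding level_def fixf_def by auto
    then show ?thesis using auts_inv1(2)[OF F_sub h(1), of "h' x"] h(2) xc by simp
  qed
  then show "restrict h (level B) = restrict h' (level B)" by (auto intro: restrict_ext)
qed

text \<open>The maps are finitely many because each is determined by the images of the elements of \<open>B\<close>, which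
  have finite orbits.\<close>

lemma level_maps:
  assumes B: "finite B" "B \<subseteq> \<S>" and V: "subgroup V \<Gamma>"
  shows "finite (level_maps V B)"
    and "\<And>t. t \<in> level_maps V B \<Longrightarrow> \<exists>h\<in>V. \<forall>x\<in>level B. t x = h x"
    and "\<And>t x. t \<in> level_maps V B \<Longrightarrow> x \<in> level B \<Longrightarrow> t x \<in> \<S>"
    and "\<And>t t'. t \<in> level_maps V B \<Longrightarrow> t' \<in> level_maps V B \<Longrightarrow> t \<noteq> t' \<Longrightarrow> \<exists>x\<in>level B. t x \<noteq> t' x"
    and "\<And>s. s \<in> V \<Longrightarrow> bij_betw (\<lambda>t. restrict (\<lambda>x. s (t x)) (level B)) (level_maps V B) (level_maps V B)"
    and "level_maps V B \<noteq> {}"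
proof -
  interpret \<Gamma>: group \<Gamma> by (rule group_\<Gamma>)
  interpret V: subgroup V \<Gamma> by (rule V)
  let ?T = "level_maps V B"
  have VG: "h \<in> V \<Longrightarrow> h \<in> auts F" for h using V.subset by blast
  have BE: "B \<subseteq> level B" by (rule level_base[OF B(2)])
  have Bc: "b \<in> B \<Longrightarrow> b \<in> carrier \<Omega>" for b using B(2) S_carrier by blast
  show rep: "\<exists>h\<in>V. \<forall>x\<in>level B. t x = h x" if "t \<in> ?T" for t using that unfolding level_maps_def by auto
  show TS: "t x \<in> \<S>" if "t \<in> ?T" "x \<in> level B" for t x
    using that S_aut VG level_S unfolding level_maps_def by auto
  have inj: "inj_on (\<lambda>t. restrict t B) ?T"
  proof (rule inj_onI)
    fix t t' assume t: "t \<in> ?T" "t' \<in> ?T" and e: "restrict t B = restrict t' B"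
    obtain h h' where h: "h \<in> V" "t = restrict h (level B)" "h' \<in> V" "t' = restrict h' (level B)"
      using t unfolding level_maps_def by auto
    have "h b = h' b" if "b \<in> B" for b
      using fun_cong[OF e, of b] that BE h(2,4) by (auto simp: subset_iff)
    then show "t = t'" using level_eqI(2)[OF B(2) VG[OF h(1)] VG[OF h(3)]] h(2,4) by simp
  qed
  have "(\<lambda>t. restrict t B) ` ?T \<subseteq> (\<Pi>\<^sub>E b\<in>B. {s b | s. s \<in> auts F})"
  proof
    fix f assume "f \<in> (\<lambda>t. restrict t B) ` ?T"
    then obtain h where h: "h \<in> V" "f = restrict (restrict h (level B)) B" unfolding level_maps_def by auto
    show "f \<in> (\<Pi>\<^sub>E b\<in>B. {s b | s. s \<in> auts F})"
      unfolding h(2) using h(1) VG BE by (auto simp: subset_iff)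
  qed
  moreover have "finite (\<Pi>\<^sub>E b\<in>B. {s b | s. s \<in> auts F})"
    by (rule finite_PiE) (use B(1) finite_orbit Bc in auto)
  ultimately have "finite ((\<lambda>t. restrict t B) ` ?T)" by (rule finite_subset)
  then show fin: "finite ?T" using inj by (rule finite_imageD)
  show "\<exists>x\<in>level B. t x \<noteq> t' x" if "t \<in> ?T" "t' \<in> ?T" "t \<noteq> t'" for t t'
  proof (rule ccontr)
    assume "\<not> ?thesis"
    then have "t = t'" using that(1,2) unfolding level_maps_def by (auto intro!: restrict_ext)
    then show False using that(3) by simp
  qed
  show "bij_betw (\<lambda>t. restrict (\<lambda>x. s (t x)) (level B)) ?T ?T" if s: "s \<in> V" for s
  proof -
    let ?f = "\<lambda>t. restrict (\<lambda>x. s (t x)) (level B)"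
    have f: "?f (restrict h (level B)) = restrict (s \<otimes>\<^bsub>\<Gamma>\<^esub> h) (level B)" if "h \<in> V" for h
      using auts_mult[OF VG[OF s] VG[OF that]] level_S S_carrier by (intro ext) (auto simp: restrict_def)
    have "?f ` ?T \<subseteq> ?T"
    proof
      fix t assume "t \<in> ?f ` ?T"
      then obtain h where "h \<in> V" "t = ?f (restrict h (level B))" unfolding level_maps_def by auto
      then show "t \<in> ?T" unfolding level_maps_def using f V.m_closed[OF s] by simp
    qed
    moreover have "inj_on ?f ?T"
    proof (rule inj_onI)
      fix t t' assume t: "t \<in> ?T" "t' \<in> ?T" and e: "?f t = ?f t'"
      obtain h h' where h: "h \<in> V" "t = restrict h (level B)" "h' \<in> V" "t' = restrict h' (level B)"
        using t unfolding level_maps_def by auto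
      have "t x = t' x" if x: "x \<in> level B" for x
      proof -
        have "s (t x) = s (t' x)" using fun_cong[OF e, of x] x by simp
        then show ?thesis using aut_inj[OF VG[OF s]] TS[OF t(1) x] TS[OF t(2) x] S_carrier by blast
      qed
      then show "t = t'" unfolding h by (auto intro!: restrict_ext)
    qed
    ultimately show ?thesis using fin endo_inj_surj by (simp add: bij_betw_def endo_inj_surj)
  qed
  show "?T \<noteq> {}" unfolding level_maps_def using V.one_closed by blast
qed

lemma level_subfield: "subfield (level B) \<Omega>"
  unfolding level_def by (rule fixf_subfield) (auto simp: stab_def)

text \<open>Suppose that \<open>s\<close> is not in \<open>U\<close>. Then the restrictions of \<open>U\<close> and of \<open>s U\<close> to the level of \<open>B\<close>
  are disjoint sets of characters, but the sum \<open>\<Sum>\<^sub>t t(x)\<close> over the first is fixed by \<open>U\<close>, hence by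
  \<open>s\<close>, and so equals the sum over the second. This contradicts independence.\<close>

lemma artin:
  assumes U: "subgroup U \<Gamma>" and B: "finite B" "B \<subseteq> \<S>" "stab B \<subseteq> U"
    and s: "s \<in> auts F" "\<And>x. x \<in> fixf U \<Longrightarrow> s x = x"
  shows "s \<in> U"
proof (rule ccontr)
  assume sU: "s \<notin> U"
  interpret \<Gamma>: group \<Gamma> by (rule group_\<Gamma>)
  interpret U: subgroup U \<Gamma> by (rule U)
  let ?T = "level_maps U B" and ?E = "level B"
  note T = level_maps[OF B(1,2) U]
  have UG: "h \<in> U \<Longrightarrow> h \<in> auts F" for h using U.subset by blast
  have ES: "x \<in> ?E \<Longrightarrow> x \<in> carrier \<Omega>" for x using level_S S_carrier by blast
  have TC: "t \<in> ?T \<Longrightarrow> x \<in> ?E \<Longrightarrow> t x \<in> carrier \<Omega>" for t x using T(3) S_carrier by blast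
  \<comment> \<open>The restrictions of the coset \<open>s U\<close>.\<close>
  define T' where "T' = (\<lambda>t. restrict (\<lambda>x. s (t x)) ?E) ` ?T"
  have trace: "(\<Oplus>t\<in>?T. t x) \<in> fixf U" if x: "x \<in> ?E" for x
    unfolding fixf_def
  proof (intro CollectI conjI ballI)
    show "(\<Oplus>t\<in>?T. t x) \<in> \<S>" by (rule S_finsum[OF T(1)]) (rule T(3)[OF _ x])
    fix u assume u: "u \<in> U"
    have "u (\<Oplus>t\<in>?T. t x) = (\<Oplus>t\<in>?T. u (t x))" 
      by (rule aut_finsum[OF UG[OF u] T(1)]) (rule TC[OF _ x])
    also have "\<dots> = (\<Oplus>t\<in>?T. (restrict (\<lambda>x. u (t x)) ?E) x)" using x by simp
    also have "\<dots> = (\<Oplus>t\<in>(\<lambda>t. restrict (\<lambda>x. u (t x)) ?E) ` ?T. t x)"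
    proof (rule finsum_reindex[symmetric])
      show "inj_on (\<lambda>t. restrict (\<lambda>x. u (t x)) ?E) ?T" by (rule bij_betw_imp_inj_on[OF T(5)[OF u]])
      show "(\<lambda>t. t x) \<in> (\<lambda>t. restrict (\<lambda>x. u (t x)) ?E) ` ?T \<rightarrow> carrier \<Omega>"
        unfolding bij_betw_imp_surj_on[OF T(5)[OF u]] using TC x by blast
    qed
    also have "\<dots> = (\<Oplus>t\<in>?T. t x)" using T(5)[OF u] by (simp add: bij_betw_def)
    finally show "u (\<Oplus>t\<in>?T. t x) = (\<Oplus>t\<in>?T. t x)" .
  qed
  have injs: "inj_on (\<lambda>t. restrict (\<lambda>x. s (t x)) ?E) ?T"
  proof (rule inj_onI, rule ccontr)
    fix t t' assume t: "t \<in> ?T" "t' \<in> ?T" and e: "restrict (\<lambda>x. s (t x)) ?E = restrict (\<lambda>x. s (t' x)) ?E" and "t \<noteq> t'"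
    then obtain x where x: "x \<in> ?E" "t x \<noteq> t' x" using T(4) by blast
    have "s (t x) = s (t' x)" using fun_cong[OF e, of x] x by simp
    then show False using aut_inj[OF s(1)] TC t x by blast
  qed
  have disj: "?T \<inter> T' = {}"
  proof (rule ccontr)
    assume "?T \<inter> T' \<noteq> {}"
    then obtain h h' where h: "h \<in> U" "h' \<in> U" "restrict h' ?E = restrict (\<lambda>x. s (restrict h ?E x)) ?E"
      unfolding T'_def level_maps_def by blast
    have "h' b = (s \<otimes>\<^bsub>\<Gamma>\<^esub> h) b" if "b \<in> B" for b
    proof -
      have "b \<in> ?E" using that level_base[OF B(2)] by blast
      then show ?thesis using fun_cong[OF h(3), of b] auts_mult[OF s(1) UG[OF h(1)] ES] by simp
    qed
    then have "inv\<^bsub>\<Gamma>\<^esub> h' \<otimes>\<^bsub>\<Gamma>\<^esub> (s \<otimes>\<^bsub>\<Gamma>\<^esub> h) \<in> U"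
      using level_eqI(1)[OF B(2) UG[OF h(2)], of "s \<otimes>\<^bsub>\<Gamma>\<^esub> h"] s(1) UG[OF h(1)] B(3) by auto
    then have "h' \<otimes>\<^bsub>\<Gamma>\<^esub> (inv\<^bsub>\<Gamma>\<^esub> h' \<otimes>\<^bsub>\<Gamma>\<^esub> (s \<otimes>\<^bsub>\<Gamma>\<^esub> h)) \<otimes>\<^bsub>\<Gamma>\<^esub> inv\<^bsub>\<Gamma>\<^esub> h \<in> U" using h by blast
    moreover have "h' \<otimes>\<^bsub>\<Gamma>\<^esub> (inv\<^bsub>\<Gamma>\<^esub> h' \<otimes>\<^bsub>\<Gamma>\<^esub> (s \<otimes>\<^bsub>\<Gamma>\<^esub> h)) \<otimes>\<^bsub>\<Gamma>\<^esub> inv\<^bsub>\<Gamma>\<^esub> h = s"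
      using s(1) UG[OF h(1)] UG[OF h(2)] by (simp add: \<Gamma>.m_assoc[symmetric]) (simp add: \<Gamma>.m_assoc)
    ultimately show False using sU by simp
  qed
  have hom': "\<exists>h\<in>auts F. \<forall>x\<in>?E. t x = h x" if "t \<in> ?T \<union> T'" for t
  proof (cases "t \<in> ?T")
    case True
    then show ?thesis using T(2) UG by blast
  next
    case False
    then have "t \<in> T'" using that by blast
    then obtain h where h: "h \<in> U" "t = restrict (\<lambda>x. s (restrict h ?E x)) ?E" 
      unfolding T'_def level_maps_def by blast
    then have "\<forall>x\<in>?E. t x = (s \<otimes>\<^bsub>\<Gamma>\<^esub> h) x" using auts_mult[OF s(1) UG[OF h(1)] ES] by simp
    then show ?thesis using s(1) UG[OF h(1)] by blast
  qed
  note Er = subringE[OF subfieldE(1)[OF level_subfield]]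
  define a where "a t = (if t \<in> ?T then \<one> else \<ominus> \<one>)" for t
  have ext: "t \<in> extensional ?E" if "t \<in> ?T \<union> T'" for t using that unfolding T'_def level_maps_def by auto
  obtain t0 where t0: "t0 \<in> ?T" using T(6) by blast
  have "a t0 = \<zero>"
  proof (rule dedekind_independence[where T = "?T \<union> T'" and E = ?E and a = a])
    show "finite (?T \<union> T')" unfolding T'_def using T(1) by simp
    show "\<one> \<in> ?E" "\<And>x y. x \<in> ?E \<Longrightarrow> y \<in> ?E \<Longrightarrow> x \<otimes> y \<in> ?E" using Er by auto
    show c: "t x \<in> carrier \<Omega>" if "t \<in> ?T \<union> T'" "x \<in> ?E" for t x
      using hom'[OF that(1)] ES[OF that(2)] that(2) by auto
    show "t (x \<otimes> y) = t x \<otimes> t y" if "t \<in> ?T \<union> T'" "x \<in> ?E" "y \<in> ?E" for t x y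
      using hom'[OF that(1)] ES[OF that(2)] ES[OF that(3)] that(2,3) Er(6) aut_mult by auto
    show "t \<one> = \<one>" if "t \<in> ?T \<union> T'" for t using hom'[OF that(1)] Er(3) aut_one by auto
    show "\<exists>x\<in>?E. t x \<noteq> t' x" if "t \<in> ?T \<union> T'" "t' \<in> ?T \<union> T'" "t \<noteq> t'" for t t'
      using ext that by (meson extensionalityI)
    show "a t \<in> carrier \<Omega>" for t unfolding a_def by simp
    show "(\<Oplus>t\<in>?T \<union> T'. a t \<otimes> t x) = \<zero>" if x: "x \<in> ?E" for x
    proof -
      have "(\<Oplus>t\<in>?T \<union> T'. a t \<otimes> t x) = (\<Oplus>t\<in>?T. a t \<otimes> t x) \<oplus> (\<Oplus>t\<in>T'. a t \<otimes> t x)"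
        by (rule finsum_Un_disjoint) (use T(1) disj c x in \<open>auto simp: T'_def a_def\<close>)
      also have "(\<Oplus>t\<in>?T. a t \<otimes> t x) = (\<Oplus>t\<in>?T. t x)"
        by (rule finsum_cong') (use TC x in \<open>auto simp: a_def\<close>)
      also have "(\<Oplus>t\<in>T'. a t \<otimes> t x) = (\<Oplus>t\<in>T'. \<ominus> \<one> \<otimes> t x)"
        by (rule finsum_cong') (use disj c x in \<open>auto simp: a_def\<close>)
      also have "\<dots> = \<ominus> \<one> \<otimes> (\<Oplus>t\<in>T'. t x)"
        by (rule finsum_rdistr[symmetric]) (use T(1) c x in \<open>auto simp: T'_def\<close>)
      also have "(\<Oplus>t\<in>T'. t x) = (\<Oplus>t\<in>?T. s (t x))"
      proof -
        have "(\<Oplus>t\<in>T'. t x) = (\<Oplus>t\<in>?T. (restrict (\<lambda>x. s (t x)) ?E) x)"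
          unfolding T'_def by (rule finsum_reindex[OF _ injs]) (use c x in \<open>simp add: T'_def Pi_iff\<close>)
        then show ?thesis using x by simp
      qed
      also have "\<dots> = s (\<Oplus>t\<in>?T. t x)" 
        by (rule aut_finsum[OF s(1) T(1), symmetric]) (rule TC[OF _ x])
      also have "\<dots> = (\<Oplus>t\<in>?T. t x)" by (rule s(2)[OF trace[OF x]])
      finally show ?thesis using TC x by (simp add: l_minus r_neg finsum_closed Pi_I)
    qed
    show "t0 \<in> ?T \<union> T'" using t0 by blast
  qed
  then show False using t0 unfolding a_def by simp
qed

section \<open>The Galois correspondence\<close>

lemma restrict_gal:
  assumes L: "subring L \<Omega>" "F \<subseteq> L" and st: "\<And>s x. s \<in> auts F \<Longrightarrow> x \<in> L \<Longrightarrow> s x \<in> L" and s: "s \<in> auts F"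
  shows "restrict s L \<in> carrier (gal_group \<Omega> L F)"
proof -
  interpret \<Gamma>: group \<Gamma> by (rule group_\<Gamma>)
  have Lc: "L \<subseteq> carrier \<Omega>" by (rule subringE(1)[OF L(1)])
  have "bij_betw (restrict s L) L L"
  proof -
    have "inj_on (restrict s L) L" using aut_inj[OF s] Lc unfolding inj_on_def by auto
    moreover have "restrict s L ` L = L"
    proof
      show "restrict s L ` L \<subseteq> L" using st[OF s] by auto
      show "L \<subseteq> restrict s L ` L"
      proof
        fix y assume y: "y \<in> L"
        define x where "x = (inv\<^bsub>\<Gamma>\<^esub> s) y"
        have "x \<in> L" unfolding x_def using st y s by simp
        moreover have "s x = y" unfolding x_def using auts_inv1(2)[OF F_sub s] y Lc by blast
        ultimately show "y \<in> restrict s L ` L" by force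
      qed
    qed
    ultimately show ?thesis by (simp add: bij_betw_def)
  qed
  moreover have "restrict s L \<in> ring_hom (\<Omega>\<lparr>carrier := L\<rparr>) (\<Omega>\<lparr>carrier := L\<rparr>)" 
    by (rule ring_hom_memI) (use st[OF s] Lc aut_mult[OF s] aut_add[OF s] aut_one[OF s] subringE[OF L(1)] in \<open>auto simp: subset_iff\<close>)
  moreover have "restrict s L x = x" if "x \<in> F" for x using that L(2) aut_fix[OF s] by auto
  ultimately show ?thesis unfolding gal_group_iff by simp
qed

lemma galois_restrict:
  assumes L: "galois_extension \<Omega> L F"
  shows "s \<in> auts F \<Longrightarrow> restrict s L \<in> carrier (gal_group \<Omega> L F)"
    and "t \<in> carrier (gal_group \<Omega> L F) \<Longrightarrow> \<exists>s\<in>auts F. restrict s L = t"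
    and "s \<in> auts F \<Longrightarrow> t \<in> auts F \<Longrightarrow> restrict (s \<otimes>\<^bsub>\<Gamma>\<^esub> t) L = restrict s L \<otimes>\<^bsub>gal_group \<Omega> L F\<^esub> restrict t L"
    and "s \<in> auts F \<Longrightarrow> restrict s L = \<one>\<^bsub>gal_group \<Omega> L F\<^esub> \<longleftrightarrow> s \<in> stab L"
    and "group (gal_group \<Omega> L F)"
proof -
  have Lf: "subfield L \<Omega>" and FL: "F \<subseteq> L" using L unfolding galois_extension_def by auto
  have Lsub: "subring L \<Omega>" and Lc: "L \<subseteq> carrier \<Omega>" using subfieldE(1,3)[OF Lf] by auto
  interpret \<Gamma>: group \<Gamma> by (rule group_\<Gamma>)
  show grp: "group (gal_group \<Omega> L F)" by (rule gal_group_is_group[OF subring_is_ring[OF Lsub] FL])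
  interpret G: group "gal_group \<Omega> L F" by (rule grp)
  show r: "restrict s L \<in> carrier (gal_group \<Omega> L F)" if "s \<in> auts F" for s
    by (rule restrict_gal[OF Lsub FL]) (use galois_normal[OF L] that in auto)
  show "\<exists>s\<in>auts F. restrict s L = t" if t: "t \<in> carrier (gal_group \<Omega> L F)"
  proof -
    obtain s where s: "s \<in> auts F" "\<And>x. x \<in> L \<Longrightarrow> s x = t x" using extend_aut[OF Lf FL t] by blast
    have "restrict s L = t" by (rule gal_group_ext[OF r[OF s(1)] t]) (use s in simp)
    then show ?thesis using s(1) by blast
  qed
  show "restrict (s \<otimes>\<^bsub>\<Gamma>\<^esub> t) L = restrict s L \<otimes>\<^bsub>gal_group \<Omega> L F\<^esub> restrict t L"
    if s: "s \<in> auts F" and t: "t \<in> auts F" for s t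
  proof (rule gal_group_ext)
    show "restrict (s \<otimes>\<^bsub>\<Gamma>\<^esub> t) L \<in> carrier (gal_group \<Omega> L F)" using r s t by simp
    show "restrict s L \<otimes>\<^bsub>gal_group \<Omega> L F\<^esub> restrict t L \<in> carrier (gal_group \<Omega> L F)" using r s t by simp
    fix x assume x: "x \<in> L"
    then show "restrict (s \<otimes>\<^bsub>\<Gamma>\<^esub> t) L x = (restrict s L \<otimes>\<^bsub>gal_group \<Omega> L F\<^esub> restrict t L) x"
      using gal_group_mult[OF r[OF s] r[OF t] x] auts_mult[OF s t] Lc galois_normal[OF L x t] by auto
  qed
  show "restrict s L = \<one>\<^bsub>gal_group \<Omega> L F\<^esub> \<longleftrightarrow> s \<in> stab L" if "s \<in> auts F" for s
    using that unfolding gal_group_one stab_def by (auto simp: restrict_def fun_eq_iff)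
qed

lemma fixf_stab_galois:
  assumes L: "galois_extension \<Omega> L F" shows "fixf (stab L) = L"
proof
  have Lf: "subfield L \<Omega>" and FL: "F \<subseteq> L" using L unfolding galois_extension_def by auto
  show "L \<subseteq> fixf (stab L)" using galois_sub_S[OF L] unfolding fixf_def stab_def by auto
  show "fixf (stab L) \<subseteq> L"
  proof
    fix x assume x: "x \<in> fixf (stab L)"
    have "s x = x" if "s \<in> auts L" for s
      using x that auts_mono[OF FL] aut_fix[OF that] unfolding fixf_def stab_def by blast
    then show "x \<in> L" using S_fixed[OF Lf FL, of x] x unfolding fixf_def by blast
  qed
qed

lemma fixf_galois:
  assumes U: "U \<lhd> \<Gamma>" shows "galois_extension \<Omega> (fixf U) F"
proof -
  interpret \<Gamma>: group \<Gamma> by (rule group_\<Gamma>)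
  interpret U: normal U \<Gamma> by (rule U)
  have UG: "U \<subseteq> auts F" by (rule U.subset)
  note sf = fixf_subfield[OF UG]
  have FL: "F \<subseteq> fixf U" using F_sub_S UG aut_fix unfolding fixf_def by blast
  have st: "s x \<in> fixf U" if s: "s \<in> auts F" and x: "x \<in> fixf U" for s x
  proof -
    have xS: "x \<in> \<S>" using x unfolding fixf_def by blast
    note xc = S_carrier[OF xS]
    have "u (s x) = s x" if u: "u \<in> U" for u
    proof -
      have "inv\<^bsub>\<Gamma>\<^esub> s \<otimes>\<^bsub>\<Gamma>\<^esub> u \<otimes>\<^bsub>\<Gamma>\<^esub> s \<in> U" using U.inv_op_closed1[OF s u] .
      then have "(inv\<^bsub>\<Gamma>\<^esub> s \<otimes>\<^bsub>\<Gamma>\<^esub> u \<otimes>\<^bsub>\<Gamma>\<^esub> s) x = x" using x unfolding fixf_def by blast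
      moreover have uG: "u \<in> auts F" using u UG by blast
      ultimately have "(inv\<^bsub>\<Gamma>\<^esub> s) (u (s x)) = x"
        using s xc by (simp add: auts_mult)
      then show ?thesis using auts_inv1(2)[OF F_sub s, of "u (s x)"] uG s xc by simp
    qed
    then show ?thesis unfolding fixf_def using S_aut[OF s xS] by blast
  qed
  have "{x \<in> fixf U. \<forall>s\<in>carrier (gal_group \<Omega> (fixf U) F). s x = x} = F"
  proof
    show "F \<subseteq> {x \<in> fixf U. \<forall>s\<in>carrier (gal_group \<Omega> (fixf U) F). s x = x}"
    proof (intro subsetI CollectI conjI ballI)
      fix x s assume x: "x \<in> F" and s: "s \<in> carrier (gal_group \<Omega> (fixf U) F)"
      show "s x = x" using s x unfolding gal_group_iff by simp
    qed (use FL in blast)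
    show "{x \<in> fixf U. \<forall>s\<in>carrier (gal_group \<Omega> (fixf U) F). s x = x} \<subseteq> F"
    proof clarify
      fix x assume x: "x \<in> fixf U" and fx: "\<forall>s\<in>carrier (gal_group \<Omega> (fixf U) F). s x = x"
      have "s x = x" if s: "s \<in> auts F" for s
      proof -
        have "restrict s (fixf U) \<in> carrier (gal_group \<Omega> (fixf U) F)"
          by (rule restrict_gal[OF subfieldE(1)[OF sf] FL]) (use st s in auto)
        then show ?thesis using fx x by (metis restrict_apply')
      qed
      then show "x \<in> F" using S_fixed[OF subfield_axioms, of x] x unfolding fixf_def by blast
    qed
  qed
  moreover have "\<forall>x\<in>fixf U. (algebraic over F) x"
    using algebraic_extension S_carrier unfolding fixf_def by simp
  ultimately show ?thesis unfolding galois_extension_def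
    using subfield_axioms sf FL by simp
qed

end

lemma nat_mod_add:
  assumes "int p > 0" shows "nat ((i + j) mod int p) = (nat (i mod int p) + nat (j mod int p)) mod p"
proof -
  have "int (nat ((i + j) mod int p)) = int ((nat (i mod int p) + nat (j mod int p)) mod p)"
    using assms by (simp add: zmod_int mod_add_eq)
  then show ?thesis by (simp only: of_nat_eq_iff)
qed

lemma minus_mod_shift:
  assumes "(a :: int) mod m = (b + c) mod m" shows "(- c) mod m = (b + - a) mod m"
proof -
  have "m dvd a - (b + c)" using assms by (simp add: mod_eq_dvd_iff)
  then have "m dvd - c - (b + - a)" by (simp add: algebra_simps)
  then show ?thesis by (simp add: mod_eq_dvd_iff)
qed

context galois_closure
begin

lemma one_car: "\<one> \<in> carrier \<Omega>" by simp

section \<open>Kummer and Artin--Schreier elements\<close>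

text \<open>From \<open>w\<^sup>c \<in> M\<close> it follows that \<open>(w\<^sup>p)\<^sup>c \<in> M\<close>, hence \<open>w\<^sup>p \<in> M\<close>; now use that \<open>c\<close> and \<open>p\<close> are
  coprime.\<close>

lemma S_kummer:
  assumes p: "prime p" "nmul p \<one> \<noteq> \<zero>" and w: "w \<in> carrier \<Omega>" "w [^] p \<in> \<S>"
  shows "w \<in> \<S>"
  unfolding \<S>_def sep_def
proof (intro CollectI conjI allI impI)
  show "w \<in> carrier \<Omega>" by fact
  fix M assume M: "subfield M \<Omega>" "F \<subseteq> M" and wM: "w [^] chr \<in> M"
  note Msub = subfieldE(1)[OF M(1)]
  show "w \<in> M"
  proof (cases "chr = 1 \<or> w = \<zero>")
    case True
    then show ?thesis using wM w subringE(2)[OF Msub] by auto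
  next
    case False
    have pc: "prime chr" using chr False unfolding char_exp_def by auto
    then have "chr \<noteq> p" using chr p(2) prime_gt_1_nat[OF pc] unfolding char_exp_def by auto
    then have "coprime p chr" using p(1) pc by (simp add: primes_coprime)
    then obtain a b where ab: "p * a = chr * b + 1" using coprime_bezout_strong[of p chr] False by auto
    have "(w [^] p) [^] chr = (w [^] chr) [^] p" using w by (simp add: nat_pow_pow mult.commute)
    then have "(w [^] p) [^] chr \<in> M" using pow_in_subring[OF Msub wM] by simp
    then have "w [^] p \<in> M" using sepD[OF _ M] w(2) unfolding \<S>_def by blast
    then have 1: "w [^] (p * a) \<in> M" using pow_in_subring[OF Msub] w by (simp add: nat_pow_pow[symmetric])
    have 2: "w [^] (chr * b) \<in> M" using pow_in_subring[OF Msub wM] w by (simp add: nat_pow_pow[symmetric])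
    have 3: "w [^] (chr * b) \<noteq> \<zero>" using pow_eq_zero[OF w(1)] False by blast
    have "w [^] (p * a) = w [^] (chr * b) \<otimes> w" unfolding ab using w by simp
    then have "w = inv (w [^] (chr * b)) \<otimes> w [^] (p * a)"
      using w 3 by (simp add: m_assoc[symmetric] field_Units)
    then show ?thesis using inv_in_subfield[OF M(1) 2 3] 1 subringE(6)[OF Msub] by metis
  qed
qed

text \<open>Here \<open>c = p\<close>. From \<open>w\<^sup>p \<in> M\<close> it follows that \<open>(w\<^sup>p - w)\<^sup>p = (w\<^sup>p)\<^sup>p - w\<^sup>p \<in> M\<close>, hence
  \<open>w\<^sup>p - w \<in> M\<close>.\<close>

lemma S_artin_schreier:
  assumes p: "prime p" "nmul p \<one> = \<zero>" and w: "w \<in> carrier \<Omega>" "w [^] p \<ominus> w \<in> \<S>"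
  shows "w \<in> \<S>"
  unfolding \<S>_def sep_def
proof (intro CollectI conjI allI impI)
  show "w \<in> carrier \<Omega>" by fact
  have "chr dvd p" "prime chr" using char_exp_dvd[OF chr p(2)] p(1) prime_gt_0_nat by auto
  then have cp: "chr = p" using p(1) primes_dvd_imp_eq by blast
  fix M assume M: "subfield M \<Omega>" "F \<subseteq> M" and wM: "w [^] chr \<in> M"
  note Msub = subfieldE(1)[OF M(1)]
  interpret f: ring_hom_ring \<Omega> \<Omega> "\<lambda>a. a [^] chr"
    by (intro ring_hom_ringI2 ring_axioms frobenius_hom[OF chr])
  define a where "a = w [^] p \<ominus> w"
  have ac: "a \<in> carrier \<Omega>" unfolding a_def using w by simp
  have "a [^] chr = (w [^] chr) [^] chr \<oplus> \<ominus> (w [^] chr)"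
    unfolding a_def minus_eq using w(1) cp f.hom_add[of "w [^] p" "\<ominus> w"] f.hom_a_inv[of w] by simp
  then have "a [^] chr \<in> M" using wM pow_in_subring[OF Msub wM] subringE(5,7)[OF Msub] by simp
  then have aM: "a \<in> M" using sepD[OF _ M, of a chr] w(2) unfolding a_def \<S>_def by blast
  have "w = w [^] chr \<oplus> \<ominus> a" unfolding a_def cp using w 
    by (simp add: minus_eq minus_add a_assoc[symmetric] r_neg)
  then show "w \<in> M" using wM aM subringE(5,7)[OF Msub] by metis
qed

lemma pth_root_exists:
  assumes "y \<in> carrier \<Omega>" "n > 0" obtains w where "w \<in> carrier \<Omega>" "w [^] (n::nat) = y"
proof -
  note pp = pure_poly[OF carrier_is_subring assms]
  obtain w where "w \<in> carrier \<Omega>" "eval (pure_poly n y) w = \<zero>" 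
    using root_exists[OF pp(1)] pp(2) assms(2) by auto
  then show ?thesis using that pp(4) by blast
qed

lemma artin_schreier_root_exists:
  assumes "a \<in> carrier \<Omega>" "n \<ge> 2" obtains w where "w \<in> carrier \<Omega>" "w [^] (n::nat) \<ominus> w = a"
proof -
  define P where "P = (\<one> # replicate (n - 2) \<zero>) @ [\<ominus> \<one>] @ [\<ominus> a]"
  have P: "P \<in> carrier (poly_ring \<Omega>)" using assms by (auto simp: P_def univ_poly_carrier[symmetric] polynomial_def)
  have "Polynomials.degree P = n" using assms(2) by (simp add: P_def)
  then obtain w where w: "w \<in> carrier \<Omega>" "eval P w = \<zero>" using root_exists[OF P] assms(2) by auto
  have m: "eval (\<one> # replicate (n - 2) \<zero>) w = w [^] (n - 2)" 
    using eval_monom[of \<one> w "n - 2"] w by (simp add: monom_def)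
  have "eval P w = (w [^] (n - 2) \<otimes> w \<oplus> \<ominus> \<one>) \<otimes> w \<oplus> \<ominus> a"
  proof -
    have s: "set (\<one> # replicate (n - 2) \<zero>) \<subseteq> carrier \<Omega>" by auto
    have "eval ((\<one> # replicate (n - 2) \<zero>) @ [\<ominus> \<one>]) w = w [^] (n - 2) \<otimes> w \<oplus> \<ominus> \<one>"
      using eval_append_aux[OF s a_inv_closed[OF one_car] w(1)] m by (simp only:)
    moreover have "eval (((\<one> # replicate (n - 2) \<zero>) @ [\<ominus> \<one>]) @ [\<ominus> a]) w 
        = eval ((\<one> # replicate (n - 2) \<zero>) @ [\<ominus> \<one>]) w \<otimes> w \<oplus> \<ominus> a"
      by (rule eval_append_aux) (use assms w in auto)
    ultimately show ?thesis unfolding P_def by simp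
  qed
  also have "\<dots> = w [^] Suc (Suc (n - 2)) \<ominus> w \<ominus> a" using w assms by (simp add: l_distr l_minus minus_eq)
  also have "Suc (Suc (n - 2)) = n" using assms(2) by simp
  finally have "w [^] n \<ominus> w \<ominus> a = \<zero>" using w(2) by simp
  then have "w [^] n \<ominus> w = a" using w(1) assms(1) by simp
  then show ?thesis using that w(1) by blast
qed

text \<open>Exponents are integers read modulo \<open>p\<close>, because characters take values in integers modulo \<open>p\<close>
  throughout.\<close>

definition rt :: "nat \<Rightarrow> 'a \<Rightarrow> int \<Rightarrow> 'a" where "rt p \<xi> k = \<xi> [^] nat (k mod int p)"

lemma rt_closed [simp]: "\<xi> \<in> carrier \<Omega> \<Longrightarrow> rt p \<xi> k \<in> carrier \<Omega>" by (simp add: rt_def)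

lemma rt_cong: "i mod int p = j mod int p \<Longrightarrow> rt p \<xi> i = rt p \<xi> j" by (simp add: rt_def)

context
  fixes p :: nat and \<xi> assumes p: "prime p" and \<xi>: "\<xi> \<in> carrier \<Omega>" "\<xi> [^] p = \<one>" "\<xi> \<noteq> \<one>"
begin

lemma xi_mod: "\<xi> [^] (n::nat) = \<xi> [^] (n mod p)"
proof -
  have "\<xi> [^] n = \<xi> [^] (p * (n div p) + n mod p)" by simp
  also have "\<dots> = (\<xi> [^] p) [^] (n div p) \<otimes> \<xi> [^] (n mod p)" 
    using \<xi>(1) by (simp only: nat_pow_mult[symmetric] nat_pow_pow)
  finally show ?thesis using \<xi> by simp
qed

lemma rt_add: "rt p \<xi> (i + j) = rt p \<xi> i \<otimes> rt p \<xi> j"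
proof -
  have p0: "int p > 0" using p prime_gt_0_nat by simp
  have "nat ((i + j) mod int p) = (nat (i mod int p) + nat (j mod int p)) mod p"
    by (rule nat_mod_add[OF p0])
  then show ?thesis unfolding rt_def using \<xi>(1) by (simp add: nat_pow_mult xi_mod[symmetric])
qed

lemma rt_0: "rt p \<xi> 0 = \<one>" by (simp add: rt_def)

lemma rt_neg: "rt p \<xi> k \<otimes> rt p \<xi> (- k) = \<one>" using rt_add[of k "-k"] rt_0 by simp

lemma rt_nonzero: "rt p \<xi> k \<noteq> \<zero>"
  using rt_neg[of k] \<xi>(1) by (metis l_null one_not_zero rt_closed)

lemma rt_pow: "rt p \<xi> k [^] p = \<one>"
  unfolding rt_def using \<xi> by (metis nat_pow_one nat_pow_pow mult.commute)

lemma rt_eq_one: assumes "rt p \<xi> k = \<one>" shows "k mod int p = 0"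
proof (rule ccontr)
  assume k: "k mod int p \<noteq> 0"
  define n where "n = nat (k mod int p)"
  have p0: "int p > 0" using p prime_gt_0_nat by simp
  have n: "0 < n" "n < p" using k p0 pos_mod_sign[OF p0, of k] pos_mod_bound[OF p0, of k] unfolding n_def by linarith+
  then have "\<not> p dvd n" by (simp add: nat_dvd_not_less)
  then have "coprime n p" using p by (metis prime_imp_coprime coprime_commute)
  then obtain a b where ab: "n * a = p * b + 1" 
    using coprime_bezout_strong[of n p] p by (metis not_prime_1)
  have "(\<xi> [^] n) [^] a = (\<xi> [^] p) [^] b \<otimes> \<xi>" 
    using \<xi>(1) ab by (simp add: nat_pow_pow nat_pow_mult[symmetric])
  moreover have "\<xi> [^] n = \<one>" using assms unfolding rt_def n_def .
  ultimately show False using \<xi> by simp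
qed

lemma rt_inj: assumes "rt p \<xi> i = rt p \<xi> j" shows "i mod int p = j mod int p"
proof -
  have "rt p \<xi> (i - j) = \<one>" using rt_add[of i "-j"] rt_neg[of j] assms by simp
  then have "(i - j) mod int p = 0" by (rule rt_eq_one)
  then show ?thesis by (simp add: mod_eq_dvd_iff mod_eq_0_iff_dvd)
qed

lemma root_of_unity_rt:
  assumes x: "x \<in> carrier \<Omega>" "x [^] p = \<one>" obtains k where "0 \<le> k" "k < int p" "x = rt p \<xi> k"
proof -
  have p0: "p > 0" using p prime_gt_0_nat by simp
  define P where "P = pure_poly p \<one>"
  note pp = pure_poly[OF carrier_is_subring one_car p0, folded P_def]
  define R where "R = rt p \<xi> ` {0..<int p}"
  have sub: "R \<subseteq> set_mset (roots P)"
  proof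
    fix r assume "r \<in> R"
    then obtain k where k: "r = rt p \<xi> k" unfolding R_def by blast
    show "r \<in># roots P"
      unfolding roots_mem_iff_is_root[OF pp(1)] is_root_def k
      using pp(3) pp(4)[OF rt_closed[OF \<xi>(1)]] rt_pow rt_closed[OF \<xi>(1)] by blast
  qed
  have "card R = p" unfolding R_def 
    by (subst card_image) (auto simp: inj_on_def dest!: rt_inj)
  moreover have "card (set_mset (roots P)) \<le> size (roots P)" 
    by (metis size_mset_set size_mset_mono mset_set_set_mset_msubset)
  moreover have "size (roots P) \<le> p" using size_roots_le_degree[OF pp(1)] pp(2) by simp
  ultimately have "R = set_mset (roots P)" using sub by (intro card_seteq) auto
  moreover have "x \<in># roots P" using x pp by (auto simp: roots_mem_iff_is_root[OF pp(1)] is_root_def)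
  ultimately obtain k where "k \<in> {0..<int p}" "x = rt p \<xi> k" unfolding R_def by blast
  then show ?thesis using that[of k] by simp
qed

end

text \<open>The image of \<open>k\<close> under \<open>\<int>/p \<rightarrow> \<Omega>\<close> in characteristic \<open>p\<close>.\<close>

definition cst :: "nat \<Rightarrow> int \<Rightarrow> 'a" where "cst p k = nmul (nat (k mod int p)) \<one>"

lemma cst_closed [simp]: "cst p k \<in> carrier \<Omega>" by (simp add: cst_def)

lemma aut_nmul: assumes s: "s \<in> auts M" shows "s (nmul n \<one>) = nmul n \<one>"
  by (induct n) (simp_all add: aut_zero[OF s] aut_add[OF s] aut_one[OF s])

lemma aut_cst: "s \<in> auts M \<Longrightarrow> s (cst p k) = cst p k" unfolding cst_def by (rule aut_nmul)

lemma cst_cong: "i mod int p = j mod int p \<Longrightarrow> cst p i = cst p j" by (simp add: cst_def)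

context
  fixes p :: nat assumes p: "prime p" and char: "nmul p \<one> = \<zero>"
begin

lemma char_exp_p: "char_exp p" unfolding char_exp_def using p char by simp

lemma nmul_mod: "nmul n \<one> = nmul (n mod p) \<one>"
proof -
  have "nmul n \<one> = nmul (p * (n div p) + n mod p) \<one>" by simp
  also have "\<dots> = nmul (p * (n div p)) \<one> \<oplus> nmul (n mod p) \<one>" by (simp only: add.nat_pow_mult[symmetric] one_car)
  finally show ?thesis using char by (simp add: nat_mult_one)
qed

lemma cst_add: "cst p (i + j) = cst p i \<oplus> cst p j"
proof -
  have p0: "int p > 0" using p prime_gt_0_nat by simp
  have "nat ((i + j) mod int p) = (nat (i mod int p) + nat (j mod int p)) mod p"
    by (rule nat_mod_add[OF p0])
  then show ?thesis unfolding cst_def by (simp add: add.nat_pow_mult nmul_mod[symmetric])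
qed

lemma cst_0: "cst p 0 = \<zero>" by (simp add: cst_def)

lemma cst_neg: "cst p k \<oplus> cst p (- k) = \<zero>" using cst_add[of k "-k"] cst_0 by simp

lemma nmul_pow: "nmul n \<one> [^] p = nmul n \<one>"
proof (induct n)
  case 0
  show ?case using p prime_gt_0_nat by (simp add: nat_pow_zero)
next
  case (Suc n)
  then show ?case using frobenius_add[OF char_exp_p, of "nmul n \<one>" \<one>] by simp
qed

lemma cst_eq_zero: assumes "cst p k = \<zero>" shows "k mod int p = 0"
proof (rule ccontr)
  assume k: "k mod int p \<noteq> 0"
  define n where "n = nat (k mod int p)"
  have p0: "int p > 0" using p prime_gt_0_nat by simp
  have n: "0 < n" "n < p" using k p0 pos_mod_sign[OF p0, of k] pos_mod_bound[OF p0, of k] unfolding n_def by linarith+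
  have "nmul n \<one> = \<zero>" using assms unfolding cst_def n_def .
  then show False using char_exp_dvd(2)[OF char_exp_p] n nat_dvd_not_less by blast
qed

lemma cst_inj: assumes "cst p i = cst p j" shows "i mod int p = j mod int p"
proof -
  have "cst p (i - j) = \<zero>" using cst_add[of i "-j"] cst_neg[of j] assms by simp
  then have "(i - j) mod int p = 0" by (rule cst_eq_zero)
  then show ?thesis by (simp add: mod_eq_dvd_iff mod_eq_0_iff_dvd)
qed

lemma frobenius_fixed_cst:
  assumes x: "x \<in> carrier \<Omega>" "x [^] p = x" obtains k where "0 \<le> k" "k < int p" "x = cst p k"
proof (cases "x = \<zero>")
  case True
  then show ?thesis using that[of 0] cst_0 p prime_gt_0_nat by simp
next
  case False
  have p1: "p - 1 > 0" using p prime_gt_1_nat by simp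
  have p2: "p = Suc (p - 1)" using p1 by simp
  have key: "y [^] (p - 1) = \<one>" if "y \<in> carrier \<Omega>" "y \<noteq> \<zero>" "y [^] p = y" for y
  proof -
    have "y [^] (p - 1) \<otimes> y = \<one> \<otimes> y" using that p2 by (metis l_one nat_pow_Suc)
    then show ?thesis using that m_rcancel[of y "y [^] (p - 1)" \<one>] by simp
  qed
  define P where "P = pure_poly (p - 1) \<one>"
  note pp = pure_poly[OF carrier_is_subring one_car p1, folded P_def]
  define R where "R = cst p ` {1..<int p}"
  have inj: "inj_on (cst p) {1..<int p}" by (auto simp: inj_on_def dest!: cst_inj)
  have "cst p k \<noteq> \<zero>" if "k \<in> {1..<int p}" for k using cst_eq_zero[of k] that by auto
  then have sub: "R \<subseteq> set_mset (roots P)"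
    unfolding R_def using pp key nmul_pow by (auto simp: roots_mem_iff_is_root[OF pp(1)] is_root_def cst_def)
  have "card R = p - 1" unfolding R_def by (subst card_image[OF inj]) simp
  moreover have "card (set_mset (roots P)) \<le> size (roots P)" 
    by (metis size_mset_set size_mset_mono mset_set_set_mset_msubset)
  moreover have "size (roots P) \<le> p - 1" using size_roots_le_degree[OF pp(1)] pp(2) by simp
  ultimately have "R = set_mset (roots P)" using sub by (intro card_seteq) auto
  moreover have "x \<in># roots P" using x key False pp by (auto simp: roots_mem_iff_is_root[OF pp(1)] is_root_def)
  ultimately obtain k where "k \<in> {1..<int p}" "x = cst p k" unfolding R_def by blast
  then show ?thesis using that[of k] by simp
qed

end

section \<open>Hilbert's Theorem 90\<close>

text \<open>Values are integers read modulo \<open>p\<close>. The second condition is continuity, witnessed by \<open>B\<close>.\<close>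

definition character_on :: "nat \<Rightarrow> ('a \<Rightarrow> 'a) set \<Rightarrow> 'a set \<Rightarrow> (('a \<Rightarrow> 'a) \<Rightarrow> int) \<Rightarrow> bool" where
  "character_on p V B \<chi> \<longleftrightarrow>
     (\<forall>s\<in>V. \<forall>t\<in>V. \<chi> (s \<otimes>\<^bsub>\<Gamma>\<^esub> t) mod int p = (\<chi> s + \<chi> t) mod int p) \<and> (\<forall>s\<in>V \<inter> stab B. \<chi> s mod int p = 0)"

lemma level_shift:
  assumes B: "finite B" "B \<subseteq> \<S>" and V: "subgroup V \<Gamma>" and s: "s \<in> V"
    and f: "\<And>t. t \<in> level_maps V B \<Longrightarrow> f t \<in> carrier \<Omega>"
  shows "(\<Oplus>t\<in>level_maps V B. f (restrict (\<lambda>x. s (t x)) (level B))) = (\<Oplus>t\<in>level_maps V B. f t)"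
proof -
  note b = level_maps(5)[OF B V s]
  have "(\<Oplus>t\<in>(\<lambda>t. restrict (\<lambda>x. s (t x)) (level B)) ` level_maps V B. f t)
    = (\<Oplus>t\<in>level_maps V B. f (restrict (\<lambda>x. s (t x)) (level B)))"
    by (rule finsum_reindex[OF _ bij_betw_imp_inj_on[OF b]])
       (use f in \<open>simp add: Pi_iff bij_betw_imp_surj_on[OF b]\<close>)
  then show ?thesis unfolding bij_betw_imp_surj_on[OF b] by simp
qed

lemma level_character:
  assumes B: "finite B" "B \<subseteq> \<S>" and V: "subgroup V \<Gamma>" and \<chi>: "character_on p V B \<chi>"
  obtains \<chi>' where "\<And>s t. s \<in> V \<Longrightarrow> t \<in> level_maps V B \<Longrightarrow>
     \<chi>' (restrict (\<lambda>x. s (t x)) (level B)) mod int p = (\<chi> s + \<chi>' t) mod int p"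
proof -
  interpret \<Gamma>: group \<Gamma> by (rule group_\<Gamma>)
  interpret V: subgroup V \<Gamma> by (rule V)
  have VG: "h \<in> V \<Longrightarrow> h \<in> auts F" for h using V.subset by blast
  define rep where "rep t = (SOME h. h \<in> V \<and> restrict h (level B) = t)" for t
  have rep: "rep t \<in> V" "restrict (rep t) (level B) = t" if "t \<in> level_maps V B" for t
    using someI_ex[of "\<lambda>h. h \<in> V \<and> restrict h (level B) = t"] that unfolding rep_def level_maps_def by blast+
  have wd: "\<chi> h mod int p = \<chi> h' mod int p" if h: "h \<in> V" "h' \<in> V" and e: "restrict h (level B) = restrict h' (level B)" for h h'
  proof -
    have "h b = h' b" if "b \<in> B" for b 
      using fun_cong[OF e, of b] level_base[OF B(2)] that by (auto simp: subset_iff)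
    then have "inv\<^bsub>\<Gamma>\<^esub> h \<otimes>\<^bsub>\<Gamma>\<^esub> h' \<in> stab B" using level_eqI(1)[OF B(2) VG[OF h(1)] VG[OF h(2)]] by blast
    moreover have d: "inv\<^bsub>\<Gamma>\<^esub> h \<otimes>\<^bsub>\<Gamma>\<^esub> h' \<in> V" using h by blast
    ultimately have "\<chi> (inv\<^bsub>\<Gamma>\<^esub> h \<otimes>\<^bsub>\<Gamma>\<^esub> h') mod int p = 0" using \<chi> unfolding character_on_def by blast
    moreover have "h \<otimes>\<^bsub>\<Gamma>\<^esub> (inv\<^bsub>\<Gamma>\<^esub> h \<otimes>\<^bsub>\<Gamma>\<^esub> h') = h'" using VG[OF h(1)] VG[OF h(2)] by (simp add: \<Gamma>.m_assoc[symmetric])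
    then have "\<chi> h' mod int p = (\<chi> h + \<chi> (inv\<^bsub>\<Gamma>\<^esub> h \<otimes>\<^bsub>\<Gamma>\<^esub> h')) mod int p"
      using \<chi> h(1) d unfolding character_on_def by metis
    ultimately show ?thesis by (metis add.right_neutral mod_add_right_eq)
  qed
  show ?thesis
  proof (rule that[of "\<lambda>t. \<chi> (rep t)"])
    fix s t assume s: "s \<in> V" and t: "t \<in> level_maps V B"
    let ?t' = "restrict (\<lambda>x. s (t x)) (level B)"
    have e: "?t' = restrict (s \<otimes>\<^bsub>\<Gamma>\<^esub> rep t) (level B)"
      using auts_mult[OF VG[OF s] VG[OF rep(1)[OF t]]] level_S S_carrier fun_cong[OF rep(2)[OF t]]
      by (intro restrict_ext) (metis restrict_apply')
    have t': "?t' \<in> level_maps V B" using bij_betw_apply[OF level_maps(5)[OF B V s] t] .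
    have "\<chi> (rep ?t') mod int p = \<chi> (s \<otimes>\<^bsub>\<Gamma>\<^esub> rep t) mod int p"
      by (rule wd) (use rep t' t s e in auto)
    then show "\<chi> (rep ?t') mod int p = (\<chi> s + \<chi> (rep t)) mod int p"
      using \<chi> s rep(1)[OF t] unfolding character_on_def by metis
  qed
qed

text \<open>Otherwise the maps of the level would be dependent.\<close>

lemma level_combination_nonzero:
  assumes B: "finite B" "B \<subseteq> \<S>" and V: "subgroup V \<Gamma>" 
    and a: "\<And>t. t \<in> level_maps V B \<Longrightarrow> a t \<in> carrier \<Omega> \<and> a t \<noteq> \<zero>"
  shows "\<exists>x\<in>level B. (\<Oplus>t\<in>level_maps V B. a t \<otimes> t x) \<noteq> \<zero>"
proof (rule ccontr)
  assume "\<not> ?thesis"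
  then have rel: "(\<Oplus>t\<in>level_maps V B. a t \<otimes> t x) = \<zero>" if "x \<in> level B" for x using that by blast
  note T = level_maps[OF B V]
  have VG: "h \<in> V \<Longrightarrow> h \<in> auts F" for h using subgroup.subset[OF V] by blast
  note Er = subringE[OF subfieldE(1)[OF level_subfield]]
  obtain t0 where t0: "t0 \<in> level_maps V B" using T(6) by blast
  have "a t0 = \<zero>"
  proof (rule dedekind_independence[where T = "level_maps V B" and E = "level B" and a = a])
    show "t (x \<otimes> y) = t x \<otimes> t y" if "t \<in> level_maps V B" "x \<in> level B" "y \<in> level B" for t x y
      using T(2)[OF that(1)] that(2,3) Er(6) aut_mult[OF VG] level_S S_carrier by metis
    show "t \<one> = \<one>" if "t \<in> level_maps V B" for t using T(2)[OF that] Er(3) aut_one[OF VG] by metis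
    show "t x \<in> carrier \<Omega>" if "t \<in> level_maps V B" "x \<in> level B" for t x using T(3)[OF that] S_carrier by blast
  qed (use T Er a rel t0 in auto)
  then show False using a t0 by blast
qed

text \<open>The element \<open>y = \<Sum>\<^sub>t rt p \<xi> (- \<chi>(t)) t(x)\<close>, summed over the maps of a level, transforms as required, and
  independence provides an \<open>x\<close> with \<open>y \<noteq> 0\<close>.\<close>

lemma hilbert90_mult:
  assumes B: "finite B" "B \<subseteq> \<S>" and V: "subgroup V \<Gamma>" and \<chi>: "character_on p V B \<chi>"
    and p: "prime p" and \<xi>: "\<xi> \<in> \<S>" "\<xi> [^] p = \<one>" "\<xi> \<noteq> \<one>" and fix_\<xi>: "\<And>s. s \<in> V \<Longrightarrow> s \<xi> = \<xi>"
  obtains y where "y \<in> \<S>" "y \<noteq> \<zero>" "\<And>s. s \<in> V \<Longrightarrow> s y = rt p \<xi> (\<chi> s) \<otimes> y"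
proof -
  have \<xi>c: "\<xi> \<in> carrier \<Omega>" using \<xi>(1) by (rule S_carrier)
  note rt = rt_add[OF p \<xi>c \<xi>(2,3)] rt_nonzero[OF p \<xi>c \<xi>(2,3)]
  note T = level_maps[OF B V]
  have VG: "h \<in> V \<Longrightarrow> h \<in> auts F" for h using subgroup.subset[OF V] by blast
  let ?T = "level_maps V B"
  obtain \<chi>' where \<chi>': "\<And>s t. s \<in> V \<Longrightarrow> t \<in> ?T \<Longrightarrow> \<chi>' (restrict (\<lambda>x. s (t x)) (level B)) mod int p = (\<chi> s + \<chi>' t) mod int p"
    using level_character[OF B V \<chi>] by blast
  define a where "a t = rt p \<xi> (- \<chi>' t)" for t
  have ac: "a t \<in> carrier \<Omega>" for t unfolding a_def using \<xi>c by simp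
  obtain x where x: "x \<in> level B" "(\<Oplus>t\<in>?T. a t \<otimes> t x) \<noteq> \<zero>"
    using level_combination_nonzero[OF B V, of a] ac rt(2) unfolding a_def by blast
  have tx: "t x \<in> carrier \<Omega>" if "t \<in> ?T" for t using T(3)[OF that x(1)] S_carrier by blast
  have aS: "a t \<in> \<S>" for t unfolding a_def rt_def by (rule pow_in_subring[OF subfieldE(1)[OF S_subfield] \<xi>(1)])
  show ?thesis
  proof (rule that[of "\<Oplus>t\<in>?T. a t \<otimes> t x"])
    show "(\<Oplus>t\<in>?T. a t \<otimes> t x) \<in> \<S>" by (rule S_finsum[OF T(1)]) (use aS T(3)[OF _ x(1)] S_ring(6) in blast)
    show "(\<Oplus>t\<in>?T. a t \<otimes> t x) \<noteq> \<zero>" by fact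
    fix s assume s: "s \<in> V"
    have sa: "s (a t) = a t" for t unfolding a_def rt_def using aut_pow[OF VG[OF s] \<xi>c] fix_\<xi>[OF s] by simp
    let ?sh = "\<lambda>t. restrict (\<lambda>x. s (t x)) (level B)"
    have "s (\<Oplus>t\<in>?T. a t \<otimes> t x) = (\<Oplus>t\<in>?T. s (a t \<otimes> t x))"
      by (rule aut_finsum[OF VG[OF s] T(1)]) (use ac tx in auto)
    also have "\<dots> = (\<Oplus>t\<in>?T. rt p \<xi> (\<chi> s) \<otimes> (a (?sh t) \<otimes> (?sh t) x))"
    proof (rule finsum_cong')
      fix t assume t: "t \<in> ?T"
      have "(- \<chi>' t) mod int p = (\<chi> s + - \<chi>' (?sh t)) mod int p"
        by (rule minus_mod_shift[OF \<chi>'[OF s t]])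
      then have "a t = rt p \<xi> (\<chi> s + - \<chi>' (?sh t))" unfolding a_def by (rule rt_cong)
      also have "\<dots> = rt p \<xi> (\<chi> s) \<otimes> a (?sh t)" unfolding a_def by (rule rt(1))
      finally have e: "a t = rt p \<xi> (\<chi> s) \<otimes> a (?sh t)" .
      have "s (a t \<otimes> t x) = a t \<otimes> s (t x)" using aut_mult[OF VG[OF s] ac tx[OF t]] sa by simp
      also have "\<dots> = rt p \<xi> (\<chi> s) \<otimes> (a (?sh t) \<otimes> (?sh t) x)" 
        unfolding e using x(1) ac tx[OF t] VG[OF s] \<xi>c by (simp add: m_assoc)
      finally show "s (a t \<otimes> t x) = rt p \<xi> (\<chi> s) \<otimes> (a (?sh t) \<otimes> (?sh t) x)" .
    qed (use ac tx \<xi>c x(1) VG[OF s] in auto)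
    also have "\<dots> = rt p \<xi> (\<chi> s) \<otimes> (\<Oplus>t\<in>?T. a (?sh t) \<otimes> (?sh t) x)"
      by (rule finsum_rdistr[symmetric]) (use T(1) \<xi>c ac tx x(1) VG[OF s] in auto)
    also have "(\<Oplus>t\<in>?T. a (?sh t) \<otimes> (?sh t) x) = (\<Oplus>t\<in>?T. a t \<otimes> t x)"
      by (rule level_shift[OF B V s]) (use ac tx in auto)
    finally show "s (\<Oplus>t\<in>?T. a t \<otimes> t x) = rt p \<xi> (\<chi> s) \<otimes> (\<Oplus>t\<in>?T. a t \<otimes> t x)" .
  qed
qed

text \<open>The additive analogue uses \<open>- \<Sum>\<^sub>t \<chi>(t) t(x)\<close>, divided by the trace \<open>\<Sum>\<^sub>t t(x) \<noteq> 0\<close>.\<close>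

lemma hilbert90_add:
  assumes B: "finite B" "B \<subseteq> \<S>" and V: "subgroup V \<Gamma>" and \<chi>: "character_on p V B \<chi>"
    and p: "prime p" and char: "nmul p \<one> = \<zero>"
  obtains y where "y \<in> \<S>" "\<And>s. s \<in> V \<Longrightarrow> s y = y \<oplus> cst p (\<chi> s)"
proof -
  note ca = cst_add[OF p char] cst_neg[OF p char]
  note T = level_maps[OF B V]
  have VG: "h \<in> V \<Longrightarrow> h \<in> auts F" for h using subgroup.subset[OF V] by blast
  let ?T = "level_maps V B"
  obtain \<chi>' where \<chi>': "\<And>s t. s \<in> V \<Longrightarrow> t \<in> ?T \<Longrightarrow> \<chi>' (restrict (\<lambda>x. s (t x)) (level B)) mod int p = (\<chi> s + \<chi>' t) mod int p"
    using level_character[OF B V \<chi>] by blast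
  obtain x where x: "x \<in> level B" "(\<Oplus>t\<in>?T. \<one> \<otimes> t x) \<noteq> \<zero>"
    using level_combination_nonzero[OF B V, of "\<lambda>_. \<one>"] by auto
  have tx: "t x \<in> carrier \<Omega>" if "t \<in> ?T" for t using T(3)[OF that x(1)] S_carrier by blast
  define \<theta> where "\<theta> = (\<Oplus>t\<in>?T. t x)"
  have "(\<Oplus>t\<in>?T. \<one> \<otimes> t x) = \<theta>" unfolding \<theta>_def by (rule finsum_cong') (use tx in auto)
  then have \<theta>0: "\<theta> \<noteq> \<zero>" using x(2) by simp
  have \<theta>S: "\<theta> \<in> \<S>" unfolding \<theta>_def by (rule S_finsum[OF T(1)]) (rule T(3)[OF _ x(1)])
  note \<theta>c = S_carrier[OF \<theta>S]
  define b where "b t = cst p (- \<chi>' t)" for t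
  have bc: "b t \<in> carrier \<Omega>" for t unfolding b_def by simp
  have nS: "nmul n \<one> \<in> \<S>" for n by (induct n) (use S_ring in auto)
  define z where "z = (\<Oplus>t\<in>?T. b t \<otimes> t x)"
  have zS: "z \<in> \<S>" unfolding z_def b_def cst_def
    by (rule S_finsum[OF T(1)]) (use nS T(3)[OF _ x(1)] S_ring(6) in blast)
  note zc = S_carrier[OF zS]
  have shift\<theta>: "s \<theta> = \<theta>" and shiftz: "s z = z \<oplus> cst p (\<chi> s) \<otimes> \<theta>" if s: "s \<in> V" for s
  proof -
    let ?sh = "\<lambda>t. restrict (\<lambda>x. s (t x)) (level B)"
    have "s \<theta> = (\<Oplus>t\<in>?T. s (t x))"
      unfolding \<theta>_def by (rule aut_finsum[OF VG[OF s] T(1)]) (use tx in auto)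
    also have "\<dots> = (\<Oplus>t\<in>?T. (?sh t) x)" using x(1) by simp
    also have "\<dots> = \<theta>" unfolding \<theta>_def by (rule level_shift[OF B V s]) (use tx in auto)
    finally show s\<theta>: "s \<theta> = \<theta>" .
    have "s z = (\<Oplus>t\<in>?T. s (b t \<otimes> t x))"
      unfolding z_def by (rule aut_finsum[OF VG[OF s] T(1)]) (use bc tx in auto)
    also have "\<dots> = (\<Oplus>t\<in>?T. b (?sh t) \<otimes> (?sh t) x \<oplus> cst p (\<chi> s) \<otimes> s (t x))"
    proof (rule finsum_cong')
      fix t assume t: "t \<in> ?T"
      have "(- \<chi>' t) mod int p = (- \<chi>' (?sh t) + \<chi> s) mod int p"
        using minus_mod_shift[OF \<chi>'[OF s t]] by (simp add: add.commute)
      then have "b t = cst p (- \<chi>' (?sh t) + \<chi> s)" unfolding b_def by (rule cst_cong)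
      then have e: "b t = b (?sh t) \<oplus> cst p (\<chi> s)" unfolding b_def by (simp only: ca(1))
      have "s (b t \<otimes> t x) = b t \<otimes> s (t x)" using aut_mult[OF VG[OF s] bc tx[OF t]] aut_cst[OF VG[OF s]] unfolding b_def by simp
      then show "s (b t \<otimes> t x) = b (?sh t) \<otimes> (?sh t) x \<oplus> cst p (\<chi> s) \<otimes> s (t x)" 
        unfolding e using x(1) bc tx[OF t] VG[OF s] by (simp add: l_distr)
    qed (use bc tx x(1) VG[OF s] in auto)
    also have "\<dots> = (\<Oplus>t\<in>?T. b (?sh t) \<otimes> (?sh t) x) \<oplus> (\<Oplus>t\<in>?T. cst p (\<chi> s) \<otimes> s (t x))"
      by (rule finsum_addf) (use bc tx x(1) VG[OF s] in auto)
    also have "(\<Oplus>t\<in>?T. b (?sh t) \<otimes> (?sh t) x) = z"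
      unfolding z_def by (rule level_shift[OF B V s]) (use bc tx in auto)
    also have "(\<Oplus>t\<in>?T. cst p (\<chi> s) \<otimes> s (t x)) = cst p (\<chi> s) \<otimes> (\<Oplus>t\<in>?T. s (t x))"
      by (rule finsum_rdistr[symmetric]) (use T(1) tx VG[OF s] in auto)
    also have "(\<Oplus>t\<in>?T. s (t x)) = s \<theta>"
      unfolding \<theta>_def by (rule aut_finsum[OF VG[OF s] T(1), symmetric]) (use tx in auto)
    finally show "s z = z \<oplus> cst p (\<chi> s) \<otimes> \<theta>" unfolding s\<theta> .
  qed
  have i\<theta>: "inv \<theta> \<in> \<S>" "\<theta> \<otimes> inv \<theta> = \<one>" 
    using inv_in_subfield[OF S_subfield \<theta>S \<theta>0] \<theta>c \<theta>0 by (auto simp: field_Units)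
  show ?thesis
  proof (rule that[of "z \<otimes> inv \<theta>"])
    show "z \<otimes> inv \<theta> \<in> \<S>" using S_ring(6) zS i\<theta> by blast
    fix s assume s: "s \<in> V"
    have "s (z \<otimes> inv \<theta>) = s z \<otimes> inv (s \<theta>)"
      using aut_mult[OF VG[OF s] zc S_carrier[OF i\<theta>(1)]] aut_inv[OF VG[OF s] \<theta>c \<theta>0] by simp
    also have "\<dots> = z \<otimes> inv \<theta> \<oplus> cst p (\<chi> s) \<otimes> (\<theta> \<otimes> inv \<theta>)"
      unfolding shift\<theta>[OF s] shiftz[OF s] using zc \<theta>c S_carrier[OF i\<theta>(1)] by (simp add: l_distr m_assoc)
    finally show "s (z \<otimes> inv \<theta>) = z \<otimes> inv \<theta> \<oplus> cst p (\<chi> s)" unfolding i\<theta>(2) by simp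
  qed
qed

end

section \<open>Truncated polynomials modulo a prime\<close>

text \<open>\<open>q\<close> is zero in \<open>(\<int>/p)[T]/(T\<^sup>l)\<close>. Integer polynomials as representatives avoid a type for this
  ring.\<close>

definition low_zero :: "nat \<Rightarrow> nat \<Rightarrow> int poly \<Rightarrow> bool" where
  "low_zero p l q \<longleftrightarrow> (\<forall>k<l. int p dvd poly.coeff q k)"

lemma low_zero_add: "low_zero p l q \<Longrightarrow> low_zero p l r \<Longrightarrow> low_zero p l (q + r)"
  by (simp add: low_zero_def)

lemma low_zero_minus: "low_zero p l q \<Longrightarrow> low_zero p l (- q)"
  by (simp add: low_zero_def)

lemma low_zero_diff: "low_zero p l q \<Longrightarrow> low_zero p l r \<Longrightarrow> low_zero p l (q - r)"
  by (simp add: low_zero_def)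

lemma low_zero_mult: "low_zero p l q \<Longrightarrow> low_zero p l (r * q)"
  unfolding low_zero_def coeff_mult by (intro allI impI dvd_sum) auto

lemma low_zero_0 [simp]: "low_zero p l 0" by (simp add: low_zero_def)

lemma low_zero_sym: "low_zero p l (q - r) \<longleftrightarrow> low_zero p l (r - q)"
  using low_zero_minus[of p l "q - r"] low_zero_minus[of p l "r - q"] by auto

lemma low_zero_trans: "low_zero p l (q - r) \<Longrightarrow> low_zero p l (r - s) \<Longrightarrow> low_zero p l (q - s)"
  using low_zero_add[of p l "q - r" "r - s"] by simp

lemma low_zero_smult: "low_zero p l (smult (int p) q)" by (simp add: low_zero_def)

lemma low_zero_monom: "l \<le> k \<Longrightarrow> low_zero p l (monom a k)" by (simp add: low_zero_def)

text \<open>Induction on \<open>l\<close>: each step corrects one more coefficient.\<close>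

lemma unit_inverse:
  assumes p: "prime p" and u: "\<not> int p dvd poly.coeff u 0"
  shows "\<exists>v. low_zero p l (u * v - 1)"
proof (induct l)
  case 0
  show ?case by (simp add: low_zero_def)
next
  case (Suc l)
  then obtain v where v: "low_zero p l (u * v - 1)" by blast
  have "coprime (poly.coeff u 0) (int p)" 
    using p u by (metis coprime_commute prime_imp_coprime prime_nat_int_transfer)
  then obtain w where w: "[poly.coeff u 0 * w = 1] (mod int p)" using cong_solve_coprime_int by blast
  define d where "d = poly.coeff (u * v - 1) l"
  define v' where "v' = v + monom (- d * w) l"
  have "int p dvd poly.coeff (u * v' - 1) k" if k: "k < Suc l" for k
  proof -
    have "u * v' - 1 = (u * v - 1) + monom (- d * w) l * u" unfolding v'_def by (simp add: algebra_simps)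
    then have e: "poly.coeff (u * v' - 1) k = poly.coeff (u * v - 1) k + (if k < l then 0 else (- d * w) * poly.coeff u (k - l))"
      by (simp add: coeff_monom_mult)
    show ?thesis
    proof (cases "k < l")
      case True
      then show ?thesis using e v unfolding low_zero_def by simp
    next
      case False
      then have "k = l" using k by simp
      then have "poly.coeff (u * v' - 1) k = d * (1 - poly.coeff u 0 * w)" using e unfolding d_def by (simp add: algebra_simps)
      moreover have "int p dvd 1 - poly.coeff u 0 * w" using w by (metis cong_iff_dvd_diff cong_sym)
      ultimately show ?thesis by simp
    qed
  qed
  then show ?case unfolding low_zero_def by blast
qed

text \<open>The norm element \<open>1 + \<sigma> + \<dots> + \<sigma>\<^sup>p\<^sup>-\<^sup>1\<close> equals \<open>((1 + T)\<^sup>p - 1) / T\<close> and so is \<open>T\<^sup>p\<^sup>-\<^sup>1\<close> modulo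
  \<open>p\<close>. This is what ties the norm equation to powers of \<open>D\<close>.\<close>

lemma norm_poly:
  assumes p: "prime p"
  obtains r where "(\<Sum>i<p. [:1, 1:] ^ i) = monom 1 (p - 1) + smult (int p) (r :: int poly)"
proof -
  define s where "s = (\<Sum>i<p. [:1, 1:: int:] ^ i)"
  have X: "[:1, 1:: int:] - 1 = [:0, 1:]" by (simp add: one_pCons)
  have "[:1, 1:: int:] ^ p - 1 = [:0, 1:] * s" 
    using power_diff_1_eq[of "[:1, 1:: int:]" p] unfolding X s_def .
  then have c: "poly.coeff s k = int (p choose Suc k)" for k
  proof -
    have "poly.coeff ([:0, 1:] * s) (Suc k) = poly.coeff ([:1, 1:: int:] ^ p) (Suc k)"
      using \<open>[:1, 1:: int:] ^ p - 1 = [:0, 1:] * s\<close>[symmetric] by simp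
    moreover have "poly.coeff ([:1, 1:: int:] ^ p) j = int (p choose j)" for j
    proof (cases "j \<le> p")
      case True
      then show ?thesis by (simp add: coeff_linear_poly_power)
    next
      case False
      then have "degree ([:1, 1:: int:] ^ p) < j" using degree_linear_power[of 1 p] by (simp add: degree_power_eq)
      then show ?thesis using False by (simp add: coeff_eq_0)
    qed
    ultimately show ?thesis by simp
  qed
  have "int p dvd poly.coeff (s - monom 1 (p - 1)) k" for k
  proof (cases "k = p - 1")
    case True
    then show ?thesis using p prime_gt_0_nat[OF p] by (simp add: c)
  next
    case False
    have "p dvd (p choose Suc k)"
    proof (cases "Suc k < p")
      case True
      then show ?thesis using p by (intro dvd_choose_prime) auto
    next
      case f: False
      then have "p < Suc k" using False by simp
      then have "p choose Suc k = 0" by (rule binomial_eq_0)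
      then show ?thesis by (simp only: dvd_0_right)
    qed
    then show ?thesis using False by (simp add: c)
  qed
  then have "[:int p:] dvd s - monom 1 (p - 1)" by (simp add: const_poly_dvd_iff)
  then obtain r where "s - monom 1 (p - 1) = [:int p:] * r" by (elim dvdE)
  then have "s = monom 1 (p - 1) + smult (int p) r" by (simp add: algebra_simps)
  then show ?thesis using that unfolding s_def by blast
qed

lemma norm_poly_low_zero: "prime p \<Longrightarrow> l \<le> p - 1 \<Longrightarrow> low_zero p l (\<Sum>i<p. [:1, 1:] ^ i)"
  by (metis norm_poly low_zero_add low_zero_monom low_zero_smult)

text \<open>One representative for each unit of \<open>(\<int>/p)[T]/(T\<^sup>l)\<close>.\<close>

definition unit_reps :: "nat \<Rightarrow> nat \<Rightarrow> int poly set" where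
  "unit_reps p l = {q. (\<forall>k<l. poly.coeff q k \<in> {0..<int p}) \<and> (\<forall>k\<ge>l. poly.coeff q k = 0) \<and> poly.coeff q 0 \<noteq> 0}"

lemma exists_rep:
  assumes "p > 0"
  shows "\<exists>r. (\<forall>k<l. poly.coeff r k \<in> {0..<int p}) \<and> (\<forall>k\<ge>l. poly.coeff r k = 0) \<and> low_zero p l (q - r)"
proof -
  define r where "r = (\<Sum>k<l. monom (poly.coeff q k mod int p) k)"
  have c: "poly.coeff r j = (if j < l then poly.coeff q j mod int p else 0)" for j
    unfolding r_def by (simp add: coeff_sum)
  show ?thesis
    by (rule exI[of _ r]) (use assms in \<open>auto simp: c low_zero_def minus_mod_eq_mult_div\<close>)
qed

lemma card_unit_reps:
  assumes "p > 0" "l \<ge> 1"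
  shows "finite (unit_reps p l)" "card (unit_reps p l) = p ^ (l - 1) * (p - 1)"
proof -
  define S where "S = (\<lambda>k::nat. if k = 0 then {1..<int p} else {0..<int p})"
  define h where "h q = restrict (poly.coeff q) {..<l}" for q :: "int poly"
  have bij: "bij_betw h (unit_reps p l) (\<Pi>\<^sub>E k\<in>{..<l}. S k)"
  proof (rule bij_betwI')
    fix q r assume q: "q \<in> unit_reps p l" and r: "r \<in> unit_reps p l"
    show "(h q = h r) = (q = r)"
    proof
      assume e: "h q = h r"
      have "poly.coeff q k = poly.coeff r k" for k
        using fun_cong[OF e, of k] q r unfolding h_def unit_reps_def by (cases "k < l") auto
      then show "q = r" by (simp add: poly_eq_iff)
    qed simp
  next
    fix q assume q: "q \<in> unit_reps p l"
    then have q1: "\<forall>k<l. poly.coeff q k \<in> {0..<int p}" and q2: "poly.coeff q 0 \<noteq> 0" unfolding unit_reps_def by auto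
    have "poly.coeff q k \<in> S k" if "k < l" for k
    proof (cases "k = 0")
      case True
      have "poly.coeff q 0 \<in> {0..<int p}" using q1 assms(2) by simp
      then have "1 \<le> poly.coeff q 0" "poly.coeff q 0 < int p" using q2 by simp_all
      then show ?thesis using True by (simp add: S_def)
    next
      case False
      then show ?thesis using q1 that by (simp add: S_def)
    qed
    then show "h q \<in> (\<Pi>\<^sub>E k\<in>{..<l}. S k)" unfolding h_def by (simp add: PiE_iff)
  next
    fix f assume f: "f \<in> (\<Pi>\<^sub>E k\<in>{..<l}. S k)"
    define q where "q = (\<Sum>k<l. monom (f k) k)"
    have c: "poly.coeff q j = (if j < l then f j else 0)" for j
      unfolding q_def by (simp add: coeff_sum)
    have fS: "f k \<in> S k" if "k < l" for k using f that by (auto simp: PiE_iff)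
    have "S k \<subseteq> {0..<int p}" for k by (auto simp: S_def)
    then have "f k \<in> {0..<int p}" if "k < l" for k using fS[OF that] by blast
    moreover have "f 0 \<noteq> 0" using fS[of 0] assms(2) by (simp add: S_def)
    ultimately have "q \<in> unit_reps p l"
      unfolding unit_reps_def using c assms(2) by simp
    moreover have "f = h q" using f unfolding h_def by (auto simp: c PiE_iff extensional_def)
    ultimately show "\<exists>q\<in>unit_reps p l. f = h q" by blast
  qed
  have fin: "finite (\<Pi>\<^sub>E k\<in>{..<l}. S k)" by (rule finite_PiE) (auto simp: S_def)
  show "finite (unit_reps p l)" using bij fin bij_betw_finite by blast
  have "card (unit_reps p l) = (\<Prod>k<l. card (S k))"
    using bij_betw_same_card[OF bij] by (simp add: card_PiE)
  also have "\<dots> = card (S 0) * (\<Prod>k=1..<l. card (S k))"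
    using assms(2) by (metis atLeast0LessThan One_nat_def prod.atLeast_Suc_lessThan less_eq_Suc_le)
  also have "(\<Prod>k=1..<l. card (S k)) = (\<Prod>k=1..<l. p)" by (rule prod.cong) (auto simp: S_def)
  also have "\<dots> = p ^ (l - 1)" by simp
  also have "card (S 0) = p - 1" by (simp add: S_def nat_diff_distrib)
  finally show "card (unit_reps p l) = p ^ (l - 1) * (p - 1)" by simp
qed

section \<open>Cardinalities in the extended nonnegative reals\<close>

definition ecard :: "'a set \<Rightarrow> ennreal" where
  "ecard S = (if finite S then of_nat (card S) else \<infinity>)"

lemma ecard_bij: "bij_betw h A B \<Longrightarrow> ecard A = ecard B"
  unfolding ecard_def using bij_betw_finite[of h A B] bij_betw_same_card[of h A B] by simp

lemma ecard_times: "ecard (A \<times> B) = ecard A * ecard B"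
proof (cases "finite A \<and> finite B")
  case True
  then show ?thesis by (simp add: ecard_def card_cartesian_product)
next
  case False
  show ?thesis
  proof (cases "A = {} \<or> B = {}")
    case True
    then show ?thesis by (auto simp: ecard_def)
  next
    case ne: False
    have inf: "infinite (A \<times> B)" using False ne by (auto simp: finite_cartesian_product_iff)
    have pos: "ecard A \<noteq> 0" "ecard B \<noteq> 0" using ne by (auto simp: ecard_def)
    have "ecard A = \<infinity> \<or> ecard B = \<infinity>" using False by (auto simp: ecard_def)
    then have "ecard A * ecard B = \<infinity>" using pos by (auto simp: ennreal_top_mult ennreal_mult_top)
    then show ?thesis using inf by (simp add: ecard_def)
  qed
qed

text \<open>Choosing one bijection for each fibre identifies \<open>A\<close> with \<open>W \<times> K\<close>, whether or not the sets are
  finite.\<close>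

lemma ecard_fibration:
  assumes im: "\<phi> ` A = W" and fib: "\<And>w. w \<in> W \<Longrightarrow> \<exists>h. bij_betw h K {a \<in> A. \<phi> a = w}"
  shows "ecard A = ecard W * ecard K"
proof -
  obtain h where h: "\<And>w. w \<in> W \<Longrightarrow> bij_betw (h w) K {a \<in> A. \<phi> a = w}" using fib by metis
  have "bij_betw (\<lambda>(w, k). h w k) (W \<times> K) A"
  proof (rule bij_betwI')
    fix x y assume x: "x \<in> W \<times> K" and y: "y \<in> W \<times> K"
    obtain w k w' k' where e: "x = (w, k)" "y = (w', k')" by (metis surj_pair)
    have 1: "\<phi> (h w k) = w" "\<phi> (h w' k') = w'" using bij_betw_apply[OF h] x y e by auto
    show "((case x of (w, k) \<Rightarrow> h w k) = (case y of (w, k) \<Rightarrow> h w k)) = (x = y)"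
    proof
      assume "(case x of (w, k) \<Rightarrow> h w k) = (case y of (w, k) \<Rightarrow> h w k)"
      then have hh: "h w k = h w' k'" using e by simp
      then have w: "w = w'" using 1 by simp
      moreover have "k = k'" using hh bij_betw_imp_inj_on[OF h[of w]] x y e unfolding w inj_on_def by blast
      ultimately show "x = y" using e by simp
    qed simp
  next
    fix x assume "x \<in> W \<times> K"
    then show "(case x of (w, k) \<Rightarrow> h w k) \<in> A" using bij_betw_apply[OF h] by auto
  next
    fix a assume a: "a \<in> A"
    then have w: "\<phi> a \<in> W" using im by blast
    have "a \<in> h (\<phi> a) ` K" unfolding bij_betw_imp_surj_on[OF h[OF w]] using a by simp
    then obtain k where "k \<in> K" "a = h (\<phi> a) k" by (elim imageE)
    then show "\<exists>x\<in>W \<times> K. a = (case x of (w, k) \<Rightarrow> h w k)" using w by (intro bexI[of _ "(\<phi> a, k)"]) simp_all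
  qed
  then show ?thesis using ecard_bij ecard_times by metis
qed

section \<open>Characters of the kernel of a map onto a cyclic group\<close>

text \<open>The group \<open>G\<close> plays the part of the automorphism group of \<open>\<Omega>\<close>, and \<open>\<U>\<close> of a neighbourhood basis
  of the identity.\<close>

locale cyclic_quotient = group G for G :: "('g, 'n) monoid_scheme" (structure) +
  fixes p :: nat and c :: "'g \<Rightarrow> int" and \<tau> :: 'g and \<U> :: "'g set set"
  assumes prime_p: "prime p"
    and c_hom: "c \<in> hom G (integer_mod_group p)"
    and tau: "\<tau> \<in> carrier G" "c \<tau> = 1"
    and open_normal: "U \<in> \<U> \<Longrightarrow> U \<lhd> G"
    and open_sub: "U \<in> \<U> \<Longrightarrow> U \<subseteq> {n \<in> carrier G. c n = 0}"
    and open_Int: "U \<in> \<U> \<Longrightarrow> V \<in> \<U> \<Longrightarrow> U \<inter> V \<in> \<U>"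
    and open_nonempty: "\<U> \<noteq> {}"
begin

lemma p_pos: "p > 0" "int p > 0" "p > 1" using prime_p prime_gt_0_nat prime_gt_1_nat by auto

lemma c_range: "g \<in> carrier G \<Longrightarrow> 0 \<le> c g \<and> c g < int p"
  using c_hom p_pos unfolding hom_def by (auto simp: carrier_integer_mod_group Pi_iff)

lemma c_mult: "g \<in> carrier G \<Longrightarrow> h \<in> carrier G \<Longrightarrow> c (g \<otimes> h) = (c g + c h) mod int p"
  using c_hom unfolding hom_def by simp

lemma c_one: "c \<one> = 0"
  using hom_one[OF c_hom is_group group_integer_mod_group] by simp

definition N where "N = {n \<in> carrier G. c n = 0}"

lemma N_carrier: "n \<in> N \<Longrightarrow> n \<in> carrier G" by (simp add: N_def)

lemma N_mult: "m \<in> N \<Longrightarrow> n \<in> N \<Longrightarrow> m \<otimes> n \<in> N" by (simp add: N_def c_mult)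

lemma N_one: "\<one> \<in> N" by (simp add: N_def c_one)

lemma c_inv: "g \<in> carrier G \<Longrightarrow> c (inv g) = (- c g) mod int p"
proof -
  assume g: "g \<in> carrier G"
  have "(c g + c (inv g)) mod int p = 0" using c_mult[OF g inv_closed[OF g]] g c_one by simp
  then have "int p dvd c (inv g) - (- c g)" by (simp add: add.commute mod_eq_0_iff_dvd)
  then have "c (inv g) mod int p = (- c g) mod int p" by (simp add: mod_eq_dvd_iff)
  then show ?thesis using c_range[OF inv_closed[OF g]] by simp
qed

lemma N_inv: "n \<in> N \<Longrightarrow> inv n \<in> N" by (simp add: N_def c_inv)

definition conj where "conj n = \<tau> \<otimes> n \<otimes> inv \<tau>"

lemma conj_carrier: "n \<in> carrier G \<Longrightarrow> conj n \<in> carrier G" unfolding conj_def using tau by simp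

lemma c_conj: "n \<in> carrier G \<Longrightarrow> c (conj n) = c n"
  unfolding conj_def using tau c_range[of n]
  by (simp add: c_mult c_inv mod_add_eq)

lemma conj_N: "n \<in> N \<Longrightarrow> conj n \<in> N" using conj_carrier c_conj by (simp add: N_def)

lemma conj_mult: "m \<in> carrier G \<Longrightarrow> n \<in> carrier G \<Longrightarrow> conj (m \<otimes> n) = conj m \<otimes> conj n"
  unfolding conj_def using tau by (simp add: m_assoc inv_solve_left)

lemma conj_pow_N: "n \<in> N \<Longrightarrow> (conj ^^ i) n \<in> N" by (induct i) (simp_all add: conj_N)

lemma conj_open: "U \<in> \<U> \<Longrightarrow> n \<in> U \<Longrightarrow> conj n \<in> U"
  using open_normal normal.inv_op_closed2 tau unfolding conj_def by metis

lemma tau_pow_conj: "n \<in> carrier G \<Longrightarrow> \<tau> [^] i \<otimes> n = (conj ^^ i) n \<otimes> \<tau> [^] (i::nat)"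
proof (induct i arbitrary: n)
  case 0 then show ?case by simp
next
  case (Suc i)
  have "\<tau> [^] Suc i \<otimes> n = \<tau> [^] i \<otimes> (conj n \<otimes> \<tau>)"
    unfolding conj_def using Suc(2) tau by (simp add: m_assoc)
  also have "\<dots> = \<tau> [^] i \<otimes> conj n \<otimes> \<tau>" using Suc(2) tau conj_carrier by (simp add: m_assoc)
  also have "\<dots> = (conj ^^ i) (conj n) \<otimes> \<tau> [^] i \<otimes> \<tau>" using Suc conj_carrier by simp
  also have "\<dots> = (conj ^^ Suc i) n \<otimes> \<tau> [^] Suc i"
  proof -
    have "(conj ^^ i) (conj n) \<in> carrier G" using Suc(2) conj_carrier by (induct i) auto
    then show ?thesis using tau by (simp add: m_assoc funpow_swap1)
  qed
  finally show ?case .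
qed

lemma c_tau_pow: "c (\<tau> [^] (i::nat)) = int i mod int p"
  by (induct i) (use tau in \<open>auto simp: c_one c_mult mod_add_right_eq mod_add_left_eq add.commute\<close>)

lemma tau_p_N: "\<tau> [^] p \<in> N" using tau c_tau_pow[of p] by (simp add: N_def)

lemma conj_tau_p: "conj (\<tau> [^] p) = \<tau> [^] p"
  unfolding conj_def using tau by (metis inv_solve_right nat_pow_Suc nat_pow_Suc2 nat_pow_closed m_closed)

text \<open>The operator \<open>\<sigma> - 1\<close>. It is defined on all functions, and statements about characters modulo \<open>p\<close> are
  divisibility statements on \<open>N\<close>, so that values can be integers.\<close>

definition Dl :: "('g \<Rightarrow> int) \<Rightarrow> 'g \<Rightarrow> int" where "Dl f = (\<lambda>n. f (conj n) - f n)"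

definition act :: "int poly \<Rightarrow> ('g \<Rightarrow> int) \<Rightarrow> 'g \<Rightarrow> int" where
  "act q f = (\<lambda>n. \<Sum>i\<le>degree q. poly.coeff q i * (Dl ^^ i) f n)"

lemma Dl_linear: "(Dl ^^ k) (\<lambda>n. a * f n + b * g n) = (\<lambda>n. a * (Dl ^^ k) f n + b * (Dl ^^ k) g n)"
  by (induct k) (simp_all add: Dl_def algebra_simps fun_eq_iff)

lemma act_linear: "act q (\<lambda>n. a * f n + b * g n) = (\<lambda>n. a * act q f n + b * act q g n)"
  unfolding act_def Dl_linear by (simp add: sum.distrib sum_distrib_left algebra_simps)

lemma act_alt: "degree q \<le> m \<Longrightarrow> act q f n = (\<Sum>i\<le>m. poly.coeff q i * (Dl ^^ i) f n)"
  unfolding act_def by (rule sum.mono_neutral_left) (auto simp: coeff_eq_0)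

lemma act_0 [simp]: "act 0 f = (\<lambda>n. 0)" by (simp add: act_def)

lemma act_pCons: "act (pCons a q) f = (\<lambda>n. a * f n + act q (Dl f) n)"
proof
  fix n
  have "act (pCons a q) f n = (\<Sum>i\<le>Suc (degree q). poly.coeff (pCons a q) i * (Dl ^^ i) f n)"
    by (rule act_alt) (simp add: degree_pCons_le)
  also have "\<dots> = a * f n + (\<Sum>i\<le>degree q. poly.coeff q i * (Dl ^^ Suc i) f n)"
    by (subst sum.atMost_Suc_shift) simp
  also have "(\<Sum>i\<le>degree q. poly.coeff q i * (Dl ^^ Suc i) f n) = act q (Dl f) n"
    unfolding act_def by (simp only: funpow_Suc_right comp_def)
  finally show "act (pCons a q) f n = a * f n + act q (Dl f) n" .
qed

lemma act_1 [simp]: "act 1 f = f" by (simp add: one_pCons act_pCons)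

lemma act_add: "act (q + r) f = (\<lambda>n. act q f n + act r f n)"
proof
  fix n
  define m where "m = max (degree q) (degree r)"
  have "degree (q + r) \<le> m" "degree q \<le> m" "degree r \<le> m" unfolding m_def by (auto intro: degree_add_le_max)
  then show "act (q + r) f n = act q f n + act r f n"
    by (simp add: act_alt[where m = m] sum.distrib algebra_simps)
qed

lemma act_smult: "act (smult a q) f = (\<lambda>n. a * act q f n)"
proof
  fix n
  have "act (smult a q) f n = (\<Sum>i\<le>degree q. poly.coeff (smult a q) i * (Dl ^^ i) f n)"
    by (rule act_alt) (simp add: degree_smult_le)
  then show "act (smult a q) f n = a * act q f n" by (simp add: act_def sum_distrib_left algebra_simps)
qed

lemma act_Dl: "act q (Dl f) = Dl (act q f)"
proof -
  have "(Dl ^^ i) (Dl f) n = (Dl ^^ i) f (conj n) - (Dl ^^ i) f n" for i n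
    by (simp add: funpow_swap1[symmetric]) (simp add: Dl_def)
  then show ?thesis unfolding act_def by (subst (2) Dl_def) (simp add: sum_subtractf right_diff_distrib)
qed

lemma act_mult: "act (q * r) f = act q (act r f)"
proof (induct q arbitrary: f rule: pCons_induct)
  case 0 then show ?case by simp
next
  case (pCons a q)
  have "act (pCons a q * r) f = (\<lambda>n. a * act r f n + act (q * r) (Dl f) n)"
    by (simp add: act_add act_smult act_pCons)
  then show ?case unfolding pCons(2) by (simp add: act_Dl act_pCons)
qed

lemma act_monom: "act (monom a k) f = (\<lambda>n. a * (Dl ^^ k) f n)"
  by (induct k arbitrary: f) (simp_all add: monom_Suc monom_0 act_pCons funpow_swap1)

lemma act_conj_pow: "f ((conj ^^ i) n) = act ([:1, 1:] ^ i) f n"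
proof (induct i arbitrary: n)
  case 0 then show ?case by simp
next
  case (Suc i)
  have "f ((conj ^^ Suc i) n) = f ((conj ^^ i) (conj n))" by (simp add: funpow_swap1)
  also have "\<dots> = act ([:1, 1:] ^ i) f (conj n)" by (rule Suc)
  also have "\<dots> = act [:1, 1:] (act ([:1, 1:] ^ i) f) n" by (simp add: act_pCons Dl_def)
  finally show ?case by (simp only: act_mult[symmetric] power_Suc)
qed

lemma act_sum: "act (\<Sum>i\<in>A. q i) f = (\<lambda>n. \<Sum>i\<in>A. act (q i) f n)"
  by (induct A rule: infinite_finite_induct) (simp_all add: act_add)

definition vanish where "vanish f \<longleftrightarrow> (\<forall>n\<in>N. int p dvd f n)"

lemma vanish_Dl: "vanish f \<Longrightarrow> vanish (Dl f)" unfolding vanish_def Dl_def using conj_N by simp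

lemma vanish_Dl_pow: "vanish f \<Longrightarrow> vanish ((Dl ^^ k) f)" by (induct k) (simp_all add: vanish_Dl)

lemma vanish_Dl_mono: "vanish ((Dl ^^ l) f) \<Longrightarrow> l \<le> k \<Longrightarrow> vanish ((Dl ^^ k) f)"
  using vanish_Dl_pow[of "(Dl ^^ l) f" "k - l"] by (metis funpow_add comp_apply le_add_diff_inverse2)

lemma vanish_act: "vanish f \<Longrightarrow> vanish (act q f)"
  unfolding vanish_def act_def using vanish_Dl_pow[unfolded vanish_def, of f] unfolding vanish_def by (auto intro!: dvd_sum)

lemma vanish_add: "vanish f \<Longrightarrow> vanish g \<Longrightarrow> vanish (\<lambda>n. f n + g n)" unfolding vanish_def by simp

definition feq where "feq f g \<longleftrightarrow> vanish (\<lambda>n. f n - g n)"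

lemma feq_act: "feq f g \<Longrightarrow> feq (act q f) (act q g)"
  using vanish_act[of "\<lambda>n. f n - g n" q] act_linear[of q 1 f "-1" g] unfolding feq_def by simp

lemma feq_Dl: "feq f g \<Longrightarrow> feq ((Dl ^^ k) f) ((Dl ^^ k) g)"
  using feq_act[of f g "monom 1 k"] by (simp add: act_monom)

lemma feq_vanish: "feq f g \<Longrightarrow> vanish f \<longleftrightarrow> vanish g"
  unfolding feq_def vanish_def by (metis dvd_diff_commute zdvd_zdiffD)

lemma feq_sym: "feq f g \<Longrightarrow> feq g f" unfolding feq_def vanish_def by (simp add: dvd_diff_commute)
lemma feq_trans: "feq f g \<Longrightarrow> feq g h \<Longrightarrow> feq f h" 
  using vanish_add[of "\<lambda>n. f n - g n" "\<lambda>n. g n - h n"] unfolding feq_def by simp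

definition smooth_hom where
  "smooth_hom f \<longleftrightarrow> (\<forall>m\<in>N. \<forall>n\<in>N. int p dvd f (m \<otimes> n) - (f m + f n)) \<and> (\<exists>U\<in>\<U>. \<forall>n\<in>U. int p dvd f n)"

lemma smooth_hom_mult: "smooth_hom f \<Longrightarrow> m \<in> N \<Longrightarrow> n \<in> N \<Longrightarrow> int p dvd f (m \<otimes> n) - (f m + f n)"
  unfolding smooth_hom_def by blast

lemma open_N: "U \<in> \<U> \<Longrightarrow> U \<subseteq> N" using open_sub unfolding N_def by blast

lemma smooth_hom_linear:
  assumes f: "smooth_hom f" and g: "smooth_hom g" shows "smooth_hom (\<lambda>n. a * f n + b * g n)"
proof -
  obtain U V where U: "U \<in> \<U>" "\<forall>n\<in>U. int p dvd f n" and V: "V \<in> \<U>" "\<forall>n\<in>V. int p dvd g n"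
    using f g unfolding smooth_hom_def by blast
  have "\<forall>n\<in>U \<inter> V. int p dvd a * f n + b * g n" using U V by simp
  moreover have "int p dvd (a * f (m \<otimes> n) + b * g (m \<otimes> n)) - (a * f m + b * g m + (a * f n + b * g n))"
    if "m \<in> N" "n \<in> N" for m n
  proof -
    have "int p dvd a * (f (m \<otimes> n) - (f m + f n)) + b * (g (m \<otimes> n) - (g m + g n))"
      using smooth_hom_mult[OF f that] smooth_hom_mult[OF g that] by simp
    then show ?thesis by (simp add: algebra_simps)
  qed
  ultimately show ?thesis using open_Int[OF U(1) V(1)] unfolding smooth_hom_def by blast
qed

lemma smooth_hom_Dl: assumes f: "smooth_hom f" shows "smooth_hom (Dl f)"
proof -
  obtain U where U: "U \<in> \<U>" "\<forall>n\<in>U. int p dvd f n" using f unfolding smooth_hom_def by blast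
  have "\<forall>n\<in>U. int p dvd Dl f n" using U conj_open[OF U(1)] unfolding Dl_def by simp
  moreover have "int p dvd Dl f (m \<otimes> n) - (Dl f m + Dl f n)" if "m \<in> N" "n \<in> N" for m n
  proof -
    have "int p dvd (f (conj m \<otimes> conj n) - (f (conj m) + f (conj n))) - (f (m \<otimes> n) - (f m + f n))"
      by (intro dvd_diff smooth_hom_mult[OF f] conj_N that)
    then show ?thesis unfolding Dl_def using that N_carrier by (simp add: conj_mult algebra_simps)
  qed
  ultimately show ?thesis using U(1) unfolding smooth_hom_def by blast
qed

lemma smooth_hom_zero: "smooth_hom (\<lambda>n. 0)" using open_nonempty unfolding smooth_hom_def by auto

lemma smooth_hom_Dl_pow: "smooth_hom f \<Longrightarrow> smooth_hom ((Dl ^^ k) f)" by (induct k) (simp_all add: smooth_hom_Dl)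

lemma smooth_hom_act: "smooth_hom f \<Longrightarrow> smooth_hom (act q f)"
proof (induct q arbitrary: f rule: pCons_induct)
  case 0 then show ?case using smooth_hom_zero by simp
next
  case (pCons a q)
  then show ?case using smooth_hom_linear[of f "act q (Dl f)" a 1] smooth_hom_Dl by (simp add: act_pCons)
qed

lemma smooth_hom_one: assumes "smooth_hom f" shows "int p dvd f \<one>"
  using smooth_hom_mult[OF assms N_one N_one] by simp

lemma smooth_hom_inv: assumes "smooth_hom f" "n \<in> N" shows "int p dvd f (inv n) + f n"
proof -
  have "int p dvd f (n \<otimes> inv n) - (f n + f (inv n))" by (rule smooth_hom_mult[OF assms N_inv[OF assms(2)]])
  then have "int p dvd f \<one> - (f n + f (inv n))" using N_carrier[OF assms(2)] by simp
  then show ?thesis using smooth_hom_one[OF assms(1)] by (metis add.commute dvd_diff_commute zdvd_zdiffD)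
qed

lemma smooth_hom_feq: assumes f: "smooth_hom f" and e: "feq f g" shows "smooth_hom g"
proof -
  obtain U where U: "U \<in> \<U>" "\<forall>n\<in>U. int p dvd f n" using f unfolding smooth_hom_def by blast
  have d: "int p dvd f n - g n" if "n \<in> N" for n using e that unfolding feq_def vanish_def by blast
  have "\<forall>n\<in>U. int p dvd g n" using U open_N[OF U(1)] d by (metis dvd_diff_commute subsetD zdvd_zdiffD)
  moreover have "int p dvd g (m \<otimes> n) - (g m + g n)" if "m \<in> N" "n \<in> N" for m n
  proof -
    have "int p dvd (f (m \<otimes> n) - (f m + f n)) - ((f (m \<otimes> n) - g (m \<otimes> n)) - (f m - g m) - (f n - g n))"
      by (intro dvd_diff smooth_hom_mult[OF f] d that N_mult)
    then show ?thesis by (simp add: algebra_simps)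
  qed
  ultimately show ?thesis using U(1) unfolding smooth_hom_def by blast
qed

lemma act_tau_p:
  assumes "int p dvd f (\<tau> [^] p)" shows "int p dvd (Dl ^^ k) f (\<tau> [^] p)" "int p dvd act q f (\<tau> [^] p)"
proof -
  have "Dl g (\<tau> [^] p) = 0" for g unfolding Dl_def conj_tau_p by simp
  then show k: "int p dvd (Dl ^^ k) f (\<tau> [^] p)" for k using assms by (cases k) simp_all
  show "int p dvd act q f (\<tau> [^] p)" unfolding act_def using k by (intro dvd_sum) simp
qed

lemma act_low_zero:
  assumes v: "vanish ((Dl ^^ l) f)" and q: "low_zero p l q" shows "vanish (act q f)"
  unfolding vanish_def act_def
proof (intro ballI dvd_sum)
  fix n i assume n: "n \<in> N"
  show "int p dvd poly.coeff q i * (Dl ^^ i) f n"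
  proof (cases "i < l")
    case True then show ?thesis using q unfolding low_zero_def by simp
  next
    case False
    then have "vanish ((Dl ^^ i) f)" using vanish_Dl_mono[OF v] by simp
    then show ?thesis using n unfolding vanish_def by simp
  qed
qed

lemma act_diff: "act (q - r) f = (\<lambda>n. act q f n - act r f n)"
  using act_add[of q "- r" f] act_smult[of "-1" r f] by simp

subsection \<open>The module homomorphism attached to a character\<close>

text \<open>The homomorphism \<open>N \<rightarrow> A\<^sub>l\<close> with top coefficient \<open>f\<close>. Equivariance forces the other coefficients:
  multiplication by \<open>T\<close> shifts the coefficients upwards and corresponds to \<open>D\<close>.\<close>

definition lam :: "('g \<Rightarrow> int) \<Rightarrow> nat \<Rightarrow> 'g \<Rightarrow> int poly" where
  "lam f l n = (\<Sum>j<l. monom ((Dl ^^ (l - 1 - j)) f n) j)"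

lemma coeff_lam: "poly.coeff (lam f l n) j = (if j < l then (Dl ^^ (l - 1 - j)) f n else 0)"
  unfolding lam_def by (simp add: coeff_sum)

lemma lam_mult:
  assumes f: "smooth_hom f" and n: "m \<in> N" "n \<in> N"
  shows "low_zero p l (lam f l (m \<otimes> n) - (lam f l m + lam f l n))"
  unfolding low_zero_def using smooth_hom_mult[OF smooth_hom_Dl_pow[OF f] n] by (simp add: coeff_lam)

lemma lam_one: "smooth_hom f \<Longrightarrow> low_zero p l (lam f l \<one>)"
  unfolding low_zero_def using smooth_hom_one[OF smooth_hom_Dl_pow] by (simp add: coeff_lam)

lemma lam_inv: "smooth_hom f \<Longrightarrow> n \<in> N \<Longrightarrow> low_zero p l (lam f l (inv n) + lam f l n)"
  unfolding low_zero_def using smooth_hom_inv[OF smooth_hom_Dl_pow] by (simp add: coeff_lam)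

lemma lam_zero_iff:
  assumes "vanish ((Dl ^^ l) f)" "n \<in> N"
  shows "low_zero p l (lam f l n) \<longleftrightarrow> (\<forall>k. int p dvd (Dl ^^ k) f n)"
proof
  assume z: "low_zero p l (lam f l n)"
  show "\<forall>k. int p dvd (Dl ^^ k) f n"
  proof
    fix k show "int p dvd (Dl ^^ k) f n"
    proof (cases "k < l")
      case True
      then have "int p dvd poly.coeff (lam f l n) (l - 1 - k)" using z unfolding low_zero_def by simp
      then show ?thesis using True by (simp add: coeff_lam)
    next
      case False
      then show ?thesis using vanish_Dl_mono[OF assms(1), of k] assms(2) unfolding vanish_def by simp
    qed
  qed
qed (simp add: low_zero_def coeff_lam)

text \<open>Equivariance: \<open>\<sigma> = 1 + T\<close> on \<open>A\<^sub>l\<close>. The constant coefficient uses \<open>D\<^sup>l f = 0\<close>.\<close>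

lemma lam_conj:
  assumes v: "vanish ((Dl ^^ l) f)" and n: "n \<in> N"
  shows "low_zero p l (lam f l (conj n) - [:1, 1:] * lam f l n)"
  unfolding low_zero_def
proof (intro allI impI)
  fix j assume j: "j < l"
  have D: "(Dl ^^ k) f (conj n) = (Dl ^^ k) f n + (Dl ^^ Suc k) f n" for k by (simp add: Dl_def)
  show "int p dvd poly.coeff (lam f l (conj n) - [:1, 1:] * lam f l n) j"
  proof (cases j)
    case 0
    then have "Suc (l - 1) = l" using j by simp
    then have "poly.coeff (lam f l (conj n) - [:1, 1:] * lam f l n) j = (Dl ^^ l) f n"
      using 0 j D[of "l - 1"] by (simp add: coeff_lam)
    then show ?thesis using v n unfolding vanish_def by simp
  next
    case (Suc i)
    then have "Suc (l - 1 - j) = l - 1 - i" using j by simp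
    then have "poly.coeff (lam f l (conj n) - [:1, 1:] * lam f l n) j = 0"
      using Suc j D[of "l - 1 - j"] by (simp add: coeff_lam del: funpow.simps)
    then show ?thesis by simp
  qed
qed

lemma lam_conj_pow:
  assumes v: "vanish ((Dl ^^ l) f)" and n: "n \<in> N"
  shows "low_zero p l (lam f l ((conj ^^ i) n) - [:1, 1:] ^ i * lam f l n)"
proof (induct i)
  case 0 then show ?case by simp
next
  case (Suc i)
  have "low_zero p l (lam f l (conj ((conj ^^ i) n)) - [:1, 1:] * lam f l ((conj ^^ i) n))"
    by (rule lam_conj[OF v conj_pow_N[OF n]])
  moreover have "low_zero p l ([:1, 1:] * (lam f l ((conj ^^ i) n) - [:1, 1:] ^ i * lam f l n))"
    by (rule low_zero_mult[OF Suc])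
  ultimately have "low_zero p l ((lam f l (conj ((conj ^^ i) n)) - [:1, 1:] * lam f l ((conj ^^ i) n)) 
     + [:1, 1:] * (lam f l ((conj ^^ i) n) - [:1, 1:] ^ i * lam f l n))" by (rule low_zero_add)
  then show ?case by (simp add: algebra_simps)
qed

lemma lam_nat_pow:
  assumes f: "smooth_hom f" and n: "n \<in> N"
  shows "n [^] (a::nat) \<in> N \<and> low_zero p l (lam f l (n [^] a) - smult (int a) (lam f l n))"
proof (induct a)
  case 0
  then show ?case using N_one lam_one[OF f] by simp
next
  case (Suc a)
  then have a: "n [^] a \<in> N" by simp
  have "low_zero p l ((lam f l (n [^] a \<otimes> n) - (lam f l (n [^] a) + lam f l n)) 
     + (lam f l (n [^] a) - smult (int a) (lam f l n)))"
    using lam_mult[OF f a n] Suc low_zero_add by blast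
  then show ?case using N_mult[OF a n] by (simp add: algebra_simps smult_add_left)
qed

text \<open>Multiplication by \<open>T\<close> is realised by \<open>n \<mapsto> (\<tau> n \<tau>\<^sup>-\<^sup>1) n\<^sup>-\<^sup>1\<close>, whatever \<open>f\<close> and \<open>l\<close> are, so one element serves to
  compare several characters.\<close>

lemma lam_poly_multiple:
  assumes n: "n \<in> N"
  shows "\<exists>m\<in>N. \<forall>f l. smooth_hom f \<longrightarrow> vanish ((Dl ^^ l) f) \<longrightarrow> low_zero p l (lam f l m - r * lam f l n)"
proof (induct r rule: pCons_induct)
  case 0
  then show ?case using N_one lam_one by (intro bexI[of _ "\<one>"]) auto
next
  case (pCons a q)
  then obtain m where m: "m \<in> N" and q: "\<And>f l. smooth_hom f \<Longrightarrow> vanish ((Dl ^^ l) f) \<Longrightarrow> low_zero p l (lam f l m - q * lam f l n)"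
    by blast
  define T where "T = [:0, 1 :: int:]"
  have t: "[:1, 1 :: int:] = 1 + T" "pCons a q = [:a:] + T * q" by (simp_all add: T_def one_pCons)
  define b where "b = nat (a mod int p)"
  have b: "int b = a mod int p" using p_pos unfolding b_def by simp
  define k where "k = n [^] b"
  define u where "u = conj m \<otimes> inv m"
  have k: "k \<in> N" unfolding k_def using lam_nat_pow[OF smooth_hom_zero n] by blast
  have u: "u \<in> N" unfolding u_def using m conj_N N_inv N_mult by blast
  have "low_zero p l (lam f l (k \<otimes> u) - pCons a q * lam f l n)" if f: "smooth_hom f" and v: "vanish ((Dl ^^ l) f)" for f l
  proof -
    have 1: "low_zero p l (lam f l (k \<otimes> u) - (lam f l k + lam f l u))" by (rule lam_mult[OF f k u])
    have 2: "low_zero p l (lam f l k - smult (int b) (lam f l n))" unfolding k_def using lam_nat_pow[OF f n] by blast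
    have 3: "low_zero p l (smult (int b) (lam f l n) - smult a (lam f l n))"
    proof -
      have "int p dvd int b - a" unfolding b by (simp add: mod_eq_dvd_iff[symmetric])
      then obtain d where "int b - a = int p * d" by (elim dvdE)
      then have "smult (int b) (lam f l n) - smult a (lam f l n) = smult (int p) (smult d (lam f l n))"
        by (simp add: smult_diff_left[symmetric])
      then show ?thesis using low_zero_smult by metis
    qed
    have 4: "low_zero p l (lam f l u - (lam f l (conj m) + lam f l (inv m)))"
      unfolding u_def by (rule lam_mult[OF f conj_N[OF m] N_inv[OF m]])
    have 5: "low_zero p l (lam f l (conj m) - [:1, 1:] * lam f l m)" by (rule lam_conj[OF v m])
    have 6: "low_zero p l (lam f l (inv m) + lam f l m)" by (rule lam_inv[OF f m])
    have 7: "low_zero p l (T * (lam f l m - q * lam f l n))" by (rule low_zero_mult[OF q[OF f v]])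
    have "low_zero p l ((lam f l (k \<otimes> u) - (lam f l k + lam f l u)) + (lam f l k - smult (int b) (lam f l n))
      + (smult (int b) (lam f l n) - smult a (lam f l n)) + (lam f l u - (lam f l (conj m) + lam f l (inv m)))
      + (lam f l (conj m) - [:1, 1:] * lam f l m) + (lam f l (inv m) + lam f l m) + T * (lam f l m - q * lam f l n))"
      by (intro low_zero_add 1 2 3 4 5 6 7)
    also have "(lam f l (k \<otimes> u) - (lam f l k + lam f l u)) + (lam f l k - smult (int b) (lam f l n))
      + (smult (int b) (lam f l n) - smult a (lam f l n)) + (lam f l u - (lam f l (conj m) + lam f l (inv m)))
      + (lam f l (conj m) - [:1, 1:] * lam f l m) + (lam f l (inv m) + lam f l m) + T * (lam f l m - q * lam f l n)
      = lam f l (k \<otimes> u) - pCons a q * lam f l n"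
      unfolding t by (simp add: algebra_simps)
    finally show ?thesis .
  qed
  then show ?case using N_mult[OF k u] by blast
qed

text \<open>This turns the action of \<open>\<int>[D]\<close> on characters into multiplication in \<open>A\<^sub>l\<close>, so that units of \<open>A\<^sub>l\<close>
  act on the characters with a given kernel.\<close>

lemma act_lam:
  assumes v: "vanish ((Dl ^^ l) f)" and l: "l \<ge> 1" and n: "n \<in> N"
  shows "int p dvd act q f n - poly.coeff (q * lam f l n) (l - 1)"
proof -
  define m where "m = max (degree q) l"
  have z: "int p dvd poly.coeff q i * (Dl ^^ i) f n" if "i \<ge> l" for i
    using vanish_Dl_mono[OF v that] n unfolding vanish_def by simp
  have "poly.coeff (q * lam f l n) (l - 1) = (\<Sum>i\<le>l - 1. poly.coeff q i * (Dl ^^ i) f n)"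
    unfolding coeff_mult using l by (intro sum.cong) (auto simp: coeff_lam)
  moreover have "act q f n = (\<Sum>i\<le>m. poly.coeff q i * (Dl ^^ i) f n)"
    by (rule act_alt) (simp add: m_def)
  moreover have "(\<Sum>i\<le>m. poly.coeff q i * (Dl ^^ i) f n) = (\<Sum>i\<le>l - 1. poly.coeff q i * (Dl ^^ i) f n) 
     + (\<Sum>i\<in>{..m} - {..l - 1}. poly.coeff q i * (Dl ^^ i) f n)"
  proof -
    have "{..l - 1} \<subseteq> {..m}" using l by (auto simp: m_def)
    then show ?thesis using sum.subset_diff[of "{..l - 1}" "{..m}"] by (simp add: add.commute)
  qed
  ultimately have "act q f n - poly.coeff (q * lam f l n) (l - 1) = (\<Sum>i\<in>{..m} - {..l - 1}. poly.coeff q i * (Dl ^^ i) f n)"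
    by simp
  also have "int p dvd \<dots>" using l by (intro dvd_sum z) auto
  finally show ?thesis .
qed

subsection \<open>Reduced characters\<close>

text \<open>Representatives of characters modulo \<open>p\<close>, for counting: values in \<open>{0..<p}\<close>, and undefined outside \<open>N\<close>.\<close>

definition nrm where "nrm f = restrict (\<lambda>n. f n mod int p) N"

definition J where "J = {f \<in> N \<rightarrow>\<^sub>E {0..<int p}. smooth_hom f}"

text \<open>The condition on \<open>\<tau>\<^sup>p\<close> is the obstruction to extending the homomorphism of \<open>f\<close> to the whole group.\<close>

definition J0 where "J0 l = {f \<in> J. vanish ((Dl ^^ l) f) \<and> int p dvd f (\<tau> [^] p)}"

text \<open>Those \<open>f\<close> for which \<open>lam f l\<close> is onto, see \<open>X_surj\<close>.\<close>

definition Xs where "Xs l = {f \<in> J0 l. \<not> vanish ((Dl ^^ (l - 1)) f)}"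

lemma feq_nrm: "feq f (nrm f)"
  unfolding feq_def vanish_def nrm_def by (simp add: mod_eq_dvd_iff[symmetric])

lemma nrm_J: "smooth_hom f \<Longrightarrow> nrm f \<in> J"
  unfolding J_def using smooth_hom_feq[OF _ feq_nrm] p_pos by (auto simp: nrm_def)

lemma J_eqI: "f \<in> J \<Longrightarrow> g \<in> J \<Longrightarrow> feq f g \<Longrightarrow> f = g"
proof (rule ext)
  fix n assume f: "f \<in> J" and g: "g \<in> J" and e: "feq f g"
  show "f n = g n"
  proof (cases "n \<in> N")
    case True
    then have "f n mod int p = g n mod int p" using e unfolding feq_def vanish_def by (simp add: mod_eq_dvd_iff)
    moreover have "f n \<in> {0..<int p}" "g n \<in> {0..<int p}" using f g True unfolding J_def by (auto simp: PiE_iff)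
    ultimately show ?thesis by simp
  next
    case False
    then show ?thesis using f g unfolding J_def by (auto simp: PiE_iff extensional_def)
  qed
qed

lemma J_smooth: "f \<in> J \<Longrightarrow> smooth_hom f" by (simp add: J_def)

lemma nrm_J0:
  assumes "smooth_hom f" "vanish ((Dl ^^ l) f)" "int p dvd f (\<tau> [^] p)" shows "nrm f \<in> J0 l"
proof -
  have "vanish ((Dl ^^ l) (nrm f))" using feq_vanish[OF feq_Dl[OF feq_nrm]] assms(2) by blast
  moreover have "int p dvd nrm f (\<tau> [^] p)" using assms(3) tau_p_N by (simp add: nrm_def dvd_mod)
  ultimately show ?thesis unfolding J0_def using nrm_J[OF assms(1)] by simp
qed

lemma J0_D: "f \<in> J0 l \<Longrightarrow> smooth_hom f" "f \<in> J0 l \<Longrightarrow> vanish ((Dl ^^ l) f)" "f \<in> J0 l \<Longrightarrow> int p dvd f (\<tau> [^] p)"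
  "f \<in> J0 l \<Longrightarrow> f \<in> J"
  unfolding J0_def J_def by auto

text \<open>The kernel of \<open>lam f l\<close> for all \<open>l\<close> with \<open>D\<^sup>l f = 0\<close>.\<close>

definition ker_of where "ker_of f = {n \<in> N. \<forall>k. int p dvd (Dl ^^ k) f n}"

text \<open>Some value of \<open>lam f l\<close> has a nonzero constant coefficient, so it is a unit, and the image is closed
  under multiplication by polynomials.\<close>

lemma X_unit_element:
  assumes f: "f \<in> Xs l" and l: "l \<ge> 1"
  shows "\<exists>n\<in>N. low_zero p l (lam f l n - 1)"
proof -
  have f0: "f \<in> J0 l" and nv: "\<not> vanish ((Dl ^^ (l - 1)) f)" using f unfolding Xs_def by auto
  note F = J0_D[OF f0]
  obtain n where n: "n \<in> N" "\<not> int p dvd (Dl ^^ (l - 1)) f n" using nv unfolding vanish_def by blast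
  have "\<not> int p dvd poly.coeff (lam f l n) 0" using n l by (simp add: coeff_lam)
  then obtain v where v: "low_zero p l (lam f l n * v - 1)" using unit_inverse[OF prime_p] by blast
  obtain m where m: "m \<in> N" "low_zero p l (lam f l m - v * lam f l n)"
    using lam_poly_multiple[OF n(1), of v] F by blast
  have "low_zero p l (lam f l m - 1)" using low_zero_trans[OF m(2), of 1] v by (simp add: mult.commute)
  then show ?thesis using m(1) by blast
qed

lemma X_surj:
  assumes f: "f \<in> Xs l" and l: "l \<ge> 1"
  shows "\<exists>n\<in>N. low_zero p l (lam f l n - q)"
proof -
  have f0: "f \<in> J0 l" using f unfolding Xs_def by auto
  note F = J0_D[OF f0]
  obtain n where n: "n \<in> N" "low_zero p l (lam f l n - 1)" using X_unit_element[OF f l] by blast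
  obtain m where m: "m \<in> N" "low_zero p l (lam f l m - q * lam f l n)"
    using lam_poly_multiple[OF n(1), of q] F by blast
  have "low_zero p l (q * (lam f l n - 1))" by (rule low_zero_mult[OF n(2)])
  then have "low_zero p l (q * lam f l n - q)" by (simp add: algebra_simps)
  then show ?thesis using low_zero_trans[OF m(2)] m(1) by blast
qed

lemma feq_act_low_zero:
  assumes "vanish ((Dl ^^ l) f)" "low_zero p l (q - r)" shows "feq (act q f) (act r f)"
  using act_low_zero[OF assms] unfolding feq_def act_diff .

text \<open>Since \<open>lam f l\<close> is onto, the annihilator of \<open>f\<close> is that of \<open>A\<^sub>l\<close>.\<close>

lemma X_annihilator:
  assumes f: "f \<in> Xs l" and l: "l \<ge> 1" and q: "vanish (act q f)"
  shows "low_zero p l q"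
  unfolding low_zero_def
proof (intro allI impI)
  fix j assume j: "j < l"
  have f0: "f \<in> J0 l" using f unfolding Xs_def by auto
  note F = J0_D[OF f0]
  obtain n where n: "n \<in> N" "low_zero p l (lam f l n - monom 1 (l - 1 - j))" using X_surj[OF f l] by blast
  have "low_zero p l (q * (lam f l n - monom 1 (l - 1 - j)))" by (rule low_zero_mult[OF n(2)])
  then have 1: "int p dvd poly.coeff (q * lam f l n) (l - 1) - poly.coeff (q * monom 1 (l - 1 - j)) (l - 1)"
    using l unfolding low_zero_def by (simp add: algebra_simps)
  have "poly.coeff (q * monom 1 (l - 1 - j)) (l - 1) = poly.coeff q j"
    using j by (simp add: mult.commute[of q] coeff_monom_mult)
  moreover have "int p dvd poly.coeff (q * lam f l n) (l - 1)"
    using act_lam[OF F(2) l n(1), of q] q n(1) unfolding vanish_def by (metis dvd_diff_commute zdvd_zdiffD)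
  ultimately show "int p dvd poly.coeff q j" using 1 by (metis dvd_diff_commute zdvd_zdiffD)
qed

lemma ker_of_act_subset: "ker_of f \<subseteq> ker_of (act q f)"
proof
  fix n assume n: "n \<in> ker_of f"
  have "int p dvd (Dl ^^ k) (act q f) n" for k
  proof -
    have "(Dl ^^ k) (act q f) = act (monom 1 k * q) f" by (simp add: act_mult act_monom)
    then show ?thesis using n unfolding ker_of_def by (auto simp: act_def intro!: dvd_sum)
  qed
  then show "n \<in> ker_of (act q f)" using n unfolding ker_of_def by blast
qed

lemma ker_of_feq: assumes "feq f g" shows "ker_of f = ker_of g"
proof -
  have "int p dvd (Dl ^^ k) f n \<longleftrightarrow> int p dvd (Dl ^^ k) g n" if "n \<in> N" for k n
    using feq_Dl[OF assms, of k] that unfolding feq_def vanish_def by (metis dvd_diff_commute zdvd_zdiffD)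
  then show ?thesis unfolding ker_of_def by blast
qed

lemma unit_act_X:
  assumes f: "f \<in> Xs l" and l: "l \<ge> 1" and q: "\<not> int p dvd poly.coeff q 0"
  shows "nrm (act q f) \<in> Xs l" "ker_of (nrm (act q f)) = ker_of f"
proof -
  have f0: "f \<in> J0 l" using f unfolding Xs_def by auto
  note F = J0_D[OF f0]
  have "(Dl ^^ l) (act q f) = act (monom 1 l * q) f" by (simp add: act_mult act_monom)
  moreover have "low_zero p l (monom 1 l * q)" by (simp add: low_zero_mult low_zero_monom mult.commute)
  ultimately have v: "vanish ((Dl ^^ l) (act q f))" using act_low_zero[OF F(2)] by simp
  have j: "nrm (act q f) \<in> J0 l"
    by (rule nrm_J0[OF smooth_hom_act[OF F(1)] v act_tau_p(2)[where f = f and q = q, OF F(3)]])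
  have "\<not> vanish ((Dl ^^ (l - 1)) (nrm (act q f)))"
  proof
    assume "vanish ((Dl ^^ (l - 1)) (nrm (act q f)))"
    then have "vanish ((Dl ^^ (l - 1)) (act q f))" using feq_vanish[OF feq_Dl[OF feq_nrm]] by blast
    moreover have "(Dl ^^ (l - 1)) (act q f) = act (monom 1 (l - 1) * q) f" by (simp add: act_mult act_monom)
    ultimately have "low_zero p l (monom 1 (l - 1) * q)" using X_annihilator[OF f l] by simp
    then have "int p dvd poly.coeff (monom 1 (l - 1) * q) (l - 1)" using l unfolding low_zero_def by simp
    then show False using q by (simp add: coeff_monom_mult)
  qed
  then show "nrm (act q f) \<in> Xs l" using j unfolding Xs_def by simp
  obtain v where v: "low_zero p l (q * v - 1)" using unit_inverse[OF prime_p q] by blast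
  then have "feq (act (v * q) f) (act 1 f)" using feq_act_low_zero[OF F(2), of "v * q" 1] by (simp add: mult.commute)
  then have "ker_of (act v (act q f)) = ker_of f" using ker_of_feq by (simp add: act_mult)
  then have "ker_of (act q f) \<subseteq> ker_of f" using ker_of_act_subset[of "act q f" v] by simp
  then have "ker_of (act q f) = ker_of f" using ker_of_act_subset by blast
  then show "ker_of (nrm (act q f)) = ker_of f" using ker_of_feq[OF feq_nrm] by simp
qed

text \<open>Let \<open>lam f l\<close> take the value \<open>1\<close> at \<open>n\<^sub>0\<close>. Modulo the common kernel, each \<open>n\<close> is the multiple of \<open>n\<^sub>0\<close>
  by the polynomial \<open>lam f l n\<close>. Hence \<open>lam f' l n\<close> is \<open>lam f l n\<close> times \<open>q = lam f' l n\<^sub>0\<close>.\<close>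

lemma same_kernel_unit:
  assumes f: "f \<in> Xs l" and f': "f' \<in> Xs l" and l: "l \<ge> 1" and e: "ker_of f' = ker_of f"
  shows "\<exists>q. feq f' (act q f)"
proof -
  have f0: "f \<in> J0 l" "f' \<in> J0 l" using f f' unfolding Xs_def by auto
  note F = J0_D[OF f0(1)] and F' = J0_D[OF f0(2)]
  obtain n0 where n0: "n0 \<in> N" "low_zero p l (lam f l n0 - 1)" using X_unit_element[OF f l] by blast
  define q where "q = lam f' l n0"
  have "int p dvd f' n - act q f n" if n: "n \<in> N" for n
  proof -
    define r where "r = lam f l n"
    obtain m where m: "m \<in> N" "low_zero p l (lam f l m - r * lam f l n0)" "low_zero p l (lam f' l m - r * lam f' l n0)"
      using lam_poly_multiple[OF n0(1), of r] F F' by blast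
    have "low_zero p l (r * (lam f l n0 - 1))" by (rule low_zero_mult[OF n0(2)])
    then have "low_zero p l (r * lam f l n0 - r)" by (simp add: algebra_simps)
    then have mn: "low_zero p l (lam f l m - lam f l n)" using low_zero_trans[OF m(2)] unfolding r_def by blast
    have nm: "n \<otimes> inv m \<in> N" using n m N_mult N_inv by blast
    have diff: "low_zero p l (lam g l (n \<otimes> inv m) - (lam g l n - lam g l m))" if g: "smooth_hom g" for g
    proof -
      have "low_zero p l ((lam g l (n \<otimes> inv m) - (lam g l n + lam g l (inv m))) + (lam g l (inv m) + lam g l m))"
        by (intro low_zero_add lam_mult[OF g n N_inv[OF m(1)]] lam_inv[OF g m(1)])
      then show ?thesis by (simp add: algebra_simps)
    qed
    have "low_zero p l (lam f l (n \<otimes> inv m))"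
      using low_zero_add[OF diff[OF F(1)] low_zero_minus[OF mn]] by simp
    then have "n \<otimes> inv m \<in> ker_of f" using lam_zero_iff[OF F(2) nm] nm unfolding ker_of_def by blast
    then have "low_zero p l (lam f' l (n \<otimes> inv m))" 
      using lam_zero_iff[OF F'(2) nm] e unfolding ker_of_def by blast
    then have "low_zero p l (lam f' l n - lam f' l m)" using low_zero_diff[OF _ diff[OF F'(1)]] by fastforce
    then have "low_zero p l (lam f' l n - r * q)" using low_zero_trans m(3) unfolding q_def by blast
    then have "int p dvd poly.coeff (lam f' l n) (l - 1) - poly.coeff (r * q) (l - 1)"
      using l unfolding low_zero_def by simp
    then have 1: "int p dvd f' n - poly.coeff (q * lam f l n) (l - 1)"
      using l by (simp add: coeff_lam r_def mult.commute)
    have "int p dvd (f' n - poly.coeff (q * lam f l n) (l - 1)) - (act q f n - poly.coeff (q * lam f l n) (l - 1))"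
      using 1 act_lam[OF F(2) l n, of q] by (rule dvd_diff)
    then show ?thesis by simp
  qed
  then show ?thesis unfolding feq_def vanish_def by blast
qed

text \<open>Together with \<open>X_annihilator\<close>: the units of \<open>A\<^sub>l\<close> act simply transitively on the characters
  with a given kernel.\<close>

lemma fibre_bij:
  assumes f: "f \<in> Xs l" and l: "l \<ge> 1"
  shows "bij_betw (\<lambda>q. nrm (act q f)) (unit_reps p l) {f' \<in> Xs l. ker_of f' = ker_of f}"
proof (rule bij_betwI')
  have f0: "f \<in> J0 l" using f unfolding Xs_def by auto
  note F = J0_D[OF f0]
  {
    fix q assume q: "q \<in> unit_reps p l"
    have "poly.coeff q 0 \<in> {0..<int p}" "poly.coeff q 0 \<noteq> 0" using q l unfolding unit_reps_def by auto
    then have "\<not> int p dvd poly.coeff q 0" using zdvd_not_zless[of "poly.coeff q 0" "int p"] by simp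
    then show "nrm (act q f) \<in> {f' \<in> Xs l. ker_of f' = ker_of f}" using unit_act_X[OF f l] by blast
  next
    fix q r assume q: "q \<in> unit_reps p l" and r: "r \<in> unit_reps p l"
    show "(nrm (act q f) = nrm (act r f)) = (q = r)"
    proof
      assume "nrm (act q f) = nrm (act r f)"
      then have "feq (act q f) (act r f)" using feq_nrm[of "act q f"] feq_sym[OF feq_nrm[of "act r f"]] feq_trans by metis
      then have "low_zero p l (q - r)" using X_annihilator[OF f l, of "q - r"] unfolding feq_def act_diff by blast
      then have "poly.coeff q k mod int p = poly.coeff r k mod int p" if "k < l" for k
        using that unfolding low_zero_def by (simp add: mod_eq_dvd_iff)
      then have "poly.coeff q k = poly.coeff r k" for k
        using q r unfolding unit_reps_def by (cases "k < l") auto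
      then show "q = r" by (simp add: poly_eq_iff)
    qed simp
  next
    fix f' assume f': "f' \<in> {f' \<in> Xs l. ker_of f' = ker_of f}"
    then obtain q where q: "feq f' (act q f)" using same_kernel_unit[OF f _ l] by blast
    obtain r where r: "\<forall>k<l. poly.coeff r k \<in> {0..<int p}" "\<forall>k\<ge>l. poly.coeff r k = 0" "low_zero p l (q - r)"
      using exists_rep[OF p_pos(1)] by blast
    have e: "feq f' (act r f)" using q feq_act_low_zero[OF F(2) r(3)] feq_trans by blast
    have "poly.coeff r 0 \<noteq> 0"
    proof
      assume "poly.coeff r 0 = 0"
      then have "low_zero p l (monom 1 (l - 1) * r)" using l unfolding low_zero_def by (auto simp: coeff_monom_mult)
      then have "vanish (act (monom 1 (l - 1) * r) f)" by (rule act_low_zero[OF F(2)])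
      then have "vanish ((Dl ^^ (l - 1)) (act r f))" by (simp add: act_mult act_monom)
      then have "vanish ((Dl ^^ (l - 1)) f')" using feq_vanish[OF feq_Dl[OF e]] by blast
      then show False using f' unfolding Xs_def by blast
    qed
    then have rr: "r \<in> unit_reps p l" using r unfolding unit_reps_def by blast
    have "f' = nrm (act r f)"
    proof (rule J_eqI)
      show "f' \<in> J" using f' unfolding Xs_def J0_def by blast
      show "nrm (act r f) \<in> J" by (rule nrm_J[OF smooth_hom_act[OF F(1)]])
      show "feq f' (nrm (act r f))" using e feq_nrm feq_trans by blast
    qed
    then show "\<exists>q\<in>unit_reps p l. f' = nrm (act q f)" using rr by blast
  }
qed

end

section \<open>Quotients onto the semidirect product\<close>

text \<open>A presentation of \<open>A\<^sub>l \<rtimes> \<int>/p\<close> by integer polynomials, where \<open>\<sigma>\<close> acts as \<open>1 + T\<close>.\<close>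

locale truncated_semidirect =
  fixes p l :: nat and P :: "('v \<times> int, 'w) monoid_scheme" and \<psi> :: "int poly \<Rightarrow> 'v"
  assumes P_group: "group P"
    and psi_eq: "\<psi> q = \<psi> r \<longleftrightarrow> low_zero p l (q - r)"
    and P_carrier: "carrier P = range \<psi> \<times> {0..<int p}"
    and P_mult: "i \<in> {0..<int p} \<Longrightarrow> j \<in> {0..<int p} \<Longrightarrow>
        (\<psi> q, i) \<otimes>\<^bsub>P\<^esub> (\<psi> r, j) = (\<psi> (q + [:1, 1:] ^ nat i * r), (i + j) mod int p)"
    and P_one: "\<one>\<^bsub>P\<^esub> = (\<psi> 0, 0)"

context cyclic_quotient
begin

text \<open>Kernels of smooth surjections onto \<open>P\<close> over \<open>\<int>/p\<close>. These correspond to the solution fields.\<close>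

definition quotients :: "('v \<times> int, 'w) monoid_scheme \<Rightarrow> 'g set set" where
  "quotients P = {U. \<exists>\<Phi>. \<Phi> \<in> hom G P \<and> \<Phi> ` carrier G = carrier P \<and> (\<forall>g\<in>carrier G. snd (\<Phi> g) = c g) \<and>
      U = {g \<in> carrier G. \<Phi> g = \<one>\<^bsub>P\<^esub>} \<and> (\<exists>V\<in>\<U>. V \<subseteq> U)}"

text \<open>Decomposition \<open>g = n \<tau>\<^sup>j\<close> with \<open>n \<in> N\<close> and \<open>0 \<le> j < p\<close>.\<close>

definition npart where "npart g = g \<otimes> inv (\<tau> [^] nat (c g))"

lemma npart:
  assumes "g \<in> carrier G" shows "npart g \<in> N" "g = npart g \<otimes> \<tau> [^] nat (c g)"
proof -
  note r = c_range[OF assms]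
  have e: "c (\<tau> [^] nat (c g)) = c g" using c_tau_pow[of "nat (c g)"] r by simp
  have "c (g \<otimes> inv (\<tau> [^] nat (c g))) = 0"
    using c_mult[of g "inv (\<tau> [^] nat (c g))"] c_inv[of "\<tau> [^] nat (c g)"] assms tau unfolding e by (simp add: mod_add_right_eq)
  then show "npart g \<in> N" unfolding npart_def N_def using assms tau by simp
  show "g = npart g \<otimes> \<tau> [^] nat (c g)" unfolding npart_def using assms tau by (simp add: m_assoc)
qed

lemma npart_N: "n \<in> N \<Longrightarrow> npart n = n" unfolding npart_def N_def by simp

lemma npart_eqI:
  assumes n: "n \<in> N" and g: "g = n \<otimes> \<tau> [^] k" "k < p" shows "npart g = n" "c g = int k"
proof -
  have nc: "n \<in> carrier G" "c n = 0" using n unfolding N_def by auto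
  show cg: "c g = int k" unfolding g(1) using nc tau g(2) by (simp add: c_mult c_tau_pow)
  show "npart g = n" unfolding npart_def cg unfolding g(1) using nc tau by (simp add: m_assoc)
qed

text \<open>The factor \<open>\<tau>\<^sup>p\<close> is the carry when the exponents of \<open>\<tau>\<close> add up to at least \<open>p\<close>.\<close>

lemma npart_mult:
  assumes g: "g \<in> carrier G" and h: "h \<in> carrier G"
  shows "\<exists>e\<in>{\<one>, \<tau> [^] p}. npart (g \<otimes> h) = npart g \<otimes> (conj ^^ nat (c g)) (npart h) \<otimes> e"
proof -
  define i j where "i = nat (c g)" and "j = nat (c h)"
  have ij: "i < p" "j < p" using c_range[OF g] c_range[OF h] unfolding i_def j_def by auto
  note G = npart[OF g, folded i_def] and H = npart[OF h, folded j_def]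
  define m where "m = npart g \<otimes> (conj ^^ i) (npart h)"
  have cN: "(conj ^^ i) (npart h) \<in> N" by (rule conj_pow_N[OF H(1)])
  have m: "m \<in> N" unfolding m_def using N_mult[OF G(1) cN] .
  note car = N_carrier[OF G(1)] N_carrier[OF H(1)] N_carrier[OF cN] N_carrier[OF m]
  have "g \<otimes> h = npart g \<otimes> (\<tau> [^] i \<otimes> npart h) \<otimes> \<tau> [^] j"
    using car tau by (subst G(2), subst H(2)) (simp add: m_assoc)
  also have "\<dots> = npart g \<otimes> ((conj ^^ i) (npart h) \<otimes> \<tau> [^] i) \<otimes> \<tau> [^] j"
    using tau_pow_conj[OF car(2)] by simp
  also have "\<dots> = m \<otimes> \<tau> [^] (i + j)"
    unfolding m_def using car tau by (simp add: m_assoc nat_pow_mult)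
  finally have gh: "g \<otimes> h = m \<otimes> \<tau> [^] (i + j)" .
  show ?thesis
  proof (cases "i + j < p")
    case True
    then have "npart (g \<otimes> h) = m" using npart_eqI(1)[OF m gh] by blast
    then show ?thesis using car unfolding m_def i_def by simp
  next
    case False
    then have "i + j = p + (i + j - p)" by simp
    then have "\<tau> [^] (i + j) = \<tau> [^] p \<otimes> \<tau> [^] (i + j - p)" using tau by (metis nat_pow_mult)
    then have "g \<otimes> h = (m \<otimes> \<tau> [^] p) \<otimes> \<tau> [^] (i + j - p)" using gh car tau by (simp add: m_assoc)
    moreover have "m \<otimes> \<tau> [^] p \<in> N" using N_mult[OF m tau_p_N] .
    ultimately have "npart (g \<otimes> h) = m \<otimes> \<tau> [^] p" using npart_eqI(1)[of "m \<otimes> \<tau> [^] p"] ij by simp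
    then show ?thesis unfolding m_def i_def by simp
  qed
qed

lemma lam_npart_mult:
  assumes f: "smooth_hom f" "vanish ((Dl ^^ l) f)" "int p dvd f (\<tau> [^] p)"
    and g: "g \<in> carrier G" and h: "h \<in> carrier G"
  shows "low_zero p l (lam f l (npart (g \<otimes> h)) - (lam f l (npart g) + [:1, 1:] ^ nat (c g) * lam f l (npart h)))"
proof -
  obtain e where e: "e \<in> {\<one>, \<tau> [^] p}" "npart (g \<otimes> h) = npart g \<otimes> (conj ^^ nat (c g)) (npart h) \<otimes> e"
    using npart_mult[OF g h] by blast
  have eN: "e \<in> N" using e(1) N_one tau_p_N by auto
  have e0: "low_zero p l (lam f l e)"
  proof (cases "e = \<one>")
    case True then show ?thesis using lam_one[OF f(1)] by simp
  next
    case False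
    then have "e = \<tau> [^] p" using e(1) by blast
    then show ?thesis using act_tau_p(1)[of f, OF f(3)] by (simp add: low_zero_def coeff_lam)
  qed
  note gN = npart(1)[OF g] and hN = npart(1)[OF h]
  note cN = conj_pow_N[OF hN, of "nat (c g)"]
  let ?b = "(conj ^^ nat (c g)) (npart h)"
  have "low_zero p l ((lam f l (npart g \<otimes> ?b \<otimes> e) - (lam f l (npart g \<otimes> ?b) + lam f l e)) + lam f l e
     + (lam f l (npart g \<otimes> ?b) - (lam f l (npart g) + lam f l ?b))
     + (lam f l ?b - [:1, 1:] ^ nat (c g) * lam f l (npart h)))"
    by (intro low_zero_add lam_mult[OF f(1)] e0 lam_conj_pow[OF f(2) hN] N_mult gN cN eN)
  then show ?thesis unfolding e(2) by (simp add: algebra_simps)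
qed

text \<open>\<open>n \<tau>\<^sup>j \<mapsto> (lam f l n, j)\<close> is a homomorphism because \<open>f\<close> vanishes at the carry \<open>\<tau>\<^sup>p\<close>.\<close>

lemma ker_of_quotient:
  assumes P: "truncated_semidirect p l P \<psi>" and f: "f \<in> Xs l" and l: "l \<ge> 1"
  shows "ker_of f \<in> quotients P"
proof -
  interpret P: truncated_semidirect p l P \<psi> by (rule P)
  have f0: "f \<in> J0 l" using f unfolding Xs_def by auto
  note F = J0_D[OF f0]
  define \<Phi> where "\<Phi> g = (\<psi> (lam f l (npart g)), c g)" for g
  have cr: "c g \<in> {0..<int p}" if "g \<in> carrier G" for g using c_range[OF that] by simp
  have hom: "\<Phi> \<in> hom G P"
  proof (rule homI)
    fix g assume g: "g \<in> carrier G"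
    then show "\<Phi> g \<in> carrier P" unfolding P.P_carrier \<Phi>_def using cr by simp
    fix h assume h: "h \<in> carrier G"
    have "\<psi> (lam f l (npart (g \<otimes> h))) = \<psi> (lam f l (npart g) + [:1, 1:] ^ nat (c g) * lam f l (npart h))"
      unfolding P.psi_eq by (rule lam_npart_mult[OF F(1-3) g h])
    then show "\<Phi> (g \<otimes> h) = \<Phi> g \<otimes>\<^bsub>P\<^esub> \<Phi> h"
      unfolding \<Phi>_def P.P_mult[OF cr[OF g] cr[OF h]] using c_mult[OF g h] by simp
  qed
  have surj: "\<Phi> ` carrier G = carrier P"
  proof
    show "\<Phi> ` carrier G \<subseteq> carrier P" using hom unfolding hom_def by blast
    show "carrier P \<subseteq> \<Phi> ` carrier G"
    proof
      fix x assume "x \<in> carrier P"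
      then obtain q j where x: "x = (\<psi> q, j)" "0 \<le> j" "j < int p" unfolding P.P_carrier by auto
      obtain n where n: "n \<in> N" "low_zero p l (lam f l n - q)" using X_surj[OF f l] by blast
      define g where "g = n \<otimes> \<tau> [^] nat j"
      have "npart g = n" "c g = j" using npart_eqI[OF n(1) g_def] x by auto
      then have "\<Phi> g = x" unfolding \<Phi>_def x P.psi_eq using n(2) P.psi_eq by simp
      moreover have "g \<in> carrier G" unfolding g_def using N_carrier[OF n(1)] tau by simp
      ultimately show "x \<in> \<Phi> ` carrier G" by blast
    qed
  qed
  have ker: "ker_of f = {g \<in> carrier G. \<Phi> g = \<one>\<^bsub>P\<^esub>}"
  proof -
    have "\<Phi> g = \<one>\<^bsub>P\<^esub> \<longleftrightarrow> g \<in> N \<and> (\<forall>k. int p dvd (Dl ^^ k) f g)" if g: "g \<in> carrier G" for g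
    proof (cases "g \<in> N")
      case True
      then show ?thesis using lam_zero_iff[OF F(2) True] 
        unfolding \<Phi>_def P.P_one by (simp add: npart_N P.psi_eq) (simp add: N_def)
    next
      case False
      then show ?thesis using g unfolding \<Phi>_def P.P_one N_def by simp
    qed
    then show ?thesis unfolding ker_of_def using N_carrier by blast
  qed
  have "\<exists>V\<in>\<U>. V \<subseteq> ker_of f"
  proof -
    obtain V where V: "V \<in> \<U>" "\<forall>n\<in>V. int p dvd f n" using F(1) unfolding smooth_hom_def by blast
    have "\<forall>n\<in>V. int p dvd (Dl ^^ k) f n" for k
      by (induct k) (use V conj_open[OF V(1)] in \<open>auto simp: Dl_def\<close>)
    then show ?thesis using V(1) open_N[OF V(1)] unfolding ker_of_def by blast
  qed
  moreover have "\<forall>g\<in>carrier G. snd (\<Phi> g) = c g" by (simp add: \<Phi>_def)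
  ultimately show ?thesis unfolding quotients_def using hom surj ker by blast
qed

text \<open>Conversely \<open>f\<close> is the top coefficient of the first component. In the semidirect product the
  \<open>p\<close>-th power of \<open>(a, \<sigma>)\<close> is the norm of \<open>a\<close>, and the norm element is zero on \<open>A\<^sub>l\<close> for
  \<open>l \<le> p - 1\<close>; this gives \<open>f(\<tau>\<^sup>p) = 0\<close>.\<close>

lemma quotient_ker_of:
  assumes P: "truncated_semidirect p l P \<psi>" and l: "l \<ge> 1" "l \<le> p - 1" and U: "U \<in> quotients P"
  shows "\<exists>f\<in>Xs l. ker_of f = U"
proof -
  interpret P: truncated_semidirect p l P \<psi> by (rule P)
  interpret PG: group P by (rule P.P_group)
  obtain \<Phi> V where \<Phi>: "\<Phi> \<in> hom G P" "\<Phi> ` carrier G = carrier P" "\<And>g. g \<in> carrier G \<Longrightarrow> snd (\<Phi> g) = c g"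
      "U = {g \<in> carrier G. \<Phi> g = \<one>\<^bsub>P\<^esub>}" and V: "V \<in> \<U>" "V \<subseteq> U"
    using U unfolding quotients_def by blast
  have hom: "\<Phi> (g \<otimes> h) = \<Phi> g \<otimes>\<^bsub>P\<^esub> \<Phi> h" if "g \<in> carrier G" "h \<in> carrier G" for g h
    using \<Phi>(1) that unfolding hom_def by blast
  \<comment> \<open>\<open>\<Lambda>\<close> lifts the first component to polynomials; it is a cocycle modulo \<open>p\<close> and \<open>T\<^sup>l\<close>.\<close>
  define \<Lambda> where "\<Lambda> g = (SOME q. fst (\<Phi> g) = \<psi> q)" for g
  have \<Lambda>: "\<Phi> g = (\<psi> (\<Lambda> g), c g)" if g: "g \<in> carrier G" for g
  proof -
    have "\<Phi> g \<in> carrier P" using \<Phi>(2) g by blast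
    then have "\<exists>q. fst (\<Phi> g) = \<psi> q" unfolding P.P_carrier by auto
    then have "fst (\<Phi> g) = \<psi> (\<Lambda> g)" unfolding \<Lambda>_def by (rule someI_ex)
    then show ?thesis using \<Phi>(3)[OF g] by (metis prod.collapse)
  qed
  have cr: "c g \<in> {0..<int p}" if "g \<in> carrier G" for g using c_range[OF that] by simp
  have \<Lambda>_mult: "low_zero p l (\<Lambda> (g \<otimes> h) - (\<Lambda> g + [:1, 1:] ^ nat (c g) * \<Lambda> h))" if g: "g \<in> carrier G" "h \<in> carrier G" for g h
  proof -
    have "(\<psi> (\<Lambda> (g \<otimes> h)), c (g \<otimes> h)) = (\<psi> (\<Lambda> g + [:1, 1:] ^ nat (c g) * \<Lambda> h), (c g + c h) mod int p)"
      using hom[OF g] \<Lambda> g P.P_mult[OF cr[OF g(1)] cr[OF g(2)]] by simp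
    then show ?thesis using P.psi_eq by simp
  qed
  have \<Lambda>_N: "low_zero p l (\<Lambda> (m \<otimes> n) - (\<Lambda> m + \<Lambda> n))" if "m \<in> N" "n \<in> N" for m n
    using \<Lambda>_mult[of m n] that unfolding N_def by simp
  have \<Lambda>_conj: "low_zero p l (\<Lambda> (conj n) - [:1, 1:] * \<Lambda> n)" if n: "n \<in> N" for n
  proof -
    have nc: "n \<in> carrier G" "c n = 0" using n unfolding N_def by auto
    have cc: "conj n \<in> carrier G" "c (conj n) = 0" using conj_N[OF n] unfolding N_def by auto
    have e: "conj n \<otimes> \<tau> = \<tau> \<otimes> n" unfolding conj_def using nc tau by (simp add: m_assoc)
    have 1: "low_zero p l (\<Lambda> (\<tau> \<otimes> n) - (\<Lambda> \<tau> + [:1, 1:] * \<Lambda> n))" using \<Lambda>_mult[OF tau(1) nc(1)] tau by simp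
    have 2: "low_zero p l (\<Lambda> (\<tau> \<otimes> n) - (\<Lambda> (conj n) + \<Lambda> \<tau>))" using \<Lambda>_mult[OF cc(1) tau(1)] cc e by simp
    have "low_zero p l (v - u)" if "low_zero p l (a - (b + u))" "low_zero p l (a - (v + b))" for a b u v
      using low_zero_diff[OF that] by (simp add: algebra_simps)
    then show ?thesis using 1 2 by blast
  qed
  define f where "f = restrict (\<lambda>n. poly.coeff (\<Lambda> n) (l - 1) mod int p) N"
  have fN: "int p dvd f n - poly.coeff (\<Lambda> n) (l - 1)" if "n \<in> N" for n
    using that unfolding f_def by (simp add: mod_eq_dvd_iff[symmetric])
  have Dk: "int p dvd (Dl ^^ k) f n - poly.coeff (monom 1 k * \<Lambda> n) (l - 1)" if "n \<in> N" for k n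
    using that
  proof (induct k arbitrary: n)
    case 0
    then show ?case using fN by simp
  next
    case (Suc k)
    have 1: "int p dvd (Dl ^^ k) f (conj n) - poly.coeff (monom 1 k * \<Lambda> (conj n)) (l - 1)" using Suc conj_N by blast
    have 2: "int p dvd (Dl ^^ k) f n - poly.coeff (monom 1 k * \<Lambda> n) (l - 1)" using Suc by blast
    have "low_zero p l (monom 1 k * (\<Lambda> (conj n) - [:1, 1:] * \<Lambda> n))" by (rule low_zero_mult[OF \<Lambda>_conj[OF Suc(2)]])
    then have 3: "int p dvd poly.coeff (monom 1 k * (\<Lambda> (conj n) - [:1, 1:] * \<Lambda> n)) (l - 1)" 
      using l(1) unfolding low_zero_def by simp
    have "monom 1 (Suc k) * \<Lambda> n = monom 1 k * \<Lambda> (conj n) - monom 1 k * \<Lambda> n - monom 1 k * (\<Lambda> (conj n) - [:1, 1:] * \<Lambda> n)"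
    proof -
      define T where "T = [:0, 1 :: int:]"
      have "[:1, 1 :: int:] = 1 + T" "monom 1 (Suc k) = T * monom 1 k" by (simp_all add: T_def one_pCons monom_Suc)
      then show ?thesis by (simp add: algebra_simps)
    qed
    then have "(Dl ^^ Suc k) f n - poly.coeff (monom 1 (Suc k) * \<Lambda> n) (l - 1)
      = ((Dl ^^ k) f (conj n) - poly.coeff (monom 1 k * \<Lambda> (conj n)) (l - 1))
       - ((Dl ^^ k) f n - poly.coeff (monom 1 k * \<Lambda> n) (l - 1)) + poly.coeff (monom 1 k * (\<Lambda> (conj n) - [:1, 1:] * \<Lambda> n)) (l - 1)"
      by (simp only: coeff_diff) (simp add: Dl_def)
    then show ?case using 1 2 3 by (metis dvd_add dvd_diff)
  qed
  have Dk': "int p dvd (Dl ^^ k) f n - (if k < l then poly.coeff (\<Lambda> n) (l - 1 - k) else 0)" if "n \<in> N" for k n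
  proof -
    have "l - 1 < k \<longleftrightarrow> \<not> k < l" using l(1) by auto
    then show ?thesis using Dk[OF that, of k] by (cases "k < l") (simp_all add: coeff_monom_mult)
  qed
  have Dk_iff: "low_zero p l (\<Lambda> n) \<longleftrightarrow> (\<forall>k. int p dvd (Dl ^^ k) f n)" if n: "n \<in> N" for n
  proof
    assume z: "low_zero p l (\<Lambda> n)"
    show "\<forall>k. int p dvd (Dl ^^ k) f n"
    proof
      fix k
      have "int p dvd (if k < l then poly.coeff (\<Lambda> n) (l - 1 - k) else 0)" using z unfolding low_zero_def by simp
      then show "int p dvd (Dl ^^ k) f n" using Dk'[OF n, of k] by (metis zdvd_zdiffD)
    qed
  next
    assume z: "\<forall>k. int p dvd (Dl ^^ k) f n"
    have "int p dvd poly.coeff (\<Lambda> n) j" if "j < l" for j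
    proof -
      have "int p dvd (Dl ^^ (l - 1 - j)) f n - poly.coeff (\<Lambda> n) j" using Dk'[OF n, of "l - 1 - j"] that by simp
      then show ?thesis using z by (metis dvd_diff_commute zdvd_zdiffD)
    qed
    then show "low_zero p l (\<Lambda> n)" unfolding low_zero_def by blast
  qed
  have U_iff: "g \<in> U \<longleftrightarrow> g \<in> N \<and> low_zero p l (\<Lambda> g)" for g
    unfolding \<Phi>(4) N_def using \<Lambda> P.P_one P.psi_eq[of "\<Lambda> g" 0] by auto
  have U_ker: "ker_of f = U"
    unfolding ker_of_def using U_iff Dk_iff by blast
  have smooth: "smooth_hom f"
    unfolding smooth_hom_def
  proof (intro conjI ballI bexI[OF _ V(1)])
    fix m n assume mn: "m \<in> N" "n \<in> N"
    have 1: "int p dvd poly.coeff (\<Lambda> (m \<otimes> n)) (l - 1) - (poly.coeff (\<Lambda> m) (l - 1) + poly.coeff (\<Lambda> n) (l - 1))"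
      using \<Lambda>_N[OF mn] l(1) unfolding low_zero_def by simp
    have "int p dvd (f (m \<otimes> n) - poly.coeff (\<Lambda> (m \<otimes> n)) (l - 1))
       + (poly.coeff (\<Lambda> (m \<otimes> n)) (l - 1) - (poly.coeff (\<Lambda> m) (l - 1) + poly.coeff (\<Lambda> n) (l - 1)))
       - (f m - poly.coeff (\<Lambda> m) (l - 1)) - (f n - poly.coeff (\<Lambda> n) (l - 1))"
      by (intro dvd_add dvd_diff 1 fN mn N_mult)
    then show "int p dvd f (m \<otimes> n) - (f m + f n)" by (simp add: algebra_simps)
  next
    fix n assume "n \<in> V"
    then have "n \<in> ker_of f" using V(2) U_ker by blast
    then show "int p dvd f n" unfolding ker_of_def by (metis (mono_tags, lifting) funpow_0 mem_Collect_eq)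
  qed
  have fJ: "f \<in> J" unfolding J_def using smooth p_pos by (auto simp: f_def)
  have "vanish ((Dl ^^ l) f)" using Dk'[of _ l] unfolding vanish_def by simp
  moreover have "int p dvd f (\<tau> [^] p)"
  proof -
    \<comment> \<open>\<open>(a, \<sigma>)\<^sup>k = ((1 + \<sigma> + \<dots> + \<sigma>\<^sup>k\<^sup>-\<^sup>1) a, \<sigma>\<^sup>k)\<close>\<close>
    have tk: "low_zero p l (\<Lambda> (\<tau> [^] k) - (\<Sum>i<k. [:1, 1:] ^ i) * \<Lambda> \<tau>)" if "k \<le> p" for k
      using that
    proof (induct k)
      case 0
      have "low_zero p l (\<Lambda> (\<one> \<otimes> \<one>) - (\<Lambda> \<one> + \<Lambda> \<one>))" by (rule \<Lambda>_N[OF N_one N_one])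
      then show ?case using low_zero_minus by fastforce
    next
      case (Suc k)
      then have "k < p" "low_zero p l (\<Lambda> (\<tau> [^] k) - (\<Sum>i<k. [:1, 1:] ^ i) * \<Lambda> \<tau>)" by auto
      moreover have "c (\<tau> [^] k) = int k" using \<open>k < p\<close> by (simp add: c_tau_pow)
      then have "low_zero p l (\<Lambda> (\<tau> [^] k \<otimes> \<tau>) - (\<Lambda> (\<tau> [^] k) + [:1, 1:] ^ k * \<Lambda> \<tau>))"
        using \<Lambda>_mult[of "\<tau> [^] k" \<tau>] tau by simp
      ultimately have "low_zero p l ((\<Lambda> (\<tau> [^] k) - (\<Sum>i<k. [:1, 1:] ^ i) * \<Lambda> \<tau>) 
        + (\<Lambda> (\<tau> [^] k \<otimes> \<tau>) - (\<Lambda> (\<tau> [^] k) + [:1, 1:] ^ k * \<Lambda> \<tau>)))" using low_zero_add by blast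
      then show ?case by (simp add: algebra_simps)
    qed
    have "low_zero p l (\<Lambda> \<tau> * (\<Sum>i<p. [:1, 1:] ^ i))"
      by (rule low_zero_mult[OF norm_poly_low_zero[OF prime_p l(2)]])
    then have "low_zero p l (\<Lambda> (\<tau> [^] p))" using low_zero_add[OF tk[of p]] by (fastforce simp: mult.commute)
    then show ?thesis using Dk_iff[OF tau_p_N] by (metis funpow_0)
  qed
  moreover have "\<not> vanish ((Dl ^^ (l - 1)) f)"
  proof
    assume v: "vanish ((Dl ^^ (l - 1)) f)"
    have "(\<psi> 1, 0) \<in> \<Phi> ` carrier G" unfolding \<Phi>(2) P.P_carrier using p_pos by simp
    then obtain g where g: "g \<in> carrier G" "\<Phi> g = (\<psi> 1, 0)" by auto
    then have gN: "g \<in> N" and e: "\<psi> (\<Lambda> g) = \<psi> 1" using \<Lambda>[OF g(1)] unfolding N_def by auto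
    then have "int p dvd poly.coeff (\<Lambda> g - 1) 0" using P.psi_eq l(1) unfolding low_zero_def by auto
    moreover have "int p dvd (Dl ^^ (l - 1)) f g - poly.coeff (\<Lambda> g) 0" using Dk'[OF gN, of "l - 1"] l(1) by simp
    then have "int p dvd poly.coeff (\<Lambda> g) 0" using v gN unfolding vanish_def by (metis dvd_diff_commute zdvd_zdiffD)
    ultimately have "int p dvd 1" by (metis coeff_diff dvd_diff_commute zdvd_zdiffD lead_coeff_1 degree_1)
    then show False using p_pos by simp
  qed
  ultimately have "f \<in> Xs l" unfolding Xs_def J0_def using fJ by blast
  then show ?thesis using U_ker by blast
qed

text \<open>The fibres of \<open>f \<mapsto> ker_of f\<close> are torsors under the units of \<open>A\<^sub>l\<close>.\<close>

theorem ecard_Xs: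
  assumes P: "truncated_semidirect p l P \<psi>" and l: "l \<ge> 1" "l \<le> p - 1"
  shows "ecard (Xs l) = ecard (quotients P) * of_nat (p ^ (l - 1) * (p - 1))"
proof -
  have "ecard (Xs l) = ecard (quotients P) * ecard (unit_reps p l)"
  proof (rule ecard_fibration)
    show "ker_of ` Xs l = quotients P"
      using ker_of_quotient[OF P _ l(1)] quotient_ker_of[OF P l] by blast
    fix U assume "U \<in> quotients P"
    then obtain f where "f \<in> Xs l" "ker_of f = U" using quotient_ker_of[OF P l] by blast
    then show "\<exists>h. bij_betw h (unit_reps p l) {f \<in> Xs l. ker_of f = U}" using fibre_bij[OF _ l(1)] by blast
  qed
  then show ?thesis using card_unit_reps[OF p_pos(1) l(1)] unfolding ecard_def[of "unit_reps p l"] by simp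
qed

section \<open>Counting along the filtration\<close>

lemma nrm_cong: "feq f g \<Longrightarrow> nrm f = nrm g"
  unfolding feq_def vanish_def nrm_def by (auto simp: mod_eq_dvd_iff)

lemma nrm_zero_iff: "nrm f = nrm (\<lambda>n. 0) \<longleftrightarrow> vanish f"
  unfolding nrm_def vanish_def by (auto simp: fun_eq_iff restrict_def mod_eq_0_iff_dvd split: if_splits)

lemma nrm_idem: "f \<in> J \<Longrightarrow> nrm f = f"
  using J_eqI[OF nrm_J[OF J_smooth] _ feq_sym[OF feq_nrm]] by blast

definition Wset where "Wset = (\<lambda>f. nrm (Dl f)) ` J0 2"

context
  assumes key: "\<And>f. smooth_hom f \<Longrightarrow> vanish ((Dl ^^ 2) f) \<Longrightarrow> int p dvd f (\<tau> [^] p) \<Longrightarrow>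
    \<exists>g. smooth_hom g \<and> vanish (\<lambda>n. (\<Sum>i<p. g ((conj ^^ i) n)) - Dl f n)"
begin

text \<open>For \<open>f \<in> J0 2\<close> let \<open>g\<close> have norm \<open>D f\<close>, that is \<open>D\<^sup>p\<^sup>-\<^sup>1 g = D f\<close>. Then \<open>D\<^sup>p\<^sup>-\<^sup>i g\<close> is the
  required preimage. It vanishes at \<open>\<tau>\<^sup>p\<close> because it is in the image of \<open>D\<close> for \<open>i < p\<close>
  and \<open>\<tau>\<^sup>p\<close> commutes with \<open>\<tau>\<close>.\<close>

lemma top_power_image:
  assumes i: "2 \<le> i" "i \<le> p - 1"
  shows "(\<lambda>f. nrm ((Dl ^^ (i - 1)) f)) ` J0 i = Wset"
proof
  show "(\<lambda>f. nrm ((Dl ^^ (i - 1)) f)) ` J0 i \<subseteq> Wset"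
  proof clarify
    fix f assume f: "f \<in> J0 i"
    note F = J0_D[OF f]
    define g where "g = (Dl ^^ (i - 2)) f"
    have e: "(Dl ^^ 2) g = (Dl ^^ i) f" "Dl g = (Dl ^^ (i - 1)) f"
    proof -
      have "(Dl ^^ 2) g = (Dl ^^ (2 + (i - 2))) f" unfolding g_def by (simp only: funpow_add comp_apply)
      moreover have "2 + (i - 2) = i" using i by simp
      ultimately show "(Dl ^^ 2) g = (Dl ^^ i) f" by metis
      have "Dl g = (Dl ^^ Suc (i - 2)) f" unfolding g_def by simp
      moreover have "Suc (i - 2) = i - 1" using i by simp
      ultimately show "Dl g = (Dl ^^ (i - 1)) f" by metis
    qed
    have "nrm g \<in> J0 2"
    proof (rule nrm_J0)
      show "smooth_hom g" unfolding g_def by (rule smooth_hom_Dl_pow[OF F(1)])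
      show "vanish ((Dl ^^ 2) g)" unfolding e by (rule F(2))
      show "int p dvd g (\<tau> [^] p)" unfolding g_def by (rule act_tau_p(1)[of f, OF F(3)])
    qed
    moreover have "nrm (Dl (nrm g)) = nrm ((Dl ^^ (i - 1)) f)"
      using nrm_cong[OF feq_Dl[OF feq_sym[OF feq_nrm[of g]], of 1]] e(2) by simp
    ultimately show "nrm ((Dl ^^ (i - 1)) f) \<in> Wset" unfolding Wset_def by (metis image_eqI)
  qed
  show "Wset \<subseteq> (\<lambda>f. nrm ((Dl ^^ (i - 1)) f)) ` J0 i"
  proof
    fix w assume "w \<in> Wset"
    then obtain f where f: "f \<in> J0 2" "w = nrm (Dl f)" unfolding Wset_def by blast
    note F = J0_D[OF f(1)]
    obtain g where g: "smooth_hom g" "vanish (\<lambda>n. (\<Sum>i<p. g ((conj ^^ i) n)) - Dl f n)" using key[OF F(1-3)] by blast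
    have s: "(\<lambda>n. \<Sum>i<p. g ((conj ^^ i) n)) = act (\<Sum>i<p. [:1, 1:] ^ i) g"
      unfolding act_sum by (simp only: act_conj_pow)
    obtain r where r: "(\<Sum>i<p. [:1, 1:] ^ i) = monom 1 (p - 1) + smult (int p) (r :: int poly)" 
      using norm_poly[OF prime_p] by blast
    have "act (\<Sum>i<p. [:1, 1:] ^ i) g = (\<lambda>n. (Dl ^^ (p - 1)) g n + int p * act r g n)"
      unfolding r by (simp add: act_add act_smult act_monom)
    then have "feq (act (\<Sum>i<p. [:1, 1:] ^ i) g) ((Dl ^^ (p - 1)) g)" unfolding feq_def vanish_def by simp
    moreover have "feq (act (\<Sum>i<p. [:1, 1:] ^ i) g) (Dl f)" using g(2) unfolding feq_def s[symmetric] .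
    ultimately have e: "feq ((Dl ^^ (p - 1)) g) (Dl f)" using feq_sym feq_trans by blast
    define h where "h = (Dl ^^ (p - i)) g"
    have "(Dl ^^ i) h = (Dl ^^ (i + (p - i))) g" unfolding h_def by (simp only: funpow_add comp_apply)
    also have "i + (p - i) = 1 + (p - 1)" using i by simp
    finally have hi: "(Dl ^^ i) h = Dl ((Dl ^^ (p - 1)) g)" by simp
    have "(Dl ^^ (i - 1)) h = (Dl ^^ (i - 1 + (p - i))) g" unfolding h_def by (simp only: funpow_add comp_apply)
    also have "i - 1 + (p - i) = p - 1" using i by simp
    finally have hi1: "(Dl ^^ (i - 1)) h = (Dl ^^ (p - 1)) g" .
    have "p - i = Suc (p - i - 1)" using i by simp
    then have "h = Dl ((Dl ^^ (p - i - 1)) g)" unfolding h_def by (metis comp_apply funpow.simps(2))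
    then have "h (\<tau> [^] p) = 0" unfolding Dl_def by (simp add: conj_tau_p)
    then have h0: "int p dvd h (\<tau> [^] p)" by simp
    have "vanish (Dl (Dl f))" using F(2) by (simp add: numeral_2_eq_2)
    then have "vanish ((Dl ^^ i) h)" unfolding hi using feq_vanish[OF feq_Dl[OF e, of 1]] by simp
    moreover have "smooth_hom h" unfolding h_def by (rule smooth_hom_Dl_pow[OF g(1)])
    ultimately have "nrm h \<in> J0 i" using h0 nrm_J0[of h i] by blast
    moreover have "nrm ((Dl ^^ (i - 1)) (nrm h)) = w"
      using nrm_cong[OF feq_Dl[OF feq_sym[OF feq_nrm[of h]], of "i - 1"]] nrm_cong[OF e] f(2) hi1 by simp
    ultimately show "w \<in> (\<lambda>f. nrm ((Dl ^^ (i - 1)) f)) ` J0 i" by blast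
  qed
qed

lemma top_power_fibre:
  assumes i: "2 \<le> i" and a: "a \<in> J0 i"
  shows "bij_betw (\<lambda>k. nrm (\<lambda>n. k n + a n)) (J0 (i - 1)) {f \<in> J0 i. nrm ((Dl ^^ (i - 1)) f) = nrm ((Dl ^^ (i - 1)) a)}"
proof (rule bij_betwI')
  note A = J0_D[OF a]
  have lin: "(Dl ^^ m) (\<lambda>n. k n + a n) = (\<lambda>n. (Dl ^^ m) k n + (Dl ^^ m) a n)" for m k
    using Dl_linear[of m 1 k 1 a] by simp
  have lin': "(Dl ^^ m) (\<lambda>n. k n - a n) = (\<lambda>n. (Dl ^^ m) k n - (Dl ^^ m) a n)" for m k
    using Dl_linear[of m 1 k "-1" a] by simp
  {
    fix k assume k: "k \<in> J0 (i - 1)"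
    note K = J0_D[OF k]
    have "smooth_hom (\<lambda>n. k n + a n)" using smooth_hom_linear[OF K(1) A(1), of 1 1] by simp
    moreover have "vanish ((Dl ^^ i) (\<lambda>n. k n + a n))"
      unfolding lin using vanish_Dl_mono[OF K(2)] A(2) by (intro vanish_add) auto
    moreover have "int p dvd k (\<tau> [^] p) + a (\<tau> [^] p)" using K(3) A(3) by simp
    ultimately have "nrm (\<lambda>n. k n + a n) \<in> J0 i" using nrm_J0[of "\<lambda>n. k n + a n" i] by blast
    moreover have "nrm ((Dl ^^ (i - 1)) (nrm (\<lambda>n. k n + a n))) = nrm ((Dl ^^ (i - 1)) (\<lambda>n. k n + a n))"
      by (rule nrm_cong[OF feq_Dl[OF feq_sym[OF feq_nrm]]])
    moreover have "\<dots> = nrm ((Dl ^^ (i - 1)) a)"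
      by (rule nrm_cong) (use K(2) in \<open>simp add: lin feq_def\<close>)
    ultimately show "nrm (\<lambda>n. k n + a n) \<in> {f \<in> J0 i. nrm ((Dl ^^ (i - 1)) f) = nrm ((Dl ^^ (i - 1)) a)}" by simp
  next
    fix k k' assume k: "k \<in> J0 (i - 1)" "k' \<in> J0 (i - 1)"
    show "(nrm (\<lambda>n. k n + a n) = nrm (\<lambda>n. k' n + a n)) = (k = k')"
    proof
      assume e: "nrm (\<lambda>n. k n + a n) = nrm (\<lambda>n. k' n + a n)"
      have "feq (\<lambda>n. k n + a n) (\<lambda>n. k' n + a n)"
        using feq_nrm[of "\<lambda>n. k n + a n"] feq_sym[OF feq_nrm[of "\<lambda>n. k' n + a n"]] feq_trans unfolding e by blast
      then have "feq k k'" unfolding feq_def by simp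
      then show "k = k'" using J_eqI J0_D(4) k by blast
    qed simp
  next
    fix f assume "f \<in> {f \<in> J0 i. nrm ((Dl ^^ (i - 1)) f) = nrm ((Dl ^^ (i - 1)) a)}"
    then have f: "f \<in> J0 i" and e: "nrm ((Dl ^^ (i - 1)) f) = nrm ((Dl ^^ (i - 1)) a)" by auto
    note F = J0_D[OF f]
    have "feq ((Dl ^^ (i - 1)) f) ((Dl ^^ (i - 1)) a)"
      using feq_nrm[of "(Dl ^^ (i - 1)) f"] feq_sym[OF feq_nrm[of "(Dl ^^ (i - 1)) a"]] feq_trans unfolding e by blast
    then have v: "vanish ((Dl ^^ (i - 1)) (\<lambda>n. f n - a n))" unfolding lin' feq_def .
    have s: "smooth_hom (\<lambda>n. f n - a n)" using smooth_hom_linear[OF F(1) A(1), of 1 "-1"] by simp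
    have "int p dvd f (\<tau> [^] p) - a (\<tau> [^] p)" using F(3) A(3) by simp
    then have k: "nrm (\<lambda>n. f n - a n) \<in> J0 (i - 1)" using nrm_J0[of "\<lambda>n. f n - a n" "i - 1"] s v by blast
    have "feq (\<lambda>n. nrm (\<lambda>n. f n - a n) n + a n) f"
      using feq_sym[OF feq_nrm[of "\<lambda>n. f n - a n"]] unfolding feq_def by (simp add: algebra_simps)
    then have "nrm (\<lambda>n. nrm (\<lambda>n. f n - a n) n + a n) = f" using nrm_cong nrm_idem[OF F(4)] by metis
    then show "\<exists>k\<in>J0 (i - 1). f = nrm (\<lambda>n. k n + a n)" using k by metis
  }
qed

lemma ecard_J0_step:
  assumes i: "2 \<le> i" "i \<le> p - 1"
  shows "ecard (J0 i) = ecard Wset * ecard (J0 (i - 1))"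
    and "ecard (Xs i) = ecard (Wset - {nrm (\<lambda>n. 0)}) * ecard (J0 (i - 1))"
proof -
  let ?\<phi> = "\<lambda>f. nrm ((Dl ^^ (i - 1)) f)"
  have fib: "\<exists>h. bij_betw h (J0 (i - 1)) {f \<in> J0 i. ?\<phi> f = w}" if w: "w \<in> Wset" for w
  proof -
    obtain a where "a \<in> J0 i" "w = ?\<phi> a" using top_power_image[OF i] w by blast
    then show ?thesis using top_power_fibre[OF i(1)] by blast
  qed
  show "ecard (J0 i) = ecard Wset * ecard (J0 (i - 1))"
    by (rule ecard_fibration[OF top_power_image[OF i] fib])
  show "ecard (Xs i) = ecard (Wset - {nrm (\<lambda>n. 0)}) * ecard (J0 (i - 1))"
  proof (rule ecard_fibration)
    have "Xs i = {f \<in> J0 i. ?\<phi> f \<noteq> nrm (\<lambda>n. 0)}" unfolding Xs_def nrm_zero_iff by blast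
    moreover have "h ` {a \<in> A. h a \<noteq> z} = h ` A - {z}" for h :: "('g \<Rightarrow> int) \<Rightarrow> 'g \<Rightarrow> int" and A z by auto
    ultimately show "?\<phi> ` Xs i = Wset - {nrm (\<lambda>n. 0)}" using top_power_image[OF i] by simp
    fix w assume w: "w \<in> Wset - {nrm (\<lambda>n. 0)}"
    have "{f \<in> Xs i. ?\<phi> f = w} = {f \<in> J0 i. ?\<phi> f = w}" using w unfolding Xs_def nrm_zero_iff[symmetric] by blast
    then show "\<exists>h. bij_betw h (J0 (i - 1)) {f \<in> Xs i. ?\<phi> f = w}" using fib w by simp
  qed
qed

lemma ecard_insert: "a \<notin> A \<Longrightarrow> ecard (insert a A) = 1 + ecard A"
  by (auto simp: ecard_def)

lemma zero_J0: "nrm (\<lambda>n. 0) \<in> J0 l"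
proof (rule nrm_J0[OF smooth_hom_zero])
  have "(Dl ^^ l) (\<lambda>n. 0) = (\<lambda>n. 0)" by (induct l) (simp_all add: Dl_def)
  then show "vanish ((Dl ^^ l) (\<lambda>n. 0))" by (simp add: vanish_def)
qed simp

lemma ecard_J0_one: "ecard (J0 1) = 1 + ecard (Xs 1)"
proof -
  have "f = nrm (\<lambda>n. 0)" if "f \<in> J0 1" "vanish f" for f
    using nrm_zero_iff[of f] that nrm_idem[OF J0_D(4)[OF that(1)]] by simp
  moreover have "vanish (nrm (\<lambda>n. 0))" using nrm_zero_iff[of "nrm (\<lambda>n. 0)"] nrm_idem[OF J0_D(4)[OF zero_J0]] by simp
  moreover have "Xs 1 = {f \<in> J0 1. \<not> vanish f}" by (simp add: Xs_def)
  ultimately have "J0 1 = insert (nrm (\<lambda>n. 0)) (Xs 1)" "nrm (\<lambda>n. 0) \<notin> Xs 1" using zero_J0[of 1] by blast+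
  then show ?thesis using ecard_insert by metis
qed

lemma ecard_Wset: "ecard Wset = 1 + ecard (Wset - {nrm (\<lambda>n. 0)})"
proof -
  have "nrm (Dl (nrm (\<lambda>n. 0))) = nrm (Dl (\<lambda>n. 0))"
    using nrm_cong[OF feq_Dl[OF feq_sym[OF feq_nrm[of "\<lambda>n. 0"]], of 1]] by simp
  also have "Dl (\<lambda>n. 0) = (\<lambda>n. 0)" by (simp add: Dl_def)
  finally have "nrm (\<lambda>n. 0) \<in> Wset" using zero_J0[of 2] unfolding Wset_def by (metis image_eqI)
  then show ?thesis using ecard_insert[of "nrm (\<lambda>n. 0)" "Wset - {nrm (\<lambda>n. 0)}"] by (simp add: insert_absorb)
qed

lemma ecard_J0_power: "Suc k \<le> p - 1 \<Longrightarrow> ecard (J0 (Suc k)) = ecard Wset ^ k * ecard (J0 1)"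
proof (induct k)
  case 0 then show ?case by simp
next
  case (Suc k)
  then show ?case using ecard_J0_step(1)[of "Suc (Suc k)"] by (simp add: mult.assoc)
qed

end

end

lemma ennreal_mult_cancel: "x * c = y * c \<Longrightarrow> c \<noteq> 0 \<Longrightarrow> c \<noteq> top_class.top \<Longrightarrow> x = (y :: ennreal)"
  by (metis mult_divide_eq_ennreal)

lemma ennreal_divide_mult_self: "b \<noteq> 0 \<Longrightarrow> b \<noteq> top_class.top \<Longrightarrow> x / b * b = (x :: ennreal)"
  using ennreal_divide_self[of b] by (simp add: ennreal_divide_times less_top)

text \<open>In the application \<open>a\<close> is \<open>|J\<^sub>1|\<close>, \<open>w\<close> is \<open>|W| - 1\<close> and \<open>k\<close> is \<open>l - 2\<close>. The bracket equals
  \<open>(1 + w) / p\<close> for finite \<open>a\<close>. If \<open>a\<close> is infinite, the quotient in the bracket is \<open>0\<close>, and both sides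
  are \<open>0\<close> or infinite according to \<open>w\<close>.\<close>

lemma counting_formula:
  fixes a w \<nu>1 \<nu>2 \<nu>l :: ennreal and p k :: nat
  assumes p: "p > 1" and a: "a = 1 + \<nu>1 * of_nat (p - 1)"
    and 2: "\<nu>2 * of_nat (p * (p - 1)) = w * a"
    and l: "\<nu>l * of_nat (p ^ (k + 1) * (p - 1)) = w * ((1 + w) ^ k * a)"
  shows "\<nu>l = \<nu>2 * (1 / of_nat p + of_nat (p - 1) * \<nu>2 / (1 + of_nat (p - 1) * \<nu>1)) ^ k"
proof -
  define P Q :: ennreal where "P = of_nat p" and "Q = of_nat (p - 1)"
  have P: "P \<noteq> 0" "P \<noteq> top_class.top" and Q: "Q \<noteq> 0" "Q \<noteq> top_class.top" unfolding P_def Q_def using p by auto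
  have a': "1 + of_nat (p - 1) * \<nu>1 = a" using a by (simp add: mult.commute)
  have 2: "\<nu>2 * (P * Q) = w * a" using 2 unfolding P_def Q_def by simp
  have l: "\<nu>l * (P ^ (k + 1) * Q) = w * ((1 + w) ^ k * a)" using l unfolding P_def Q_def by simp
  have PQ: "P * Q \<noteq> 0" "P * Q \<noteq> top_class.top" using P Q by (auto simp: ennreal_mult_eq_top_iff)
  have Pk: "P ^ n \<noteq> 0" "P ^ n \<noteq> top_class.top" for n using P by (auto simp: power_eq_top_ennreal_iff)
  have PkQ: "P ^ (k + 1) * Q \<noteq> 0" "P ^ (k + 1) * Q \<noteq> top_class.top" using Pk[of "k + 1"] Q by (auto simp: ennreal_mult_eq_top_iff)
  have a0: "a \<noteq> 0" unfolding a by simp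
  show ?thesis
  proof (cases "a = top_class.top")
    case True
    have br: "1 / of_nat p + of_nat (p - 1) * \<nu>2 / (1 + of_nat (p - 1) * \<nu>1) = 1 / P"
      unfolding a' True P_def by (simp add: divide_ennreal_def)
    show ?thesis
    proof (cases "w = 0")
      case w: True
      have "\<nu>2 = 0" "\<nu>l = 0" using 2 l PQ PkQ unfolding w by auto
      then show ?thesis by simp
    next
      case False
      have "\<nu>2 * (P * Q) = top_class.top" using 2 False unfolding True by (simp add: ennreal_mult_top)
      then have v2: "\<nu>2 = top_class.top" using PQ by (auto simp: ennreal_mult_eq_top_iff)
      have "(1 + w) ^ k \<noteq> 0" by simp
      then have "\<nu>l * (P ^ (k + 1) * Q) = top_class.top" using l False unfolding True by (simp add: ennreal_mult_top)
      then have "\<nu>l = top_class.top" using PkQ by (auto simp: ennreal_mult_eq_top_iff)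
      moreover have "(1 / P) ^ k \<noteq> 0" using P by (simp add: divide_ennreal_def)
      ultimately show ?thesis unfolding br v2 by (simp add: ennreal_top_mult)
    qed
  next
    case False
    have "(Q * \<nu>2 / a) * (a * P) = (Q * \<nu>2 / a * a) * P" by (simp add: mult.assoc)
    also have "\<dots> = Q * \<nu>2 * P" by (simp only: ennreal_divide_mult_self[OF a0 False])
    also have "\<dots> = w * a" using 2 by (simp add: mult_ac)
    also have "\<dots> = (w / P) * (a * P)" 
    proof -
      have "(w / P) * (a * P) = (w / P * P) * a" by (simp add: mult_ac)
      also have "w / P * P = w" by (rule ennreal_divide_mult_self[OF P])
      finally show ?thesis by simp
    qed
    finally have "Q * \<nu>2 / a = w / P"
      by (rule ennreal_mult_cancel) (use a0 False P in \<open>auto simp: ennreal_mult_eq_top_iff\<close>)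
    then have "1 / P + Q * \<nu>2 / a = (1 + w) / P" by (simp add: divide_ennreal_def distrib_right)
    then have br: "1 / of_nat p + of_nat (p - 1) * \<nu>2 / (1 + of_nat (p - 1) * \<nu>1) = (1 + w) / P"
      unfolding a' unfolding P_def Q_def .
    have "(\<nu>2 * ((1 + w) / P) ^ k) * (P ^ (k + 1) * Q) = (\<nu>2 * (P * Q)) * (((1 + w) / P) * P) ^ k"
      by (simp add: power_mult_distrib mult_ac)
    also have "((1 + w) / P) * P = 1 + w" by (rule ennreal_divide_mult_self[OF P])
    also have "\<nu>2 * (P * Q) * (1 + w) ^ k = \<nu>l * (P ^ (k + 1) * Q)" unfolding 2 l by (simp add: mult_ac)
    finally have "\<nu>2 * ((1 + w) / P) ^ k = \<nu>l" using ennreal_mult_cancel PkQ by blast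
    then show ?thesis unfolding br by simp
  qed
qed

theorem (in cyclic_quotient) abstract_formula:
  assumes key: "\<And>f. smooth_hom f \<Longrightarrow> vanish ((Dl ^^ 2) f) \<Longrightarrow> int p dvd f (\<tau> [^] p) \<Longrightarrow>
    \<exists>g. smooth_hom g \<and> vanish (\<lambda>n. (\<Sum>i<p. g ((conj ^^ i) n)) - Dl f n)"
    and l: "2 \<le> l" "l \<le> p - 1"
    and P1: "truncated_semidirect p 1 P1 \<psi>1" and P2: "truncated_semidirect p 2 P2 \<psi>2" and Pl: "truncated_semidirect p l Pl \<psi>l"
  shows "ecard (quotients Pl) = ecard (quotients P2) *
     (1 / of_nat p + of_nat (p - 1) * ecard (quotients P2) / (1 + of_nat (p - 1) * ecard (quotients P1))) ^ (l - 2)"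
proof (rule counting_formula[where a = "ecard (J0 1)" and w = "ecard (Wset - {nrm (\<lambda>n. 0)})"])
  have l1: "Suc (l - 2) = l - 1" "l - 2 + 1 = l - 1" using l by auto
  show "p > 1" by (rule p_pos)
  show "ecard (J0 1) = 1 + ecard (quotients P1) * of_nat (p - 1)"
    using ecard_J0_one[OF key] ecard_Xs[OF P1] l by simp
  show "ecard (quotients P2) * of_nat (p * (p - 1)) = ecard (Wset - {nrm (\<lambda>n. 0)}) * ecard (J0 1)"
    using ecard_J0_step(2)[OF key, of 2] ecard_Xs[OF P2] l by simp
  have "ecard (J0 (l - 1)) = (1 + ecard (Wset - {nrm (\<lambda>n. 0)})) ^ (l - 2) * ecard (J0 1)"
    using ecard_J0_power[OF key, of "l - 2"] l ecard_Wset[OF key] unfolding l1 by simp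
  then show "ecard (quotients Pl) * of_nat (p ^ (l - 2 + 1) * (p - 1)) = ecard (Wset - {nrm (\<lambda>n. 0)}) *
     ((1 + ecard (Wset - {nrm (\<lambda>n. 0)})) ^ (l - 2) * ecard (J0 1))"
    using ecard_J0_step(2)[OF key l] ecard_Xs[OF Pl] l unfolding l1 by simp
qed

section \<open>The group ring as a quotient of the integer polynomials\<close>

text \<open>The coefficient at \<open>\<sigma>\<^sup>j\<close> of the image of \<open>q\<close> in \<open>\<int>[X]/(X\<^sup>p - 1)\<close>.\<close>

definition wrap :: "nat \<Rightarrow> int poly \<Rightarrow> int \<Rightarrow> int" where
  "wrap p q = fold_coeffs (\<lambda>a g j. (if j = 0 then a else 0) + g ((j - 1) mod int p)) q (\<lambda>_. 0)"

lemma wrap_0 [simp]: "wrap p 0 j = 0" by (simp add: wrap_def)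

lemma wrap_pCons: "wrap p (pCons a q) j = (if j = 0 then a else 0) + wrap p q ((j - 1) mod int p)"
  by (cases "a = 0 \<and> q = 0") (auto simp: wrap_def)

lemma wrap_add: "wrap p (q + r) j = wrap p q j + wrap p r j"
  by (induct q r arbitrary: j rule: poly_induct2) (simp_all add: wrap_pCons)

lemma wrap_smult: "wrap p (smult a q) j = a * wrap p q j"
  by (induct q arbitrary: j rule: pCons_induct) (simp_all add: wrap_pCons distrib_left)

lemma wrap_minus: "wrap p (- q) j = - wrap p q j" using wrap_smult[of p "-1" q j] by simp

lemma wrap_diff: "wrap p (q - r) j = wrap p q j - wrap p r j"
  using wrap_add[of p q "- r" j] by (simp add: wrap_minus)

lemma sum_shift_mod:
  assumes "p > 0"
  shows "(\<Sum>y\<in>{0..<int p}. g ((y - 1) mod int p) y) = (\<Sum>z\<in>{0..<int p}. g z ((z + 1) mod int p))"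
proof (rule sum.reindex_bij_witness[where i = "\<lambda>z. (z + 1) mod int p" and j = "\<lambda>y. (y - 1) mod int p"])
  fix y assume y: "y \<in> {0..<int p}"
  show "((y - 1) mod int p + 1) mod int p = y" using y assms by (simp add: mod_add_left_eq)
  then show "g ((y - 1) mod int p) (((y - 1) mod int p + 1) mod int p) = g ((y - 1) mod int p) y" by simp
  show "(y - 1) mod int p \<in> {0..<int p}" using assms by simp
next
  fix z assume z: "z \<in> {0..<int p}"
  show "((z + 1) mod int p - 1) mod int p = z" using z assms by (simp add: mod_diff_left_eq)
  show "(z + 1) mod int p \<in> {0..<int p}" using assms by simp
qed

lemma wrap_mult:
  assumes p: "p > 0" and x: "x \<in> {0..<int p}"
  shows "wrap p (q * r) x = (\<Sum>y\<in>{0..<int p}. wrap p q y * wrap p r ((x - y) mod int p))"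
  using x
proof (induct q arbitrary: x rule: pCons_induct)
  case 0 then show ?case by simp
next
  case (pCons a q)
  have xm: "(x - 1) mod int p \<in> {0..<int p}" using p by simp
  have "(\<Sum>y\<in>{0..<int p}. wrap p (pCons a q) y * wrap p r ((x - y) mod int p))
    = (\<Sum>y\<in>{0..<int p}. if y = 0 then a * wrap p r ((x - y) mod int p) else 0)
     + (\<Sum>y\<in>{0..<int p}. wrap p q ((y - 1) mod int p) * wrap p r ((x - y) mod int p))"
    unfolding sum.distrib[symmetric] by (rule sum.cong) (auto simp: wrap_pCons algebra_simps)
  also have "(\<Sum>y\<in>{0..<int p}. if y = 0 then a * wrap p r ((x - y) mod int p) else 0) = a * wrap p r x"
    using p pCons(3) by (simp add: sum.delta)
  also have "(\<Sum>y\<in>{0..<int p}. wrap p q ((y - 1) mod int p) * wrap p r ((x - y) mod int p))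
    = (\<Sum>z\<in>{0..<int p}. wrap p q z * wrap p r ((x - (z + 1) mod int p) mod int p))"
    by (rule sum_shift_mod[OF p])
  also have "\<dots> = (\<Sum>z\<in>{0..<int p}. wrap p q z * wrap p r (((x - 1) mod int p - z) mod int p))"
    by (rule sum.cong) (simp_all add: mod_diff_left_eq mod_diff_right_eq algebra_simps)
  also have "\<dots> = wrap p (q * r) ((x - 1) mod int p)" using pCons(2)[OF xm] by simp
  finally show ?case by (simp add: wrap_add wrap_smult wrap_pCons mult_pCons_left)
qed

lemma wrap_monom:
  assumes p: "p > 0" and j: "j \<in> {0..<int p}"
  shows "wrap p (monom a i) j = (if int i mod int p = j then a else 0)"
  using j
proof (induct i arbitrary: j)
  case 0
  then show ?case by (auto simp: monom_0 wrap_pCons)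
next
  case (Suc i)
  have jm: "(j - 1) mod int p \<in> {0..<int p}" using p by simp
  have "int i mod int p = (j - 1) mod int p \<longleftrightarrow> int (Suc i) mod int p = j mod int p"
    by (simp add: mod_eq_dvd_iff algebra_simps)
  then show ?case using Suc jm by (auto simp: monom_Suc wrap_pCons)
qed

lemma one_plus_T_pow_p: assumes "prime p" shows "low_zero p p ([:1, 1:] ^ p - 1)"
proof -
  have "[:1, 1 :: int:] - 1 = [:0, 1:]" by (simp add: one_pCons)
  then have e: "[:1, 1 :: int:] ^ p - 1 = [:0, 1:] * (\<Sum>i<p. [:1, 1:] ^ i)"
    using power_diff_1_eq[of "[:1, 1 :: int:]" p] by simp
  obtain r where r: "(\<Sum>i<p. [:1, 1:] ^ i) = monom 1 (p - 1) + smult (int p) (r :: int poly)" using norm_poly[OF assms] .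
  have "[:0, 1 :: int:] * monom 1 (p - 1) = monom 1 p" using prime_gt_0_nat[OF assms] by (simp add: monom_Suc[symmetric])
  then have "[:1, 1 :: int:] ^ p - 1 = monom 1 p + smult (int p) ([:0, 1:] * r)"
    unfolding e r by (simp only: distrib_left mult_smult_right)
  then show ?thesis by (simp only: low_zero_add low_zero_monom low_zero_smult order_refl)
qed

lemma one_plus_T_pow_mod:
  assumes "prime p" "l \<le> p" shows "low_zero p l ([:1, 1:] ^ n - [:1, 1:] ^ (n mod p))"
proof -
  have "low_zero p p ([:1, 1:] ^ (p * k + m) - [:1, 1:] ^ m)" for k m
  proof (induct k)
    case 0 then show ?case by simp
  next
    case (Suc k)
    have "low_zero p p ([:1, 1:] ^ (p * k + m) * ([:1, 1:] ^ p - 1) + ([:1, 1:] ^ (p * k + m) - [:1, 1:] ^ m))"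
      by (intro low_zero_add low_zero_mult one_plus_T_pow_p assms(1) Suc)
    then show ?case by (simp add: algebra_simps power_add)
  qed
  from this[of "n div p" "n mod p"] show ?thesis using assms(2) unfolding low_zero_def by simp
qed

text \<open>Substituting \<open>1 + T\<close> for \<open>X\<close> in \<open>u\<close> and in its reduction modulo \<open>X\<^sup>p - 1\<close> gives polynomials that agree
  modulo \<open>p\<close> and \<open>T\<^sup>p\<close>, since \<open>(1 + T)\<^sup>p - 1\<close> is \<open>T\<^sup>p\<close> modulo \<open>p\<close>.\<close>

lemma shift_wrap:
  assumes p: "prime p"
  shows "low_zero p p (pcompose u [:1, 1:] - (\<Sum>j\<in>{0..<int p}. smult (wrap p u j) ([:1, 1:] ^ nat j)))"
proof (induct u rule: pCons_induct)
  case 0 then show ?case by simp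
next
  case (pCons a u)
  have p0: "p > 0" using p prime_gt_0_nat by blast
  let ?T = "[:1, 1 :: int:]"
  have "(\<Sum>j\<in>{0..<int p}. smult (wrap p (pCons a u) j) (?T ^ nat j))
     = (\<Sum>j\<in>{0..<int p}. if j = 0 then smult a (?T ^ nat j) else 0) 
     + (\<Sum>j\<in>{0..<int p}. smult (wrap p u ((j - 1) mod int p)) (?T ^ nat j))"
    unfolding sum.distrib[symmetric] by (rule sum.cong) (auto simp: wrap_pCons smult_add_left)
  also have "(\<Sum>j\<in>{0..<int p}. if j = 0 then smult a (?T ^ nat j) else 0) = [:a:]"
    using p0 by (simp add: sum.delta)
  also have "(\<Sum>j\<in>{0..<int p}. smult (wrap p u ((j - 1) mod int p)) (?T ^ nat j))
     = (\<Sum>z\<in>{0..<int p}. smult (wrap p u z) (?T ^ nat ((z + 1) mod int p)))" by (rule sum_shift_mod[OF p0])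
  finally have e: "(\<Sum>j\<in>{0..<int p}. smult (wrap p (pCons a u) j) (?T ^ nat j)) 
    = [:a:] + (\<Sum>z\<in>{0..<int p}. smult (wrap p u z) (?T ^ nat ((z + 1) mod int p)))" .
  have d: "low_zero p p (\<Sum>z\<in>{0..<int p}. smult (wrap p u z) (?T ^ Suc (nat z) - ?T ^ nat ((z + 1) mod int p)))"
  proof -
    have "low_zero p p (smult (wrap p u z) (?T ^ Suc (nat z) - ?T ^ nat ((z + 1) mod int p)))" if "z \<in> {0..<int p}" for z
    proof -
      have "nat ((z + 1) mod int p) = Suc (nat z) mod p"
        using that by (simp add: nat_mod_distrib nat_add_distrib)
      then have "low_zero p p (?T ^ Suc (nat z) - ?T ^ nat ((z + 1) mod int p))"
        using one_plus_T_pow_mod[OF p, of p "Suc (nat z)"] by simp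
      then show ?thesis using low_zero_mult[of p p _ "[:wrap p u z:]"] by simp
    qed
    then show ?thesis unfolding low_zero_def by (auto simp: coeff_sum intro!: dvd_sum)
  qed
  have "low_zero p p (?T * (pcompose u ?T - (\<Sum>j\<in>{0..<int p}. smult (wrap p u j) (?T ^ nat j)))
     + (\<Sum>z\<in>{0..<int p}. smult (wrap p u z) (?T ^ Suc (nat z) - ?T ^ nat ((z + 1) mod int p))))"
    by (intro low_zero_add low_zero_mult pCons d)
  also have "?T * (pcompose u ?T - (\<Sum>j\<in>{0..<int p}. smult (wrap p u j) (?T ^ nat j)))
     + (\<Sum>z\<in>{0..<int p}. smult (wrap p u z) (?T ^ Suc (nat z) - ?T ^ nat ((z + 1) mod int p)))
     = pcompose (pCons a u) ?T - (\<Sum>j\<in>{0..<int p}. smult (wrap p (pCons a u) j) (?T ^ nat j))"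
  proof -
    have "(\<Sum>z\<in>{0..<int p}. smult (wrap p u z) (?T ^ Suc (nat z) - ?T ^ nat ((z + 1) mod int p)))
      = ?T * (\<Sum>j\<in>{0..<int p}. smult (wrap p u j) (?T ^ nat j)) - (\<Sum>z\<in>{0..<int p}. smult (wrap p u z) (?T ^ nat ((z + 1) mod int p)))"
      unfolding sum_distrib_left sum_subtractf[symmetric] 
      by (rule sum.cong) (simp_all only: power_Suc mult_smult_right smult_diff_right)
    then show ?thesis unfolding e by (simp add: pcompose_pCons right_diff_distrib)
  qed
  finally show ?case .
qed

lemma pcompose_power: "pcompose (q ^ n) r = (pcompose q r :: 'a :: comm_semiring_1 poly) ^ n"
  by (induct n) (simp_all add: pcompose_mult pcompose_1)

locale group_ring_mod =
  fixes p :: nat assumes p: "prime p"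
begin

lemma p0: "p > 0" "int p > 0" "int p > 1" using p prime_gt_0_nat prime_gt_1_nat by auto

text \<open>The surjection \<open>\<int>[X] \<rightarrow> (\<int>/p)[G\<^sub>1]\<close> with \<open>X \<mapsto> \<sigma>\<close>. Ring axioms for the group ring, which is
  defined by explicit convolution, are transported along it.\<close>

definition ev :: "int poly \<Rightarrow> int \<Rightarrow> int" where
  "ev q = (\<lambda>j\<in>{0..<int p}. wrap p q j mod int p)"

lemma FpG_simps:
  "carrier (FpG p) = {0..<int p} \<rightarrow>\<^sub>E {0..<int p}"
  "\<zero>\<^bsub>FpG p\<^esub> = (\<lambda>x\<in>{0..<int p}. 0)"
  "f \<oplus>\<^bsub>FpG p\<^esub> h = (\<lambda>x\<in>{0..<int p}. (f x + h x) mod int p)"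
  "\<one>\<^bsub>FpG p\<^esub> = FpG_elt p 0"
  "FpG_elt p g = (\<lambda>x\<in>{0..<int p}. if x = g then 1 else 0)"
proof -
  have c: "carrier (integer_mod_group p) = {0..<int p}" using p0 by (simp add: carrier_integer_mod_group)
  have r: "{0..int p - 1} = {0..<int p}" by auto
  show "carrier (FpG p) = {0..<int p} \<rightarrow>\<^sub>E {0..<int p}" "\<zero>\<^bsub>FpG p\<^esub> = (\<lambda>x\<in>{0..<int p}. 0)"
    "f \<oplus>\<^bsub>FpG p\<^esub> h = (\<lambda>x\<in>{0..<int p}. (f x + h x) mod int p)" "\<one>\<^bsub>FpG p\<^esub> = FpG_elt p 0"
    unfolding group_ring_def group_ring_elt_def by (simp_all add: c residue_ring_def r)
  show "FpG_elt p g = (\<lambda>x\<in>{0..<int p}. if x = g then 1 else 0)"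
    unfolding group_ring_elt_def c by (rule restrict_ext) (simp add: residue_ring_def)
qed

lemma residue_finsum:
  assumes "finite A" "f \<in> A \<rightarrow> {0..<int p}"
  shows "finsum (residue_ring (int p)) f A = (\<Sum>a\<in>A. f a) mod int p"
proof -
  interpret R: residues "int p" "residue_ring (int p)" by unfold_locales (use p0 in auto)
  interpret R: cring "residue_ring (int p)" by (rule R.cring)
  have rc: "carrier (residue_ring (int p)) = {0..<int p}" by (auto simp: residue_ring_def)
  show ?thesis using assms
  proof (induct A)
    case empty
    show ?case unfolding R.finsum_empty by (simp add: residue_ring_def)
  next
    case (insert a A)
    then show ?case by (subst R.finsum_insert) (auto simp: rc residue_ring_def mod_add_right_eq)
  qed
qed

lemma FpG_mult:
  assumes f: "f \<in> carrier (FpG p)" and h: "h \<in> carrier (FpG p)"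
  shows "f \<otimes>\<^bsub>FpG p\<^esub> h = (\<lambda>x\<in>{0..<int p}. (\<Sum>y\<in>{0..<int p}. f y * h ((x - y) mod int p)) mod int p)"
proof -
  have c: "carrier (integer_mod_group p) = {0..<int p}" using p0 by (simp add: carrier_integer_mod_group)
  have e: "finsum (residue_ring (int p)) (\<lambda>y. (f y * h (inv\<^bsub>integer_mod_group p\<^esub> y \<otimes>\<^bsub>integer_mod_group p\<^esub> x)) mod int p) {0..<int p}
    = (\<Sum>y\<in>{0..<int p}. f y * h ((x - y) mod int p)) mod int p" if x: "x \<in> {0..<int p}" for x
  proof -
    have "finsum (residue_ring (int p)) (\<lambda>y. (f y * h (inv\<^bsub>integer_mod_group p\<^esub> y \<otimes>\<^bsub>integer_mod_group p\<^esub> x)) mod int p) {0..<int p}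
      = (\<Sum>y\<in>{0..<int p}. (f y * h (inv\<^bsub>integer_mod_group p\<^esub> y \<otimes>\<^bsub>integer_mod_group p\<^esub> x)) mod int p) mod int p"
      by (rule residue_finsum) (use p0 in auto)
    also have "\<dots> = (\<Sum>y\<in>{0..<int p}. f y * h (inv\<^bsub>integer_mod_group p\<^esub> y \<otimes>\<^bsub>integer_mod_group p\<^esub> x)) mod int p"
      by (rule mod_sum_eq)
    also have "(\<Sum>y\<in>{0..<int p}. f y * h (inv\<^bsub>integer_mod_group p\<^esub> y \<otimes>\<^bsub>integer_mod_group p\<^esub> x))
      = (\<Sum>y\<in>{0..<int p}. f y * h ((x - y) mod int p))"
      by (rule sum.cong) (simp_all add: c mod_add_left_eq)
    finally show ?thesis .
  qed
  show ?thesis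
    unfolding group_ring_def using e by (auto simp: c residue_ring_def intro!: restrict_ext)
qed

lemma ev_closed: "ev q \<in> carrier (FpG p)" unfolding FpG_simps ev_def using p0 by auto

lemma ev_add: "ev (q + r) = ev q \<oplus>\<^bsub>FpG p\<^esub> ev r"
  unfolding FpG_simps ev_def by (rule restrict_ext) (simp add: wrap_add mod_add_eq)

lemma ev_mult: "ev (q * r) = ev q \<otimes>\<^bsub>FpG p\<^esub> ev r"
  unfolding FpG_mult[OF ev_closed ev_closed] 
proof (subst ev_def, rule restrict_ext)
  fix x assume x: "x \<in> {0..<int p}"
  have "(\<Sum>y\<in>{0..<int p}. ev q y * ev r ((x - y) mod int p)) mod int p
     = (\<Sum>y\<in>{0..<int p}. (ev q y * ev r ((x - y) mod int p)) mod int p) mod int p" by (rule mod_sum_eq[symmetric])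
  also have "(\<Sum>y\<in>{0..<int p}. (ev q y * ev r ((x - y) mod int p)) mod int p)
     = (\<Sum>y\<in>{0..<int p}. (wrap p q y * wrap p r ((x - y) mod int p)) mod int p)"
    by (rule sum.cong) (use p0 in \<open>simp_all add: ev_def mod_mult_eq\<close>)
  also have "\<dots> mod int p = (\<Sum>y\<in>{0..<int p}. wrap p q y * wrap p r ((x - y) mod int p)) mod int p" by (rule mod_sum_eq)
  finally show "wrap p (q * r) x mod int p = (\<Sum>y\<in>{0..<int p}. ev q y * ev r ((x - y) mod int p)) mod int p"
    unfolding wrap_mult[OF p0(1) x] by simp
qed

lemma ev_monom: "0 \<le> g \<Longrightarrow> g < int p \<Longrightarrow> ev (monom 1 (nat g)) = FpG_elt p g"
  unfolding FpG_simps ev_def using p0 by (intro restrict_ext) (auto simp: wrap_monom)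

lemma ev_1: "ev 1 = \<one>\<^bsub>FpG p\<^esub>" using ev_monom[of 0] p0 by (simp add: FpG_simps(4))

lemma ev_0: "ev 0 = \<zero>\<^bsub>FpG p\<^esub>" unfolding FpG_simps ev_def by simp

lemma ev_surj: "range ev = carrier (FpG p)"
proof
  show "range ev \<subseteq> carrier (FpG p)" using ev_closed by blast
  show "carrier (FpG p) \<subseteq> range ev"
  proof
    fix f assume f: "f \<in> carrier (FpG p)"
    define q where "q = (\<Sum>i\<in>{0..<int p}. monom (f i) (nat i))"
    have s: "wrap p (\<Sum>i\<in>A. monom (f i) (nat i)) j = (\<Sum>i\<in>A. wrap p (monom (f i) (nat i)) j)" for A j
      by (induct A rule: infinite_finite_induct) (simp_all add: wrap_add)
    have "wrap p q j = f j" if j: "j \<in> {0..<int p}" for j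
    proof -
      have "wrap p q j = (\<Sum>i\<in>{0..<int p}. if i = j then f i else 0)"
        unfolding q_def s by (rule sum.cong) (use j p0 in \<open>auto simp: wrap_monom\<close>)
      then show ?thesis using j by (simp add: sum.delta)
    qed
    moreover have "f j mod int p = f j" if "j \<in> {0..<int p}" for j using f that unfolding FpG_simps by (auto simp: PiE_iff)
    ultimately have "f = ev q" using f unfolding ev_def FpG_simps by (auto simp: PiE_iff extensional_def fun_eq_iff)
    then show "f \<in> range ev" by blast
  qed
qed

lemma FpG_cring: "cring (FpG p)"
proof -
  have surj: "\<exists>q. f = ev q" if "f \<in> carrier (FpG p)" for f using that ev_surj by blast
  show ?thesis
  proof (rule cringI)
    show "abelian_group (FpG p)"
    proof (rule abelian_groupI)
      fix x y z assume "x \<in> carrier (FpG p)" "y \<in> carrier (FpG p)" "z \<in> carrier (FpG p)"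
      then obtain q r s where e: "x = ev q" "y = ev r" "z = ev s" using surj by blast
      show "x \<oplus>\<^bsub>FpG p\<^esub> y \<in> carrier (FpG p)" unfolding e ev_add[symmetric] by (rule ev_closed)
      show "x \<oplus>\<^bsub>FpG p\<^esub> y \<oplus>\<^bsub>FpG p\<^esub> z = x \<oplus>\<^bsub>FpG p\<^esub> (y \<oplus>\<^bsub>FpG p\<^esub> z)"
        unfolding e ev_add[symmetric] by (simp add: add.assoc)
      show "x \<oplus>\<^bsub>FpG p\<^esub> y = y \<oplus>\<^bsub>FpG p\<^esub> x" unfolding e ev_add[symmetric] by (simp add: add.commute)
      show "\<zero>\<^bsub>FpG p\<^esub> \<oplus>\<^bsub>FpG p\<^esub> x = x" unfolding e ev_add[symmetric] ev_0[symmetric] by simp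
      show "\<exists>y\<in>carrier (FpG p). y \<oplus>\<^bsub>FpG p\<^esub> x = \<zero>\<^bsub>FpG p\<^esub>"
        by (rule bexI[of _ "ev (- q)"]) (simp_all add: e ev_add[symmetric] ev_0[symmetric] ev_closed)
    qed (simp add: ev_0[symmetric] ev_closed)
    show "comm_monoid (FpG p)"
    proof (rule comm_monoidI)
      fix x y z assume "x \<in> carrier (FpG p)" "y \<in> carrier (FpG p)" "z \<in> carrier (FpG p)"
      then obtain q r s where e: "x = ev q" "y = ev r" "z = ev s" using surj by blast
      show "x \<otimes>\<^bsub>FpG p\<^esub> y \<in> carrier (FpG p)" unfolding e ev_mult[symmetric] by (rule ev_closed)
      show "x \<otimes>\<^bsub>FpG p\<^esub> y \<otimes>\<^bsub>FpG p\<^esub> z = x \<otimes>\<^bsub>FpG p\<^esub> (y \<otimes>\<^bsub>FpG p\<^esub> z)"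
        unfolding e ev_mult[symmetric] by (simp add: mult.assoc)
      show "x \<otimes>\<^bsub>FpG p\<^esub> y = y \<otimes>\<^bsub>FpG p\<^esub> x" unfolding e ev_mult[symmetric] by (simp add: mult.commute)
      show "\<one>\<^bsub>FpG p\<^esub> \<otimes>\<^bsub>FpG p\<^esub> x = x" unfolding e ev_mult[symmetric] ev_1[symmetric] by simp
    qed (simp add: ev_1[symmetric] ev_closed)
    fix x y z assume "x \<in> carrier (FpG p)" "y \<in> carrier (FpG p)" "z \<in> carrier (FpG p)"
    then obtain q r s where e: "x = ev q" "y = ev r" "z = ev s" using surj by blast
    show "(x \<oplus>\<^bsub>FpG p\<^esub> y) \<otimes>\<^bsub>FpG p\<^esub> z = x \<otimes>\<^bsub>FpG p\<^esub> z \<oplus>\<^bsub>FpG p\<^esub> y \<otimes>\<^bsub>FpG p\<^esub> z"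
      unfolding e ev_mult[symmetric] ev_add[symmetric] by (simp add: distrib_right)
  qed
qed

lemma ev_minus: "ev (q - r) = ev q \<ominus>\<^bsub>FpG p\<^esub> ev r"
proof -
  interpret cring "FpG p" by (rule FpG_cring)
  have "ev q = ev (q - r) \<oplus>\<^bsub>FpG p\<^esub> ev r" by (simp add: ev_add[symmetric])
  then show ?thesis using ev_closed by (simp add: minus_eq a_assoc r_neg)
qed

lemma ev_pow: "ev (q ^ n) = ev q [^]\<^bsub>FpG p\<^esub> n"
proof -
  interpret cring "FpG p" by (rule FpG_cring)
  show ?thesis 
  proof (induct n)
    case 0
    show ?case by (simp add: ev_1)
  next
    case (Suc n)
    then show ?case using ev_mult[of "q ^ n" q] by (simp add: mult.commute)
  qed
qed

lemma A_ideal_eq: "A_ideal p l = range (\<lambda>r. ev (r * [:-1, 1:] ^ l))"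
proof -
  interpret cring "FpG p" by (rule FpG_cring)
  have X: "FpG_elt p 1 = ev [:0, 1:]" using ev_monom[of 1] p0 by (simp add: monom_Suc monom_0)
  have "FpG_elt p 1 \<ominus>\<^bsub>FpG p\<^esub> \<one>\<^bsub>FpG p\<^esub> = ev [:-1, 1:]"
    unfolding X ev_1[symmetric] ev_minus[symmetric] by (simp add: one_pCons)
  then have "A_ideal p l = Idl\<^bsub>FpG p\<^esub> {ev ([:-1, 1:] ^ l)}" unfolding A_ideal_def ev_pow by simp
  also have "\<dots> = PIdl\<^bsub>FpG p\<^esub> (ev ([:-1, 1:] ^ l))" using cgenideal_eq_genideal[OF ev_closed] by simp
  also have "\<dots> = range (\<lambda>r. ev (r * [:-1, 1:] ^ l))"
    unfolding cgenideal_def ev_mult ev_surj[symmetric] by blast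
  finally show ?thesis .
qed

lemma A_ideal_ideal: "ideal (A_ideal p l) (FpG p)"
proof -
  interpret cring "FpG p" by (rule FpG_cring)
  have "FpG_elt p 1 = ev (Polynomial.monom 1 1)" using ev_monom[of 1] p0 by simp
  then have "FpG_elt p 1 \<in> carrier (FpG p)" using ev_closed by simp
  then show ?thesis unfolding A_ideal_def by (intro genideal_ideal) simp
qed

text \<open>The map \<open>\<int>[T] \<rightarrow> A\<^sub>l\<close> with \<open>T \<mapsto> \<sigma> - 1\<close>.\<close>

definition psi :: "nat \<Rightarrow> int poly \<Rightarrow> (int \<Rightarrow> int) set" where
  "psi l q = A_ideal p l +>\<^bsub>FpG p\<^esub> ev (pcompose q [:-1, 1:])"

lemma psi_eq: assumes l: "l \<le> p" shows "psi l q = psi l r \<longleftrightarrow> low_zero p l (q - r)"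
proof -
  interpret cring "FpG p" by (rule FpG_cring)
  let ?S = "[:-1, 1 :: int:]" and ?T = "[:1, 1 :: int:]"
  have ST: "pcompose (pcompose u ?S) ?T = u" for u :: "int poly"
    unfolding pcompose_assoc[symmetric] by (simp add: pcompose_pCons)
  have "psi l q = psi l r \<longleftrightarrow> ev (pcompose q ?S) \<ominus>\<^bsub>FpG p\<^esub> ev (pcompose r ?S) \<in> A_ideal p l"
    unfolding psi_def using quotient_eq_iff_same_a_r_cos[OF A_ideal_ideal ev_closed ev_closed] by simp
  also have "\<dots> \<longleftrightarrow> (\<exists>s. ev (pcompose (q - r) ?S) = ev (s * ?S ^ l))"
    unfolding A_ideal_eq ev_minus[symmetric] pcompose_diff by blast
  also have "\<dots> \<longleftrightarrow> low_zero p l (q - r)"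
  proof
    assume "\<exists>s. ev (pcompose (q - r) ?S) = ev (s * ?S ^ l)"
    then obtain s where s: "ev (pcompose (q - r) ?S) = ev (s * ?S ^ l)" by blast
    define u where "u = pcompose (q - r) ?S - s * ?S ^ l"
    have "int p dvd wrap p u j" if "j \<in> {0..<int p}" for j
      using fun_cong[OF s, of j] that unfolding ev_def u_def by (simp add: wrap_diff mod_eq_dvd_iff)
    then have "low_zero p p (\<Sum>j\<in>{0..<int p}. smult (wrap p u j) (?T ^ nat j))"
      unfolding low_zero_def by (auto simp: coeff_sum intro!: dvd_sum dvd_mult2)
    then have "low_zero p p (pcompose u ?T)" using low_zero_add[OF shift_wrap[OF p, of u]] by fastforce
    moreover have "pcompose u ?T = (q - r) - pcompose s ?T * Polynomial.monom 1 l"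
    proof -
      have "pcompose (?S ^ l) ?T = Polynomial.monom 1 l"
        by (simp add: pcompose_power pcompose_pCons monom_altdef)
      then show ?thesis unfolding u_def by (simp add: pcompose_diff pcompose_mult ST)
    qed
    ultimately have "low_zero p l ((q - r) - pcompose s ?T * Polynomial.monom 1 l)" using l unfolding low_zero_def by simp
    moreover have "low_zero p l (pcompose s ?T * Polynomial.monom 1 l)" by (rule low_zero_mult[OF low_zero_monom]) simp
    ultimately show "low_zero p l (q - r)" using low_zero_add by fastforce
  next
    assume z: "low_zero p l (q - r)"
    define b where "b = poly_shift l (q - r)"
    define a where "a = poly_cutoff l (q - r)"
    have qr: "q - r = a + b * Polynomial.monom 1 l"
      unfolding a_def b_def by (rule poly_eqI) (auto simp: coeff_poly_cutoff coeff_poly_shift mult.commute[of _ "Polynomial.monom _ _"] coeff_monom_mult)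
    have "[:int p:] dvd a" unfolding const_poly_dvd_iff a_def using z unfolding low_zero_def by (simp add: coeff_poly_cutoff)
    then obtain a' where a': "a = smult (int p) a'" by (auto elim!: dvdE)
    have "pcompose (Polynomial.monom 1 l) ?S = ?S ^ l" by (simp add: monom_altdef pcompose_power pcompose_pCons)
    then have "pcompose (q - r) ?S = smult (int p) (pcompose a' ?S) + pcompose b ?S * ?S ^ l"
      unfolding qr a' by (simp add: pcompose_add pcompose_mult pcompose_smult)
    then have "ev (pcompose (q - r) ?S) = ev (pcompose b ?S * ?S ^ l)"
      unfolding ev_def by (intro restrict_ext) (simp add: wrap_add wrap_smult)
    then show "\<exists>s. ev (pcompose (q - r) ?S) = ev (s * ?S ^ l)" by blast
  qed
  finally show ?thesis .
qed

lemma A_semidirect_truncated: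
  assumes l: "l \<le> p" shows "truncated_semidirect p l (A_semidirect p l) (psi l)"
proof -
  interpret cring "FpG p" by (rule FpG_cring)
  interpret I: ideal "A_ideal p l" "FpG p" by (rule A_ideal_ideal)
  let ?P = "A_semidirect p l" and ?S = "[:-1, 1 :: int:]" and ?T = "[:1, 1 :: int:]"
  have gc: "carrier (integer_mod_group p) = {0..<int p}" using p0 by (simp add: carrier_integer_mod_group)
  have ST: "pcompose (pcompose u ?T) ?S = u" for u :: "int poly"
    unfolding pcompose_assoc[symmetric] by (simp add: pcompose_pCons)
  have carr: "carrier (A_mod p l) = range (psi l)"
  proof -
    have "carrier (A_mod p l) = (\<lambda>x. A_ideal p l +>\<^bsub>FpG p\<^esub> x) ` carrier (FpG p)"
      unfolding A_mod_def FactRing_def A_RCOSETS_def' by auto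
    also have "\<dots> = range (\<lambda>q. A_ideal p l +>\<^bsub>FpG p\<^esub> ev q)" unfolding ev_surj[symmetric] by blast
    also have "\<dots> = range (psi l)"
    proof
      show "range (psi l) \<subseteq> range (\<lambda>q. A_ideal p l +>\<^bsub>FpG p\<^esub> ev q)" unfolding psi_def by blast
      have "A_ideal p l +>\<^bsub>FpG p\<^esub> ev q = psi l (pcompose q ?T)" for q unfolding psi_def ST ..
      then show "range (\<lambda>q. A_ideal p l +>\<^bsub>FpG p\<^esub> ev q) \<subseteq> range (psi l)" by auto
    qed
    finally show ?thesis .
  qed
  have carP: "carrier ?P = range (psi l) \<times> {0..<int p}"
    unfolding A_semidirect_def semidirect_product_def by (simp add: carr gc)
  have multP: "(psi l q, i) \<otimes>\<^bsub>?P\<^esub> (psi l r, j) = (psi l (q + ?T ^ nat i * r), (i + j) mod int p)"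
    if i: "i \<in> {0..<int p}" and j: "j \<in> {0..<int p}" for q r i j
  proof -
    have "pcompose (?T ^ nat i) ?S = Polynomial.monom 1 (nat i)" by (simp add: pcompose_power pcompose_pCons monom_altdef)
    then have "ev (pcompose (?T ^ nat i) ?S) = FpG_elt p i" using ev_monom[of i] i by simp
    moreover from this have "FpG_elt p i \<in> carrier (FpG p)" using ev_closed[of "pcompose (?T ^ nat i) ?S"] by simp
    ultimately have "A_act p l i (psi l r) = psi l (?T ^ nat i * r)"
      unfolding A_act_def psi_def A_mod_def FactRing_def
      by (simp add: I.rcoset_mult_add ev_closed pcompose_mult ev_mult)
    moreover have "psi l q \<oplus>\<^bsub>A_mod p l\<^esub> psi l s = psi l (q + s)" for s
      unfolding psi_def A_mod_def FactRing_def by (simp add: I.a_rcos_sum ev_closed pcompose_add ev_add)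
    ultimately show ?thesis unfolding A_semidirect_def semidirect_product_def by simp
  qed
  have oneP: "\<one>\<^bsub>?P\<^esub> = (psi l 0, 0)"
    unfolding A_semidirect_def semidirect_product_def psi_def A_mod_def FactRing_def
    by (simp add: ev_0) (simp add: a_coset_add_zero I.a_subset)
  note pe = psi_eq[OF l]
  have inP: "(psi l q, i) \<in> carrier ?P" if "i \<in> {0..<int p}" for q i unfolding carP using that by simp
  have m: "(i + j) mod int p \<in> {0..<int p}" for i j using p0 by simp
  have cong: "psi l (q + ?T ^ nat ((i + j) mod int p) * r) = psi l (q + ?T ^ nat i * (?T ^ nat j * r))"
    if ij: "i \<in> {0..<int p}" "j \<in> {0..<int p}" for q r i j
  proof -
    have "nat ((i + j) mod int p) = (nat i + nat j) mod p" using ij by (simp add: nat_mod_distrib nat_add_distrib)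
    then have "low_zero p l (r * (?T ^ (nat i + nat j) - ?T ^ nat ((i + j) mod int p)))"
      using one_plus_T_pow_mod[OF p l, of "nat i + nat j"] low_zero_mult by simp
    then have "low_zero p l ((q + ?T ^ nat i * (?T ^ nat j * r)) - (q + ?T ^ nat ((i + j) mod int p) * r))"
      by (simp add: algebra_simps power_add)
    then show ?thesis using pe low_zero_sym by blast
  qed
  have grp: "group ?P"
  proof (rule groupI)
    fix x y assume "x \<in> carrier ?P" "y \<in> carrier ?P"
    then obtain q r i j where e: "x = (psi l q, i)" "y = (psi l r, j)" and ij: "i \<in> {0..<int p}" "j \<in> {0..<int p}" 
      unfolding carP by blast
    show "x \<otimes>\<^bsub>?P\<^esub> y \<in> carrier ?P" unfolding e multP[OF ij] by (rule inP[OF m])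
    fix z assume "z \<in> carrier ?P"
    then obtain s k where e': "z = (psi l s, k)" and k: "k \<in> {0..<int p}" unfolding carP by blast
    show "x \<otimes>\<^bsub>?P\<^esub> y \<otimes>\<^bsub>?P\<^esub> z = x \<otimes>\<^bsub>?P\<^esub> (y \<otimes>\<^bsub>?P\<^esub> z)"
      unfolding e e' multP[OF ij] multP[OF ij(2) k] multP[OF m k] multP[OF ij(1) m]
      using cong[OF ij, of "q + ?T ^ nat i * r" s] by (simp add: distrib_left add.assoc mod_add_left_eq mod_add_right_eq)
  next
    show "\<one>\<^bsub>?P\<^esub> \<in> carrier ?P" unfolding oneP using inP p0 by simp
    fix x assume "x \<in> carrier ?P"
    then obtain q i where e: "x = (psi l q, i)" and i: "i \<in> {0..<int p}" unfolding carP by blast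
    have z: "0 \<in> {0..<int p}" using p0 by simp
    show "\<one>\<^bsub>?P\<^esub> \<otimes>\<^bsub>?P\<^esub> x = x" unfolding oneP e multP[OF z i] using i by simp
    define j where "j = (- i) mod int p"
    have j: "j \<in> {0..<int p}" unfolding j_def using p0 by simp
    have "(j + i) mod int p = 0" unfolding j_def by (simp add: mod_add_left_eq)
    then have "(psi l (- (?T ^ nat j * q)), j) \<otimes>\<^bsub>?P\<^esub> x = \<one>\<^bsub>?P\<^esub>" unfolding e multP[OF j i] oneP by simp
    then show "\<exists>y\<in>carrier ?P. y \<otimes>\<^bsub>?P\<^esub> x = \<one>\<^bsub>?P\<^esub>" using inP[OF j] by blast
  qed
  show ?thesis by (rule truncated_semidirect.intro[OF grp pe carP multP oneP])
qed

end

section \<open>Solutions as open normal subgroups\<close>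

context galois_closure
begin

definition orb where "orb B = {s b | s b. s \<in> auts F \<and> b \<in> B}"

lemma auts_one: "(\<lambda>x\<in>carrier \<Omega>. x) \<in> auts F"
  using group.is_monoid[OF group_\<Gamma>, THEN monoid.one_closed] by (simp add: gal_group_one)

lemma orb:
  assumes B: "finite B" "B \<subseteq> \<S>"
  shows "finite (orb B)" "orb B \<subseteq> \<S>" "B \<subseteq> orb B" "s \<in> auts F \<Longrightarrow> b \<in> orb B \<Longrightarrow> s b \<in> orb B"
proof -
  have Bc: "b \<in> B \<Longrightarrow> b \<in> carrier \<Omega>" for b using B(2) S_carrier by blast
  have "orb B = (\<Union>b\<in>B. {s b | s. s \<in> auts F})" unfolding orb_def by blast
  then show "finite (orb B)" using B(1) finite_orbit Bc by simp
  show "orb B \<subseteq> \<S>" unfolding orb_def using S_aut B(2) by blast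
  show "B \<subseteq> orb B"
  proof
    fix b assume b: "b \<in> B"
    then have "b = (\<lambda>x\<in>carrier \<Omega>. x) b" using Bc by simp
    then show "b \<in> orb B" unfolding orb_def using auts_one b by blast
  qed
  show "s b \<in> orb B" if s: "s \<in> auts F" and b: "b \<in> orb B"
  proof -
    interpret \<Gamma>: group \<Gamma> by (rule group_\<Gamma>)
    obtain t b' where t: "t \<in> auts F" "b' \<in> B" "b = t b'" using b unfolding orb_def by blast
    have "s b = (s \<otimes>\<^bsub>\<Gamma>\<^esub> t) b'" using auts_mult[OF s t(1) Bc[OF t(2)]] t(3) by simp
    then show ?thesis unfolding orb_def using \<Gamma>.m_closed[OF s t(1)] t(2) by blast
  qed
qed

lemma stab_anti: "B \<subseteq> C \<Longrightarrow> stab C \<subseteq> stab B" unfolding stab_def by blast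

lemma stab_normal:
  assumes B: "B \<subseteq> carrier \<Omega>" and st: "\<And>s b. s \<in> auts F \<Longrightarrow> b \<in> B \<Longrightarrow> s b \<in> B"
  shows "stab B \<lhd> \<Gamma>"
proof -
  interpret \<Gamma>: group \<Gamma> by (rule group_\<Gamma>)
  show ?thesis
  proof (rule \<Gamma>.normal_invI[OF stab_subgroup[OF B]])
    fix s h assume s: "s \<in> auts F" and h: "h \<in> stab B"
    have hG: "h \<in> auts F" using h unfolding stab_def by blast
    have "(s \<otimes>\<^bsub>\<Gamma>\<^esub> h \<otimes>\<^bsub>\<Gamma>\<^esub> inv\<^bsub>\<Gamma>\<^esub> s) b = b" if b: "b \<in> B" for b
    proof -
      have bc: "b \<in> carrier \<Omega>" using b B by blast
      have i: "inv\<^bsub>\<Gamma>\<^esub> s \<in> auts F" using s by simp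
      have ib: "(inv\<^bsub>\<Gamma>\<^esub> s) b \<in> B" by (rule st[OF i b])
      have "(s \<otimes>\<^bsub>\<Gamma>\<^esub> h \<otimes>\<^bsub>\<Gamma>\<^esub> inv\<^bsub>\<Gamma>\<^esub> s) b = s (h ((inv\<^bsub>\<Gamma>\<^esub> s) b))"
        using auts_mult[OF \<Gamma>.m_closed[OF s hG] i bc] auts_mult[OF s hG] ib B by auto
      also have "h ((inv\<^bsub>\<Gamma>\<^esub> s) b) = (inv\<^bsub>\<Gamma>\<^esub> s) b" using h ib unfolding stab_def by blast
      also have "s ((inv\<^bsub>\<Gamma>\<^esub> s) b) = b" by (rule auts_inv1(2)[OF F_sub s bc])
      finally show ?thesis .
    qed
    then show "s \<otimes>\<^bsub>\<Gamma>\<^esub> h \<otimes>\<^bsub>\<Gamma>\<^esub> inv\<^bsub>\<Gamma>\<^esub> s \<in> stab B" unfolding stab_def using s hG by simp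
  qed
qed

text \<open>For each nontrivial element of the finite group choose one element of \<open>L\<close> that it moves.\<close>

lemma finite_separating:
  assumes L: "galois_extension \<Omega> L F" and fin: "finite (carrier (gal_group \<Omega> L F))"
  obtains B where "finite B" "B \<subseteq> L" "stab B \<subseteq> stab L"
proof -
  define T where "T = {t \<in> carrier (gal_group \<Omega> L F). \<exists>x\<in>L. t x \<noteq> x}"
  define w where "w t = (SOME x. x \<in> L \<and> t x \<noteq> x)" for t
  have w: "w t \<in> L" "t (w t) \<noteq> w t" if "t \<in> T" for t
    using someI_ex[of "\<lambda>x. x \<in> L \<and> t x \<noteq> x"] that unfolding T_def w_def by blast+
  have "stab (w ` T) \<subseteq> stab L"
  proof
    fix s assume s: "s \<in> stab (w ` T)"
    have sG: "s \<in> auts F" using s unfolding stab_def by blast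
    show "s \<in> stab L"
    proof (rule ccontr)
      assume "s \<notin> stab L"
      then obtain x where x: "x \<in> L" "s x \<noteq> x" unfolding stab_def using sG by blast
      have r: "restrict s L \<in> T" unfolding T_def using galois_restrict(1)[OF L sG] x by auto
      have "s (w (restrict s L)) = w (restrict s L)" using s r unfolding stab_def by blast
      then show False using w(2)[OF r] restrict_apply'[OF w(1)[OF r], of s] by argo
    qed
  qed
  moreover have "finite T" unfolding T_def using fin by simp
  ultimately show ?thesis using that[of "w ` T"] w(1) by blast
qed

end

locale cyclic_extension = galois_closure +
  fixes K :: "'a set" and \<theta> :: "('a \<Rightarrow> 'a) \<Rightarrow> int" and p :: nat
  assumes prime_p: "prime p" and K: "galois_extension \<Omega> K F"
    and theta: "\<theta> \<in> iso (gal_group \<Omega> K F) (integer_mod_group p)"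
begin

text \<open>The exponent of \<open>\<sigma>\<close> in the restriction of \<open>s\<close> to \<open>K\<close>.\<close>

definition cl :: "('a \<Rightarrow> 'a) \<Rightarrow> int" where "cl s = \<theta> (restrict s K)"

text \<open>Stability of \<open>B\<close> makes these subgroups normal. By \<open>open_inside\<close> they form a neighbourhood basis of
  the identity.\<close>

definition opens :: "('a \<Rightarrow> 'a) set set" where
  "opens = {stab B | B. finite B \<and> B \<subseteq> \<S> \<and> (\<forall>s\<in>auts F. \<forall>b\<in>B. s b \<in> B) \<and> stab B \<subseteq> stab K}"

lemma p_pos: "p > 0" "int p > 0" "p > 1" using prime_p prime_gt_0_nat prime_gt_1_nat by auto

lemma Gal_K: "group (gal_group \<Omega> K F)" by (rule galois_restrict(5)[OF K])

lemma cl_hom: "cl \<in> hom \<Gamma> (integer_mod_group p)"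
proof (rule homI)
  have th: "\<theta> \<in> hom (gal_group \<Omega> K F) (integer_mod_group p)" using theta unfolding iso_def by blast
  fix s t assume s: "s \<in> auts F" and t: "t \<in> auts F"
  show "cl s \<in> carrier (integer_mod_group p)" unfolding cl_def using hom_in_carrier[OF th galois_restrict(1)[OF K s]] .
  show "cl (s \<otimes>\<^bsub>\<Gamma>\<^esub> t) = cl s \<otimes>\<^bsub>integer_mod_group p\<^esub> cl t"
    unfolding cl_def galois_restrict(3)[OF K s t] using hom_mult[OF th galois_restrict(1)[OF K s] galois_restrict(1)[OF K t]] .
qed

lemma cl_zero_iff: assumes s: "s \<in> auts F" shows "cl s = 0 \<longleftrightarrow> s \<in> stab K"
proof -
  interpret A: group "gal_group \<Omega> K F" by (rule Gal_K)
  have th: "\<theta> \<in> hom (gal_group \<Omega> K F) (integer_mod_group p)" and inj: "inj_on \<theta> (carrier (gal_group \<Omega> K F))"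
    using theta unfolding iso_def bij_betw_def by auto
  have "\<theta> \<one>\<^bsub>gal_group \<Omega> K F\<^esub> = 0"
    using hom_one[OF th Gal_K group_integer_mod_group] by simp
  then have "cl s = 0 \<longleftrightarrow> restrict s K = \<one>\<^bsub>gal_group \<Omega> K F\<^esub>"
    unfolding cl_def using inj_onD[OF inj _ galois_restrict(1)[OF K s] A.one_closed] by auto
  then show ?thesis using galois_restrict(4)[OF K s] by simp
qed

lemma cl_surj: obtains t where "t \<in> auts F" "cl t = 1"
proof -
  have "\<theta> ` carrier (gal_group \<Omega> K F) = carrier (integer_mod_group p)" using theta unfolding iso_def bij_betw_def by auto
  moreover have "1 \<in> carrier (integer_mod_group p)" using p_pos by (simp add: carrier_integer_mod_group)
  ultimately obtain t where t: "t \<in> carrier (gal_group \<Omega> K F)" "\<theta> t = 1" by (metis imageE)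
  obtain s where "s \<in> auts F" "restrict s K = t" using galois_restrict(2)[OF K t(1)] by blast
  then show ?thesis using that t(2) unfolding cl_def by blast
qed

lemma K_separating: obtains B where "finite B" "B \<subseteq> K" "stab B \<subseteq> stab K"
proof -
  have "bij_betw \<theta> (carrier (gal_group \<Omega> K F)) (carrier (integer_mod_group p))" using theta unfolding iso_def by blast
  moreover have "finite (carrier (integer_mod_group p))" using p_pos by (simp add: carrier_integer_mod_group)
  ultimately have "finite (carrier (gal_group \<Omega> K F))" using bij_betw_finite by blast
  from finite_separating[OF K this] that show ?thesis by blast
qed

lemma open_inside:
  assumes B: "finite B" "B \<subseteq> \<S>" obtains U where "U \<in> opens" "U \<subseteq> stab B"
proof -
  obtain C where C: "finite C" "C \<subseteq> K" "stab C \<subseteq> stab K" by (rule K_separating)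
  have BC: "finite (B \<union> C)" "B \<union> C \<subseteq> \<S>" using B C galois_sub_S[OF K] by auto
  note o = orb[OF BC]
  have "stab (orb (B \<union> C)) \<subseteq> stab B" "stab (orb (B \<union> C)) \<subseteq> stab K"
    using stab_anti[of B "orb (B \<union> C)"] stab_anti[of C "orb (B \<union> C)"] o(3) C(3) by auto
  moreover from this have "stab (orb (B \<union> C)) \<in> opens" unfolding opens_def using o(1,2,4) by blast
  ultimately show ?thesis using that by blast
qed

lemma cyclic_quotient_\<Gamma>:
  assumes "\<tau> \<in> auts F" "cl \<tau> = 1" shows "cyclic_quotient \<Gamma> p cl \<tau> opens"
proof (intro cyclic_quotient.intro group_\<Gamma> cyclic_quotient_axioms.intro prime_p cl_hom assms)
  show "U \<lhd> \<Gamma>" if U: "U \<in> opens" for U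
  proof -
    obtain B where B: "U = stab B" "B \<subseteq> \<S>" "\<forall>s\<in>auts F. \<forall>b\<in>B. s b \<in> B" using U unfolding opens_def by blast
    show ?thesis unfolding B(1) by (rule stab_normal) (use B S_carrier in auto)
  qed
  show "U \<subseteq> {n \<in> auts F. cl n = 0}" if U: "U \<in> opens" for U
  proof
    fix s assume s: "s \<in> U"
    obtain B where "U = stab B" "stab B \<subseteq> stab K" using U unfolding opens_def by blast
    then have "s \<in> stab K" "s \<in> auts F" using s unfolding stab_def by auto
    then show "s \<in> {n \<in> auts F. cl n = 0}" using cl_zero_iff by simp
  qed
  show "U \<inter> V \<in> opens" if U: "U \<in> opens" and V: "V \<in> opens" for U V
  proof -
    obtain B where B: "U = stab B" "finite B" "B \<subseteq> \<S>" "\<forall>s\<in>auts F. \<forall>b\<in>B. s b \<in> B" "stab B \<subseteq> stab K" 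
      using U unfolding opens_def by blast
    obtain C where C: "V = stab C" "finite C" "C \<subseteq> \<S>" "\<forall>s\<in>auts F. \<forall>b\<in>C. s b \<in> C"
      using V unfolding opens_def by blast
    have "U \<inter> V = stab (B \<union> C)" unfolding B(1) C(1) stab_def by blast
    moreover have "stab (B \<union> C) \<subseteq> stab K" using stab_anti[of B "B \<union> C"] B(5) by blast
    moreover have "\<forall>s\<in>auts F. \<forall>b\<in>B \<union> C. s b \<in> B \<union> C" "finite (B \<union> C)" "B \<union> C \<subseteq> \<S>" using B C by auto
    ultimately show ?thesis unfolding opens_def by blast
  qed
  show "opens \<noteq> {}" using open_inside[of "{}"] by blast
qed

lemma solution_stab:
  assumes \<tau>: "\<tau> \<in> auts F" "cl \<tau> = 1" and fin: "finite (carrier P)" and P: "group P"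
    and L: "L \<in> embedding_solutions \<Omega> F K \<theta> P snd"
  shows "stab L \<in> cyclic_quotient.quotients \<Gamma> cl opens P"
proof -
  interpret CQ: cyclic_quotient \<Gamma> p cl \<tau> opens by (rule cyclic_quotient_\<Gamma>[OF \<tau>])
  obtain \<phi> where Lg: "galois_extension \<Omega> L F" and KL: "K \<subseteq> L" and \<phi>: "\<phi> \<in> iso (gal_group \<Omega> L F) P"
    and c: "\<forall>s\<in>carrier (gal_group \<Omega> L F). snd (\<phi> s) = \<theta> (restrict s K)"
    using L unfolding embedding_solutions_def by blast
  have \<phi>h: "\<phi> \<in> hom (gal_group \<Omega> L F) P" and \<phi>b: "bij_betw \<phi> (carrier (gal_group \<Omega> L F)) (carrier P)"
    using \<phi> unfolding iso_def by auto
  note R = galois_restrict[OF Lg]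
  interpret A: group "gal_group \<Omega> L F" by (rule R(5))
  define \<Phi> where "\<Phi> s = \<phi> (restrict s L)" for s
  have "\<Phi> \<in> hom \<Gamma> P"
    by (rule homI) (simp_all add: \<Phi>_def R(1,3) hom_in_carrier[OF \<phi>h] hom_mult[OF \<phi>h])
  moreover have "\<Phi> ` auts F = carrier P"
  proof
    show "\<Phi> ` auts F \<subseteq> carrier P" unfolding \<Phi>_def using R(1) hom_in_carrier[OF \<phi>h] by blast
    show "carrier P \<subseteq> \<Phi> ` auts F"
    proof
      fix y assume "y \<in> carrier P"
      then obtain t where t: "t \<in> carrier (gal_group \<Omega> L F)" "y = \<phi> t" using \<phi>b unfolding bij_betw_def by blast
      then show "y \<in> \<Phi> ` auts F" using R(2)[OF t(1)] unfolding \<Phi>_def by blast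
    qed
  qed
  moreover have "\<forall>s\<in>auts F. snd (\<Phi> s) = cl s"
  proof
    fix s assume s: "s \<in> auts F"
    have "restrict (restrict s L) K = restrict s K" using KL by (auto simp: restrict_def fun_eq_iff)
    then show "snd (\<Phi> s) = cl s" unfolding \<Phi>_def cl_def using c R(1)[OF s] by simp
  qed
  moreover have "stab L = {s \<in> auts F. \<Phi> s = \<one>\<^bsub>P\<^esub>}"
  proof -
    have "\<Phi> s = \<one>\<^bsub>P\<^esub> \<longleftrightarrow> s \<in> stab L" if s: "s \<in> auts F" for s
    proof -
      have "\<phi> \<one>\<^bsub>gal_group \<Omega> L F\<^esub> = \<one>\<^bsub>P\<^esub>" by (rule hom_one[OF \<phi>h R(5) P])
      then have "\<Phi> s = \<one>\<^bsub>P\<^esub> \<longleftrightarrow> restrict s L = \<one>\<^bsub>gal_group \<Omega> L F\<^esub>"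
        unfolding \<Phi>_def using inj_onD[OF bij_betw_imp_inj_on[OF \<phi>b] _ R(1)[OF s] A.one_closed] by auto
      then show ?thesis using R(4)[OF s] by simp
    qed
    moreover have "stab L \<subseteq> auts F" unfolding stab_def by blast
    ultimately show ?thesis by blast
  qed
  moreover have "\<exists>V\<in>opens. V \<subseteq> stab L"
  proof -
    have "finite (carrier (gal_group \<Omega> L F))" using bij_betw_finite[OF \<phi>b] fin by simp
    then obtain B where B: "finite B" "B \<subseteq> L" "stab B \<subseteq> stab L" using finite_separating[OF Lg] by blast
    then obtain U where "U \<in> opens" "U \<subseteq> stab B" using open_inside[of B] galois_sub_S[OF Lg] by blast
    then show ?thesis using B(3) by blast
  qed
  ultimately show ?thesis unfolding CQ.quotients_def by blast
qed

text \<open>By Artin's theorem the open subgroup \<open>U\<close> is the full fixer of its fixed field.\<close>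

lemma quotient_fixed_field:
  assumes \<tau>: "\<tau> \<in> auts F" "cl \<tau> = 1" and P: "group P"
    and U: "U \<in> cyclic_quotient.quotients \<Gamma> cl opens P"
  shows "fixf U \<in> embedding_solutions \<Omega> F K \<theta> P snd" "stab (fixf U) = U"
proof -
  interpret CQ: cyclic_quotient \<Gamma> p cl \<tau> opens by (rule cyclic_quotient_\<Gamma>[OF \<tau>])
  obtain \<Phi> V where \<Phi>: "\<Phi> \<in> hom \<Gamma> P" "\<Phi> ` auts F = carrier P" "\<forall>s\<in>auts F. snd (\<Phi> s) = cl s"
    and Uk: "U = {s \<in> auts F. \<Phi> s = \<one>\<^bsub>P\<^esub>}" and V: "V \<in> opens" "V \<subseteq> U"
    using U unfolding CQ.quotients_def by blast
  interpret P: group P by (rule P)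
  interpret h: group_hom \<Gamma> P \<Phi> by unfold_locales (rule \<Phi>(1))
  have Un: "U \<lhd> \<Gamma>" using h.normal_kernel unfolding kernel_def Uk .
  define L where "L = fixf U"
  have Lg: "galois_extension \<Omega> L F" unfolding L_def by (rule fixf_galois[OF Un])
  note R = galois_restrict[OF Lg]
  have UG: "U \<subseteq> auts F" unfolding Uk by blast
  obtain B where B: "V = stab B" "finite B" "B \<subseteq> \<S>" using V(1) unfolding opens_def by blast
  show sL: "stab (fixf U) = U"
  proof
    show "U \<subseteq> stab (fixf U)"
    proof
      fix s assume s: "s \<in> U"
      then show "s \<in> stab (fixf U)" unfolding stab_def fixf_def using subsetD[OF UG s] by simp
    qed
    show "stab (fixf U) \<subseteq> U"
    proof
      fix s assume s: "s \<in> stab (fixf U)"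
      show "s \<in> U"
      proof (rule artin[OF normal_imp_subgroup[OF Un] B(2,3)])
        show "stab B \<subseteq> U" using V(2) unfolding B(1) .
        show "s \<in> auts F" using s unfolding stab_def by simp
        show "s x = x" if "x \<in> fixf U" for x using s that unfolding stab_def by simp
      qed
    qed
  qed
  have UK: "U \<subseteq> stab K"
  proof
    fix s assume s: "s \<in> U"
    have e: "\<Phi> s = \<Phi> \<one>\<^bsub>\<Gamma>\<^esub>" using s unfolding Uk by simp
    have "cl s = snd (\<Phi> s)" using \<Phi>(3) subsetD[OF UG s] by simp
    also have "\<dots> = cl \<one>\<^bsub>\<Gamma>\<^esub>" unfolding e by (rule bspec[OF \<Phi>(3) CQ.one_closed])
    finally show "s \<in> stab K" using cl_zero_iff[OF subsetD[OF UG s]] CQ.c_one by simp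
  qed
  have KL: "K \<subseteq> L"
  proof -
    have "fixf (stab K) \<subseteq> fixf U" unfolding fixf_def using UK by blast
    then show ?thesis unfolding L_def fixf_stab_galois[OF K] .
  qed
  define rep where "rep t = (SOME s. s \<in> auts F \<and> restrict s L = t)" for t
  have rep: "rep t \<in> auts F" "restrict (rep t) L = t" if "t \<in> carrier (gal_group \<Omega> L F)" for t
    using someI_ex[of "\<lambda>s. s \<in> auts F \<and> restrict s L = t"] R(2)[OF that] unfolding rep_def by blast+
  define \<phi> where "\<phi> t = \<Phi> (rep t)" for t
  have eq: "\<Phi> s = \<Phi> s' \<longleftrightarrow> restrict s L = restrict s' L" if s: "s \<in> auts F" "s' \<in> auts F" for s s'
  proof -
    have c: "inv\<^bsub>\<Gamma>\<^esub> s \<otimes>\<^bsub>\<Gamma>\<^esub> s' \<in> auts F" using s by simp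
    have "\<Phi> (inv\<^bsub>\<Gamma>\<^esub> s \<otimes>\<^bsub>\<Gamma>\<^esub> s') = inv\<^bsub>P\<^esub> \<Phi> s \<otimes>\<^bsub>P\<^esub> \<Phi> s'" using s by simp
    also have "\<dots> = \<one>\<^bsub>P\<^esub> \<longleftrightarrow> \<Phi> s = \<Phi> s'"
    proof -
      have c: "\<Phi> s \<in> carrier P" "\<Phi> s' \<in> carrier P" using s by simp_all
      have "\<one>\<^bsub>P\<^esub> = inv\<^bsub>P\<^esub> \<Phi> s \<otimes>\<^bsub>P\<^esub> \<Phi> s' \<longleftrightarrow> \<Phi> s' = \<Phi> s"
        using P.inv_solve_left[OF P.one_closed c] P.r_one[OF c(1)] by simp
      then show ?thesis by (simp only: eq_commute)
    qed
    finally have 1: "\<Phi> s = \<Phi> s' \<longleftrightarrow> inv\<^bsub>\<Gamma>\<^esub> s \<otimes>\<^bsub>\<Gamma>\<^esub> s' \<in> stab L" unfolding L_def sL using c unfolding Uk by simp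
    have "restrict (inv\<^bsub>\<Gamma>\<^esub> s \<otimes>\<^bsub>\<Gamma>\<^esub> s') L = \<one>\<^bsub>gal_group \<Omega> L F\<^esub> \<longleftrightarrow> restrict s L = restrict s' L"
    proof -
      interpret A: group "gal_group \<Omega> L F" by (rule R(5))
      have "restrict s L \<otimes>\<^bsub>gal_group \<Omega> L F\<^esub> restrict (inv\<^bsub>\<Gamma>\<^esub> s \<otimes>\<^bsub>\<Gamma>\<^esub> s') L = restrict s' L"
        using R(3)[OF s(1) c] s CQ.m_assoc[of s "inv\<^bsub>\<Gamma>\<^esub> s" s'] by simp
      then show ?thesis using A.l_cancel_one[OF R(1)[OF s(1)] R(1)[OF c]] by metis
    qed
    then show ?thesis unfolding 1 R(4)[OF c, symmetric] .
  qed
  have \<phi>r: "\<phi> (restrict s L) = \<Phi> s" if "s \<in> auts F" for s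
    using eq[OF rep(1)[OF R(1)[OF that]] that] rep(2)[OF R(1)[OF that]] unfolding \<phi>_def by simp
  have "\<phi> \<in> iso (gal_group \<Omega> L F) P"
  proof (rule isoI)
    show "\<phi> \<in> hom (gal_group \<Omega> L F) P"
    proof (rule homI)
      fix t u assume t: "t \<in> carrier (gal_group \<Omega> L F)" and u: "u \<in> carrier (gal_group \<Omega> L F)"
      show "\<phi> t \<in> carrier P" unfolding \<phi>_def using rep(1)[OF t] by simp
      have "\<phi> (t \<otimes>\<^bsub>gal_group \<Omega> L F\<^esub> u) = \<phi> (restrict (rep t \<otimes>\<^bsub>\<Gamma>\<^esub> rep u) L)"
        using R(3)[OF rep(1)[OF t] rep(1)[OF u]] rep(2)[OF t] rep(2)[OF u] by simp
      also have "\<dots> = \<Phi> (rep t \<otimes>\<^bsub>\<Gamma>\<^esub> rep u)" using \<phi>r rep(1)[OF t] rep(1)[OF u] by simp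
      finally show "\<phi> (t \<otimes>\<^bsub>gal_group \<Omega> L F\<^esub> u) = \<phi> t \<otimes>\<^bsub>P\<^esub> \<phi> u"
        unfolding \<phi>_def using rep(1)[OF t] rep(1)[OF u] by simp
    qed
    show "bij_betw \<phi> (carrier (gal_group \<Omega> L F)) (carrier P)"
    proof (rule bij_betwI')
      fix t u assume t: "t \<in> carrier (gal_group \<Omega> L F)" and u: "u \<in> carrier (gal_group \<Omega> L F)"
      show "\<phi> t = \<phi> u \<longleftrightarrow> t = u"
        unfolding \<phi>_def eq[OF rep(1)[OF t] rep(1)[OF u]] rep(2)[OF t] rep(2)[OF u] ..
      show "\<phi> t \<in> carrier P" unfolding \<phi>_def using rep(1)[OF t] by simp
    next
      fix y assume "y \<in> carrier P"
      then obtain s where s: "s \<in> auts F" "y = \<Phi> s" using \<Phi>(2) by blast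
      then show "\<exists>t\<in>carrier (gal_group \<Omega> L F). y = \<phi> t" by (intro bexI[of _ "restrict s L"]) (simp_all add: R(1) \<phi>r)
    qed
  qed
  moreover have "snd (\<phi> t) = \<theta> (restrict t K)" if t: "t \<in> carrier (gal_group \<Omega> L F)" for t
  proof -
    have "restrict (restrict (rep t) L) K = restrict (rep t) K" using KL by (auto simp: restrict_def fun_eq_iff)
    then show ?thesis unfolding \<phi>_def using \<Phi>(3) rep[OF t] unfolding cl_def by simp
  qed
  ultimately have "\<exists>\<phi>\<in>iso (gal_group \<Omega> L F) P. \<forall>t\<in>carrier (gal_group \<Omega> L F). snd (\<phi> t) = \<theta> (restrict t K)"
    by (intro bexI[of _ \<phi>] ballI)
  then have "L \<in> embedding_solutions \<Omega> F K \<theta> P snd"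
    unfolding embedding_solutions_def using Lg KL by simp
  then show "fixf U \<in> embedding_solutions \<Omega> F K \<theta> P snd" unfolding L_def .
qed

lemma nu_quotients:
  assumes \<tau>: "\<tau> \<in> auts F" "cl \<tau> = 1" and fin: "finite (carrier P)" and P: "group P"
  shows "nu \<Omega> F K \<theta> P snd = ecard (cyclic_quotient.quotients \<Gamma> cl opens P)"
proof -
  have "bij_betw stab (embedding_solutions \<Omega> F K \<theta> P snd) (cyclic_quotient.quotients \<Gamma> cl opens P)"
  proof (rule bij_betw_byWitness[where f' = fixf])
    show "\<forall>L\<in>embedding_solutions \<Omega> F K \<theta> P snd. fixf (stab L) = L"
      unfolding embedding_solutions_def using fixf_stab_galois by blast
  qed (use solution_stab[OF \<tau> fin P] quotient_fixed_field[OF \<tau> P] in auto)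
  then have "ecard (embedding_solutions \<Omega> F K \<theta> P snd) = ecard (cyclic_quotient.quotients \<Gamma> cl opens P)"
    by (rule ecard_bij)
  then show ?thesis unfolding nu_def ecard_def Let_def .
qed

end

section \<open>The norm equation in characteristic \<open>p\<close>\<close>

text \<open>Set \<open>\<chi>(n \<tau>\<^sup>j) = h(n)\<close>. Invariance of \<open>h\<close> makes this multiplicative up to the carry \<open>\<tau>\<^sup>p\<close>, where
  \<open>h\<close> vanishes.\<close>

lemma (in cyclic_quotient) extend_character:
  assumes h: "smooth_hom h" and v: "vanish (Dl h)" and t: "int p dvd h (\<tau> [^] p)"
  shows "\<exists>\<chi>. (\<forall>n\<in>N. \<chi> n = h n) \<and> \<chi> \<tau> mod int p = 0 \<and>
    (\<forall>g\<in>carrier G. \<forall>k\<in>carrier G. \<chi> (g \<otimes> k) mod int p = (\<chi> g + \<chi> k) mod int p)"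
proof -
  define \<chi> where "\<chi> g = h (npart g)" for g
  have "\<chi> n = h n" if "n \<in> N" for n unfolding \<chi>_def npart_N[OF that] ..
  moreover have "npart \<tau> = \<one>" using npart_eqI(1)[OF N_one, of \<tau> 1] tau p_pos(3) by simp
  then have "\<chi> \<tau> mod int p = 0" using smooth_hom_one[OF h] unfolding \<chi>_def by simp
  moreover have "\<chi> (g \<otimes> k) mod int p = (\<chi> g + \<chi> k) mod int p" if g: "g \<in> carrier G" and k: "k \<in> carrier G" for g k
  proof -
    define i where "i = nat (c g)"
    obtain e where e: "e = \<one> \<or> e = \<tau> [^] p" "npart (g \<otimes> k) = npart g \<otimes> (conj ^^ i) (npart k) \<otimes> e"
      using npart_mult[OF g k] unfolding i_def by blast
    have eN: "e \<in> N" and he: "int p dvd h e" using e(1) N_one tau_p_N t smooth_hom_one[OF h] by auto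
    note a = npart(1)[OF g] and b = npart(1)[OF k]
    have hc: "int p dvd h ((conj ^^ j) n) - h n" if n: "n \<in> N" for j n
    proof (induct j)
      case 0 then show ?case by simp
    next
      case (Suc j)
      have "int p dvd Dl h ((conj ^^ j) n) + (h ((conj ^^ j) n) - h n)"
        using v conj_pow_N[OF n, of j] Suc unfolding vanish_def by (intro dvd_add) auto
      then show ?case by (simp add: Dl_def)
    qed
    have cN: "(conj ^^ i) (npart k) \<in> N" by (rule conj_pow_N[OF b])
    have "int p dvd (h (npart g \<otimes> (conj ^^ i) (npart k) \<otimes> e) - (h (npart g \<otimes> (conj ^^ i) (npart k)) + h e))
      + (h (npart g \<otimes> (conj ^^ i) (npart k)) - (h (npart g) + h ((conj ^^ i) (npart k)))) 
      + (h ((conj ^^ i) (npart k)) - h (npart k)) + h e"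
      by (intro dvd_add smooth_hom_mult[OF h] N_mult a cN eN he hc b)
    then have "int p dvd h (npart (g \<otimes> k)) - (h (npart g) + h (npart k))" unfolding e(2) by (simp add: algebra_simps)
    then show ?thesis unfolding \<chi>_def by (simp add: mod_eq_dvd_iff)
  qed
  ultimately show ?thesis by (intro exI[of _ \<chi>] conjI ballI)
qed

context galois_closure
begin

lemma finsum_additive:
  assumes "finite A" "\<And>a. a \<in> A \<Longrightarrow> f a \<in> carrier \<Omega>"
    and h: "\<And>u. u \<in> carrier \<Omega> \<Longrightarrow> h u \<in> carrier \<Omega>" "h \<zero> = \<zero>"
      "\<And>u v. u \<in> carrier \<Omega> \<Longrightarrow> v \<in> carrier \<Omega> \<Longrightarrow> h (u \<oplus> v) = h u \<oplus> h v"
  shows "h (\<Oplus>a\<in>A. f a) = (\<Oplus>a\<in>A. h (f a))"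
  using assms(1,2)
proof (induct A rule: finite_induct)
  case empty then show ?case using h by simp
next
  case (insert a A)
  have c: "f \<in> A \<rightarrow> carrier \<Omega>" "f a \<in> carrier \<Omega>" "(\<lambda>a. h (f a)) \<in> A \<rightarrow> carrier \<Omega>" using insert h by auto
  have "h (\<Oplus>a\<in>insert a A. f a) = h (f a) \<oplus> h (\<Oplus>a\<in>A. f a)"
    using insert c by (simp add: h finsum_insert)
  also have "\<dots> = (\<Oplus>a\<in>insert a A. h (f a))" using insert c h by (simp add: finsum_insert)
  finally show ?case .
qed

lemma finsum_cyclic_shift:
  assumes f: "\<And>i::nat. f i \<in> carrier \<Omega>" and e: "f p = f 0"
  shows "(\<Oplus>i\<in>{..<p}. f (Suc i)) = (\<Oplus>i\<in>{..<p}. f i)"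
proof (cases p)
  case 0 then show ?thesis by simp
next
  case (Suc m)
  have "(\<Oplus>i\<in>{..m}. f (Suc i)) \<oplus> f 0 = (\<Oplus>i\<in>{..Suc m}. f i)" using f by (subst finsum_Suc2) auto
  also have "\<dots> = f (Suc m) \<oplus> (\<Oplus>i\<in>{..m}. f i)" using f by (subst finsum_Suc) auto
  also have "\<dots> = (\<Oplus>i\<in>{..m}. f i) \<oplus> f 0" using f e Suc by (simp add: a_comm)
  finally have "(\<Oplus>i\<in>{..m}. f (Suc i)) = (\<Oplus>i\<in>{..m}. f i)" using f by (simp add: add.r_cancel)
  then show ?thesis unfolding Suc lessThan_Suc_atMost .
qed

context
  fixes p :: nat assumes p: "prime p" and char: "nmul p \<one> = \<zero>"
begin

lemma cst_sum: "finite A \<Longrightarrow> (\<Oplus>i\<in>A. cst p (u i)) = cst p (\<Sum>i\<in>A. u i)"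
  by (induct A rule: finite_induct) (simp_all add: cst_0[OF p char] cst_add[OF p char] Pi_iff)

lemma artin_schreier_add:
  assumes "u \<in> carrier \<Omega>" "v \<in> carrier \<Omega>"
  shows "(u \<oplus> v) [^] p \<ominus> (u \<oplus> v) = (u [^] p \<ominus> u) \<oplus> (v [^] p \<ominus> v)"
proof -
  have "(u \<oplus> v) [^] p = u [^] p \<oplus> v [^] p" by (rule frobenius_add[OF char_exp_p[OF p char] assms])
  then show ?thesis using assms by (simp add: minus_eq minus_add a_ac)
qed

lemma artin_schreier_cst: "cst p k [^] p = cst p k"
  unfolding cst_def by (rule nmul_pow[OF p char])

text \<open>The map \<open>u \<mapsto> u\<^sup>p - u\<close> is additive with kernel the prime field.\<close>

lemma artin_schreier_fibre:
  assumes u: "u \<in> carrier \<Omega>" and v: "v \<in> carrier \<Omega>" and e: "u [^] p \<ominus> u = v [^] p \<ominus> v"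
  obtains k where "u = v \<oplus> cst p k"
proof -
  define d where "d = u \<ominus> v"
  have d: "d \<in> carrier \<Omega>" "u = v \<oplus> d" using u v unfolding d_def by (simp_all add: minus_eq a_comm[of v] a_assoc l_neg)
  have "(v [^] p \<ominus> v) \<oplus> (d [^] p \<ominus> d) = v [^] p \<ominus> v" using e unfolding d(2) artin_schreier_add[OF v d(1)] .
  then have "d [^] p \<ominus> d = \<zero>" using v d by simp
  then have "d [^] p = d" using d by simp
  then obtain k where "d = cst p k" using frobenius_fixed_cst[OF p char d(1)] by blast
  then show ?thesis using that d(2) by blast
qed

end
end

locale cyclic_extension_lift = cyclic_extension +
  fixes \<tau> assumes tau: "\<tau> \<in> auts F" "cl \<tau> = 1"
begin

sublocale CQ: cyclic_quotient \<Gamma> p cl \<tau> opens by (rule cyclic_quotient_\<Gamma>[OF tau])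

text \<open>The action of \<open>\<sigma>\<^sup>-\<^sup>i\<close> on \<open>\<Omega>\<close> through the chosen lift. The inverse makes \<open>n\<close> commute past it as
  \<open>\<tau>\<^sup>i n \<tau>\<^sup>-\<^sup>i\<close>, see \<open>sg_conj\<close>, which is the conjugation in the norm of a character.\<close>

definition sg :: "nat \<Rightarrow> 'a \<Rightarrow> 'a" where "sg i = inv\<^bsub>\<Gamma>\<^esub> (\<tau> [^]\<^bsub>\<Gamma>\<^esub> i)"

lemma sg_aut: "sg i \<in> auts F" unfolding sg_def using tau by simp

lemma sg_0: "x \<in> carrier \<Omega> \<Longrightarrow> sg 0 x = x" 
proof -
  assume x: "x \<in> carrier \<Omega>"
  have "sg 0 = \<one>\<^bsub>\<Gamma>\<^esub>" unfolding sg_def by (simp only: CQ.nat_pow_0 CQ.inv_one)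
  then show ?thesis using x by (simp add: gal_group_one)
qed

lemma sg_Suc: assumes x: "x \<in> carrier \<Omega>" shows "sg (Suc i) x = sg 1 (sg i x)"
proof -
  have "\<tau> [^]\<^bsub>\<Gamma>\<^esub> Suc i = \<tau> [^]\<^bsub>\<Gamma>\<^esub> i \<otimes>\<^bsub>\<Gamma>\<^esub> \<tau> [^]\<^bsub>\<Gamma>\<^esub> (1::nat)" using tau by simp
  then have "sg (Suc i) = sg 1 \<otimes>\<^bsub>\<Gamma>\<^esub> sg i" unfolding sg_def using tau by (simp only: CQ.inv_mult_group CQ.nat_pow_closed)
  then show ?thesis using auts_mult[OF sg_aut sg_aut x] by simp
qed

lemma N_K: "n \<in> CQ.N \<longleftrightarrow> n \<in> stab K"
  unfolding CQ.N_def using cl_zero_iff unfolding stab_def by blast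

lemma N_auts: "n \<in> CQ.N \<Longrightarrow> n \<in> auts F" by (rule CQ.N_carrier)

lemma sg_p: assumes x: "x \<in> K" shows "sg p x = x"
proof -
  have "sg p \<in> stab K" unfolding sg_def using CQ.N_inv[OF CQ.tau_p_N] N_K by simp
  then show ?thesis using x unfolding stab_def by blast
qed

lemma sg_conj:
  assumes n: "n \<in> CQ.N" and x: "x \<in> carrier \<Omega>"
  shows "n (sg i x) = sg i ((CQ.conj ^^ i) n x)"
proof -
  let ?t = "\<tau> [^]\<^bsub>\<Gamma>\<^esub> i" and ?m = "(CQ.conj ^^ i) n"
  have t: "?t \<in> auts F" using tau by simp
  have nG: "n \<in> auts F" by (rule N_auts[OF n])
  have m: "?m \<in> auts F" by (rule N_auts[OF CQ.conj_pow_N[OF n]])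
  have "?t \<otimes>\<^bsub>\<Gamma>\<^esub> n = ?m \<otimes>\<^bsub>\<Gamma>\<^esub> ?t" by (rule CQ.tau_pow_conj[OF nG])
  then have "?t (n (sg i x)) = ?m (?t (sg i x))"
    using auts_mult[OF t nG, of "sg i x"] auts_mult[OF m t, of "sg i x"] aut_closed[OF sg_aut x] by simp
  also have "?t (sg i x) = x" unfolding sg_def by (rule auts_inv1(2)[OF F_sub t x])
  finally have "sg i (?t (n (sg i x))) = sg i (?m x)" by simp
  moreover have "sg i (?t (n (sg i x))) = n (sg i x)"
    unfolding sg_def by (rule auts_inv1(1)[OF F_sub t aut_closed[OF nG aut_closed[OF sg_aut x, unfolded sg_def]]])
  ultimately show ?thesis by simp
qed

lemma K_carrier: "x \<in> K \<Longrightarrow> x \<in> carrier \<Omega>"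
  using galois_sub_S[OF K] S_carrier by blast

lemma K_subfield: "subfield K \<Omega>" using K unfolding galois_extension_def by blast

lemmas K_ring = subringE[OF subfieldE(1)[OF K_subfield]]

text \<open>Independence of the powers of \<open>\<sigma>\<close> on \<open>K\<close> gives an element of nonzero trace; the trace is fixed by
  \<open>\<sigma>\<close>, so one may divide by it.\<close>

lemma trace_one: obtains x where "x \<in> K" "(\<Oplus>i\<in>{..<p}. sg i x) = \<one>"
proof -
  define r where "r i = restrict (sg i) K" for i
  have cs: "cl (sg i) = (- int i) mod int p" for i
  proof -
    have "cl (sg i) = (- (int i mod int p)) mod int p"
      unfolding sg_def using CQ.c_inv[of "\<tau> [^]\<^bsub>\<Gamma>\<^esub> i"] tau CQ.c_tau_pow[of i] by simp
    then show ?thesis by (simp add: mod_minus_eq)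
  qed
  have inj: "inj_on r {..<p}"
  proof (rule inj_onI)
    fix i j assume i: "i \<in> {..<p}" and j: "j \<in> {..<p}" and e: "r i = r j"
    have "cl (sg i) = cl (sg j)" using e unfolding r_def cl_def by simp
    then have "(- int i) mod int p = (- int j) mod int p" unfolding cs .
    then have "int p dvd - int i - - int j" by (simp only: mod_eq_dvd_iff)
    then have "int p dvd int j - int i" by simp
    then have "int j mod int p = int i mod int p" by (simp only: mod_eq_dvd_iff)
    then show "i = j" using i j by simp
  qed
  have "\<exists>x\<in>K. (\<Oplus>t\<in>r ` {..<p}. \<one> \<otimes> t x) \<noteq> \<zero>"
  proof (rule ccontr)
    assume "\<not> ?thesis"
    then have rel: "\<And>x. x \<in> K \<Longrightarrow> (\<Oplus>t\<in>r ` {..<p}. \<one> \<otimes> t x) = \<zero>" by blast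
    have "\<one> = \<zero>"
    proof (rule dedekind_independence[where T = "r ` {..<p}" and E = K and a = "\<lambda>_. \<one>" and t = "r 0"])
      show "\<one> \<in> K" by (rule K_ring(3))
      show "x \<otimes> y \<in> K" if "x \<in> K" "y \<in> K" for x y using K_ring(6) that by blast
      show "t x \<in> carrier \<Omega>" if "t \<in> r ` {..<p}" "x \<in> K" for t x
        using that aut_closed[OF sg_aut] K_carrier unfolding r_def by auto
      show "t (x \<otimes> y) = t x \<otimes> t y" if "t \<in> r ` {..<p}" "x \<in> K" "y \<in> K" for t x y
        using that aut_mult[OF sg_aut] K_carrier K_ring(6) unfolding r_def by auto
      show "t \<one> = \<one>" if "t \<in> r ` {..<p}" for t
        using that aut_one[OF sg_aut] K_ring(3) unfolding r_def by auto
      show "\<exists>x\<in>K. t x \<noteq> t' x" if t: "t \<in> r ` {..<p}" "t' \<in> r ` {..<p}" and ne: "t \<noteq> t'" for t t'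
      proof (rule ccontr)
        assume "\<not> ?thesis"
        then have e: "\<forall>x\<in>K. t x = t' x" by blast
        have "t \<in> extensional K" "t' \<in> extensional K" using t unfolding r_def by auto
        then have "t = t'" using e by (intro extensionalityI) auto
        then show False using ne by simp
      qed
      show "r 0 \<in> r ` {..<p}" using p_pos by simp
    qed (use rel in auto)
    then show False using one_not_zero by simp
  qed
  then obtain x where x: "x \<in> K" "(\<Oplus>t\<in>r ` {..<p}. \<one> \<otimes> t x) \<noteq> \<zero>" by blast
  note xc = K_carrier[OF x(1)]
  define T where "T = (\<Oplus>i\<in>{..<p}. sg i x)"
  have Tc: "T \<in> carrier \<Omega>" unfolding T_def using aut_closed[OF sg_aut xc] by (intro finsum_closed) simp
  have "(\<Oplus>t\<in>r ` {..<p}. \<one> \<otimes> t x) = (\<Oplus>i\<in>{..<p}. \<one> \<otimes> r i x)"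
    by (rule finsum_reindex[OF _ inj]) (use x(1) xc aut_closed[OF sg_aut] in \<open>auto simp: r_def\<close>)
  also have "\<dots> = T" unfolding T_def
    by (rule finsum_cong') (use x(1) xc aut_closed[OF sg_aut] in \<open>auto simp: r_def\<close>)
  finally have T0: "T \<noteq> \<zero>" using x(2) by simp
  have sgK: "sg i u \<in> K" if "u \<in> K" for i u using galois_normal[OF K that sg_aut] .
  have finK: "(\<Oplus>i\<in>A. sg i u) \<in> K" if "u \<in> K" "finite A" for u and A :: "nat set"
    using that(2)
  proof (induct A rule: finite_induct)
    case empty then show ?case using K_ring(2) by simp
  next
    case (insert a A)
    then show ?case using K_ring(7) sgK[OF that(1)] K_carrier[OF sgK[OF that(1)]] by (simp add: Pi_iff)
  qed
  have TK: "T \<in> K" unfolding T_def by (rule finK[OF x(1)]) simp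
  have s1: "sg 1 T = T"
  proof -
    have "sg 1 T = (\<Oplus>i\<in>{..<p}. sg 1 (sg i x))" unfolding T_def
      by (rule aut_finsum[OF sg_aut]) (use aut_closed[OF sg_aut xc] in auto)
    also have "\<dots> = (\<Oplus>i\<in>{..<p}. sg (Suc i) x)" by (simp only: sg_Suc[OF xc])
    also have "\<dots> = T" unfolding T_def
      by (rule finsum_cyclic_shift) (use aut_closed[OF sg_aut xc] sg_p[OF x(1)] sg_0[OF xc] in auto)
    finally show ?thesis .
  qed
  have sT: "sg i T = T" for i
  proof (induct i)
    case 0
    show ?case by (rule sg_0[OF Tc])
  next
    case (Suc i)
    then show ?case unfolding sg_Suc[OF Tc] by (simp only: s1)
  qed
  have iT: "inv T \<in> K" "inv T \<in> carrier \<Omega>" using inv_in_subfield[OF K_subfield TK T0] K_carrier by auto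
  have Tu: "T \<in> Units \<Omega>" using Tc T0 field_Units by simp
  have siT: "sg i (inv T) = inv T" for i
  proof -
    have "sg i (T \<otimes> inv T) = T \<otimes> sg i (inv T)" using aut_mult[OF sg_aut Tc iT(2)] sT by simp
    then have "T \<otimes> sg i (inv T) = \<one>" using Tu aut_one[OF sg_aut] by simp
    then show ?thesis using Tu Tc aut_closed[OF sg_aut iT(2), of i] by (metis comm_inv_char)
  qed
  have "(\<Oplus>i\<in>{..<p}. sg i (x \<otimes> inv T)) = (\<Oplus>i\<in>{..<p}. sg i x \<otimes> inv T)"
    by (rule finsum_cong') (use aut_mult[OF sg_aut xc iT(2)] siT aut_closed[OF sg_aut xc] iT in auto)
  also have "\<dots> = (\<Oplus>i\<in>{..<p}. sg i x) \<otimes> inv T"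
    by (rule finsum_ldistr[symmetric]) (use aut_closed[OF sg_aut xc] iT in auto)
  also have "\<dots> = \<one>" unfolding T_def[symmetric] using Tu by simp
  finally show ?thesis using that K_ring(6)[OF x(1) iT(1)] by blast
qed

lemma smooth_open_set:
  assumes "CQ.smooth_hom h"
  obtains B where "finite B" "B \<subseteq> \<S>" "stab B \<subseteq> CQ.N" "\<forall>n\<in>stab B. int p dvd h n"
proof -
  obtain U where U: "U \<in> opens" "\<forall>n\<in>U. int p dvd h n" using assms unfolding CQ.smooth_hom_def by blast
  obtain B where B: "U = stab B" "finite B" "B \<subseteq> \<S>" using U(1) unfolding opens_def by blast
  then show ?thesis using that[OF B(2,3)] CQ.open_N[OF U(1)] U(2) by simp
qed

text \<open>Let \<open>y\<close> satisfy \<open>s y = y + \<chi>(s)\<close>, so that \<open>b = y\<^sup>p - y\<close> is fixed by all automorphisms, and let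
  \<open>a = b x\<close> with \<open>x \<in> K\<close> of trace \<open>1\<close>. If \<open>w\<^sup>p - w = a\<close> and \<open>W\<close> is the sum of the \<open>\<sigma>\<^sup>-\<^sup>i w\<close>, then
  \<open>W\<^sup>p - W = b\<close>, so \<open>W - y\<close> is in the prime field. Hence \<open>n W - W = \<chi>(n)\<close>, and the left side is the norm
  of the character \<open>n \<mapsto> n w - w\<close>.\<close>

lemma norm_equation_char_p:
  assumes char: "nmul p \<one> = \<zero>"
    and f: "CQ.smooth_hom f" "CQ.vanish ((CQ.Dl ^^ 2) f)" "int p dvd f (\<tau> [^]\<^bsub>\<Gamma>\<^esub> p)"
  shows "\<exists>g. CQ.smooth_hom g \<and> CQ.vanish (\<lambda>n. (\<Sum>i<p. g ((CQ.conj ^^ i) n)) - CQ.Dl f n)"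
proof -
  note pc = prime_p char
  let ?h = "CQ.Dl f"
  have h: "CQ.smooth_hom ?h" by (rule CQ.smooth_hom_Dl[OF f(1)])
  have hv: "CQ.vanish (CQ.Dl ?h)" using f(2) by (simp add: numeral_2_eq_2)
  have ht: "int p dvd ?h (\<tau> [^]\<^bsub>\<Gamma>\<^esub> p)" using CQ.act_tau_p(1)[of f 1] f(3) by simp
  obtain \<chi> where \<chi>': "\<forall>n\<in>CQ.N. \<chi> n = ?h n" 
    "\<forall>s\<in>auts F. \<forall>t\<in>auts F. \<chi> (s \<otimes>\<^bsub>\<Gamma>\<^esub> t) mod int p = (\<chi> s + \<chi> t) mod int p"
    using CQ.extend_character[OF h hv ht] by (elim exE conjE)
  note \<chi> = bspec[OF \<chi>'(1)]
  obtain B where B: "finite B" "B \<subseteq> \<S>" "stab B \<subseteq> CQ.N" "\<forall>n\<in>stab B. int p dvd ?h n"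
    by (rule smooth_open_set[OF h])
  have "character_on p (auts F) B \<chi>" unfolding character_on_def 
  proof (intro conjI ballI)
    fix s assume s: "s \<in> auts F \<inter> stab B"
    then have "\<chi> s = ?h s" using \<chi> B(3) by blast
    then show "\<chi> s mod int p = 0" using B(4) s by simp
  qed (use \<chi>'(2) in simp)
  then obtain y where y: "y \<in> \<S>" "\<And>s. s \<in> auts F \<Longrightarrow> s y = y \<oplus> cst p (\<chi> s)"
    using hilbert90_add[OF B(1,2) CQ.subgroup_self _ pc] by blast
  have yc: "y \<in> carrier \<Omega>" by (rule S_carrier[OF y(1)])
  define b where "b = y [^] p \<ominus> y"
  have bS: "b \<in> \<S>" unfolding b_def minus_eq
    using S_ring(5)[OF y(1)] S_ring(7) pow_in_subring[OF subfieldE(1)[OF S_subfield] y(1)] by blast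
  have bc: "b \<in> carrier \<Omega>" by (rule S_carrier[OF bS])
  have AS: "s (u [^] p \<ominus> u) = (s u) [^] p \<ominus> s u" if "s \<in> auts F" "u \<in> carrier \<Omega>" for s u
    using that by (simp add: minus_eq aut_add[OF that(1)] aut_neg[OF that(1)] aut_pow[OF that(1)])
  have bF: "s b = b" if s: "s \<in> auts F" for s
  proof -
    have "s b = (y [^] p \<ominus> y) \<oplus> (cst p (\<chi> s) [^] p \<ominus> cst p (\<chi> s))"
      unfolding b_def AS[OF s yc] y(2)[OF s] by (rule artin_schreier_add[OF pc yc cst_closed])
    then show ?thesis using bc unfolding artin_schreier_cst[OF pc] b_def by (simp add: minus_eq r_neg)
  qed
  obtain x where x: "x \<in> K" "(\<Oplus>i\<in>{..<p}. sg i x) = \<one>" by (rule trace_one)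
  note xc = K_carrier[OF x(1)]
  define a where "a = b \<otimes> x"
  have aS: "a \<in> \<S>" unfolding a_def by (rule S_ring(6)[OF bS]) (use x(1) galois_sub_S[OF K] in blast)
  have ac: "a \<in> carrier \<Omega>" by (rule S_carrier[OF aS])
  obtain w where w: "w \<in> carrier \<Omega>" "w [^] p \<ominus> w = a"
    using artin_schreier_root_exists[OF ac, of p] p_pos(3) by auto
  have wS: "w \<in> \<S>" by (rule S_artin_schreier[OF pc w(1)]) (simp add: w(2) aS)
  have ex: "\<exists>k. n w = w \<oplus> cst p k" if n: "n \<in> CQ.N" for n
  proof -
    have nG: "n \<in> auts F" by (rule N_auts[OF n])
    have "n x = x" using n x(1) unfolding N_K stab_def by blast
    then have "n a = a" unfolding a_def using aut_mult[OF nG bc xc] bF[OF nG] by simp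
    then have "(n w) [^] p \<ominus> n w = w [^] p \<ominus> w" using AS[OF nG w(1)] w(2) by simp
    then show ?thesis using artin_schreier_fibre[OF pc aut_closed[OF nG w(1)] w(1)] by metis
  qed
  define g where "g n = (SOME k. n w = w \<oplus> cst p k)" for n
  have g: "n w = w \<oplus> cst p (g n)" if "n \<in> CQ.N" for n
    unfolding g_def using someI_ex[OF ex[OF that]] .
  have gs: "CQ.smooth_hom g" unfolding CQ.smooth_hom_def
  proof (intro conjI ballI)
    fix m n assume m: "m \<in> CQ.N" and n: "n \<in> CQ.N"
    note mG = N_auts[OF m] and nG = N_auts[OF n]
    have "w \<oplus> cst p (g (m \<otimes>\<^bsub>\<Gamma>\<^esub> n)) = m (n w)"
      using g[OF CQ.N_mult[OF m n]] auts_mult[OF mG nG w(1)] by simp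
    also have "\<dots> = w \<oplus> cst p (g m) \<oplus> cst p (g n)"
      unfolding g[OF n] using aut_add[OF mG w(1) cst_closed] g[OF m] aut_cst[OF mG] by simp
    also have "\<dots> = w \<oplus> cst p (g m + g n)" using w(1) by (simp add: cst_add[OF pc] a_assoc)
    finally have "cst p (g (m \<otimes>\<^bsub>\<Gamma>\<^esub> n)) = cst p (g m + g n)" using w(1) by simp
    then show "int p dvd g (m \<otimes>\<^bsub>\<Gamma>\<^esub> n) - (g m + g n)"
      using cst_inj[OF pc] by (simp add: mod_eq_dvd_iff)
  next
    obtain U where U: "U \<in> opens" "U \<subseteq> stab {w}" using open_inside[of "{w}"] wS by auto
    have "int p dvd g n" if n: "n \<in> U" for n
    proof -
      have nN: "n \<in> CQ.N" using CQ.open_N[OF U(1)] n by blast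
      have "n w = w" using n U(2) unfolding stab_def by blast
      then have "cst p (g n) = \<zero>" using g[OF nN] w(1) by simp
      then show ?thesis using cst_eq_zero[OF pc] by blast
    qed
    then show "\<exists>U\<in>opens. \<forall>n\<in>U. int p dvd g n" using U(1) by blast
  qed
  define W where "W = (\<Oplus>i\<in>{..<p}. sg i w)"
  have sw: "sg i w \<in> carrier \<Omega>" for i by (rule aut_closed[OF sg_aut w(1)])
  have Wc: "W \<in> carrier \<Omega>" unfolding W_def using sw by (intro finsum_closed) simp
  have "W [^] p \<ominus> W = (\<Oplus>i\<in>{..<p}. (sg i w) [^] p \<ominus> sg i w)"
    unfolding W_def by (rule finsum_additive[where h = "\<lambda>u. u [^] p \<ominus> u"])
      (use sw artin_schreier_add[OF pc] p_pos in \<open>auto simp: nat_pow_zero minus_eq\<close>)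
  also have "\<dots> = (\<Oplus>i\<in>{..<p}. b \<otimes> sg i x)"
  proof (rule finsum_cong')
    show "(sg i w) [^] p \<ominus> sg i w = b \<otimes> sg i x" for i
      using AS[OF sg_aut w(1)] w(2) aut_mult[OF sg_aut bc xc] bF[OF sg_aut] unfolding a_def by simp
  qed (use bc aut_closed[OF sg_aut xc] in auto)
  also have "\<dots> = b \<otimes> (\<Oplus>i\<in>{..<p}. sg i x)"
    by (rule finsum_rdistr[symmetric]) (use bc aut_closed[OF sg_aut xc] in auto)
  also have "\<dots> = y [^] p \<ominus> y" unfolding x(2) using bc b_def by simp
  finally obtain k where k: "W = y \<oplus> cst p k" using artin_schreier_fibre[OF pc Wc yc] by blast
  have "int p dvd (\<Sum>i<p. g ((CQ.conj ^^ i) n)) - ?h n" if n: "n \<in> CQ.N" for n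
  proof -
    note nG = N_auts[OF n]
    have "n W = (\<Oplus>i\<in>{..<p}. n (sg i w))" unfolding W_def
      by (rule aut_finsum[OF nG]) (use sw in auto)
    also have "\<dots> = (\<Oplus>i\<in>{..<p}. sg i w \<oplus> cst p (g ((CQ.conj ^^ i) n)))"
    proof (rule finsum_cong')
      fix i
      have "n (sg i w) = sg i ((CQ.conj ^^ i) n w)" by (rule sg_conj[OF n w(1)])
      also have "\<dots> = sg i (w \<oplus> cst p (g ((CQ.conj ^^ i) n)))" using g[OF CQ.conj_pow_N[OF n]] by simp
      also have "\<dots> = sg i w \<oplus> cst p (g ((CQ.conj ^^ i) n))"
        using aut_add[OF sg_aut w(1) cst_closed] aut_cst[OF sg_aut] by simp
      finally show "n (sg i w) = sg i w \<oplus> cst p (g ((CQ.conj ^^ i) n))" .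
    qed (use sw in auto)
    also have "\<dots> = W \<oplus> (\<Oplus>i\<in>{..<p}. cst p (g ((CQ.conj ^^ i) n)))"
      unfolding W_def by (rule finsum_addf) (use sw in auto)
    also have "\<dots> = W \<oplus> cst p (\<Sum>i<p. g ((CQ.conj ^^ i) n))" by (simp only: cst_sum[OF pc finite_lessThan])
    finally have 1: "n W = W \<oplus> cst p (\<Sum>i<p. g ((CQ.conj ^^ i) n))" .
    have "n W = y \<oplus> cst p (\<chi> n) \<oplus> cst p k"
      unfolding k using aut_add[OF nG yc cst_closed] y(2)[OF nG] aut_cst[OF nG] by simp
    also have "\<dots> = W \<oplus> cst p (\<chi> n)" unfolding k using yc by (simp add: a_ac)
    finally have "cst p (\<Sum>i<p. g ((CQ.conj ^^ i) n)) = cst p (\<chi> n)" using 1 Wc by simp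
    then show ?thesis using cst_inj[OF pc] \<chi>[OF n] by (simp add: mod_eq_dvd_iff)
  qed
  then show ?thesis using gs unfolding CQ.vanish_def by blast
qed

end

context cyclic_quotient
begin

section \<open>Transfer from a subgroup of index prime to \<open>p\<close>\<close>

lemma conj_pow_mult: "m \<in> N \<Longrightarrow> n \<in> N \<Longrightarrow> (conj ^^ i) (m \<otimes> n) = (conj ^^ i) m \<otimes> (conj ^^ i) n"
  by (induct i) (simp_all add: conj_mult N_carrier conj_pow_N)

text \<open>Here \<open>\<omega>\<close> is a homomorphism \<open>N \<rightarrow> (\<int>/p)\<^sup>\<times>\<close> invariant under conjugation by \<open>\<tau>\<close>, and \<open>g'\<close> solves the
  norm equation on its kernel. Let \<open>\<rho>(\<delta>) \<in> N\<close> be a preimage of \<open>\<delta>\<close>. The transfer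
  \<open>\<Sum>\<^sub>\<delta> g'(\<rho>(\<omega>(n) \<delta>)\<^sup>-\<^sup>1 n \<rho>(\<delta>))\<close> is a character of \<open>N\<close>, and its norm is
  \<open>\<Sum>\<^sub>\<delta> h(\<rho>(\<omega>(n) \<delta>)\<^sup>-\<^sup>1 n \<rho>(\<delta>))\<close>, that is \<open>h(n)\<close> times the number of the \<open>\<delta>\<close>: conjugating by \<open>\<tau>\<^sup>i\<close>
  changes the representatives \<open>\<rho>(\<delta>)\<close> by elements of the kernel, and these changes cancel in the sum.
  This number is less than \<open>p\<close>, so one can divide by it.\<close>

lemma transfer_norm:
  fixes \<omega> :: "'g \<Rightarrow> int"
  assumes om: "\<And>n. n \<in> N \<Longrightarrow> \<omega> n \<in> {0..<int p}"
    and om_mult: "\<And>m n. m \<in> N \<Longrightarrow> n \<in> N \<Longrightarrow> \<omega> (m \<otimes> n) = \<omega> m * \<omega> n mod int p"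
    and om_conj: "\<And>n. n \<in> N \<Longrightarrow> \<omega> (conj n) = \<omega> n"
    and om_nonzero: "\<And>n. n \<in> N \<Longrightarrow> \<omega> n \<noteq> 0"
    and h: "smooth_hom h"
    and g': "\<And>m n. m \<in> N \<Longrightarrow> n \<in> N \<Longrightarrow> \<omega> m = 1 \<Longrightarrow> \<omega> n = 1 \<Longrightarrow> [g' (m \<otimes> n) = g' m + g' n] (mod int p)"
    and U: "U \<in> \<U>" "\<And>n. n \<in> U \<Longrightarrow> \<omega> n = 1" "\<And>n. n \<in> U \<Longrightarrow> int p dvd g' n"
    and norm: "\<And>n. n \<in> N \<Longrightarrow> \<omega> n = 1 \<Longrightarrow> [(\<Sum>i<p. g' ((conj ^^ i) n)) = h n] (mod int p)"
  shows "\<exists>g. smooth_hom g \<and> vanish (\<lambda>n. (\<Sum>i<p. g ((conj ^^ i) n)) - h n)"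
proof -
  interpret U: normal U G by (rule open_normal[OF U(1)])
  have om1: "\<omega> \<one> = 1" by (rule U(2)[OF U.one_closed])
  have om_pow: "\<omega> ((conj ^^ i) n) = \<omega> n" if "n \<in> N" for i n
    by (induct i) (simp_all add: om_conj conj_pow_N[OF that])
  have om_mod: "\<omega> n mod int p = \<omega> n" if "n \<in> N" for n using om[OF that] by simp
  have om_div: "\<omega> (inv a \<otimes> b) = 1" if "a \<in> N" "b \<in> N" "\<omega> a = \<omega> b" for a b
  proof -
    have "\<omega> (inv a \<otimes> b) = \<omega> (inv a \<otimes> a)" using om_mult[OF N_inv[OF that(1)]] that by simp
    then show ?thesis using om1 N_carrier[OF that(1)] by simp
  qed
  define \<Delta> where "\<Delta> = \<omega> ` N"
  have "\<Delta> \<subseteq> {0<..<int p}" unfolding \<Delta>_def using om om_nonzero by force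
  then have fin: "finite \<Delta>" and card_lt: "card \<Delta> \<le> p - 1"
    using finite_subset[of \<Delta> "{0<..<int p}"] card_mono[of "{0<..<int p}" \<Delta>] by auto
  have one\<Delta>: "1 \<in> \<Delta>" unfolding \<Delta>_def using om1 N_one by force
  then have card_gt: "card \<Delta> > 0" using fin card_gt_0_iff by blast
  have "coprime (int (card \<Delta>)) (int p)"
  proof -
    have "\<not> p dvd card \<Delta>" using card_lt card_gt p_pos(3) by (auto dest: dvd_imp_le)
    then have "coprime p (card \<Delta>)" using prime_p prime_imp_coprime by blast
    then show ?thesis by (simp add: coprime_commute)
  qed
  then obtain d' where d': "[int (card \<Delta>) * d' = 1] (mod int p)" using cong_solve_coprime_int by blast
  define \<rho> where "\<rho> \<delta> = (SOME m. m \<in> N \<and> \<omega> m = \<delta>)" for \<delta>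
  have \<rho>: "\<rho> \<delta> \<in> N" "\<omega> (\<rho> \<delta>) = \<delta>" if "\<delta> \<in> \<Delta>" for \<delta>
    using someI_ex[of "\<lambda>m. m \<in> N \<and> \<omega> m = \<delta>"] that unfolding \<rho>_def \<Delta>_def by blast+
  define \<mu> where "\<mu> n \<delta> = \<omega> n * \<delta> mod int p" for n \<delta>
  have \<mu>\<Delta>: "\<mu> n \<delta> \<in> \<Delta>" and \<mu>\<rho>: "\<mu> n \<delta> = \<omega> (n \<otimes> \<rho> \<delta>)" if n: "n \<in> N" and \<delta>: "\<delta> \<in> \<Delta>" for n \<delta>
  proof -
    show "\<mu> n \<delta> = \<omega> (n \<otimes> \<rho> \<delta>)" unfolding \<mu>_def using om_mult[OF n \<rho>(1)[OF \<delta>]] \<rho>(2)[OF \<delta>] by simp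
    then show "\<mu> n \<delta> \<in> \<Delta>" unfolding \<Delta>_def using N_mult[OF n \<rho>(1)[OF \<delta>]] by blast
  qed
  have \<mu>_mult: "\<mu> m (\<mu> n \<delta>) = \<mu> (m \<otimes> n) \<delta>" if "m \<in> N" "n \<in> N" for m n \<delta>
    unfolding \<mu>_def om_mult[OF that] by (simp add: mod_mult_left_eq mod_mult_right_eq mult.assoc)
  have \<mu>_one: "\<mu> n \<delta> = \<delta>" if "\<omega> n = 1" "\<delta> \<in> \<Delta>" for n \<delta>
    unfolding \<mu>_def using that om_mod[OF \<rho>(1)[OF that(2)]] \<rho>(2)[OF that(2)] by simp
  have shift: "(\<Sum>\<delta>\<in>\<Delta>. F (\<mu> n \<delta>)) = (\<Sum>\<delta>\<in>\<Delta>. F \<delta>)" if n: "n \<in> N" for n and F :: "int \<Rightarrow> int"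
  proof (rule sum.reindex_bij_witness[where i = "\<mu> (inv n)" and j = "\<mu> n"])
    note i = N_inv[OF n] and nc = N_carrier[OF n]
    show "\<mu> (inv n) (\<mu> n \<delta>) = \<delta>" if "\<delta> \<in> \<Delta>" for \<delta>
      unfolding \<mu>_mult[OF i n] by (rule \<mu>_one[OF _ that]) (simp add: nc om1)
    show "\<mu> n (\<mu> (inv n) \<delta>) = \<delta>" if "\<delta> \<in> \<Delta>" for \<delta>
      unfolding \<mu>_mult[OF n i] by (rule \<mu>_one[OF _ that]) (simp add: nc om1)
  qed (use \<mu>\<Delta> n N_inv in auto)
  define part where "part n \<delta> = inv (\<rho> (\<mu> n \<delta>)) \<otimes> (n \<otimes> \<rho> \<delta>)" for n \<delta>
  have part: "part n \<delta> \<in> N" "\<omega> (part n \<delta>) = 1" if n: "n \<in> N" and \<delta>: "\<delta> \<in> \<Delta>" for n \<delta>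
  proof -
    note r = \<rho>[OF \<mu>\<Delta>[OF n \<delta>]] and m = N_mult[OF n \<rho>(1)[OF \<delta>]]
    show "part n \<delta> \<in> N" unfolding part_def by (rule N_mult[OF N_inv[OF r(1)] m])
    show "\<omega> (part n \<delta>) = 1" unfolding part_def by (rule om_div[OF r(1) m trans[OF r(2) \<mu>\<rho>[OF n \<delta>]]])
  qed
  define g where "g n = d' * (\<Sum>\<delta>\<in>\<Delta>. g' (part n \<delta>))" for n
  have "smooth_hom g" unfolding smooth_hom_def
  proof (intro conjI ballI bexI[OF _ U(1)])
    fix m n assume m: "m \<in> N" and n: "n \<in> N"
    have "[g' (part (m \<otimes> n) \<delta>) = g' (part m (\<mu> n \<delta>)) + g' (part n \<delta>)] (mod int p)" if \<delta>: "\<delta> \<in> \<Delta>" for \<delta>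
    proof -
      note r = \<rho>(1)[OF \<delta>] \<rho>(1)[OF \<mu>\<Delta>[OF n \<delta>]] \<rho>(1)[OF \<mu>\<Delta>[OF m \<mu>\<Delta>[OF n \<delta>]]]
      have "part (m \<otimes> n) \<delta> = part m (\<mu> n \<delta>) \<otimes> part n \<delta>"
      proof -
        let ?a = "\<rho> (\<mu> (m \<otimes> n) \<delta>)" and ?b = "\<rho> (\<mu> n \<delta>)" and ?c = "\<rho> \<delta>"
        have car: "?a \<in> carrier G" "?b \<in> carrier G" "?c \<in> carrier G" "m \<in> carrier G" "n \<in> carrier G"
          using r m n N_carrier unfolding \<mu>_mult[OF m n] by auto
        have "inv ?a \<otimes> (m \<otimes> ?b) \<otimes> (inv ?b \<otimes> (n \<otimes> ?c)) = inv ?a \<otimes> (m \<otimes> ((?b \<otimes> inv ?b) \<otimes> (n \<otimes> ?c)))"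
          using car by (simp only: m_assoc inv_closed m_closed)
        also have "\<dots> = inv ?a \<otimes> (m \<otimes> n \<otimes> ?c)" using car by (simp add: m_assoc)
        finally show ?thesis unfolding part_def \<mu>_mult[OF m n] ..
      qed
      then show ?thesis using g' part[OF m \<mu>\<Delta>[OF n \<delta>]] part[OF n \<delta>] by simp
    qed
    then have "[(\<Sum>\<delta>\<in>\<Delta>. g' (part (m \<otimes> n) \<delta>)) = (\<Sum>\<delta>\<in>\<Delta>. g' (part m (\<mu> n \<delta>)) + g' (part n \<delta>))] (mod int p)"
      by (rule cong_sum)
    also have "(\<Sum>\<delta>\<in>\<Delta>. g' (part m (\<mu> n \<delta>)) + g' (part n \<delta>)) = (\<Sum>\<delta>\<in>\<Delta>. g' (part m \<delta>)) + (\<Sum>\<delta>\<in>\<Delta>. g' (part n \<delta>))"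
      unfolding sum.distrib shift[OF n, of "\<lambda>\<delta>. g' (part m \<delta>)"] ..
    finally have "[g (m \<otimes> n) = d' * ((\<Sum>\<delta>\<in>\<Delta>. g' (part m \<delta>)) + (\<Sum>\<delta>\<in>\<Delta>. g' (part n \<delta>)))] (mod int p)"
      unfolding g_def by (rule cong_scalar_left)
    then show "int p dvd g (m \<otimes> n) - (g m + g n)" unfolding cong_iff_dvd_diff g_def by (simp add: distrib_left)
  next
    fix n assume n: "n \<in> U"
    have nN: "n \<in> N" using open_N[OF U(1)] n by blast
    have "int p dvd g' (part n \<delta>)" if \<delta>: "\<delta> \<in> \<Delta>" for \<delta>
    proof -
      have "part n \<delta> = inv (\<rho> \<delta>) \<otimes> n \<otimes> \<rho> \<delta>"
        unfolding part_def \<mu>_one[OF U(2)[OF n] \<delta>] using N_carrier[OF nN] N_carrier[OF \<rho>(1)[OF \<delta>]] by (simp add: m_assoc)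
      then have "part n \<delta> \<in> U" using U.inv_op_closed1[OF N_carrier[OF \<rho>(1)[OF \<delta>]] n] by simp
      then show ?thesis by (rule U(3))
    qed
    then show "int p dvd g n" unfolding g_def by (intro dvd_mult dvd_sum)
  qed
  moreover have "int p dvd (\<Sum>i<p. g ((conj ^^ i) n)) - h n" if n: "n \<in> N" for n
  proof -
    \<comment> \<open>Conjugation by \<open>\<tau>\<^sup>i\<close> changes \<open>\<rho> \<delta>\<close> by the kernel element \<open>inv (\<rho> \<delta>) \<otimes> (conj ^^ i) (\<rho> \<delta>)\<close>.\<close>
    define k where "k i \<delta> = g' (inv (\<rho> \<delta>) \<otimes> (conj ^^ i) (\<rho> \<delta>))" for i \<delta>
    have e: "[g' (part ((conj ^^ i) n) \<delta>) = g' ((conj ^^ i) (part n \<delta>)) + (k i (\<mu> n \<delta>) - k i \<delta>)] (mod int p)"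
      if \<delta>: "\<delta> \<in> \<Delta>" for i \<delta>
    proof -
      let ?C = "conj ^^ i"
      note cn = conj_pow_N[OF n, of i]
      have \<mu>e: "\<mu> (?C n) \<delta> = \<mu> n \<delta>" unfolding \<mu>_def om_pow[OF n] ..
      note r = \<rho>[OF \<delta>] and r' = \<rho>[OF \<mu>\<Delta>[OF n \<delta>]]
      note a = part[OF n \<delta>] and b = part[OF cn \<delta>]
      have K: "inv m \<otimes> ?C m \<in> N" "\<omega> (inv m \<otimes> ?C m) = 1" if "m \<in> N" for m
        using that om_div[OF that conj_pow_N[OF that]] om_pow[OF that] N_mult[OF N_inv[OF that] conj_pow_N[OF that]] by auto
      have "\<rho> (\<mu> n \<delta>) \<otimes> part n \<delta> = n \<otimes> \<rho> \<delta>"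
        unfolding part_def using N_carrier r r' n by (simp add: m_assoc[symmetric])
      then have c: "?C (\<rho> (\<mu> n \<delta>)) \<otimes> ?C (part n \<delta>) = ?C n \<otimes> ?C (\<rho> \<delta>)"
        using conj_pow_mult[OF r'(1) a(1)] conj_pow_mult[OF n r(1)] by simp
      note car = N_carrier[OF r(1)] N_carrier[OF r'(1)] N_carrier[OF cn] N_carrier[OF conj_pow_N[OF r(1), of i]]
        N_carrier[OF conj_pow_N[OF r'(1), of i]] N_carrier[OF conj_pow_N[OF a(1), of i]]
      have "part (?C n) \<delta> \<otimes> (inv (\<rho> \<delta>) \<otimes> ?C (\<rho> \<delta>)) = inv (\<rho> (\<mu> n \<delta>)) \<otimes> (?C n \<otimes> (\<rho> \<delta> \<otimes> inv (\<rho> \<delta>)) \<otimes> ?C (\<rho> \<delta>))"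
        unfolding part_def \<mu>e using car by (simp only: m_assoc inv_closed m_closed)
      also have "\<dots> = inv (\<rho> (\<mu> n \<delta>)) \<otimes> (?C n \<otimes> ?C (\<rho> \<delta>))" using car by simp
      also have "\<dots> = (inv (\<rho> (\<mu> n \<delta>)) \<otimes> ?C (\<rho> (\<mu> n \<delta>))) \<otimes> ?C (part n \<delta>)"
        unfolding c[symmetric] using car by (simp add: m_assoc)
      finally have eq: "part (?C n) \<delta> \<otimes> (inv (\<rho> \<delta>) \<otimes> ?C (\<rho> \<delta>)) = (inv (\<rho> (\<mu> n \<delta>)) \<otimes> ?C (\<rho> (\<mu> n \<delta>))) \<otimes> ?C (part n \<delta>)" .
      have "\<omega> (?C (part n \<delta>)) = 1" using om_pow[OF a(1)] a(2) by simp
      then have "[g' (part (?C n) \<delta>) + k i \<delta> = k i (\<mu> n \<delta>) + g' (?C (part n \<delta>))] (mod int p)"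
        using g'[OF b(1) K(1)[OF r(1)] b(2) K(2)[OF r(1)]] 
          g'[OF K(1)[OF r'(1)] conj_pow_N[OF a(1)] K(2)[OF r'(1)], of i]
        unfolding eq k_def using cong_trans cong_sym by blast
      then show ?thesis unfolding cong_iff_dvd_diff by (simp add: algebra_simps)
    qed
    have hp: "[h (part n \<delta>) = h n + (h (\<rho> \<delta>) - h (\<rho> (\<mu> n \<delta>)))] (mod int p)" if \<delta>: "\<delta> \<in> \<Delta>" for \<delta>
    proof -
      note r = \<rho>[OF \<delta>] and r' = \<rho>[OF \<mu>\<Delta>[OF n \<delta>]] and a = part[OF n \<delta>]
      have eq: "\<rho> (\<mu> n \<delta>) \<otimes> part n \<delta> = n \<otimes> \<rho> \<delta>"
        unfolding part_def using N_carrier r r' n by (simp add: m_assoc[symmetric])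
      have "int p dvd (h (n \<otimes> \<rho> \<delta>) - (h n + h (\<rho> \<delta>))) - (h (\<rho> (\<mu> n \<delta>) \<otimes> part n \<delta>) - (h (\<rho> (\<mu> n \<delta>)) + h (part n \<delta>)))"
        by (intro dvd_diff smooth_hom_mult[OF h] n r r' a)
      then show ?thesis unfolding eq cong_iff_dvd_diff by (simp add: algebra_simps)
    qed
    have s1: "[(\<Sum>\<delta>\<in>\<Delta>. g' (part ((conj ^^ i) n) \<delta>)) = (\<Sum>\<delta>\<in>\<Delta>. g' ((conj ^^ i) (part n \<delta>)))] (mod int p)" for i
    proof -
      have "[(\<Sum>\<delta>\<in>\<Delta>. g' (part ((conj ^^ i) n) \<delta>)) = (\<Sum>\<delta>\<in>\<Delta>. g' ((conj ^^ i) (part n \<delta>)) + (k i (\<mu> n \<delta>) - k i \<delta>))] (mod int p)"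
        by (rule cong_sum) (rule e)
      also have "(\<Sum>\<delta>\<in>\<Delta>. g' ((conj ^^ i) (part n \<delta>)) + (k i (\<mu> n \<delta>) - k i \<delta>)) = (\<Sum>\<delta>\<in>\<Delta>. g' ((conj ^^ i) (part n \<delta>)))"
        unfolding sum.distrib sum_subtractf shift[OF n, of "k i"] by simp
      finally show ?thesis .
    qed
    have "[(\<Sum>\<delta>\<in>\<Delta>. \<Sum>i<p. g' ((conj ^^ i) (part n \<delta>))) = (\<Sum>\<delta>\<in>\<Delta>. h n + (h (\<rho> \<delta>) - h (\<rho> (\<mu> n \<delta>))))] (mod int p)"
      by (intro cong_sum cong_trans[OF norm hp] part n)
    also have "(\<Sum>\<delta>\<in>\<Delta>. h n + (h (\<rho> \<delta>) - h (\<rho> (\<mu> n \<delta>)))) = int (card \<Delta>) * h n"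
      unfolding sum.distrib sum_subtractf shift[OF n, of "\<lambda>\<delta>. h (\<rho> \<delta>)"] by simp
    finally have s2: "[(\<Sum>\<delta>\<in>\<Delta>. \<Sum>i<p. g' ((conj ^^ i) (part n \<delta>))) = int (card \<Delta>) * h n] (mod int p)" .
    have "(\<Sum>i<p. g ((conj ^^ i) n)) = d' * (\<Sum>i<p. \<Sum>\<delta>\<in>\<Delta>. g' (part ((conj ^^ i) n) \<delta>))"
      unfolding g_def by (simp add: sum_distrib_left)
    also have "[\<dots> = d' * (\<Sum>i<p. \<Sum>\<delta>\<in>\<Delta>. g' ((conj ^^ i) (part n \<delta>)))] (mod int p)"
      by (intro cong_scalar_left cong_sum s1)
    also have "(\<Sum>i<p. \<Sum>\<delta>\<in>\<Delta>. g' ((conj ^^ i) (part n \<delta>))) = (\<Sum>\<delta>\<in>\<Delta>. \<Sum>i<p. g' ((conj ^^ i) (part n \<delta>)))"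
      by (rule sum.swap)
    also have "[d' * \<dots> = d' * (int (card \<Delta>) * h n)] (mod int p)" by (rule cong_scalar_left[OF s2])
    also have "d' * (int (card \<Delta>) * h n) = int (card \<Delta>) * d' * h n" by simp
    also have "[\<dots> = 1 * h n] (mod int p)" by (rule cong_scalar_right[OF d'])
    finally show ?thesis by (simp add: cong_iff_dvd_diff)
  qed
  ultimately show ?thesis unfolding vanish_def by blast
qed

end


context galois_closure
begin

section \<open>The norm equation in characteristic different from \<open>p\<close>\<close>

lemma finprod_cyclic_shift:
  assumes f: "\<And>i::nat. f i \<in> carrier \<Omega> - {\<zero>}" and e: "f p = f 0"
  shows "(\<Otimes>i\<in>{..<p}. f (Suc i)) = (\<Otimes>i\<in>{..<p}. f i)"
proof (cases p)
  case 0 then show ?thesis by simp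
next
  case (Suc m)
  have c: "(\<Otimes>i\<in>{..m}. f (Suc i)) \<in> carrier \<Omega>" "(\<Otimes>i\<in>{..m}. f i) \<in> carrier \<Omega>" using f by (auto intro!: finprod_closed)
  have "(\<Otimes>i\<in>{..m}. f (Suc i)) \<otimes> f 0 = (\<Otimes>i\<in>{..Suc m}. f i)" using f by (subst finprod_Suc2) auto
  also have "\<dots> = f (Suc m) \<otimes> (\<Otimes>i\<in>{..m}. f i)" using f by (subst finprod_Suc) auto
  also have "\<dots> = (\<Otimes>i\<in>{..m}. f i) \<otimes> f 0" using f[of 0] c e Suc by (simp add: m_comm)
  finally have "(\<Otimes>i\<in>{..m}. f (Suc i)) = (\<Otimes>i\<in>{..m}. f i)" using f[of 0] c m_rcancel[of "f 0"] by auto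
  then show ?thesis unfolding Suc lessThan_Suc_atMost .
qed

lemma finprod_nonzero:
  "finite A \<Longrightarrow> (\<And>a. a \<in> A \<Longrightarrow> f a \<in> carrier \<Omega> - {\<zero>}) \<Longrightarrow> (\<Otimes>a\<in>A. f a) \<noteq> \<zero>"
proof (induct A rule: finite_induct)
  case empty then show ?case by simp
next
  case (insert a A)
  have c: "f \<in> A \<rightarrow> carrier \<Omega>" using insert by auto
  have "(\<Otimes>a\<in>insert a A. f a) = f a \<otimes> (\<Otimes>a\<in>A. f a)" by (rule finprod_insert) (use insert c in auto)
  moreover have "(\<Otimes>a\<in>A. f a) \<noteq> \<zero>" "f a \<noteq> \<zero>" "f a \<in> carrier \<Omega>" using insert by auto
  ultimately show ?case using integral[of "f a" "\<Otimes>a\<in>A. f a"] finprod_closed[OF c] by auto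
qed

lemma finprod_hom:
  assumes "finite A" "\<And>a. a \<in> A \<Longrightarrow> f a \<in> carrier \<Omega>"
    and h: "\<And>u. u \<in> carrier \<Omega> \<Longrightarrow> h u \<in> carrier \<Omega>" "h \<one> = \<one>"
      "\<And>u v. u \<in> carrier \<Omega> \<Longrightarrow> v \<in> carrier \<Omega> \<Longrightarrow> h (u \<otimes> v) = h u \<otimes> h v"
  shows "h (\<Otimes>a\<in>A. f a) = (\<Otimes>a\<in>A. h (f a))"
  using assms(1,2)
proof (induct A rule: finite_induct)
  case empty then show ?case using h by simp
next
  case (insert a A)
  have c: "f \<in> A \<rightarrow> carrier \<Omega>" "f a \<in> carrier \<Omega>" "(\<lambda>a. h (f a)) \<in> A \<rightarrow> carrier \<Omega>" using insert h by auto
  have "h (\<Otimes>a\<in>insert a A. f a) = h (f a) \<otimes> h (\<Otimes>a\<in>A. f a)"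
    using insert c by (simp add: h finprod_insert)
  also have "\<dots> = (\<Otimes>a\<in>insert a A. h (f a))" using insert c h by (simp add: finprod_insert)
  finally show ?case .
qed

lemma kummer_fibre:
  assumes p: "prime p" and \<xi>: "\<xi> \<in> carrier \<Omega>" "\<xi> [^] p = \<one>" "\<xi> \<noteq> \<one>"
    and u: "u \<in> carrier \<Omega>" and v: "v \<in> carrier \<Omega>" "v \<noteq> \<zero>" and e: "u [^] p = v [^] p"
  obtains k where "u = rt p \<xi> k \<otimes> v"
proof -
  have vu: "v \<in> Units \<Omega>" using v field_Units by simp
  have iv: "inv v \<in> carrier \<Omega>" using vu by simp
  have "(u \<otimes> inv v) [^] p = u [^] p \<otimes> inv v [^] p" by (rule nat_pow_distrib[OF u iv])
  also have "\<dots> = (v \<otimes> inv v) [^] p" unfolding e by (rule nat_pow_distrib[OF v(1) iv, symmetric])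
  also have "\<dots> = \<one>" using vu by simp
  finally obtain k where k: "u \<otimes> inv v = rt p \<xi> k" using root_of_unity_rt[OF p \<xi>, of "u \<otimes> inv v"] u iv by auto
  have "u = u \<otimes> inv v \<otimes> v" using u v iv vu by (simp add: m_assoc)
  then show ?thesis using that unfolding k by blast
qed

lemma rt_sum:
  assumes p: "prime p" and \<xi>: "\<xi> \<in> carrier \<Omega>" "\<xi> [^] p = \<one>" "\<xi> \<noteq> \<one>"
  shows "finite A \<Longrightarrow> (\<Otimes>i\<in>A. rt p \<xi> (u i)) = rt p \<xi> (\<Sum>i\<in>A. u i)"
  by (induct A rule: finite_induct) (simp_all add: rt_0[OF p \<xi>] rt_add[OF p \<xi>] Pi_iff \<xi>(1))

lemma rt_int:
  assumes p: "prime p" and \<xi>: "\<xi> \<in> carrier \<Omega>" "\<xi> [^] p = \<one>" "\<xi> \<noteq> \<one>"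
  shows "\<xi> [^] n = rt p \<xi> (int n)"
  unfolding rt_def using xi_mod[OF p \<xi>, of n] by (simp add: nat_mod_distrib)

end

context cyclic_extension_lift
begin

text \<open>Let \<open>z\<close> and \<open>y\<close> be Kummer generators of \<open>f\<close> and of the extension \<open>\<chi>\<close> of \<open>D f\<close>, on the subgroups
  fixing \<open>\<xi>\<close>. Then \<open>d = z y / \<sigma>\<^sup>-\<^sup>1 z\<close> is invariant under the subgroup of \<open>N\<close> fixing \<open>\<xi>\<close>. As \<open>\<sigma> y = y\<close> and
  \<open>\<sigma>\<^sup>-\<^sup>p z = z\<close>, its norm is \<open>y\<^sup>p\<close>. So if \<open>w\<^sup>p = d\<close>, the product \<open>W\<close> of the \<open>\<sigma>\<^sup>-\<^sup>i w\<close> is \<open>y\<close> times a root of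
  unity, and the norm of the Kummer character of \<open>w\<close> is that of \<open>y\<close>.\<close>

lemma norm_equation_char_not_p:
  assumes char: "nmul p \<one> \<noteq> \<zero>" and \<xi>S: "\<xi> \<in> \<S>" and \<xi>p: "\<xi> [^] p = \<one>" "\<xi> \<noteq> \<one>" and tau_\<xi>: "\<tau> \<xi> = \<xi>"
    and f: "CQ.smooth_hom f" "CQ.vanish ((CQ.Dl ^^ 2) f)" "int p dvd f (\<tau> [^]\<^bsub>\<Gamma>\<^esub> p)"
  shows "\<exists>g. CQ.smooth_hom g \<and> CQ.vanish (\<lambda>n. (\<Sum>i<p. g ((CQ.conj ^^ i) n)) - CQ.Dl f n)"
proof -
  have \<xi>c: "\<xi> \<in> carrier \<Omega>" by (rule S_carrier[OF \<xi>S])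
  note p\<xi> = prime_p \<xi>c \<xi>p
  let ?h = "CQ.Dl f"
  have h: "CQ.smooth_hom ?h" by (rule CQ.smooth_hom_Dl[OF f(1)])
  have hv: "CQ.vanish (CQ.Dl ?h)" using f(2) by (simp add: numeral_2_eq_2)
  have ht: "int p dvd ?h (\<tau> [^]\<^bsub>\<Gamma>\<^esub> p)" using CQ.act_tau_p(1)[of f 1] f(3) by simp
  obtain \<chi> where \<chi>': "\<forall>n\<in>CQ.N. \<chi> n = ?h n" and \<chi>\<tau>: "\<chi> \<tau> mod int p = 0" and \<chi>_mult:
    "\<forall>s\<in>auts F. \<forall>t\<in>auts F. \<chi> (s \<otimes>\<^bsub>\<Gamma>\<^esub> t) mod int p = (\<chi> s + \<chi> t) mod int p"
    using CQ.extend_character[OF h hv ht] by (elim exE conjE)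
  note \<chi> = bspec[OF \<chi>']
  \<comment> \<open>\<open>\<omega>\<close> is the cyclotomic character, \<open>s \<xi> = \<xi>\<^sup>\<omega>\<^sup>(\<^sup>s\<^sup>)\<close>.\<close>
  have ex: "\<exists>k. k \<in> {0..<int p} \<and> s \<xi> = rt p \<xi> k" if s: "s \<in> auts F" for s
  proof -
    have "(s \<xi>) [^] p = \<one>" using aut_pow[OF s \<xi>c, symmetric] \<xi>p(1) aut_one[OF s] by simp
    then obtain k where "0 \<le> k" "k < int p" "s \<xi> = rt p \<xi> k" using root_of_unity_rt[OF p\<xi> aut_closed[OF s \<xi>c]] by metis
    then show ?thesis by auto
  qed
  define \<omega> where "\<omega> s = (SOME k. k \<in> {0..<int p} \<and> s \<xi> = rt p \<xi> k)" for s
  have \<omega>: "\<omega> s \<in> {0..<int p}" "s \<xi> = rt p \<xi> (\<omega> s)" if "s \<in> auts F" for s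
    using someI_ex[OF ex[OF that]] unfolding \<omega>_def by blast+
  have \<omega>_eqI: "\<omega> s = k mod int p" if "s \<in> auts F" "s \<xi> = rt p \<xi> k" for s k
    using rt_inj[OF p\<xi>, of "\<omega> s" k] \<omega>[OF that(1)] that(2) by simp
  have s_rt: "s (rt p \<xi> k) = rt p \<xi> (\<omega> s * k)" if s: "s \<in> auts F" for s k
  proof -
    have "s (rt p \<xi> k) = (\<xi> [^] nat (\<omega> s)) [^] nat (k mod int p)"
      unfolding rt_def[of p \<xi> k] aut_pow[OF s \<xi>c] \<omega>(2)[OF s] using \<omega>(1)[OF s] by (simp add: rt_def)
    also have "\<dots> = rt p \<xi> (int (nat (\<omega> s) * nat (k mod int p)))"
      unfolding nat_pow_pow[OF \<xi>c] by (rule rt_int[OF p\<xi>])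
    also have "\<dots> = rt p \<xi> (\<omega> s * k)" 
      by (rule rt_cong) (use \<omega>(1)[OF s] p_pos in \<open>simp add: mod_mult_right_eq\<close>)
    finally show ?thesis .
  qed
  have rt_1: "rt p \<xi> 1 = \<xi>" using rt_int[OF p\<xi>, of 1] \<xi>c by simp
  have fix_iff: "\<omega> s = 1 \<longleftrightarrow> s \<xi> = \<xi>" if "s \<in> auts F" for s
    using \<omega>(2)[OF that] \<omega>_eqI[OF that, of 1] rt_1 p_pos(3) by auto
  have fix_rt: "s (rt p \<xi> k) = rt p \<xi> k" if "s \<in> auts F" "s \<xi> = \<xi>" for s k
    using s_rt[OF that(1)] fix_iff[OF that(1)] that(2) by simp
  have sg_\<xi>: "sg i \<xi> = \<xi>" for i
  proof (induct i)
    case 0 show ?case by (rule sg_0[OF \<xi>c])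
  next
    case (Suc i)
    have "sg 1 (\<tau> \<xi>) = \<xi>" unfolding sg_def using auts_inv1(1)[OF F_sub tau(1) \<xi>c] tau(1) by simp
    then show ?case unfolding sg_Suc[OF \<xi>c] Suc tau_\<xi> .
  qed
  have om_conj: "\<omega> (CQ.conj n) = \<omega> n" if n: "n \<in> CQ.N" for n
  proof -
    note nG = N_auts[OF n] and cG = N_auts[OF CQ.conj_N[OF n]]
    have "n (sg 1 \<xi>) = sg 1 (CQ.conj n \<xi>)" using sg_conj[OF n \<xi>c, of 1] by simp
    then have "n \<xi> = rt p \<xi> (\<omega> (CQ.conj n))"
      unfolding sg_\<xi> \<omega>(2)[OF cG] fix_rt[OF sg_aut sg_\<xi>] .
    then show ?thesis using \<omega>_eqI[OF nG] \<omega>(1)[OF cG] by simp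
  qed
  \<comment> \<open>\<open>stab (insert \<xi> K)\<close> is the subgroup of \<open>N\<close> on which Kummer theory applies.\<close>
  have Kc: "insert \<xi> K \<subseteq> carrier \<Omega>" using \<xi>c K_carrier by blast
  have in_N': "n \<in> stab (insert \<xi> K) \<longleftrightarrow> n \<in> CQ.N \<and> n \<xi> = \<xi>" for n
    unfolding N_K stab_def by blast
  obtain B where B: "finite B" "B \<subseteq> \<S>" "stab B \<subseteq> CQ.N" "\<forall>n\<in>stab B. int p dvd f n"
    by (rule smooth_open_set[OF f(1)])
  obtain B' where B': "finite B'" "B' \<subseteq> \<S>" "stab B' \<subseteq> CQ.N" "\<forall>n\<in>stab B'. int p dvd ?h n"
    by (rule smooth_open_set[OF h])
  have cf: "character_on p (stab (insert \<xi> K)) B f" unfolding character_on_def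
  proof (intro conjI ballI)
    fix s t assume "s \<in> stab (insert \<xi> K)" "t \<in> stab (insert \<xi> K)"
    then show "f (s \<otimes>\<^bsub>\<Gamma>\<^esub> t) mod int p = (f s + f t) mod int p"
      using CQ.smooth_hom_mult[OF f(1)] unfolding in_N' by (simp add: mod_eq_dvd_iff)
  qed (use B(4) in auto)
  have c\<chi>: "character_on p (stab {\<xi>}) B' \<chi>" unfolding character_on_def
  proof (intro conjI ballI)
    fix s t assume "s \<in> stab {\<xi>}" "t \<in> stab {\<xi>}"
    then show "\<chi> (s \<otimes>\<^bsub>\<Gamma>\<^esub> t) mod int p = (\<chi> s + \<chi> t) mod int p" using \<chi>_mult unfolding stab_def by blast
  next
    fix s assume s: "s \<in> stab {\<xi>} \<inter> stab B'"
    then have "\<chi> s = ?h s" using \<chi> B'(3) by blast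
    then show "\<chi> s mod int p = 0" using B'(4) s by simp
  qed
  have fix1: "s \<xi> = \<xi>" if "s \<in> stab (insert \<xi> K)" for s using that unfolding stab_def by blast
  have fix2: "s \<xi> = \<xi>" if "s \<in> stab {\<xi>}" for s using that unfolding stab_def by blast
  obtain z where z: "z \<in> \<S>" "z \<noteq> \<zero>" "\<And>s. s \<in> stab (insert \<xi> K) \<Longrightarrow> s z = rt p \<xi> (f s) \<otimes> z"
    using hilbert90_mult[OF B(1,2) stab_subgroup[OF Kc] cf prime_p \<xi>S \<xi>p] fix1 by blast
  have \<xi>sub: "{\<xi>} \<subseteq> carrier \<Omega>" using \<xi>c by blast
  obtain y where y: "y \<in> \<S>" "y \<noteq> \<zero>" "\<And>s. s \<in> stab {\<xi>} \<Longrightarrow> s y = rt p \<xi> (\<chi> s) \<otimes> y"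
    using hilbert90_mult[OF B'(1,2) stab_subgroup[OF \<xi>sub] c\<chi> prime_p \<xi>S \<xi>p] fix2 by blast
  note zc = S_carrier[OF z(1)] and yc = S_carrier[OF y(1)]
  have nz: "n z = rt p \<xi> (f n) \<otimes> z" and ny: "n y = rt p \<xi> (?h n) \<otimes> y" if "n \<in> CQ.N" "n \<xi> = \<xi>" for n
  proof -
    show "n z = rt p \<xi> (f n) \<otimes> z" using z(3) that in_N' by blast
    show "n y = rt p \<xi> (?h n) \<otimes> y" using y(3)[of n] that N_auts \<chi>[OF that(1)] unfolding stab_def by simp
  qed
  have conj\<xi>: "(CQ.conj ^^ i) n \<in> CQ.N" "(CQ.conj ^^ i) n \<xi> = \<xi>" if n: "n \<in> CQ.N" "n \<xi> = \<xi>" for i n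
  proof -
    show cN: "(CQ.conj ^^ i) n \<in> CQ.N" by (rule CQ.conj_pow_N[OF n(1)])
    have "\<omega> ((CQ.conj ^^ i) n) = \<omega> n"
      by (induct i) (simp_all add: om_conj CQ.conj_pow_N[OF n(1)])
    then show "(CQ.conj ^^ i) n \<xi> = \<xi>" using fix_iff[OF N_auts[OF n(1)]] fix_iff[OF N_auts[OF cN]] n(2) by simp
  qed
  define q where "q = sg 1 z"
  have qc: "q \<in> carrier \<Omega>" unfolding q_def by (rule aut_closed[OF sg_aut zc])
  have qS: "q \<in> \<S>" unfolding q_def by (rule S_aut[OF sg_aut z(1)])
  have sg_nz: "sg i u \<noteq> \<zero>" if "u \<in> carrier \<Omega>" "u \<noteq> \<zero>" for i u
    using aut_zero_iff[OF sg_aut] that by blast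
  have q0: "q \<noteq> \<zero>" unfolding q_def by (rule sg_nz[OF zc z(2)])
  have qU: "q \<in> Units \<Omega>" using qc q0 field_Units by simp
  define d where "d = z \<otimes> y \<otimes> inv q"
  have dS: "d \<in> \<S>" unfolding d_def
    by (intro S_ring(6) z(1) y(1) inv_in_subfield[OF S_subfield] qS q0)
  note dc = S_carrier[OF dS]
  have dq: "d \<otimes> q = z \<otimes> y" unfolding d_def using qU zc yc qc by (simp add: m_assoc)
  have nq: "n q = rt p \<xi> (f n + ?h n) \<otimes> q" if n: "n \<in> CQ.N" "n \<xi> = \<xi>" for n
  proof -
    have "n q = sg 1 (CQ.conj n z)" unfolding q_def using sg_conj[OF n(1) zc, of 1] by simp
    also have "\<dots> = sg 1 (rt p \<xi> (f (CQ.conj n)) \<otimes> z)" using nz[of "CQ.conj n"] conj\<xi>[OF n, of 1] by simp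
    also have "\<dots> = rt p \<xi> (f (CQ.conj n)) \<otimes> q"
      unfolding q_def using aut_mult[OF sg_aut rt_closed[OF \<xi>c] zc] fix_rt[OF sg_aut sg_\<xi>] by simp
    finally show ?thesis by (simp add: CQ.Dl_def)
  qed
  have nd: "n d = d" if n: "n \<in> CQ.N" "n \<xi> = \<xi>" for n
  proof -
    note nG = N_auts[OF n(1)]
    let ?r = "rt p \<xi> (f n + ?h n)"
    have ndc: "n d \<in> carrier \<Omega>" by (rule aut_closed[OF nG dc])
    have "n d \<otimes> (?r \<otimes> q) = n (d \<otimes> q)" using aut_mult[OF nG dc qc] nq[OF n] by simp
    also have "\<dots> = (rt p \<xi> (f n) \<otimes> z) \<otimes> (rt p \<xi> (?h n) \<otimes> y)"
      unfolding dq using aut_mult[OF nG zc yc] nz[OF n] ny[OF n] by simp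
    also have "\<dots> = ?r \<otimes> (z \<otimes> y)" unfolding rt_add[OF p\<xi>] using zc yc \<xi>c by (simp add: m_ac)
    also have "\<dots> = d \<otimes> (?r \<otimes> q)" unfolding dq[symmetric] using dc qc \<xi>c by (simp add: m_ac)
    finally have e: "n d \<otimes> (?r \<otimes> q) = d \<otimes> (?r \<otimes> q)" .
    have "?r \<otimes> q \<noteq> \<zero>" using integral[of ?r q] rt_nonzero[OF p\<xi>] q0 qc \<xi>c by auto
    then show ?thesis using m_rcancel[of "?r \<otimes> q" "n d" d] e ndc dc qc \<xi>c by simp
  qed
  obtain w where w: "w \<in> carrier \<Omega>" "w [^] p = d" by (rule pth_root_exists[OF dc p_pos(1)])
  have wS: "w \<in> \<S>" by (rule S_kummer[OF prime_p char w(1)]) (simp add: w(2) dS)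
  have d0: "d \<noteq> \<zero>" using dq z(2) y(2) zc yc qc integral by fastforce
  have w0: "w \<noteq> \<zero>" using d0 w(2) p_pos(1) by (auto simp: nat_pow_zero)
  have ex_g: "\<exists>k. n w = rt p \<xi> k \<otimes> w" if n: "n \<in> CQ.N" "n \<xi> = \<xi>" for n
  proof -
    note nG = N_auts[OF n(1)]
    have "(n w) [^] p = w [^] p" using aut_pow[OF nG w(1), of p] nd[OF n] w(2) by simp
    then show ?thesis using kummer_fibre[OF p\<xi> aut_closed[OF nG w(1)] w(1) w0] by metis
  qed
  define g' where "g' n = (SOME k. n w = rt p \<xi> k \<otimes> w)" for n
  have g': "n w = rt p \<xi> (g' n) \<otimes> w" if n: "n \<in> CQ.N" "n \<xi> = \<xi>" for n
    unfolding g'_def using someI_ex[OF ex_g[OF n]] .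
  have rt_cancel: "[i = j] (mod int p)" if "rt p \<xi> i \<otimes> u = rt p \<xi> j \<otimes> u" "u \<in> carrier \<Omega>" "u \<noteq> \<zero>" for i j u
  proof -
    have "rt p \<xi> i = rt p \<xi> j"
      by (rule iffD1[OF m_rcancel[OF that(3,2) rt_closed[OF \<xi>c] rt_closed[OF \<xi>c]] that(1)])
    then show ?thesis unfolding cong_def by (rule rt_inj[OF p\<xi>])
  qed
  \<comment> \<open>The norm of \<open>d\<close> telescopes to \<open>y\<^sup>p\<close>; multiplying by \<open>Z\<close> avoids quotients.\<close>
  define W where "W = (\<Otimes>i\<in>{..<p}. sg i w)"
  have sw: "sg i w \<in> carrier \<Omega>" "sg i w \<noteq> \<zero>" for i using aut_closed[OF sg_aut w(1)] sg_nz[OF w(1) w0] by auto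
  have Wc: "W \<in> carrier \<Omega>" unfolding W_def using sw by (intro finprod_closed) simp
  have W0: "W \<noteq> \<zero>" unfolding W_def by (rule finprod_nonzero) (use sw in auto)
  have sz: "sg i z \<in> carrier \<Omega>" "sg i z \<noteq> \<zero>" for i using aut_closed[OF sg_aut zc] sg_nz[OF zc z(2)] by auto
  have sgy: "sg i y = y" for i
  proof (induct i)
    case 0 show ?case by (rule sg_0[OF yc])
  next
    case (Suc i)
    have "\<tau> \<in> stab {\<xi>}" using tau(1) tau_\<xi> unfolding stab_def by simp
    then have "\<tau> y = rt p \<xi> (\<chi> \<tau>) \<otimes> y" by (rule y(3))
    moreover have "rt p \<xi> (\<chi> \<tau>) = rt p \<xi> 0" by (rule rt_cong) (simp add: \<chi>\<tau>)
    ultimately have "\<tau> y = y" using yc rt_0[OF p\<xi>] by simp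
    moreover have "sg 1 (\<tau> y) = y" unfolding sg_def using auts_inv1(1)[OF F_sub tau(1) yc] tau(1) by simp
    ultimately show ?case unfolding sg_Suc[OF yc] Suc by simp
  qed
  have "sg p z = z"
  proof -
    have tN: "sg p \<in> CQ.N" unfolding sg_def using CQ.N_inv[OF CQ.tau_p_N] .
    have "int p dvd f (sg p) + f (\<tau> [^]\<^bsub>\<Gamma>\<^esub> p)" unfolding sg_def by (rule CQ.smooth_hom_inv[OF f(1) CQ.tau_p_N])
    then have "int p dvd f (sg p)" using f(3) by (metis dvd_add_left_iff)
    then have "rt p \<xi> (f (sg p)) = rt p \<xi> 0" by (intro rt_cong) simp
    then show ?thesis using nz[OF tN sg_\<xi>] rt_0[OF p\<xi>] zc by simp
  qed
  then have shift: "(\<Otimes>i\<in>{..<p}. sg (Suc i) z) = (\<Otimes>i\<in>{..<p}. sg i z)"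
    by (intro finprod_cyclic_shift) (use sz sg_0[OF zc] in auto)
  define Z where "Z = (\<Otimes>i\<in>{..<p}. sg i z)"
  have Z: "Z \<in> carrier \<Omega>" "Z \<noteq> \<zero>" unfolding Z_def using finprod_nonzero[of "{..<p}" "\<lambda>i. sg i z"] sz by (auto intro: finprod_closed)
  have "W [^] p = (\<Otimes>i\<in>{..<p}. sg i w [^] p)"
    unfolding W_def by (rule finprod_hom[where h = "\<lambda>u. u [^] p"]) (use sw in \<open>auto simp: nat_pow_distrib\<close>)
  also have "\<dots> = (\<Otimes>i\<in>{..<p}. sg i d)"
    by (rule finprod_cong') (use aut_pow[OF sg_aut w(1)] aut_closed[OF sg_aut dc] w(2) in auto)
  finally have Wd: "W [^] p = (\<Otimes>i\<in>{..<p}. sg i d)" .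
  have sd: "sg i d \<in> carrier \<Omega>" for i by (rule aut_closed[OF sg_aut dc])
  have "W [^] p \<otimes> Z = (\<Otimes>i\<in>{..<p}. sg i d) \<otimes> (\<Otimes>i\<in>{..<p}. sg (Suc i) z)" unfolding Wd shift Z_def ..
  also have "\<dots> = (\<Otimes>i\<in>{..<p}. sg i d \<otimes> sg (Suc i) z)"
    by (rule finprod_multf[symmetric]) (use sd sz in auto)
  also have "\<dots> = (\<Otimes>i\<in>{..<p}. y \<otimes> sg i z)"
  proof (rule finprod_cong')
    fix i
    have "sg (Suc i) z = sg i q"
    proof -
      have "sg i (sg 1 z) = sg (Suc i) z"
      proof (induct i)
        case 0 show ?case using sg_0[OF aut_closed[OF sg_aut zc]] by simp
      next
        case (Suc j)
        show ?case unfolding sg_Suc[OF aut_closed[OF sg_aut zc], of j] Suc sg_Suc[OF zc, of "Suc j"] ..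
      qed
      then show ?thesis unfolding q_def by simp
    qed
    then have "sg i d \<otimes> sg (Suc i) z = sg i (z \<otimes> y)" using aut_mult[OF sg_aut dc qc, of i] dq by simp
    also have "\<dots> = y \<otimes> sg i z" using aut_mult[OF sg_aut zc yc, of i] sgy sz yc by (simp add: m_comm)
    finally show "sg i d \<otimes> sg (Suc i) z = y \<otimes> sg i z" .
  qed (use yc sz in auto)
  also have "\<dots> = (\<Otimes>i\<in>{..<p}. y) \<otimes> Z" unfolding Z_def by (rule finprod_multf) (use yc sz in auto)
  also have "(\<Otimes>i\<in>{..<p}. y) = y [^] p" using finprod_const[of y "{..<p}"] yc by simp
  finally have "W [^] p = y [^] p" using m_rcancel[of Z "W [^] p" "y [^] p"] Z Wc yc by simp
  then obtain k where k: "W = rt p \<xi> k \<otimes> y" using kummer_fibre[OF p\<xi> Wc yc y(2)] by blast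
  have norm: "[(\<Sum>i<p. g' ((CQ.conj ^^ i) n)) = ?h n] (mod int p)" if n: "n \<in> CQ.N" "\<omega> n = 1" for n
  proof -
    note nG = N_auts[OF n(1)]
    have n\<xi>: "n \<xi> = \<xi>" using fix_iff[OF nG] n(2) by simp
    have "n W = (\<Otimes>i\<in>{..<p}. n (sg i w))" unfolding W_def
      by (rule finprod_hom) (use sw aut_closed[OF nG] aut_one[OF nG] aut_mult[OF nG] in auto)
    also have "\<dots> = (\<Otimes>i\<in>{..<p}. rt p \<xi> (g' ((CQ.conj ^^ i) n)) \<otimes> sg i w)"
    proof (rule finprod_cong')
      fix i
      have "n (sg i w) = sg i ((CQ.conj ^^ i) n w)" by (rule sg_conj[OF n(1) w(1)])
      also have "\<dots> = sg i (rt p \<xi> (g' ((CQ.conj ^^ i) n)) \<otimes> w)" using g'[OF conj\<xi>[OF n(1) n\<xi>]] by simp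
      also have "\<dots> = rt p \<xi> (g' ((CQ.conj ^^ i) n)) \<otimes> sg i w"
        using aut_mult[OF sg_aut rt_closed[OF \<xi>c] w(1)] fix_rt[OF sg_aut sg_\<xi>] by simp
      finally show "n (sg i w) = rt p \<xi> (g' ((CQ.conj ^^ i) n)) \<otimes> sg i w" .
    qed (use sw \<xi>c in auto)
    also have "\<dots> = (\<Otimes>i\<in>{..<p}. rt p \<xi> (g' ((CQ.conj ^^ i) n))) \<otimes> W"
      unfolding W_def by (rule finprod_multf) (use sw \<xi>c in auto)
    also have "\<dots> = rt p \<xi> (\<Sum>i<p. g' ((CQ.conj ^^ i) n)) \<otimes> W" by (simp only: rt_sum[OF p\<xi> finite_lessThan])
    finally have 1: "n W = rt p \<xi> (\<Sum>i<p. g' ((CQ.conj ^^ i) n)) \<otimes> W" .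
    have "n W = rt p \<xi> k \<otimes> (rt p \<xi> (?h n) \<otimes> y)"
      unfolding k using aut_mult[OF nG rt_closed[OF \<xi>c] yc] fix_rt[OF nG n\<xi>] ny[OF n(1) n\<xi>] by simp
    also have "\<dots> = rt p \<xi> (?h n) \<otimes> W" unfolding k using yc \<xi>c by (simp add: m_ac)
    finally show ?thesis using rt_cancel[OF _ Wc W0] 1 by simp
  qed
  obtain U where U: "U \<in> opens" "U \<subseteq> stab {\<xi>, w}" using open_inside[of "{\<xi>, w}"] \<xi>S wS by auto
  show ?thesis
  proof (rule CQ.transfer_norm[where \<omega> = \<omega> and g' = g' and U = U])
    show "\<omega> n \<in> {0..<int p}" if "n \<in> CQ.N" for n by (rule \<omega>(1)[OF N_auts[OF that]])
    show "\<omega> n \<noteq> 0" if "n \<in> CQ.N" for n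
    proof
      assume "\<omega> n = 0"
      then have "n \<xi> = \<one>" using \<omega>(2)[OF N_auts[OF that]] rt_0[OF p\<xi>] by simp
      then have "n \<xi> = n \<one>" using aut_one[OF N_auts[OF that]] by simp
      then show False using aut_inj[OF N_auts[OF that] \<xi>c one_car] \<xi>p(2) by blast
    qed
    show "\<omega> (m \<otimes>\<^bsub>\<Gamma>\<^esub> n) = \<omega> m * \<omega> n mod int p" if "m \<in> CQ.N" "n \<in> CQ.N" for m n
    proof (rule \<omega>_eqI)
      note mG = N_auts[OF that(1)] and nG = N_auts[OF that(2)]
      show "m \<otimes>\<^bsub>\<Gamma>\<^esub> n \<in> auts F" by (rule CQ.m_closed[OF mG nG])
      show "(m \<otimes>\<^bsub>\<Gamma>\<^esub> n) \<xi> = rt p \<xi> (\<omega> m * \<omega> n)"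
        unfolding auts_mult[OF mG nG \<xi>c] \<omega>(2)[OF nG] by (rule s_rt[OF mG])
    qed
    show "[g' (m \<otimes>\<^bsub>\<Gamma>\<^esub> n) = g' m + g' n] (mod int p)" if m: "m \<in> CQ.N" "\<omega> m = 1" and n: "n \<in> CQ.N" "\<omega> n = 1" for m n
    proof -
      note mG = N_auts[OF m(1)] and nG = N_auts[OF n(1)]
      have m\<xi>: "m \<xi> = \<xi>" and n\<xi>: "n \<xi> = \<xi>" using fix_iff mG nG m n by auto
      have mn\<xi>: "(m \<otimes>\<^bsub>\<Gamma>\<^esub> n) \<xi> = \<xi>" using auts_mult[OF mG nG \<xi>c] m\<xi> n\<xi> by simp
      have "rt p \<xi> (g' (m \<otimes>\<^bsub>\<Gamma>\<^esub> n)) \<otimes> w = m (n w)"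
        using g'[OF CQ.N_mult[OF m(1) n(1)] mn\<xi>] auts_mult[OF mG nG w(1)] by simp
      also have "\<dots> = rt p \<xi> (g' n) \<otimes> (rt p \<xi> (g' m) \<otimes> w)"
        unfolding g'[OF n(1) n\<xi>] using aut_mult[OF mG rt_closed[OF \<xi>c] w(1)] fix_rt[OF mG m\<xi>] g'[OF m(1) m\<xi>] by simp
      also have "\<dots> = rt p \<xi> (g' m + g' n) \<otimes> w" unfolding rt_add[OF p\<xi>] using w(1) \<xi>c by (simp add: m_ac)
      finally show ?thesis by (rule rt_cancel[OF _ w(1) w0])
    qed
    have Ustab: "n \<in> CQ.N" "n \<xi> = \<xi>" "n w = w" if "n \<in> U" for n
      using that U(2) CQ.open_N[OF U(1)] unfolding stab_def by auto
    show "\<omega> n = 1" if "n \<in> U" for n using fix_iff[OF N_auts] Ustab[OF that] by blast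
    show "int p dvd g' n" if "n \<in> U" for n
    proof -
      have "rt p \<xi> (g' n) \<otimes> w = rt p \<xi> 0 \<otimes> w" using g'[OF Ustab(1,2)[OF that]] Ustab(3)[OF that] rt_0[OF p\<xi>] w(1) by simp
      then have "[g' n = 0] (mod int p)" by (rule rt_cancel[OF _ w(1) w0])
      then show ?thesis by (simp add: cong_0_iff)
    qed
  qed (use om_conj h U(1) norm in auto)
qed

end

section \<open>Counting solutions of the embedding problems\<close>

lemma (in group_ring_mod) A_semidirect_finite: "finite (carrier (A_semidirect p l))"
proof -
  interpret cring "FpG p" by (rule FpG_cring)
  have "finite (carrier (FpG p))" unfolding FpG_simps by (intro finite_PiE) auto
  moreover have "carrier (A_mod p l) = (\<lambda>x. A_ideal p l +>\<^bsub>FpG p\<^esub> x) ` carrier (FpG p)"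
    unfolding A_mod_def FactRing_def A_RCOSETS_def' by auto
  ultimately show ?thesis unfolding A_semidirect_def semidirect_product_def
    using p0 by (simp add: carrier_integer_mod_group)
qed

context cyclic_extension
begin

text \<open>If \<open>t\<close> raises \<open>\<xi>\<close> to the power \<open>a\<close>, then by Fermat \<open>t\<^sup>p\<^sup>-\<^sup>1\<close> fixes \<open>\<xi>\<close>. The further
  exponent \<open>p - 1\<close> restores the class of \<open>t\<close> modulo \<open>p\<close>.\<close>

lemma generator_lift_fixing_root:
  assumes \<xi>: "\<xi> \<in> carrier \<Omega>" "\<xi> [^] p = \<one>" "\<xi> \<noteq> \<one>"
  obtains \<tau> where "\<tau> \<in> auts F" "cl \<tau> = 1" "\<tau> \<xi> = \<xi>"
proof -
  interpret \<Gamma>: group \<Gamma> by (rule group_\<Gamma>)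
  obtain t where t: "t \<in> auts F" "cl t = 1" by (rule cl_surj)
  interpret CQ: cyclic_quotient \<Gamma> p cl t opens by (rule cyclic_quotient_\<Gamma>[OF t])
  have "(t \<xi>) [^] p = \<one>" using aut_pow[OF t(1) \<xi>(1), symmetric] \<xi>(2) aut_one[OF t(1)] by simp
  then obtain k where k: "t \<xi> = rt p \<xi> k" using root_of_unity_rt[OF prime_p \<xi> aut_closed[OF t(1) \<xi>(1)]] by metis
  define a where "a = nat (k mod int p)"
  have ta: "t \<xi> = \<xi> [^] a" unfolding k rt_def a_def ..
  have tn: "(t [^]\<^bsub>\<Gamma>\<^esub> n) \<xi> = \<xi> [^] (a ^ n)" for n :: nat
  proof (induct n)
    case 0
    show ?case using \<xi>(1) by (simp add: gal_group_one)
  next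
    case (Suc n)
    have tn: "t [^]\<^bsub>\<Gamma>\<^esub> n \<in> auts F" using t(1) by simp
    have "(t [^]\<^bsub>\<Gamma>\<^esub> Suc n) \<xi> = (t [^]\<^bsub>\<Gamma>\<^esub> n) (t \<xi>)" using auts_mult[OF tn t(1) \<xi>(1)] by simp
    also have "\<dots> = (\<xi> [^] (a ^ n)) [^] a" unfolding ta using aut_pow[OF tn \<xi>(1)] Suc by simp
    also have "\<dots> = \<xi> [^] (a ^ Suc n)" using \<xi>(1) by (simp add: nat_pow_pow mult.commute)
    finally show ?case .
  qed
  have na: "\<not> p dvd a"
  proof
    assume "p dvd a"
    then have "t \<xi> = t \<one>" using ta xi_mod[OF prime_p \<xi>, of a] aut_one[OF t(1)] by simp
    then show False using aut_inj[OF t(1) \<xi>(1) one_car] \<xi>(3) by blast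
  qed
  \<comment> \<open>The exponent is 1 modulo \<open>p\<close> and a multiple of \<open>p - 1\<close>.\<close>
  define e where "e = (p - 1) * (p - 1)"
  have "[a ^ (p - 1) = 1] (mod p)" by (rule fermat_theorem[OF prime_p na])
  then have "[(a ^ (p - 1)) ^ (p - 1) = 1 ^ (p - 1)] (mod p)" by (rule cong_pow)
  then have "a ^ e mod p = 1" using p_pos unfolding e_def cong_def by (simp add: power_mult)
  then have 1: "(t [^]\<^bsub>\<Gamma>\<^esub> e) \<xi> = \<xi>" unfolding tn using xi_mod[OF prime_p \<xi>, of "a ^ e"] \<xi>(1) by simp
  have "int e = int p * (int p - 2) + 1" 
  proof -
    have "int (p - 1) = int p - 1" using p_pos by simp
    then show ?thesis unfolding e_def of_nat_mult by (simp add: algebra_simps)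
  qed
  then have "cl (t [^]\<^bsub>\<Gamma>\<^esub> e) = 1" unfolding CQ.c_tau_pow using p_pos by simp
  then show ?thesis using that[of "t [^]\<^bsub>\<Gamma>\<^esub> e"] 1 t(1) by simp
qed

lemma norm_equation:
  obtains \<tau> where "\<tau> \<in> auts F" "cl \<tau> = 1"
    "\<And>f. cyclic_quotient.smooth_hom \<Gamma> p cl opens f \<Longrightarrow>
      cyclic_quotient.vanish \<Gamma> p cl ((cyclic_quotient.Dl \<Gamma> \<tau> ^^ 2) f) \<Longrightarrow> int p dvd f (\<tau> [^]\<^bsub>\<Gamma>\<^esub> p) \<Longrightarrow>
      \<exists>g. cyclic_quotient.smooth_hom \<Gamma> p cl opens g \<and>
        cyclic_quotient.vanish \<Gamma> p cl (\<lambda>n. (\<Sum>i<p. g ((cyclic_quotient.conj \<Gamma> \<tau> ^^ i) n)) - cyclic_quotient.Dl \<Gamma> \<tau> f n)"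
proof (cases "nmul p \<one> = \<zero>")
  case True
  obtain t where t: "t \<in> auts F" "cl t = 1" by (rule cl_surj)
  interpret L: cyclic_extension_lift \<Omega> F K \<theta> p t by unfold_locales (rule t)+
  show ?thesis by (rule that[OF t]) (rule L.norm_equation_char_p[OF True])
next
  case False
  obtain \<xi> where \<xi>: "\<xi> \<in> carrier \<Omega>" "\<xi> \<noteq> \<one>" "\<xi> [^] p = \<one>"
    using root_of_unity_exists[OF _ False] p_pos by auto
  have \<xi>S: "\<xi> \<in> \<S>" by (rule S_kummer[OF prime_p False \<xi>(1)]) (simp add: \<xi>(3) S_ring(3))
  obtain t where t: "t \<in> auts F" "cl t = 1" "t \<xi> = \<xi>" by (rule generator_lift_fixing_root[OF \<xi>(1,3,2)])
  interpret L: cyclic_extension_lift \<Omega> F K \<theta> p t by unfold_locales (rule t)+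
  show ?thesis by (rule that[OF t(1,2)]) (rule L.norm_equation_char_not_p[OF False \<xi>S \<xi>(3,2) t(3)])
qed

end

lemma embedding_solutions_iso:
  fixes \<Omega> :: "('a, 'm) ring_scheme"
  assumes \<iota>: "\<iota> \<in> iso H P" and H: "group H"
  shows "embedding_solutions \<Omega> F K \<theta> H (\<pi> \<circ> \<iota>) = embedding_solutions \<Omega> F K \<theta> P \<pi>"
proof -
  have "(\<exists>\<phi>\<in>iso A H. \<forall>s\<in>carrier A. (\<pi> \<circ> \<iota>) (\<phi> s) = f s) \<longleftrightarrow> (\<exists>\<phi>\<in>iso A P. \<forall>s\<in>carrier A. \<pi> (\<phi> s) = f s)"
    for A :: "('a \<Rightarrow> 'a) monoid" and f
  proof
    assume "\<exists>\<phi>\<in>iso A H. \<forall>s\<in>carrier A. (\<pi> \<circ> \<iota>) (\<phi> s) = f s"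
    then obtain \<phi> where "\<phi> \<in> iso A H" "\<forall>s\<in>carrier A. (\<pi> \<circ> \<iota>) (\<phi> s) = f s" by blast
    then show "\<exists>\<phi>\<in>iso A P. \<forall>s\<in>carrier A. \<pi> (\<phi> s) = f s"
      using iso_set_trans[of \<phi> A H \<iota> P] \<iota> by (intro bexI[of _ "\<iota> \<circ> \<phi>"]) auto
  next
    assume "\<exists>\<phi>\<in>iso A P. \<forall>s\<in>carrier A. \<pi> (\<phi> s) = f s"
    then obtain \<phi> where \<phi>: "\<phi> \<in> iso A P" "\<forall>s\<in>carrier A. \<pi> (\<phi> s) = f s" by blast
    define j where "j = inv_into (carrier H) \<iota>"
    have j: "j \<in> iso P H" unfolding j_def by (rule group.iso_set_sym[OF H \<iota>])
    have "\<iota> ` carrier H = carrier P" using \<iota> unfolding iso_def bij_betw_def by auto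
    then have ij: "\<iota> (j x) = x" if "x \<in> carrier P" for x
      unfolding j_def using that by (auto intro: f_inv_into_f)
    have "\<phi> s \<in> carrier P" if "s \<in> carrier A" for s using \<phi>(1) that unfolding iso_def hom_def by auto
    then show "\<exists>\<phi>\<in>iso A H. \<forall>s\<in>carrier A. (\<pi> \<circ> \<iota>) (\<phi> s) = f s"
      using iso_set_trans[OF \<phi>(1) j] \<phi>(2) ij by (intro bexI[of _ "j \<circ> \<phi>"]) auto
  qed
  then show ?thesis unfolding embedding_solutions_def by simp
qed

theorem theorem5p5:
  fixes \<Omega> :: "('a, 'm) ring_scheme"
    and F K :: "'a set"
    and \<theta> :: "('a \<Rightarrow> 'a) \<Rightarrow> int"
    and p l :: nat
    and H :: "('h, 'n) monoid_scheme"
    and \<iota> :: "'h \<Rightarrow> (int \<Rightarrow> int) set \<times> int"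
  assumes "prime p" and "odd p" and "2 \<le> l" and "l \<le> p - 1"
    and "algebraic_closure \<Omega> F"
    and "galois_extension \<Omega> K F"
    and "\<theta> \<in> iso (gal_group \<Omega> K F) (integer_mod_group p)"
    and "is_H_p3 p H"
    and "\<iota> \<in> iso H (A_semidirect p 2)"
  shows "nu \<Omega> F K \<theta> (A_semidirect p l) snd =
         nu \<Omega> F K \<theta> H (snd \<circ> \<iota>) *
         (1 / of_nat p +
          of_nat (p - 1) * nu \<Omega> F K \<theta> H (snd \<circ> \<iota>) /
          (1 + of_nat (p - 1) * nu \<Omega> F K \<theta> (A_semidirect p 1) snd)) ^ (l - 2)"
proof -
  have "cyclic_extension \<Omega> F K \<theta> p"
    by (intro cyclic_extension.intro galois_closure.intro cyclic_extension_axioms.intro assms)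
  then interpret E: cyclic_extension \<Omega> F K \<theta> p .
  interpret R: group_ring_mod p by (rule group_ring_mod.intro[OF assms(1)])
  obtain \<tau> where \<tau>: "\<tau> \<in> E.auts F" "E.cl \<tau> = 1" and key:
    "\<And>f. cyclic_quotient.smooth_hom E.\<Gamma> p E.cl E.opens f \<Longrightarrow>
      cyclic_quotient.vanish E.\<Gamma> p E.cl ((cyclic_quotient.Dl E.\<Gamma> \<tau> ^^ 2) f) \<Longrightarrow> int p dvd f (\<tau> [^]\<^bsub>E.\<Gamma>\<^esub> p) \<Longrightarrow>
      \<exists>g. cyclic_quotient.smooth_hom E.\<Gamma> p E.cl E.opens g \<and>
        cyclic_quotient.vanish E.\<Gamma> p E.cl (\<lambda>n. (\<Sum>i<p. g ((cyclic_quotient.conj E.\<Gamma> \<tau> ^^ i) n)) - cyclic_quotient.Dl E.\<Gamma> \<tau> f n)"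
    using E.norm_equation by blast
  interpret CQ: cyclic_quotient E.\<Gamma> p E.cl \<tau> E.opens by (rule E.cyclic_quotient_\<Gamma>[OF \<tau>])
  have p: "1 \<le> p" "2 \<le> p" "l \<le> p" using assms(3,4) by auto
  note T = R.A_semidirect_truncated[OF p(1)] R.A_semidirect_truncated[OF p(2)] R.A_semidirect_truncated[OF p(3)]
  have nu: "nu \<Omega> F K \<theta> (A_semidirect p k) snd = ecard (CQ.quotients (A_semidirect p k))" if "k \<le> p" for k
    by (rule E.nu_quotients[OF \<tau> R.A_semidirect_finite truncated_semidirect.P_group[OF R.A_semidirect_truncated[OF that]]])
  have H: "nu \<Omega> F K \<theta> H (snd \<circ> \<iota>) = nu \<Omega> F K \<theta> (A_semidirect p 2) snd"
    using embedding_solutions_iso[OF assms(9)] assms(8) unfolding nu_def is_H_p3_def by metis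
  show ?thesis unfolding H nu[OF p(1)] nu[OF p(2)] nu[OF p(3)]
    by (rule CQ.abstract_formula[OF key assms(3,4) T])
qed

end
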